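(* Let $\alpha\in\Sigma$ (with $\Sigma$ as defined in the context). There exists a set $\mathcal{A}_\alpha\subset SL(2,\mathbb{R})$ of total Haar measure such that for every $A_0\in\mathcal{A}_\alpha$ the following holds: if $A\in C^\infty(\mathbb{T},SL(2,\mathbb{R}))$ and $B\in C^0(\mathbb{T},SL(2,\mathbb{R}))$ satisfy $A(\theta)=B(\theta+\alpha)A_0B(\theta)^{-1}$ for all $\theta\in\mathbb{T}$ (i.e. $(\alpha,A)$ is $C^0$-conjugated by $B$ to the constant cocycle $(\alpha,A_0)$), then the conjugacy $B$ is $C^\infty$.
   Context: $\mathbb{T}=\mathbb{R}/\mathbb{Z}$; $(\alpha,A)$ is the diffeomorphism $(\theta,y)\mapsto(\theta+\alpha,A(\theta)y)$ of $\mathbb{T}\times SL(2,\mathbb{R})$. **The set $\Sigma$.** For $\gamma>0,\sigma>1$ let $CD(\gamma,\sigma)=\{\alpha\in\mathbb{R}/\mathbb{Z}:\ \forall k\in\mathbb{Z}\setminus\{0\},\ \min_{l\in\mathbb{Z}}|k\alpha-l|\ge\gamma^{-1}|k|^{-\sigma}\}$. Let $G(x)=\{1/x\}$ (fractional part) be the Gauss map on $(0,1)$ and $m=\frac{1}{\log2}\frac{dx}{1+x}$ the Gauss measure. Fix $\sigma>1$ and then $\gamma$ large enough that $m(CD(\gamma,\sigma)\cap G^{-1}(CD(\gamma,\sigma)))>1-m((\frac15,\frac14]\cap G^{-1}((\frac15,\frac14]))$. Then $\Sigma$ is the set of $\alpha\in(0,1)$ (identified with points of $\mathbb{T}$) such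 that for every $N\in\mathbb{N}$ there is $k\ge N$ with $G^k(\alpha)$ and $G^{k+1}(\alpha)$ both in $CD(\gamma,\sigma)\cap(\frac15,\frac14]$. *)

theory Defs
  imports "HOL-Analysis.Analysis"
begin

definition SL2 :: "(real^2^2) set" where
  "SL2 = {X. det X = 1}"

text \<open>A Haar measure on \<open>SL2\<close>: a nonzero left-invariant Borel measure that is finite on compact
  sets (regularity is automatic, \<open>SL2\<close> being locally compact and second countable).
  It is unique up to a positive factor.\<close>

definition haar_measure_SL2 :: "(real^2^2) measure \<Rightarrow> bool" where
  "haar_measure_SL2 M \<longleftrightarrow>
     sets M = sets (restrict_space borel SL2) \<and>
     (\<forall>g\<in>SL2. \<forall>E\<in>sets M. emeasure M ((\<lambda>X. g ** X) ` E) = emeasure M E) \<and>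
     (\<forall>K. compact K \<and> K \<subseteq> SL2 \<longrightarrow> emeasure M K < \<infinity>) \<and>
     emeasure M SL2 \<noteq> 0"

definition total_haar_measure :: "(real^2^2) set \<Rightarrow> bool" where
  "total_haar_measure S \<longleftrightarrow> S \<subseteq> SL2 \<and> (\<forall>M. haar_measure_SL2 M \<longrightarrow> (AE X in M. X \<in> S))"

text \<open>Maps from \<open>\<real>/\<int>\<close> to \<open>SL2\<close> are 1-periodic maps on \<open>\<real>\<close>. As \<open>SL2\<close> is an embedded submanifold
  of the space of 2 by 2 matrices, smoothness is that of the matrix-valued map.\<close>

definition smooth :: "(real \<Rightarrow> 'a::real_normed_vector) \<Rightarrow> bool" where
  "smooth f \<longleftrightarrow>
     (\<exists>D. D 0 = f \<and> (\<forall>n::nat. \<forall>x. (D n has_vector_derivative D (Suc n) x) (at x)))"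

definition circle_maps_SL2 :: "(real \<Rightarrow> real^2^2) set" where
  "circle_maps_SL2 = {F. (\<forall>\<theta>. F (\<theta> + 1) = F \<theta>) \<and> (\<forall>\<theta>. F \<theta> \<in> SL2)}"

definition C0_circle_SL2 :: "(real \<Rightarrow> real^2^2) set" where
  "C0_circle_SL2 = {F \<in> circle_maps_SL2. continuous_on UNIV F}"

definition Cinf_circle_SL2 :: "(real \<Rightarrow> real^2^2) set" where
  "Cinf_circle_SL2 = {F \<in> circle_maps_SL2. smooth F}"

text \<open>The subset \<open>CD(\<gamma>, \<sigma>)\<close> of \<open>\<real>/\<int>\<close> is given by its (1-periodic) preimage in \<open>\<real>\<close>;
  \<open>infdist x \<int>\<close> is the distance of \<open>x\<close> to the nearest integer.\<close>

definition CD :: "real \<Rightarrow> real \<Rightarrow> real set" where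
  "CD \<gamma> \<sigma> = {\<alpha>. \<forall>k::int. k \<noteq> 0 \<longrightarrow>
     infdist (of_int k * \<alpha>) \<int> \<ge> inverse \<gamma> * of_int \<bar>k\<bar> powr (- \<sigma>)}"

text \<open>The Gauss map matters on \<open>(0,1)\<close> only. The orbit of a rational point reaches \<open>0\<close>, where
  the Gauss map is undefined; here it then stays at \<open>0\<close>, since \<open>1 / 0 = 0\<close>, and so never
  returns to \<open>(1/5, 1/4]\<close>.\<close>

definition gauss_map :: "real \<Rightarrow> real" where
  "gauss_map x = frac (1 / x)"

definition gauss_measure :: "real measure" where
  "gauss_measure =
     density lborel (\<lambda>x. ennreal (indicator {0<..<1} x * (1 / (ln 2 * (1 + x)))))"

definition gauss_preimage :: "real set \<Rightarrow> real set" where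
  "gauss_preimage S = {x \<in> {0<..<1}. gauss_map x \<in> S}"

definition admissible :: "real \<Rightarrow> real \<Rightarrow> bool" where
  "admissible \<gamma> \<sigma> \<longleftrightarrow> \<sigma> > 1 \<and> \<gamma> > 0 \<and>
     measure gauss_measure (CD \<gamma> \<sigma> \<inter> gauss_preimage (CD \<gamma> \<sigma>)) >
       1 - measure gauss_measure ({1/5<..1/4} \<inter> gauss_preimage {1/5<..1/4})"

definition Sigma_set :: "real \<Rightarrow> real \<Rightarrow> real set" where
  "Sigma_set \<gamma> \<sigma> = {\<alpha> \<in> {0<..<1}. \<forall>N::nat. \<exists>k\<ge>N.
     (gauss_map ^^ k) \<alpha> \<in> CD \<gamma> \<sigma> \<inter> {1/5<..1/4} \<and>
     (gauss_map ^^ Suc k) \<alpha> \<in> CD \<gamma> \<sigma> \<inter> {1/5<..1/4}}"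

end

theory Submission
  imports Defs
begin

text \<open>
  Let \<open>X\<close> be a matrix in \<open>SL2\<close> that has two distinct eigenvalues and a nonzero lower left entry.
  After diagonalisation over the complex numbers, a conjugacy of a smooth cocycle \<open>A\<close> to \<open>X\<close> becomes a
  continuous matrix function \<open>B\<close> of determinant 1 with \<open>B (t + \<alpha>) ** dg l = A t ** B t\<close>, where
  \<open>dg l\<close> is the diagonal matrix of the eigenvalues. The proof works at one scale \<open>N\<close> at a time. At
  scale \<open>N\<close> a frequency \<open>j\<close> has the weight \<open>wt N j = 1 + \<bar>j\<bar> / N\<close>, and Sobolev and Wiener norms are
  taken with powers of that weight, so that frequencies up to \<open>N\<close> count as bounded and all constants
  are independent of \<open>N\<close>.

  The divisors of the linearised conjugacy equation are \<open>chi j \<alpha> * l b - l a\<close>. The only arithmetic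
  information that the analysis uses is \<open>div_ok\<close>: the inverses of these divisors over all
  frequencies up to \<open>K * N\<close> have a square sum of at most \<open>(\<Lambda> * N * K ^ s)\<^sup>2\<close>, where \<open>\<Lambda>\<close> and \<open>s\<close> do not depend on
  \<open>N\<close>. Solving the linearised equation at scale \<open>N\<close> thus costs one factor \<open>N\<close>.

  Smoothing \<open>B\<close> by a kernel of degree \<open>N\<close> gives a trigonometric polynomial \<open>W\<close> that conjugates the
  cocycle to \<open>dg l + F\<close>. The error \<open>F\<close> comes from the commutator of the smoothing with the
  multiplication by \<open>A\<close>, and this commutator is \<open>o(1/N)\<close> although \<open>B\<close> is merely continuous
  (\<open>ksm_commutator\<close>): the kernel is even, so that the linear Taylor term of \<open>A\<close>, tested
  against an almost constant \<open>B\<close>, cancels. Hence \<open>N * F\<close> tends to 0 in every scaled Sobolev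
  norm (\<open>initial_approximation\<close>), which beats the factor \<open>N\<close> that the divisors cost. Consequently a
  quadratically convergent iteration (\<open>kam_step\<close>, \<open>iteration\<close>) starts at every sufficiently large
  scale at which \<open>div_ok\<close> holds. Resonances are no obstruction, because each correction is read off
  from the continuous conjugacy that is already there: it is a truncation of that conjugacy, and the equation
  serves only to show that the correction is small. The iteration writes \<open>B\<close> as an infinite product with bounded
  Wiener norm of order \<open>r\<close>, so that the Fourier coefficients of \<open>B\<close> are \<open>O(wt N j ^ (- r))\<close>. The
  scale \<open>N\<close> depends on \<open>r\<close>, but for each \<open>r\<close> a single scale suffices, and therefore \<open>B\<close> is smooth
  (\<open>conjugacy_smooth\<close>).

  It remains to find infinitely many scales with \<open>div_ok\<close>. If the \<open>k\<close>-th iterate of \<open>\<alpha>\<close> under the Gauss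
  map lies in \<open>CD \<gamma> \<sigma>\<close>, then \<open>\<alpha>\<close> is Diophantine relative to the scale \<open>N\<close> given by a
  denominator of a convergent (\<open>infinitely_many_dioph_scales\<close>). This settles matrices with \<open>\<bar>trace\<bar> > 2\<close>.
  For eigenvalues \<open>cis (\<plusminus> pi * \<phi>)\<close> one also needs a lower bound for
  the distance of \<open>j * \<alpha> + \<phi>\<close> to the integers. The phases in \<open>{0..1}\<close> that violate it at a given
  scale have a measure of at most \<open>18 * c\<close>, uniformly in the scale. So almost every phase satisfies
  it, for some \<open>c\<close>, at infinitely many of the scales (\<open>exceptional_phases_null\<close>). Finally, a null
  set of traces is avoided by almost every matrix: left multiplication by a unipotent
  one-parameter group changes the trace affinely in the parameter, and by Fubini a set that meets
  all such curves in null sets is Haar null (\<open>haar_null_if_null_on_curves\<close>).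
\<close>

section \<open>Fourier coefficients of continuous periodic functions\<close>

definition chi :: "int \<Rightarrow> real \<Rightarrow> complex" where
  "chi j t = cis (2 * pi * of_int j * t)"

definition cper :: "(real \<Rightarrow> 'a::real_normed_vector) \<Rightarrow> bool" where
  "cper f \<longleftrightarrow> continuous_on UNIV f \<and> (\<forall>t. f (t + 1) = f t)"

definition fc :: "(real \<Rightarrow> complex) \<Rightarrow> int \<Rightarrow> complex" where
  "fc f j = integral {0..1} (\<lambda>t. f t * chi (- j) t)"

lemma chi_0 [simp]: "chi 0 t = 1" and chi_at_0 [simp]: "chi j 0 = 1"
  and norm_chi [simp]: "norm (chi j t) = 1"
  by (auto simp: chi_def)

lemma chi_add: "chi (j + k) t = chi j t * chi k t"
  by (simp add: chi_def cis_mult distrib_left distrib_right)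

lemma chi_add_arg: "chi j (s + t) = chi j s * chi j t"
  by (simp add: chi_def cis_mult distrib_left distrib_right)

lemma chi_minus: "chi (- j) t = cnj (chi j t)"
  by (simp add: chi_def cis_cnj)

lemma chi_minus_arg: "chi j (- t) = cnj (chi j t)"
  by (simp add: chi_def cis_cnj)

lemma chi_cnj_mult [simp]: "chi j t * cnj (chi j t) = 1" "cnj (chi j t) * chi j t = 1"
  by (simp_all add: chi_def cis_cnj cis_mult)

lemma chi_of_int: "chi j (of_int l) = 1"
proof -
  have "chi j (of_int l) = cis (2 * pi * of_int (j * l))"
    by (simp add: chi_def mult.assoc)
  then show ?thesis by (metis cis_multiple_2pi Ints_of_int)
qed

lemma continuous_chi [continuous_intros]: "continuous_on S (chi j)"
  unfolding chi_def by (intro continuous_intros)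

lemma cper_chi [simp]: "cper (chi j)"
  using chi_of_int[of j 1] by (auto simp: cper_def continuous_chi chi_add_arg)

lemma cperD: "cper f \<Longrightarrow> f (t + 1) = f t"
  by (auto simp: cper_def)

lemma cper_cont: "cper f \<Longrightarrow> continuous_on S f"
  by (auto simp: cper_def intro: continuous_on_subset)

lemma cper_const [simp]: "cper (\<lambda>t. c)"
  by (auto simp: cper_def)
lemma cper_add: "cper f \<Longrightarrow> cper g \<Longrightarrow> cper (\<lambda>t. f t + g t)"
  by (auto simp: cper_def intro!: continuous_intros)
lemma cper_diff: "cper f \<Longrightarrow> cper g \<Longrightarrow> cper (\<lambda>t. f t - g t)"
  by (auto simp: cper_def intro!: continuous_intros)
lemma cper_minus: "cper f \<Longrightarrow> cper (\<lambda>t. - f t)"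
  by (auto simp: cper_def intro!: continuous_intros)
lemma cper_mult: fixes f :: "real \<Rightarrow> 'a::real_normed_algebra" shows "cper f \<Longrightarrow> cper g \<Longrightarrow> cper (\<lambda>t. f t * g t)"
  by (auto simp: cper_def intro!: continuous_intros)
lemma cper_divide: fixes f :: "real \<Rightarrow> 'a::real_normed_field" shows "cper f \<Longrightarrow> cper g \<Longrightarrow> (\<And>t. g t \<noteq> 0) \<Longrightarrow> cper (\<lambda>t. f t / g t)"
  by (auto simp: cper_def intro!: continuous_intros)
lemma cper_cnj: "cper f \<Longrightarrow> cper (\<lambda>t. cnj (f t))"
  by (auto simp: cper_def intro!: continuous_intros)
lemma cper_sum: "(\<And>i. i \<in> I \<Longrightarrow> cper (f i)) \<Longrightarrow> cper (\<lambda>t. \<Sum>i\<in>I. f i t)"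
  by (auto simp: cper_def intro!: continuous_intros sum.cong)
lemma cper_power: fixes f :: "real \<Rightarrow> 'a::real_normed_algebra_1" shows "cper f \<Longrightarrow> cper (\<lambda>t. f t ^ n)"
  by (auto simp: cper_def intro!: continuous_intros)
lemma cper_shift: "cper f \<Longrightarrow> cper (\<lambda>t. f (t + a))"
proof -
  assume f: "cper f"
  have "continuous_on UNIV (\<lambda>t. f (t + a))"
    by (rule continuous_on_compose2[OF cper_cont[OF f, of UNIV]]) (auto intro!: continuous_intros)
  moreover have "f (t + 1 + a) = f (t + a)" for t
    using cperD[OF f, of "t + a"] by (simp add: algebra_simps)
  ultimately show ?thesis by (simp add: cper_def)
qed
lemma cper_reflect: "cper f \<Longrightarrow> cper (\<lambda>t. f (a - t))"
proof -
  assume f: "cper f"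
  have "continuous_on UNIV (\<lambda>t. f (a - t))"
    by (rule continuous_on_compose2[OF cper_cont[OF f, of UNIV]]) (auto intro!: continuous_intros)
  moreover have "f (a - (t + 1)) = f (a - t)" for t
    using cperD[OF f, of "a - t - 1"] by (simp add: algebra_simps)
  ultimately show ?thesis by (simp add: cper_def)
qed
lemma cper_of_real: "cper f \<Longrightarrow> cper (\<lambda>t. complex_of_real (f t))"
  by (auto simp: cper_def intro!: continuous_intros)
lemma cper_norm: "cper f \<Longrightarrow> cper (\<lambda>t. norm (f t))"
  by (auto simp: cper_def intro!: continuous_intros)
lemmas cper_intros = cper_of_real cper_norm cper_const cper_chi cper_add cper_diff cper_minus cper_mult cper_cnj cper_sum
  cper_power

lemma cper_integrable: fixes f :: "real \<Rightarrow> 'a::banach" shows "cper f \<Longrightarrow> f integrable_on {a..b}"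
  by (intro integrable_continuous_interval cper_cont)

lemma cper_of_int: assumes "cper f" shows "f (t + of_int k) = f t"
proof -
  have nat: "f (t + of_nat n) = f t" for n t
  proof (induction n)
    case (Suc n)
    have "f (t + of_nat (Suc n)) = f ((t + of_nat n) + 1)" by (simp add: algebra_simps)
    then show ?case using cperD[OF assms] Suc by simp
  qed simp
  show ?thesis
  proof (cases "k \<ge> 0")
    case True then show ?thesis using nat[of t "nat k"] by simp
  next
    case False
    then show ?thesis using nat[of "t + of_int k" "nat (-k)"] by simp
  qed
qed

lemma cper_frac: assumes "cper f" shows "f (frac t) = f t"
  using cper_of_int[OF assms, of "frac t" "\<lfloor>t\<rfloor>"] by (simp add: frac_def)

lemma integral_cper_shift:
  fixes f :: "real \<Rightarrow> 'a::banach"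
  assumes f: "cper f"
  shows "integral {0..1} (\<lambda>t. f (t + a)) = integral {0..1} f"
proof -
  define b where "b = frac a"
  have b: "0 \<le> b" "b < 1" by (auto simp: b_def frac_lt_1)
  have "f (t + a) = f (t + b)" for t
    using cper_of_int[OF f, of "t + b" "\<lfloor>a\<rfloor>"] by (simp add: b_def frac_def)
  then have "integral {0..1} (\<lambda>t. f (t + a)) = integral {0..1} (\<lambda>t. f (t + b))" by simp
  also have "\<dots> = integral {b..1+b} f"
    using integral_shift_real_ivl[of b b "1+b" f] by simp
  also have "\<dots> = integral {b..1} f + integral {1..1+b} f"
    using b by (intro Henstock_Kurzweil_Integration.integral_combine[symmetric] cper_integrable f) auto
  also have "integral {1..1+b} f = integral {0..b} (\<lambda>t. f (t + 1))"
    using integral_shift_real_ivl[of 1 1 "1+b" f] by simp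
  also have "\<dots> = integral {0..b} f" using cperD[OF f] by simp
  also have "integral {b..1} f + integral {0..b} f = integral {0..1} f"
    using b Henstock_Kurzweil_Integration.integral_combine[of 0 b 1 f] cper_integrable[OF f] by (simp add: add.commute)
  finally show ?thesis .
qed

lemma integral_cper_reflect:
  fixes f :: "real \<Rightarrow> 'a::euclidean_space"
  assumes f: "cper f"
  shows "integral {0..1} (\<lambda>t. f (a - t)) = integral {0..1} f"
proof -
  have "integral {0..1} (\<lambda>t. f (a - t)) = integral {0..1} (\<lambda>t. f (- t))"
    using integral_cper_shift[OF cper_reflect[OF f, of 0], of "-a"] by (simp add: algebra_simps)
  also have "\<dots> = integral {-1..0} f"
    using Henstock_Kurzweil_Integration.integral_reflect_real[of 0 "-1" f] by simp
  also have "\<dots> = integral {0..1} (\<lambda>t. f (t + (-1)))"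
    using integral_shift_real_ivl[of "-1" "-1" 0 f] by simp
  also have "\<dots> = integral {0..1} f" by (rule integral_cper_shift[OF f])
  finally show ?thesis .
qed

lemma fc_add: "cper f \<Longrightarrow> cper g \<Longrightarrow> fc (\<lambda>t. f t + g t) j = fc f j + fc g j"
  unfolding fc_def distrib_right by (intro integral_add cper_integrable cper_mult cper_chi)
lemma fc_diff: "cper f \<Longrightarrow> cper g \<Longrightarrow> fc (\<lambda>t. f t - g t) j = fc f j - fc g j"
  unfolding fc_def left_diff_distrib by (intro integral_diff cper_integrable cper_mult cper_chi)
lemma fc_cmult: "fc (\<lambda>t. c * f t) j = c * fc f j"
  unfolding fc_def mult.assoc by (rule integral_mult_right)
lemma fc_cmult2: "fc (\<lambda>t. f t * c) j = fc f j * c"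
  using fc_cmult[of c f j] by (simp add: mult.commute)
lemma fc_minus: "fc (\<lambda>t. - f t) j = - fc f j"
  using fc_cmult[of "-1" f j] by simp
lemma fc_sum: "finite I \<Longrightarrow> (\<And>i. i \<in> I \<Longrightarrow> cper (f i)) \<Longrightarrow> fc (\<lambda>t. \<Sum>i\<in>I. f i t) j = (\<Sum>i\<in>I. fc (f i) j)"
  unfolding fc_def sum_distrib_right by (intro integral_sum cper_integrable cper_mult cper_chi)

lemma fc_chi_mult: "fc (\<lambda>t. chi k t * f t) j = fc f (j - k)"
proof -
  have "chi k t * f t * chi (- j) t = f t * chi (- (j - k)) t" for t
  proof -
    have "chi (- (j - k)) t = chi (k + - j) t" by simp
    also have "\<dots> = chi k t * chi (- j) t" by (rule chi_add)
    finally show ?thesis by (simp add: mult_ac)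
  qed
  then show ?thesis unfolding fc_def by presburger
qed

lemma fc_shift: assumes f: "cper f" shows "fc (\<lambda>t. f (t + a)) j = chi j a * fc f j"
proof -
  have "fc (\<lambda>t. f (t + a)) j = integral {0..1} (\<lambda>t. chi j a * (f (t + a) * chi (- j) (t + a)))"
    unfolding fc_def by (rule integral_cong) (simp add: chi_add_arg chi_minus mult_ac)
  also have "\<dots> = chi j a * integral {0..1} (\<lambda>t. f (t + a) * chi (- j) (t + a))"
    by (rule integral_mult_right)
  also have "integral {0..1} (\<lambda>t. f (t + a) * chi (- j) (t + a)) = fc f j"
    unfolding fc_def by (rule integral_cper_shift[of "\<lambda>t. f t * chi (-j) t"]) (intro cper_intros f)
  finally show ?thesis .
qed

lemma integral_chi: "integral {0..1} (chi j) = (if j = 0 then 1 else 0)"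
proof (cases "j = 0")
  case True
  have "chi 0 = (\<lambda>_. 1)" by auto
  with True show ?thesis by simp
next
  case False
  obtain a :: real where a: "chi j a \<noteq> 1"
  proof -
    have "2 * pi * of_int j * (1 / (2 * of_int j)) = pi" using False by simp
    then have "chi j (1 / (2 * of_int j)) = -1" unfolding chi_def by simp
    then show thesis using that by fastforce
  qed
  have "integral {0..1} (chi j) = integral {0..1} (\<lambda>t. chi j (t + a))"
    by (rule integral_cper_shift[symmetric]) simp
  also have "\<dots> = chi j a * integral {0..1} (chi j)"
    by (simp add: chi_add_arg mult.commute)
  finally show ?thesis using a False by simp
qed

lemma fc_chi: "fc (chi k) j = (if j = k then 1 else 0)"
  using fc_chi_mult[of k "\<lambda>_. 1" j] integral_chi[of "- (j - k)"] by (simp add: fc_def)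

lemma fc_const: "fc (\<lambda>t. c) j = (if j = 0 then c else 0)"
  using fc_cmult[of c "chi 0" j] fc_chi[of 0 j] by simp

lemma fc_bound:
  assumes f: "cper f" and "\<And>t. norm (f t) \<le> S"
  shows "norm (fc f j) \<le> S"
proof -
  have "norm (fc f j) \<le> S * (1 - 0)"
    unfolding fc_def
    by (rule integral_bound) (use assms in \<open>auto simp: norm_mult intro!: cper_cont cper_intros\<close>)
  then show ?thesis by simp
qed

lemma cper_bounded: assumes f: "cper f" obtains S where "S > 0" "\<And>t. norm (f t) \<le> S"
proof -
  have "bounded (f ` {0..1})"
    by (intro compact_imp_bounded compact_continuous_image cper_cont f) auto
  then obtain S where S: "S > 0" "\<And>x. x \<in> f ` {0..1} \<Longrightarrow> norm x \<le> S" by (meson bounded_pos)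
  have "norm (f t) \<le> S" for t
  proof -
    have "frac t \<in> {0..1}" using frac_lt_1[of t] frac_ge_0[of t] by auto
    then show ?thesis using S(2)[of "f (frac t)"] cper_frac[OF f, of t] by (metis imageI)
  qed
  with S(1) that show thesis by blast
qed

subsection \<open>Square integrals and the Bessel inequality\<close>

definition l2sq :: "(real \<Rightarrow> complex) \<Rightarrow> real" where
  "l2sq f = integral {0..1} (\<lambda>t. (norm (f t))\<^sup>2)"

lemma cper_norm_cont: "cper f \<Longrightarrow> continuous_on S (\<lambda>t. (norm (f t))\<^sup>2)"
  by (intro continuous_intros cper_cont)

lemma l2sq_complex: assumes f: "cper f" shows "of_real (l2sq f) = integral {0..1} (\<lambda>t. f t * cnj (f t))"
proof -
  have "((\<lambda>t. (norm (f t))\<^sup>2) has_integral l2sq f) {0..1}"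
    unfolding l2sq_def by (intro integrable_integral integrable_continuous_interval cper_norm_cont f)
  then have "((\<lambda>t. complex_of_real ((norm (f t))\<^sup>2)) has_integral of_real (l2sq f)) {0..1}"
    by (rule has_integral_of_real)
  then show ?thesis by (simp only: complex_norm_square integral_unique)
qed

lemma l2sq_mono:
  assumes "cper f" "cper g" "\<And>t. norm (f t) \<le> S * norm (g t)"
  shows "l2sq f \<le> S\<^sup>2 * l2sq g"
proof -
  have "l2sq f \<le> integral {0..1} (\<lambda>t. S\<^sup>2 * (norm (g t))\<^sup>2)"
    unfolding l2sq_def
  proof (rule integral_le)
    show "(norm (f t))\<^sup>2 \<le> S\<^sup>2 * (norm (g t))\<^sup>2" for t
      using power_mono[OF assms(3)[of t], of 2] by (simp add: power_mult_distrib)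
  next
    show "(\<lambda>t. (norm (f t))\<^sup>2) integrable_on {0..1}"
      by (intro integrable_continuous_interval cper_norm_cont assms(1))
    show "(\<lambda>t. S\<^sup>2 * (norm (g t))\<^sup>2) integrable_on {0..1}"
      by (intro integrable_continuous_interval continuous_on_mult continuous_on_const cper_norm_cont assms(2))
  qed
  then show ?thesis by (simp add: l2sq_def)
qed

lemma l2sq_bound: assumes "cper f" "\<And>t. norm (f t) \<le> S" shows "l2sq f \<le> S\<^sup>2"
  using l2sq_mono[of f "\<lambda>_. 1" S] assms by (simp add: l2sq_def)

lemma l2sq_nonneg: "l2sq f \<ge> 0"
  unfolding l2sq_def by (cases "(\<lambda>t. (norm (f t))\<^sup>2) integrable_on {0..1}") (auto simp: integral_nonneg not_integrable_integral)

lemma integral_fc_mult: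
  assumes f: "cper f" and J: "finite J"
  shows "integral {0..1} (\<lambda>t. f t * cnj (\<Sum>j\<in>J. c j * chi j t)) = (\<Sum>j\<in>J. cnj (c j) * fc f j)"
proof -
  have "integral {0..1} (\<lambda>t. f t * cnj (\<Sum>j\<in>J. c j * chi j t))
      = integral {0..1} (\<lambda>t. \<Sum>j\<in>J. cnj (c j) * (f t * chi (-j) t))"
    by (rule integral_cong) (simp add: sum_distrib_left chi_minus mult_ac)
  also have "\<dots> = (\<Sum>j\<in>J. integral {0..1} (\<lambda>t. cnj (c j) * (f t * chi (-j) t)))"
    by (intro integral_sum J cper_integrable cper_intros f)
  also have "\<dots> = (\<Sum>j\<in>J. cnj (c j) * fc f j)"
    by (simp add: fc_def)
  finally show ?thesis .
qed

lemma fc_trig: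
  assumes J: "finite J"
  shows "fc (\<lambda>t. \<Sum>j\<in>J. c j * chi j t) k = (if k \<in> J then c k else 0)"
proof -
  have "fc (\<lambda>t. \<Sum>j\<in>J. c j * chi j t) k = (\<Sum>j\<in>J. fc (\<lambda>t. c j * chi j t) k)"
    by (intro fc_sum J cper_intros)
  also have "\<dots> = (\<Sum>j\<in>J. if j = k then c k else 0)"
    by (rule sum.cong) (auto simp: fc_cmult fc_chi)
  finally show ?thesis using J by simp
qed

lemma l2sq_trig:
  assumes J: "finite J"
  shows "l2sq (\<lambda>t. \<Sum>j\<in>J. c j * chi j t) = (\<Sum>j\<in>J. (norm (c j))\<^sup>2)"
proof -
  have "of_real (l2sq (\<lambda>t. \<Sum>j\<in>J. c j * chi j t)) = (\<Sum>j\<in>J. cnj (c j) * c j)"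
    by (subst l2sq_complex, intro cper_intros, subst integral_fc_mult[OF _ J], intro cper_intros)
       (simp add: fc_trig[OF J])
  also have "\<dots> = complex_of_real (\<Sum>j\<in>J. (norm (c j))\<^sup>2)"
    unfolding of_real_sum by (intro sum.cong) (simp_all add: complex_norm_square[symmetric] mult.commute)
  finally show ?thesis using of_real_eq_iff by blast
qed

text \<open>The difference of \<open>f\<close> and its partial Fourier sum over \<open>J\<close> has a nonnegative square integral.\<close>

lemma bessel:
  assumes f: "cper f" and J: "finite J"
  shows "(\<Sum>j\<in>J. (norm (fc f j))\<^sup>2) \<le> l2sq f"
proof -
  define p where "p = (\<lambda>t. \<Sum>j\<in>J. fc f j * chi j t)"
  have p: "cper p" unfolding p_def by (intro cper_intros)
  let ?S = "\<Sum>j\<in>J. (norm (fc f j))\<^sup>2"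
  have S: "(\<Sum>j\<in>J. cnj (fc f j) * fc f j) = complex_of_real ?S"
    unfolding of_real_sum by (intro sum.cong) (simp_all add: complex_norm_square[symmetric] mult.commute)
  have fp: "integral {0..1} (\<lambda>t. f t * cnj (p t)) = of_real ?S"
    unfolding p_def by (subst integral_fc_mult[OF f J]) (rule S)
  have pp: "integral {0..1} (\<lambda>t. p t * cnj (p t)) = of_real ?S"
    using l2sq_complex[OF p] l2sq_trig[OF J, of "fc f"] by (simp add: p_def)
  have pf: "integral {0..1} (\<lambda>t. p t * cnj (f t)) = of_real ?S"
  proof -
    have "integral {0..1} (\<lambda>t. p t * cnj (f t)) = integral {0..1} (\<lambda>t. cnj (f t * cnj (p t)))"
      by (simp add: mult.commute)
    also have "\<dots> = cnj (integral {0..1} (\<lambda>t. f t * cnj (p t)))"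
      by (rule integral_cnj[symmetric])
    finally show ?thesis using fp by simp
  qed
  have "complex_of_real (l2sq (\<lambda>t. f t - p t)) =
      integral {0..1} (\<lambda>t. (f t * cnj (f t) - f t * cnj (p t)) - (p t * cnj (f t) - p t * cnj (p t)))"
    by (subst l2sq_complex, intro cper_intros f p) (simp add: algebra_simps)
  also have "\<dots> = (integral {0..1} (\<lambda>t. f t * cnj (f t)) - of_real ?S) - (of_real ?S - of_real ?S)"
    by (subst integral_diff, (intro cper_integrable cper_intros f p)+,
        subst integral_diff, (intro cper_integrable cper_intros f p)+,
        subst integral_diff, (intro cper_integrable cper_intros f p)+, simp add: fp pf pp)
  also have "\<dots> = complex_of_real (l2sq f - ?S)" by (simp add: l2sq_complex[OF f])
  finally have "l2sq (\<lambda>t. f t - p t) = l2sq f - ?S" using of_real_eq_iff by blast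
  then show ?thesis using l2sq_nonneg[of "\<lambda>t. f t - p t"] by linarith
qed

lemma sum_int_shift: "(\<Sum>j\<in>{a..b::int}. f (j + c)) = (\<Sum>j\<in>{a+c..b+c}. f j)"
  by (rule sum.reindex_bij_witness[of _ "\<lambda>j. j - c" "\<lambda>j. j + c"]) auto

definition tp :: "nat \<Rightarrow> (real \<Rightarrow> complex) \<Rightarrow> bool" where
  "tp n p \<longleftrightarrow> (\<exists>c. p = (\<lambda>t. \<Sum>j\<in>{-int n..int n}. c j * chi j t))"

definition trunc :: "nat \<Rightarrow> (real \<Rightarrow> complex) \<Rightarrow> real \<Rightarrow> complex" where
  "trunc n f t = (\<Sum>j\<in>{-int n..int n}. fc f j * chi j t)"

lemma tp_cper: "tp n p \<Longrightarrow> cper p"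
  unfolding tp_def by (auto intro!: cper_intros)

lemma tp_trunc: "tp n (trunc n f)"
  unfolding tp_def trunc_def by blast

lemma cper_trunc: "cper (trunc n f)"
  by (rule tp_cper[OF tp_trunc])

lemma fc_trunc: "fc (trunc n f) j = (if \<bar>j\<bar> \<le> int n then fc f j else 0)"
  unfolding trunc_def by (subst fc_trig) auto

lemma tp_fc_0: "tp n p \<Longrightarrow> \<bar>j\<bar> > int n \<Longrightarrow> fc p j = 0"
  unfolding tp_def by (auto simp: fc_trig)

lemma tp_eq_trunc: assumes "tp n p" shows "trunc n p = p"
proof -
  obtain c where c: "p = (\<lambda>t. \<Sum>j\<in>{-int n..int n}. c j * chi j t)" using assms by (auto simp: tp_def)
  have "fc p j = c j" if "j \<in> {-int n..int n}" for j
    using that unfolding c by (subst fc_trig) auto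
  then show ?thesis unfolding trunc_def by (subst (2) c) (auto intro!: sum.cong ext)
qed

lemma tp_expand: "tp n p \<Longrightarrow> p t = (\<Sum>j\<in>{-int n..int n}. fc p j * chi j t)"
  using tp_eq_trunc[of n p] unfolding trunc_def by metis

lemma tp_0: "tp n (\<lambda>t. 0)"
  unfolding tp_def by (rule exI[of _ "\<lambda>_. 0"]) simp

lemma tp_add: assumes "tp n p" "tp n q" shows "tp n (\<lambda>t. p t + q t)"
proof -
  obtain c d where "p = (\<lambda>t. \<Sum>j\<in>{-int n..int n}. c j * chi j t)"
    "q = (\<lambda>t. \<Sum>j\<in>{-int n..int n}. d j * chi j t)" using assms by (auto simp: tp_def)
  then show ?thesis unfolding tp_def
    by (intro exI[of _ "\<lambda>j. c j + d j"]) (simp add: sum.distrib distrib_right)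
qed

lemma tp_cmult: assumes "tp n p" shows "tp n (\<lambda>t. c * p t)"
proof -
  obtain d where "p = (\<lambda>t. \<Sum>j\<in>{-int n..int n}. d j * chi j t)" using assms by (auto simp: tp_def)
  then show ?thesis unfolding tp_def
    by (intro exI[of _ "\<lambda>j. c * d j"]) (simp add: sum_distrib_left mult.assoc)
qed

lemma tp_chi: assumes "\<bar>j\<bar> \<le> int n" shows "tp n (chi j)"
proof -
  have "chi j t = (\<Sum>i\<in>{-int n..int n}. (if i = j then 1 else 0) * chi i t)" for t
  proof -
    have "(\<Sum>i\<in>{-int n..int n}. (if i = j then 1 else 0) * chi i t)
        = (\<Sum>i\<in>{-int n..int n}. if i = j then chi i t else 0)"
      by (rule sum.cong) auto
    then show ?thesis using assms by auto
  qed
  then show ?thesis unfolding tp_def by (intro exI[of _ "\<lambda>i. if i = j then 1 else 0"] ext)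
qed

lemma tp_const: "tp n (\<lambda>t. c)"
  using tp_cmult[OF tp_chi[of 0 n], of c] by simp

lemma tp_minus: "tp n p \<Longrightarrow> tp n (\<lambda>t. - p t)"
  using tp_cmult[of n p "-1"] by simp

lemma tp_diff: "tp n p \<Longrightarrow> tp n q \<Longrightarrow> tp n (\<lambda>t. p t - q t)"
  using tp_add[OF _ tp_minus, of n p q] by simp

lemma tp_sum: "finite I \<Longrightarrow> (\<And>i. i \<in> I \<Longrightarrow> tp n (p i)) \<Longrightarrow> tp n (\<lambda>t. \<Sum>i\<in>I. p i t)"
  by (induction I rule: finite_induct) (auto intro: tp_0 tp_add)

lemma tp_mult: assumes "tp n p" "tp m q" shows "tp (n + m) (\<lambda>t. p t * q t)"
proof -
  have "p t * q t = (\<Sum>j\<in>{-int n..int n}. fc p j * (\<Sum>k\<in>{-int m..int m}. fc q k * chi (j + k) t))" for t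
    by (subst tp_expand[OF assms(1)], subst tp_expand[OF assms(2)], subst sum_distrib_right)
       (intro sum.cong refl, simp add: sum_distrib_left chi_add mult_ac)
  then show ?thesis
    by (simp only:) (intro tp_sum tp_cmult tp_chi, auto)
qed

lemma tp_mono: assumes "tp n p" "n \<le> m" shows "tp m p"
  using tp_mult[OF assms(1) tp_const[of "m - n" 1]] assms(2) by simp

lemma tp_shift: assumes "tp n p" shows "tp n (\<lambda>t. p (t + a))"
proof -
  have "p (t + a) = (\<Sum>j\<in>{-int n..int n}. (fc p j * chi j a) * chi j t)" for t
    by (subst tp_expand[OF assms]) (simp add: chi_add_arg mult_ac)
  then show ?thesis by (auto simp: tp_def)
qed

lemma tp_power: "tp n p \<Longrightarrow> tp (k * n) (\<lambda>t. p t ^ k)"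
  by (induction k) (auto intro: tp_const tp_mult)

lemma fc_tp_mult:
  assumes "tp n p" and f: "cper f"
  shows "fc (\<lambda>t. p t * f t) j = (\<Sum>k\<in>{-int n..int n}. fc p k * fc f (j - k))"
proof -
  have "(\<lambda>t. p t * f t) = (\<lambda>t. \<Sum>k\<in>{-int n..int n}. fc p k * (chi k t * f t))"
    by (subst tp_expand[OF assms(1)]) (auto simp: sum_distrib_right mult.assoc)
  then show ?thesis
    by (simp only:) (subst fc_sum, auto intro!: cper_intros f sum.cong simp: fc_cmult fc_chi_mult)
qed

section \<open>The kernel of Korovkin\<close>

text \<open>The coefficients of the eigenvector, for the largest eigenvalue, of the path on \<open>n + 1\<close> vertices. Among
  squares of trigonometric polynomials of degree \<open>n\<close> this choice maximises the first Fourier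
  coefficient, that is, it concentrates the kernel best at 0.\<close>

definition kcoef :: "nat \<Rightarrow> int \<Rightarrow> real" where
  "kcoef n k = sin (pi / (real n + 2) * (of_int k + 1))"

definition kroot :: "nat \<Rightarrow> real \<Rightarrow> complex" where
  "kroot n t = (\<Sum>k\<in>{0..int n}. of_real (kcoef n k) * chi k t)"

definition korovkin :: "nat \<Rightarrow> real \<Rightarrow> real" where
  "korovkin n t = (norm (kroot n t))\<^sup>2 / (\<Sum>k\<in>{0..int n}. (kcoef n k)\<^sup>2)"

lemma kcoef_sum_pos: "(\<Sum>k\<in>{0..int n}. (kcoef n k)\<^sup>2) > 0"
proof (rule sum_pos2[of _ 0])
  have "kcoef n 0 > 0" unfolding kcoef_def
    using mult_strict_left_mono[of 1 "real n + 2" pi] by (intro sin_gt_zero) (auto simp: field_simps)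
  then show "0 < (kcoef n 0)\<^sup>2" by simp
qed auto

lemma cper_kroot: "cper (kroot n)"
  unfolding kroot_def by (intro cper_intros)

lemma cper_kernel: "cper (korovkin n)"
proof -
  have "cper (\<lambda>t. norm (kroot n t))" by (intro cper_intros cper_kroot)
  then show ?thesis unfolding korovkin_def
    using kcoef_sum_pos[of n] by (auto simp: cper_def intro!: continuous_intros)
qed

lemma kernel_nonneg: "korovkin n t \<ge> 0"
  unfolding korovkin_def by (intro divide_nonneg_nonneg sum_nonneg) auto

lemma kernel_even: "korovkin n (- t) = korovkin n t"
proof -
  have "kroot n (- t) = cnj (kroot n t)"
    unfolding kroot_def by (simp add: chi_minus_arg)
  then show ?thesis by (simp add: korovkin_def)
qed

lemma l2sq_kroot: "l2sq (kroot n) = (\<Sum>k\<in>{0..int n}. (kcoef n k)\<^sup>2)"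
  unfolding kroot_def by (subst l2sq_trig) auto

lemma integral_kernel: "integral {0..1} (korovkin n) = 1"
proof -
  have "integral {0..1} (korovkin n) = l2sq (kroot n) / (\<Sum>k\<in>{0..int n}. (kcoef n k)\<^sup>2)"
    unfolding korovkin_def l2sq_def by simp
  then show ?thesis using kcoef_sum_pos[of n] by (simp add: l2sq_kroot)
qed

lemma tp_kernel: "tp n (\<lambda>t. of_real (korovkin n t))"
proof -
  let ?S = "\<Sum>k\<in>{0..int n}. (kcoef n k)\<^sup>2"
  have "complex_of_real (korovkin n t) = (\<Sum>k\<in>{0..int n}. \<Sum>l\<in>{0..int n}.
      (inverse (of_real ?S) * of_real (kcoef n k) * of_real (kcoef n l)) * chi (k - l) t)" for t
  proof -
    have c: "chi (k - l) t = chi k t * cnj (chi l t)" for k l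
      using chi_add[of k "-l" t] by (simp add: chi_minus)
    have "complex_of_real (korovkin n t) = inverse (of_real ?S) * (kroot n t * cnj (kroot n t))"
      unfolding korovkin_def of_real_divide complex_norm_square by (simp add: field_simps)
    also have "\<dots> = inverse (of_real ?S) * ((\<Sum>k\<in>{0..int n}. of_real (kcoef n k) * chi k t) *
        (\<Sum>l\<in>{0..int n}. of_real (kcoef n l) * cnj (chi l t)))"
      unfolding kroot_def by simp
    also have "\<dots> = (\<Sum>k\<in>{0..int n}. \<Sum>l\<in>{0..int n}. inverse (of_real ?S) *
        (of_real (kcoef n k) * chi k t * (of_real (kcoef n l) * cnj (chi l t))))"
      by (subst sum_product) (simp only: sum_distrib_left)
    also have "\<dots> = (\<Sum>k\<in>{0..int n}. \<Sum>l\<in>{0..int n}.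
        (inverse (of_real ?S) * of_real (kcoef n k) * of_real (kcoef n l)) * chi (k - l) t)"
      by (intro sum.cong refl) (simp only: c mult_ac)
    finally show ?thesis .
  qed
  then show ?thesis
    by (simp only:) (intro tp_sum tp_cmult tp_chi, auto)
qed

text \<open>The sequence \<open>kcoef n\<close> vanishes at \<open>-1\<close> and at \<open>n + 1\<close>, and the sum of its two neighbours is
  \<open>2 * cos (pi / (n + 2))\<close> times an entry. So the autocorrelation at lag 1 is an eigenvalue
  computation.\<close>

lemma kernel_first_coeff:
  "integral {0..1} (\<lambda>t. kroot n t * chi 1 t * cnj (kroot n t)) =
     of_real (cos (pi / (real n + 2)) * (\<Sum>k\<in>{0..int n}. (kcoef n k)\<^sup>2))"
proof -
  let ?J = "{0..int n}" and ?h = "pi / (real n + 2)" and ?a = "kcoef n"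
  let ?S = "\<Sum>k\<in>?J. (?a k)\<^sup>2"
  have a0: "?a (-1) = 0" by (simp add: kcoef_def)
  have an: "?a (int n + 1) = 0"
  proof -
    have "?h * (of_int (int n + 1) + 1) = pi" by (simp add: field_simps)
    then show ?thesis by (simp add: kcoef_def)
  qed
  have rec: "?a (k - 1) + ?a (k + 1) = 2 * cos ?h * ?a k" for k
  proof -
    have "?a (k - 1) = sin (?h * (of_int k + 1) - ?h)" "?a (k + 1) = sin (?h * (of_int k + 1) + ?h)"
      by (simp_all add: kcoef_def algebra_simps add_divide_distrib)
    then show ?thesis by (simp add: sin_add sin_diff kcoef_def mult_ac)
  qed
  define T where "T = (\<Sum>k\<in>?J. ?a k * ?a (k - 1))"
  have T2: "T = (\<Sum>k\<in>?J. ?a k * ?a (k + 1))"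
  proof -
    have "(\<Sum>k\<in>?J. ?a k * ?a (k + 1)) = (\<Sum>k\<in>?J. (\<lambda>k. ?a (k - 1) * ?a k) (k + 1))" by simp
    also have "\<dots> = (\<Sum>k\<in>{0+1..int n + 1}. ?a (k - 1) * ?a k)" by (rule sum_int_shift)
    also have "\<dots> = (\<Sum>k\<in>{0..int n + 1}. ?a (k - 1) * ?a k)"
    proof (rule sum.mono_neutral_left)
      show "\<forall>i\<in>{0..int n + 1} - {0+1..int n + 1}. ?a (i - 1) * ?a i = 0"
      proof
        fix i assume "i \<in> {0..int n + 1} - {0+1..int n + 1}"
        then have "i = 0" by auto
        then show "?a (i - 1) * ?a i = 0" using a0 by simp
      qed
    qed auto
    also have "\<dots> = (\<Sum>k\<in>?J. ?a (k - 1) * ?a k)"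
    proof (rule sum.mono_neutral_right)
      show "\<forall>i\<in>{0..int n + 1} - ?J. ?a (i - 1) * ?a i = 0"
      proof
        fix i assume "i \<in> {0..int n + 1} - ?J"
        then have "i = int n + 1" by auto
        then show "?a (i - 1) * ?a i = 0" using an by simp
      qed
    qed auto
    finally show ?thesis by (simp add: T_def mult.commute)
  qed
  have "2 * T = (\<Sum>k\<in>?J. ?a k * (?a (k - 1) + ?a (k + 1)))"
    using T2 by (simp add: T_def distrib_left sum.distrib)
  also have "\<dots> = (\<Sum>k\<in>?J. 2 * cos ?h * (?a k)\<^sup>2)"
    unfolding rec by (simp add: power2_eq_square mult_ac)
  also have "\<dots> = 2 * (cos ?h * ?S)" by (simp add: sum_distrib_left mult_ac)
  finally have T: "T = cos ?h * ?S" by simp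
  have fcs: "fc (\<lambda>t. kroot n t * chi 1 t) k = of_real (if k - 1 \<in> ?J then ?a (k - 1) else 0)" for k
  proof -
    have "fc (\<lambda>t. kroot n t * chi 1 t) k = fc (kroot n) (k - 1)"
      using fc_chi_mult[of 1 "kroot n" k] by (simp add: mult.commute)
    also have "\<dots> = of_real (if k - 1 \<in> ?J then ?a (k - 1) else 0)"
      unfolding kroot_def by (subst fc_trig) auto
    finally show ?thesis .
  qed
  have "integral {0..1} (\<lambda>t. kroot n t * chi 1 t * cnj (kroot n t)) =
    (\<Sum>k\<in>?J. cnj (of_real (?a k)) * fc (\<lambda>t. kroot n t * chi 1 t) k)"
    by (subst (2) kroot_def, subst integral_fc_mult) (auto intro!: cper_intros cper_kroot)
  also have "\<dots> = complex_of_real T"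
    unfolding T_def of_real_sum fcs
  proof (rule sum.cong)
    fix k assume k: "k \<in> ?J"
    show "cnj (of_real (?a k)) * complex_of_real (if k - 1 \<in> ?J then ?a (k - 1) else 0) = of_real (?a k * ?a (k - 1))"
    proof (cases "k = 0")
      case True then show ?thesis using a0 by simp
    next
      case False then show ?thesis using k by auto
    qed
  qed simp
  finally show ?thesis using T by simp
qed

text \<open>By the half-angle formula the moment is \<open>(1 - c) / 2\<close>, where \<open>c = cos (pi / (n + 2))\<close> is the first Fourier coefficient
  of the kernel. This quadratic rate is what makes the commutator estimate below possible; the
  Fejer kernel has only the rate \<open>1 / n\<close>.\<close>

lemma kernel_moment:
  assumes "n \<ge> 1"
  shows "integral {0..1} (\<lambda>t. korovkin n t * (sin (pi * t))\<^sup>2) \<le> 4 / (real n)\<^sup>2"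
proof -
  let ?S = "\<Sum>k\<in>{0..int n}. (kcoef n k)\<^sup>2" and ?h = "pi / (real n + 2)"
  note S = kcoef_sum_pos[of n]
  have "integral {0..1} (\<lambda>t. korovkin n t * (sin (pi * t))\<^sup>2) =
      integral {0..1} (\<lambda>t. (1/2) * korovkin n t - (1/2) * Re (inverse (of_real ?S) * (kroot n t * chi 1 t * cnj (kroot n t))))"
  proof (rule integral_cong)
    fix t :: real
    have 1: "kroot n t * chi 1 t * cnj (kroot n t) = of_real ((norm (kroot n t))\<^sup>2) * chi 1 t"
      by (subst complex_norm_square) (simp add: mult_ac)
    have "inverse (of_real ?S) * (kroot n t * chi 1 t * cnj (kroot n t)) = of_real (korovkin n t) * chi 1 t"
      unfolding 1 korovkin_def by (simp add: divide_inverse mult_ac)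
    then have "Re (inverse (of_real ?S) * (kroot n t * chi 1 t * cnj (kroot n t))) = korovkin n t * cos (2 * pi * t)"
      by (simp only: Re_complex_of_real Im_complex_of_real times_complex.sel chi_def cis.sel) simp
    moreover have "(sin (pi * t))\<^sup>2 = (1 - cos (2 * pi * t)) / 2"
      using cos_double_sin[of "pi * t"] by (simp add: mult_ac)
    ultimately show "korovkin n t * (sin (pi * t))\<^sup>2 = (1/2) * korovkin n t - (1/2) * Re (inverse (of_real ?S) * (kroot n t * chi 1 t * cnj (kroot n t)))"
      by (simp only:) (simp add: diff_divide_distrib right_diff_distrib)
  qed
  also have "\<dots> = (1/2) * 1 - (1/2) * Re (inverse (of_real ?S) * integral {0..1} (\<lambda>t. kroot n t * chi 1 t * cnj (kroot n t)))"
  proof -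
    have i1: "(korovkin n has_integral 1) {0..1}"
      using integrable_integral[OF cper_integrable[OF cper_kernel[of n]]] integral_kernel by metis
    have "((\<lambda>t. kroot n t * chi 1 t * cnj (kroot n t)) has_integral
        integral {0..1} (\<lambda>t. kroot n t * chi 1 t * cnj (kroot n t))) {0..1}"
      by (intro integrable_integral cper_integrable cper_intros cper_kroot)
    then have i2: "((\<lambda>t. Re (inverse (of_real ?S) * (kroot n t * chi 1 t * cnj (kroot n t)))) has_integral
        Re (inverse (of_real ?S) * integral {0..1} (\<lambda>t. kroot n t * chi 1 t * cnj (kroot n t)))) {0..1}"
      by (intro has_integral_Re has_integral_mult_right)
    show ?thesis
      by (rule integral_unique) (intro has_integral_diff has_integral_mult_right i1 i2)
  qed
  also have "\<dots> = (1 - cos ?h) / 2"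
    unfolding kernel_first_coeff using S by (simp flip: of_real_power of_real_sum of_real_inverse of_real_mult)
  also have "\<dots> \<le> ?h\<^sup>2 / 4"
  proof -
    define x where "x = ?h / 2"
    have "y = 2 * (y / 2)" for y :: real by simp
    from this[of ?h] have h: "?h = 2 * x" by (simp only: x_def)
    have "(sin x)\<^sup>2 \<le> x\<^sup>2"
      using abs_sin_x_le_abs_x[of x] by (simp only: abs_le_square_iff)
    then show ?thesis unfolding h using cos_double_sin[of x] by (simp add: power_mult_distrib)
  qed
  also have "\<dots> = (pi / 2)\<^sup>2 / (real n + 2)\<^sup>2" by (simp add: power_divide)
  also have "\<dots> \<le> 2\<^sup>2 / (real n)\<^sup>2"
    using assms pi_less_4 by (intro frac_le power_mono) auto
  finally show ?thesis by simp
qed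

lemma exists_int_near:
  fixes x :: real
  obtains l :: int where "\<bar>x - of_int l\<bar> \<le> 1/2"
proof
  show "\<bar>x - of_int (round x)\<bar> \<le> 1/2" using of_int_round_abs_le[of x] by (simp add: abs_minus_commute)
qed

lemma sin_pi_sq_int: "(sin (pi * (x - of_int l)))\<^sup>2 = (sin (pi * x))\<^sup>2"
proof -
  have s0: "sin (pi * of_int l) = 0"
    using sin_times_pi_eq_0[of "of_int l"] by (simp add: mult.commute)
  have "(cos (pi * of_int l))\<^sup>2 = 1"
    using sin_cos_squared_add[of "pi * of_int l"] s0 by simp
  then show ?thesis by (simp add: right_diff_distrib sin_diff s0 power_mult_distrib)
qed

text \<open>Concavity of the sine on the interval from 0 to half a period.\<close>

lemma sin_pi_ge: assumes "\<bar>u\<bar> \<le> 1/2" shows "2 * \<bar>u\<bar> \<le> \<bar>sin (pi * u)\<bar>"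
proof -
  have main: "2 * v \<le> sin (pi * v)" if "0 \<le> v" "v \<le> 1/2" for v :: real
  proof -
    have c: "concave_on {0..pi} sin"
    proof (rule f''_le0_imp_concave)
      show "\<And>x. x \<in> {0..pi} \<Longrightarrow> (sin has_real_derivative cos x) (at x)" by (auto intro!: derivative_eq_intros)
      show "\<And>x. x \<in> {0..pi} \<Longrightarrow> (cos has_real_derivative (- sin x)) (at x)" by (auto intro!: derivative_eq_intros)
      show "\<And>x. x \<in> {0..pi} \<Longrightarrow> - sin x \<le> 0" using sin_ge_zero by auto
    qed auto
    have "(1 - 2 * v) * sin 0 + (2 * v) * sin (pi / 2) \<le> sin (scaleR (1 - 2 * v) 0 + scaleR (2 * v) (pi / 2))"
      by (rule concave_onD[OF c]) (use that in auto)
    then show ?thesis by (simp add: mult_ac)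
  qed
  show ?thesis
  proof (cases "u \<ge> 0")
    case True then show ?thesis using main[of u] assms by auto
  next
    case False then show ?thesis using main[of "-u"] assms by auto
  qed
qed

lemma sin_pi_sq_ge: assumes "\<bar>u\<bar> \<le> 1/2" shows "4 * u\<^sup>2 \<le> (sin (pi * u))\<^sup>2"
  using power_mono[OF sin_pi_ge[OF assms], of 2] by (simp add: power_mult_distrib)

section \<open>Smoothing of continuous functions\<close>

lemma cper_kernel_refl: "cper (\<lambda>\<tau>. korovkin n (\<theta> - \<tau>))"
  by (rule cper_reflect[OF cper_kernel])

definition ksm :: "nat \<Rightarrow> (real \<Rightarrow> complex) \<Rightarrow> real \<Rightarrow> complex" where
  "ksm n f \<theta> = integral {0..1} (\<lambda>\<tau>. of_real (korovkin n (\<theta> - \<tau>)) * f \<tau>)"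


lemma ksm_eq: assumes f: "cper f"
  shows "ksm n f \<theta> = (\<Sum>j\<in>{-int n..int n}. (fc (\<lambda>t. of_real (korovkin n t)) j * fc f j) * chi j \<theta>)"
proof -
  let ?k = "fc (\<lambda>t. of_real (korovkin n t))"
  have "of_real (korovkin n (\<theta> - \<tau>)) * f \<tau> = (\<Sum>j\<in>{-int n..int n}. (?k j * chi j \<theta>) * (f \<tau> * chi (- j) \<tau>))" for \<tau>
    by (subst tp_expand[OF tp_kernel])
       (simp add: sum_distrib_right sum_distrib_left chi_add_arg[of _ \<theta> "-\<tau>", simplified] chi_minus_arg chi_minus mult_ac)
  then have "ksm n f \<theta> = (\<Sum>j\<in>{-int n..int n}. integral {0..1} (\<lambda>\<tau>. (?k j * chi j \<theta>) * (f \<tau> * chi (- j) \<tau>)))"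
    unfolding ksm_def by (simp only:) (intro integral_sum cper_integrable cper_intros f, auto)
  also have "\<dots> = (\<Sum>j\<in>{-int n..int n}. (?k j * chi j \<theta>) * fc f j)"
    unfolding fc_def by (intro sum.cong refl integral_mult_right)
  finally show ?thesis by (simp add: mult_ac)
qed

lemma tp_ksm: "cper f \<Longrightarrow> tp n (ksm n f)"
  unfolding tp_def
  by (intro exI[of _ "\<lambda>j. fc (\<lambda>t. of_real (korovkin n t)) j * fc f j"] ext ksm_eq)

lemma integral_kernel_shift: "integral {0..1} (\<lambda>\<tau>. korovkin n (\<theta> - \<tau>)) = 1"
  using integral_cper_reflect[OF cper_kernel, of n \<theta>] integral_kernel by simp

lemma cper_sinsq: "cper (\<lambda>t. (sin (pi * t))\<^sup>2)"
  using sin_pi_sq_int[of _ "-1"] by (auto simp: cper_def intro!: continuous_intros)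

lemma kernel_moment_shift:
  assumes "n \<ge> 1"
  shows "integral {0..1} (\<lambda>\<tau>. korovkin n (\<theta> - \<tau>) * (sin (pi * (\<theta> - \<tau>)))\<^sup>2) \<le> 4 / (real n)\<^sup>2"
  using integral_cper_reflect[OF cper_mult[OF cper_kernel cper_sinsq], of n \<theta>] kernel_moment[OF assms] by simp

text \<open>The kernel is a probability density whose moment against \<open>sin\<^sup>2\<close> is \<open>O(1 / n\<^sup>2)\<close>. Majorants of
  this shape are the only way in which the concentration of the kernel is used.\<close>

lemma kernel_integral_bound:
  assumes n: "n \<ge> 1" and g: "cper g" and M: "M \<ge> 0"
    and b: "\<And>\<tau>. norm (g \<tau>) \<le> e + M * (sin (pi * (\<theta> - \<tau>)))\<^sup>2"
  shows "norm (ksm n g \<theta>) \<le> e + 4 * M / (real n)\<^sup>2"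
proof -
  note k = cper_kernel_refl[of n \<theta>]
  have ks: "cper (\<lambda>\<tau>. korovkin n (\<theta> - \<tau>) * (sin (pi * (\<theta> - \<tau>)))\<^sup>2)"
    by (rule cper_mult[OF k cper_reflect[OF cper_sinsq]])
  have "norm (ksm n g \<theta>) \<le> integral {0..1} (\<lambda>\<tau>. e * korovkin n (\<theta> - \<tau>) + M * (korovkin n (\<theta> - \<tau>) * (sin (pi * (\<theta> - \<tau>)))\<^sup>2))"
    unfolding ksm_def
  proof (rule integral_norm_bound_integral)
    show "(\<lambda>\<tau>. complex_of_real (korovkin n (\<theta> - \<tau>)) * g \<tau>) integrable_on {0..1}"
      by (intro cper_integrable cper_intros k g)
    show "(\<lambda>\<tau>. e * korovkin n (\<theta> - \<tau>) + M * (korovkin n (\<theta> - \<tau>) * (sin (pi * (\<theta> - \<tau>)))\<^sup>2)) integrable_on {0..1}"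
      by (intro cper_integrable cper_add cper_mult cper_const k cper_reflect[OF cper_sinsq])
    fix \<tau> :: real
    show "norm (complex_of_real (korovkin n (\<theta> - \<tau>)) * g \<tau>) \<le> e * korovkin n (\<theta> - \<tau>) + M * (korovkin n (\<theta> - \<tau>) * (sin (pi * (\<theta> - \<tau>)))\<^sup>2)"
      using mult_left_mono[OF b[of \<tau>] kernel_nonneg[of n "\<theta> - \<tau>"]] kernel_nonneg[of n "\<theta> - \<tau>"]
      by (simp add: norm_mult algebra_simps)
  qed
  also have "\<dots> = e * integral {0..1} (\<lambda>\<tau>. korovkin n (\<theta> - \<tau>)) + M * integral {0..1} (\<lambda>\<tau>. korovkin n (\<theta> - \<tau>) * (sin (pi * (\<theta> - \<tau>)))\<^sup>2)"
    by (subst integral_add) (auto intro!: cper_integrable cper_mult k ks)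
  also have "\<dots> \<le> e * 1 + M * (4 / (real n)\<^sup>2)"
    unfolding integral_kernel_shift by (intro add_left_mono mult_left_mono kernel_moment_shift n M)
  finally show ?thesis by (simp add: mult.commute)
qed

text \<open>Uniform continuity in the form that \<open>kernel_integral_bound\<close> consumes: for points closer than some \<open>d\<close> the
  difference is below \<open>e\<close>, and for all others \<open>sin\<^sup>2\<close> is bounded below.\<close>

lemma uniform_modulus:
  assumes f: "cper f" and e: "e > 0"
  obtains M where "M \<ge> 0" "\<And>s t. norm (f s - f t :: complex) \<le> e + M * (sin (pi * (t - s)))\<^sup>2"
proof -
  obtain S where S: "S > 0" "\<And>t. norm (f t) \<le> S" using cper_bounded[OF f] by blast
  have "uniformly_continuous_on {-1..2} f"
    by (intro compact_uniformly_continuous cper_cont f) auto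
  then obtain d where d: "d > 0" "\<And>s t. s \<in> {-1..2} \<Longrightarrow> t \<in> {-1..2} \<Longrightarrow> dist s t < d \<Longrightarrow> dist (f s) (f t) < e"
    unfolding uniformly_continuous_on_def using e by metis
  define M where "M = 2 * S / (4 * d\<^sup>2)"
  have "norm (f s - f t) \<le> e + M * (sin (pi * (t - s)))\<^sup>2" for s t
  proof -
    obtain l :: int where l: "\<bar>(t - s) - of_int l\<bar> \<le> 1/2" by (rule exists_int_near)
    define u where "u = (t - s) - of_int l"
    have ft: "f t = f (frac s + u)"
      using cper_of_int[OF f, of "frac s + u" "\<lfloor>s\<rfloor> + l"] by (simp add: u_def frac_def algebra_simps)
    have fs: "f s = f (frac s)" using cper_frac[OF f] by simp
    have sq: "(sin (pi * (t - s)))\<^sup>2 = (sin (pi * u))\<^sup>2" unfolding u_def by (rule sin_pi_sq_int[symmetric])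
    show ?thesis
    proof (cases "\<bar>u\<bar> < d")
      case True
      have "dist (f (frac s)) (f (frac s + u)) < e"
        using l True frac_ge_0[of s] frac_lt_1[of s] unfolding u_def[symmetric]
        by (intro d(2)) (auto simp: dist_real_def simp del: frac_ge_0)
      moreover have "M * (sin (pi * u))\<^sup>2 \<ge> 0" using S d by (simp add: M_def)
      ultimately show ?thesis unfolding sq ft fs by (simp add: dist_norm)
    next
      case False
      have "4 * d\<^sup>2 \<le> 4 * u\<^sup>2" using False d(1) by (simp add: abs_le_square_iff[symmetric])
      also have "\<dots> \<le> (sin (pi * u))\<^sup>2" using sin_pi_sq_ge[of u] l by (simp add: u_def)
      finally have "M * (4 * d\<^sup>2) \<le> M * (sin (pi * u))\<^sup>2"
        using S d by (intro mult_left_mono) (auto simp: M_def)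
      moreover have "M * (4 * d\<^sup>2) = 2 * S" using d by (simp add: M_def)
      moreover have "norm (f s - f t) \<le> 2 * S" using norm_triangle_ineq4[of "f s" "f t"] S(2)[of s] S(2)[of t] by linarith
      ultimately show ?thesis unfolding sq using e by linarith
    qed
  qed
  moreover have "M \<ge> 0" using S by (simp add: M_def)
  ultimately show thesis using that by blast
qed

lemma ksm_diff: "cper f \<Longrightarrow> cper g \<Longrightarrow> ksm n (\<lambda>t. f t - g t) \<theta> = ksm n f \<theta> - ksm n g \<theta>"
  unfolding ksm_def right_diff_distrib by (intro integral_diff cper_integrable cper_intros cper_kernel_refl)

lemma ksm_add: "cper f \<Longrightarrow> cper g \<Longrightarrow> ksm n (\<lambda>t. f t + g t) \<theta> = ksm n f \<theta> + ksm n g \<theta>"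
  unfolding ksm_def distrib_left by (intro integral_add cper_integrable cper_intros cper_kernel_refl)

lemma ksm_cmult: "ksm n (\<lambda>t. f t * c) \<theta> = ksm n f \<theta> * c"
  unfolding ksm_def mult.assoc[symmetric] by (rule integral_mult_left)

lemma ksm_const: "ksm n (\<lambda>t. c) \<theta> = c"
proof -
  have "((\<lambda>\<tau>. korovkin n (\<theta> - \<tau>)) has_integral 1) {0..1}"
    using integrable_integral[OF cper_integrable[OF cper_reflect[OF cper_kernel]], of n \<theta> 0 1]
    unfolding integral_kernel_shift .
  from has_integral_of_real[OF this]
  have "((\<lambda>\<tau>. complex_of_real (korovkin n (\<theta> - \<tau>))) has_integral 1) {0..1}"
    by (simp only: of_real_1)
  from has_integral_mult_left[OF this, of c] show ?thesis unfolding ksm_def by (simp only: integral_unique mult_1)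
qed

lemma ksm_bound: "n \<ge> 1 \<Longrightarrow> cper f \<Longrightarrow> (\<And>t. norm (f t) \<le> S) \<Longrightarrow> norm (ksm n f \<theta>) \<le> S"
  using kernel_integral_bound[of n f 0 S \<theta>] by simp

lemma ksm_approx:
  assumes f: "cper f" and e: "e > 0"
  obtains n0 where "n0 \<ge> 1" "\<And>n \<theta>. n \<ge> n0 \<Longrightarrow> norm (ksm n f \<theta> - f \<theta>) \<le> e"
proof -
  obtain M where M: "M \<ge> 0" "\<And>s t. norm (f s - f t :: complex) \<le> e/2 + M * (sin (pi * (t - s)))\<^sup>2"
    using uniform_modulus[OF f, of "e/2"] e by auto
  obtain n0 :: nat where n0: "real n0 > 8 * M / e" using reals_Archimedean2 by blast
  have "norm (ksm n f \<theta> - f \<theta>) \<le> e" if n: "n \<ge> max n0 1" for n \<theta>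
  proof -
    have "ksm n f \<theta> - f \<theta> = ksm n (\<lambda>\<tau>. f \<tau> - f \<theta>) \<theta>"
      by (subst ksm_diff) (auto simp: ksm_const f)
    then have "norm (ksm n f \<theta> - f \<theta>) \<le> e/2 + 4 * M / (real n)\<^sup>2"
      using kernel_integral_bound[of n "\<lambda>\<tau>. f \<tau> - f \<theta>" M "e/2" \<theta>] M n by (simp add: cper_intros f)
    also have "4 * M / (real n)\<^sup>2 \<le> 4 * M / real n"
      using n M(1) by (intro divide_left_mono) (auto simp: power2_eq_square)
    also have "\<dots> \<le> e / 2"
    proof -
      have "8 * M < e * real n0" using n0 e by (simp add: field_simps)
      also have "\<dots> \<le> e * real n" using n e by (intro mult_left_mono) auto
      finally show ?thesis using n by (simp add: field_simps)
    qed
    finally show ?thesis by simp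
  qed
  then show thesis using that[of "max n0 1"] by auto
qed

lemma norm_fc_kernel: "norm (fc (\<lambda>t. of_real (korovkin n t)) j) \<le> 1"
proof -
  have "norm (fc (\<lambda>t. of_real (korovkin n t)) j) \<le> integral {0..1} (korovkin n)"
    unfolding fc_def
    by (rule integral_norm_bound_integral)
       (auto intro!: cper_integrable cper_intros cper_kernel simp: norm_mult kernel_nonneg)
  then show ?thesis by (simp add: integral_kernel)
qed

text \<open>Only this inequality of the Parseval identity is needed to pass from coefficients to square integrals.
  The smoothed functions are trigonometric polynomials whose coefficients are at most those of \<open>f\<close> in absolute value,
  and they converge to \<open>f\<close> uniformly.\<close>

lemma parseval_le:
  assumes f: "cper f" and C: "\<And>J. finite J \<Longrightarrow> (\<Sum>j\<in>J. (norm (fc f j))\<^sup>2) \<le> C"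
  shows "l2sq f \<le> C"
proof (rule field_le_epsilon)
  fix e :: real assume e: "e > 0"
  obtain S where S: "S > 0" "\<And>t. norm (f t) \<le> S" using cper_bounded[OF f] by blast
  define d where "d = min 1 (e / (2 * S + 1))"
  have d: "d > 0" "d \<le> 1" using e S by (auto simp: d_def)
  have d3: "d * (2 * S + 1) \<le> e"
  proof -
    have "d * (2 * S + 1) \<le> e / (2 * S + 1) * (2 * S + 1)"
      using S by (intro mult_right_mono) (auto simp: d_def)
    then show ?thesis using S by simp
  qed
  obtain n where n: "n \<ge> 1" "\<And>\<theta>. norm (ksm n f \<theta> - f \<theta>) \<le> d" using ksm_approx[OF f d(1)] by (metis order_refl)
  have kc: "cper (ksm n f)" by (rule tp_cper[OF tp_ksm[OF f]])
  have "l2sq (ksm n f) = (\<Sum>j\<in>{-int n..int n}. (norm (fc (\<lambda>t. of_real (korovkin n t)) j * fc f j))\<^sup>2)"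
    unfolding ksm_eq[OF f, abs_def] by (rule l2sq_trig) simp
  also have "\<dots> \<le> (\<Sum>j\<in>{-int n..int n}. (norm (fc f j))\<^sup>2)"
    using mult_right_mono[OF norm_fc_kernel[of n]] by (intro sum_mono power_mono) (auto simp: norm_mult)
  also have "\<dots> \<le> C" by (rule C) simp
  finally have kC: "l2sq (ksm n f) \<le> C" .
  have "l2sq f \<le> integral {0..1} (\<lambda>t. (norm (ksm n f t))\<^sup>2 + e)"
    unfolding l2sq_def
  proof (rule integral_le)
    fix t :: real
    have "norm (f t) \<le> norm (ksm n f t) + d"
      using n(2)[of t] norm_triangle_ineq3[of "f t" "ksm n f t"] by (simp add: norm_minus_commute)
    then have "(norm (f t))\<^sup>2 \<le> (norm (ksm n f t) + d)\<^sup>2" by (intro power_mono) auto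
    also have "\<dots> = (norm (ksm n f t))\<^sup>2 + d * (2 * norm (ksm n f t) + d)" by (simp add: power2_eq_square algebra_simps)
    also have "d * (2 * norm (ksm n f t) + d) \<le> d * (2 * S + 1)"
      using d ksm_bound[OF n(1) f S(2), of t] by (intro mult_left_mono) auto
    also have "\<dots> \<le> e" by (rule d3)
    finally show "(norm (f t))\<^sup>2 \<le> (norm (ksm n f t))\<^sup>2 + e" by simp
  qed (intro integrable_continuous_interval continuous_on_add continuous_on_const cper_norm_cont f kc)+
  also have "\<dots> = l2sq (ksm n f) + e"
    unfolding l2sq_def
    by (subst integral_add) (auto intro!: integrable_continuous_interval cper_norm_cont kc)
  finally show "l2sq f \<le> C + e" using kC by simp
qed

lemma l2sq_eq_0: assumes f: "cper f" and "l2sq f \<le> 0" shows "f t = 0"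
proof -
  have "integral {0..1} (\<lambda>t. (norm (f t))\<^sup>2) = 0"
    using assms(2) l2sq_nonneg[of f] by (simp add: l2sq_def)
  then have "\<forall>t\<in>{0..1}. (norm (f t))\<^sup>2 = 0"
    by (subst (asm) integral_eq_0_iff) (auto intro: cper_norm_cont f)
  then have "f (frac t) = 0" using frac_lt_1[of t] frac_ge_0[of t] by (simp add: less_imp_le)
  then show ?thesis using cper_frac[OF f] by simp
qed

section \<open>Smooth periodic functions and rapid decay\<close>

text \<open>Recursive form of being \<open>k\<close> times differentiable, chosen because closure properties then follow by
  induction. Being \<open>Ck k\<close> for all \<open>k\<close> is smoothness by \<open>smooth_iff_Ck\<close>.\<close>

primrec Ck :: "nat \<Rightarrow> (real \<Rightarrow> 'a::real_normed_vector) \<Rightarrow> bool" where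
  "Ck 0 f \<longleftrightarrow> True"
| "Ck (Suc k) f \<longleftrightarrow> (\<exists>f'. (\<forall>t. (f has_vector_derivative f' t) (at t)) \<and> Ck k f')"

lemma Ck_SucI: "(\<And>t. (f has_vector_derivative f' t) (at t)) \<Longrightarrow> Ck k f' \<Longrightarrow> Ck (Suc k) f"
  by auto

lemma smooth_iff_Ck: "smooth f \<longleftrightarrow> (\<forall>k. Ck k f)"
proof
  assume "smooth f"
  then obtain D where D: "D 0 = f" "\<And>n x. (D n has_vector_derivative D (Suc n) x) (at x)"
    unfolding smooth_def by blast
  have "Ck k (D n)" for k n
    by (induction k arbitrary: n) (use D(2) in auto)
  then show "\<forall>k. Ck k f" using D(1) by metis
next
  assume f: "\<forall>k. Ck k f"
  define d where "d = (\<lambda>f::real \<Rightarrow> 'a. \<lambda>t. vector_derivative f (at t))"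
  have step: "(\<forall>t. (g has_vector_derivative d g t) (at t)) \<and> (\<forall>k. Ck k (d g))" if g: "\<forall>k. Ck k g" for g
  proof -
    have 1: "(g has_vector_derivative d g t) (at t)" for t
    proof -
      obtain g' where "(g has_vector_derivative g' t) (at t)" using g[rule_format, of 1] by auto
      then show ?thesis using vector_derivative_at by (metis d_def)
    qed
    have "Ck k (d g)" for k
    proof -
      obtain g' where g': "\<And>t. (g has_vector_derivative g' t) (at t)" "Ck k g'"
        using g[rule_format, of "Suc k"] by auto
      have "g' = d g" using vector_derivative_at[OF g'(1)] by (auto simp: d_def)
      then show ?thesis using g' by simp
    qed
    with 1 show ?thesis by blast
  qed
  have "\<forall>k. Ck k ((d ^^ n) f)" for n
    by (induction n) (use f step in auto)
  then have "\<forall>n x. ((d ^^ n) f has_vector_derivative (d ^^ Suc n) f x) (at x)"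
    using step by auto
  then show "smooth f" unfolding smooth_def by (intro exI[of _ "\<lambda>n. (d ^^ n) f"]) auto
qed

lemma Ck_mono: "Ck (Suc k) f \<Longrightarrow> Ck k f"
proof (induction k arbitrary: f)
  case (Suc k)
  from Suc.prems obtain f' where "\<And>t. (f has_vector_derivative f' t) (at t)" "Ck (Suc k) f'" by auto
  then show ?case using Suc.IH[of f'] by auto
qed simp

lemma Ck_const: "Ck k (\<lambda>t. c)"
  by (induction k arbitrary: c) (auto intro!: exI[of _ "\<lambda>_. 0"] has_vector_derivative_const)

lemma Ck_add: "Ck k f \<Longrightarrow> Ck k g \<Longrightarrow> Ck k (\<lambda>t. f t + g t)"
proof (induction k arbitrary: f g)
  case (Suc k)
  from Suc.prems obtain f' g' where "\<And>t. (f has_vector_derivative f' t) (at t)" "Ck k f'"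
    "\<And>t. (g has_vector_derivative g' t) (at t)" "Ck k g'" by auto
  then show ?case using Suc.IH[of f' g']
    by (intro Ck_SucI[of _ "\<lambda>t. f' t + g' t"] has_vector_derivative_add) simp_all
qed simp

lemma Ck_bounded_linear: "bounded_linear h \<Longrightarrow> Ck k f \<Longrightarrow> Ck k (\<lambda>t. h (f t))"
proof (induction k arbitrary: f)
  case (Suc k)
  from Suc.prems(2) obtain f' where f': "\<And>t. (f has_vector_derivative f' t) (at t)" "Ck k f'" by auto
  show ?case
    by (rule Ck_SucI[of _ "\<lambda>t. h (f' t)"])
       (rule bounded_linear.has_vector_derivative[OF Suc.prems(1) f'(1)], rule Suc.IH[OF Suc.prems(1) f'(2)])
qed simp

lemma Ck_mult:
  fixes f g :: "real \<Rightarrow> 'a::real_normed_algebra"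
  shows "Ck k f \<Longrightarrow> Ck k g \<Longrightarrow> Ck k (\<lambda>t. f t * g t)"
proof (induction k arbitrary: f g)
  case (Suc k)
  from Suc.prems obtain f' g' where fg: "\<And>t. (f has_vector_derivative f' t) (at t)" "Ck k f'"
    "\<And>t. (g has_vector_derivative g' t) (at t)" "Ck k g'" by auto
  have "Ck k (\<lambda>t. f t * g' t + f' t * g t)"
    by (intro Ck_add Suc.IH fg Ck_mono[OF Suc.prems(1)] Ck_mono[OF Suc.prems(2)])
  then show ?case using has_vector_derivative_mult[OF fg(1) fg(3)] by (intro Ck_SucI)
qed simp

lemma Ck_inverse:
  fixes f :: "real \<Rightarrow> complex"
  assumes "\<And>t. f t \<noteq> 0"
  shows "Ck k f \<Longrightarrow> Ck k (\<lambda>t. inverse (f t))"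
proof (induction k)
  case (Suc k)
  from Suc.prems obtain f' where f': "\<And>t. (f has_vector_derivative f' t) (at t)" "Ck k f'" by auto
  have "((\<lambda>t. inverse (f t)) has_vector_derivative f' t * ((-1) * (inverse (f t) * inverse (f t)))) (at t)" for t
  proof -
    have "(inverse has_field_derivative - (inverse (f t) ^ 2)) (at (f t))"
      using DERIV_inverse[OF assms[of t]] by (simp add: numeral_2_eq_2)
    from field_vector_diff_chain_at[OF f'(1)[of t] this]
    show ?thesis by (simp add: o_def power2_eq_square)
  qed
  moreover have "Ck k (\<lambda>t. f' t * ((-1) * (inverse (f t) * inverse (f t))))"
    by (intro Ck_mult Ck_const f'(2) Suc.IH Ck_mono[OF Suc.prems])
  ultimately show ?case by (intro Ck_SucI)
qed simp

lemma Ck_shift: "Ck k f \<Longrightarrow> Ck k (\<lambda>t. f (t + a))"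
proof (induction k arbitrary: f)
  case (Suc k)
  from Suc.prems obtain f' where f': "\<And>t. (f has_vector_derivative f' t) (at t)" "Ck k f'" by auto
  have "((\<lambda>t. f (t + a)) has_vector_derivative f' (t + a)) (at t)" for t
  proof -
    have "((\<lambda>t. t + a) has_vector_derivative 1) (at t)" by (auto intro!: derivative_eq_intros)
    from vector_diff_chain_at[OF this f'(1)] show ?thesis by (simp add: o_def)
  qed
  then show ?case using Suc.IH[OF f'(2)] by (intro Ck_SucI)
qed simp

lemma chi_deriv: "(chi j has_vector_derivative (2 * pi * \<i> * of_int j) * chi j t) (at t)"
proof -
  have "((\<lambda>t. exp (of_real t * (2 * pi * \<i> * of_int j))) has_vector_derivative
      (2 * pi * \<i> * of_int j) * exp (of_real t * (2 * pi * \<i> * of_int j))) (at t)"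
    using exp_scaleR_has_vector_derivative_left[of "2 * pi * \<i> * of_int j" t]
    by (simp add: scaleR_conv_of_real)
  moreover have "chi j = (\<lambda>t. exp (of_real t * (2 * pi * \<i> * of_int j)))"
    unfolding chi_def cis_conv_exp by (auto simp: mult_ac)
  ultimately show ?thesis by simp
qed

lemma Ck_chi: "Ck k (chi j)"
proof -
  have "Ck k (\<lambda>t. c * chi j t)" for c
  proof (induction k arbitrary: c)
    case (Suc k)
    have "((\<lambda>t. c * chi j t) has_vector_derivative (c * (2 * pi * \<i> * of_int j)) * chi j t) (at t)" for t
      using has_vector_derivative_mult[OF has_vector_derivative_const chi_deriv, of c j t] by (simp add: mult_ac)
    then show ?case using Suc by (intro Ck_SucI)
  qed simp
  from this[of 1] show ?thesis by simp
qed

definition sper :: "(real \<Rightarrow> complex) \<Rightarrow> bool" where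
  "sper f \<longleftrightarrow> smooth f \<and> cper f"

lemma sper_cper: "sper f \<Longrightarrow> cper f"
  by (simp add: sper_def)

lemma sper_const: "sper (\<lambda>t. c)" and sper_chi: "sper (chi j)"
  by (auto simp: sper_def smooth_iff_Ck Ck_const Ck_chi)
lemma sper_add: "sper f \<Longrightarrow> sper g \<Longrightarrow> sper (\<lambda>t. f t + g t)"
  by (auto simp: sper_def smooth_iff_Ck Ck_add cper_add)
lemma sper_mult: "sper f \<Longrightarrow> sper g \<Longrightarrow> sper (\<lambda>t. f t * g t)"
  by (auto simp: sper_def smooth_iff_Ck Ck_mult cper_mult)
lemma sper_minus: "sper f \<Longrightarrow> sper (\<lambda>t. - f t)"
  using sper_mult[OF sper_const[of "-1"]] by simp
lemma sper_diff: "sper f \<Longrightarrow> sper g \<Longrightarrow> sper (\<lambda>t. f t - g t)"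
  using sper_add[OF _ sper_minus, of f g] by simp
lemma sper_shift: "sper f \<Longrightarrow> sper (\<lambda>t. f (t + a))"
  by (auto simp: sper_def smooth_iff_Ck Ck_shift cper_shift)
lemma sper_sum: "finite I \<Longrightarrow> (\<And>i. i \<in> I \<Longrightarrow> sper (f i)) \<Longrightarrow> sper (\<lambda>t. \<Sum>i\<in>I. f i t)"
  by (induction I rule: finite_induct) (auto intro: sper_const sper_add)
lemma sper_divide: assumes "sper f" "sper g" "\<And>t. g t \<noteq> 0" shows "sper (\<lambda>t. f t / g t)"
proof -
  have "sper (\<lambda>t. inverse (g t))"
    using assms cper_divide[of "\<lambda>_. 1" g] by (auto simp: sper_def smooth_iff_Ck Ck_inverse divide_inverse)
  from sper_mult[OF assms(1) this] show ?thesis by (simp add: divide_inverse)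
qed
lemma tp_sper: "tp n p \<Longrightarrow> sper p"
  unfolding tp_def by (auto intro!: sper_sum sper_mult sper_const sper_chi)

lemma sper_deriv:
  assumes "sper f"
  obtains f' where "sper f'" "\<And>t. (f has_vector_derivative f' t) (at t)"
proof -
  obtain D where D: "D 0 = f" "\<And>n x. (D n has_vector_derivative D (Suc n) x) (at x)"
    using assms unfolding sper_def smooth_def by blast
  have "((\<lambda>t. f (t + 1)) has_vector_derivative D 1 (t + 1)) (at t)" for t
  proof -
    have "((\<lambda>t. t + 1) has_vector_derivative 1) (at t)" by (auto intro!: derivative_eq_intros)
    from vector_diff_chain_at[OF this D(2)[of 0]] show ?thesis by (simp add: o_def D(1))
  qed
  moreover have "(\<lambda>t. f (t + 1)) = f" using cperD[OF sper_cper[OF assms]] by auto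
  ultimately have "D 1 (t + 1) = D 1 t" for t
    using D(2)[of 0 t] by (auto simp: D(1) intro: vector_derivative_unique_at)
  moreover have "continuous_on UNIV (D 1)"
    using D(2)[of 1] by (intro continuous_at_imp_continuous_on) (auto intro: has_vector_derivative_continuous)
  moreover have "smooth (D 1)"
    unfolding smooth_def by (intro exI[of _ "\<lambda>n. D (Suc n)"]) (use D(2) in auto)
  ultimately have "sper (D 1)" by (auto simp: sper_def cper_def)
  then show thesis using that D(2)[of 0] by (auto simp: D(1))
qed

lemma fc_deriv:
  assumes f: "cper f" "cper f'" "\<And>t. (f has_vector_derivative f' t) (at t)"
  shows "fc f' j = 2 * pi * \<i> * of_int j * fc f j"
proof -
  let ?c = "2 * pi * \<i> * of_int (- j) :: complex"
  have "((\<lambda>t. f t * (?c * chi (- j) t) + f' t * chi (- j) t) has_integral (f 1 * chi (- j) 1 - f 0 * chi (- j) 0)) {0..1}"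
  proof (rule fundamental_theorem_of_calculus)
    fix t :: real
    show "((\<lambda>t. f t * chi (- j) t) has_vector_derivative f t * (?c * chi (- j) t) + f' t * chi (- j) t) (at t within {0..1})"
      by (rule has_vector_derivative_at_within) (rule has_vector_derivative_mult[OF f(3) chi_deriv])
  qed simp
  moreover have "f 1 * chi (- j) 1 - f 0 * chi (- j) 0 = 0"
    using cperD[OF f(1), of 0] chi_of_int[of "-j" 1] by simp
  ultimately have "integral {0..1} (\<lambda>t. ?c * (f t * chi (- j) t) + f' t * chi (- j) t) = 0"
    by (simp add: integral_unique mult_ac)
  then have "?c * fc f j + fc f' j = 0"
    unfolding fc_def
    by (subst (asm) integral_add) (auto intro!: cper_integrable cper_intros f)
  then show ?thesis by (simp add: algebra_simps eq_neg_iff_add_eq_0)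
qed

text \<open>Each integration by parts gains one power of the frequency.\<close>

lemma sper_decay:
  assumes "sper f"
  shows "\<exists>C\<ge>0. \<forall>j. norm (fc f j) * (1 + \<bar>of_int j\<bar>) ^ m \<le> C"
  using assms
proof (induction m arbitrary: f)
  case 0
  obtain S where "S > 0" "\<And>t. norm (f t) \<le> S" using cper_bounded[OF sper_cper[OF 0]] by blast
  then show ?case using fc_bound[OF sper_cper[OF 0]] by (intro exI[of _ S]) auto
next
  case (Suc m)
  obtain f' where f': "sper f'" "\<And>t. (f has_vector_derivative f' t) (at t)" using sper_deriv[OF Suc.prems] by blast
  obtain C where C: "C \<ge> 0" "\<And>j. norm (fc f j) * (1 + \<bar>of_int j\<bar>) ^ m \<le> C" using Suc.IH[OF Suc.prems] by auto
  obtain C' where C': "C' \<ge> 0" "\<And>j. norm (fc f' j) * (1 + \<bar>of_int j\<bar>) ^ m \<le> C'" using Suc.IH[OF f'(1)] by auto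
  have "norm (fc f j) * (1 + \<bar>of_int j\<bar>) ^ Suc m \<le> C + C'" for j
  proof -
    let ?w = "(1 + \<bar>of_int j\<bar> :: real) ^ m"
    have "norm (fc f' j) = 2 * pi * \<bar>of_int j\<bar> * norm (fc f j)"
      using fc_deriv[OF sper_cper[OF Suc.prems] sper_cper[OF f'(1)] f'(2)] by (simp add: norm_mult)
    then have "norm (fc f j) * \<bar>of_int j\<bar> \<le> norm (fc f' j)"
      using mult_right_mono[of 1 "2 * pi" "\<bar>of_int j\<bar> * norm (fc f j)"] pi_gt3 by (simp add: mult_ac)
    then have "norm (fc f j) * \<bar>of_int j\<bar> * ?w \<le> norm (fc f' j) * ?w" by (intro mult_right_mono) auto
    moreover have "norm (fc f j) * (1 + \<bar>of_int j\<bar>) ^ Suc m = norm (fc f j) * ?w + norm (fc f j) * \<bar>of_int j\<bar> * ?w"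
      by (simp add: algebra_simps)
    ultimately show ?thesis using C(2)[of j] C'(2)[of j] by linarith
  qed
  then show ?case using C(1) C'(1) by (intro exI[of _ "C + C'"]) auto
qed

subsection \<open>Fourier synthesis\<close>

lemma norm_triangle_sub_mid: "norm (a - c) \<le> norm (a - b) + norm (b - c)"
  for a :: "'a::real_normed_vector"
  using norm_triangle_ineq[of "a - b" "b - c"] by simp

text \<open>The symmetric partial sums form a Cauchy sequence, uniformly in \<open>t\<close>, because the increments
  \<open>2 * C / (n + 2)\<^sup>2\<close> are dominated by a telescoping series.\<close>

lemma fourier_synthesis:
  fixes c :: "int \<Rightarrow> complex"
  assumes c: "\<And>j. norm (c j) * (1 + \<bar>of_int j\<bar>)\<^sup>2 \<le> C"
  obtains g where "cper g" "\<And>j. fc g j = c j"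
    "\<And>n t. norm (g t - (\<Sum>j\<in>{-int n..int n}. c j * chi j t)) \<le> 2 * C / (real n + 1)"
proof -
  define s where "s n t = (\<Sum>j\<in>{-int n..int n}. c j * chi j t)" for n t
  have C: "C \<ge> 0" using order_trans[OF norm_ge_zero[of "c 0"]] c[of 0] by simp
  have step: "norm (s (n + k) t - s n t) \<le> 2 * C * (1 / (real n + 1) - 1 / (real (n + k) + 1))" for n k t
  proof (induction k)
    case (Suc k)
    define m where "m = n + k"
    have "{-int (Suc m)..int (Suc m)} = insert (int (Suc m)) (insert (- int (Suc m)) {-int m..int m})" by auto
    then have "s (Suc m) t = c (int (Suc m)) * chi (int (Suc m)) t + (c (- int (Suc m)) * chi (- int (Suc m)) t + s m t)"
      unfolding s_def by simp
    then have "norm (s (Suc m) t - s m t) \<le> norm (c (int (Suc m))) + norm (c (- int (Suc m)))"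
      using norm_triangle_ineq[of "c (int (Suc m)) * chi (int (Suc m)) t" "c (- int (Suc m)) * chi (- int (Suc m)) t"]
      by (simp add: norm_mult)
    also have "\<dots> \<le> 2 * (C / (real m + 2)\<^sup>2)"
    proof -
      have "norm (c j) \<le> C / (real m + 2)\<^sup>2" if "\<bar>j\<bar> = int (Suc m)" for j
      proof -
        have "\<bar>real_of_int j\<bar> = real m + 1" using that by linarith
        then show ?thesis using c[of j] by (simp add: field_simps)
      qed
      from this[of "int (Suc m)"] this[of "- int (Suc m)"] show ?thesis by simp
    qed
    also have "C / (real m + 2)\<^sup>2 \<le> C * (1 / (real m + 1) - 1 / (real m + 2))"
    proof -
      have "1 / (real m + 1) - 1 / (real m + 2) = 1 / ((real m + 1) * (real m + 2))" by (simp add: field_simps)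
      moreover have "1 / (real m + 2)\<^sup>2 \<le> 1 / ((real m + 1) * (real m + 2))"
        by (intro divide_left_mono) (auto simp: power2_eq_square intro!: mult_right_mono)
      ultimately show ?thesis using mult_left_mono[OF _ C] by (metis times_divide_eq_right mult.right_neutral)
    qed
    finally have "norm (s (Suc m) t - s m t) \<le> 2 * C * (1 / (real m + 1) - 1 / (real m + 2))" by simp
    moreover have "norm (s (Suc m) t - s n t) \<le> norm (s (Suc m) t - s m t) + norm (s m t - s n t)"
      by (rule norm_triangle_sub_mid)
    ultimately have "norm (s (Suc m) t - s n t) \<le> 2 * C * (1 / (real m + 1) - 1 / (real m + 2)) + 2 * C * (1 / (real n + 1) - 1 / (real m + 1))"
      using Suc unfolding m_def[symmetric] by linarith
    also have "\<dots> = 2 * C * (1 / (real n + 1) - 1 / (real m + 2))" by (simp add: algebra_simps)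
    finally show ?case by (simp add: m_def algebra_simps)
  qed simp
  have step': "norm (s m t - s n t) \<le> 2 * C / (real n + 1)" if "n \<le> m" for m n t
  proof -
    have "norm (s m t - s n t) \<le> 2 * C * (1 / (real n + 1) - 1 / (real m + 1))"
      using step[of n "m - n" t] that by simp
    also have "\<dots> \<le> 2 * C * (1 / (real n + 1))" using C by (intro mult_left_mono) auto
    finally show ?thesis by simp
  qed
  have lim0: "(\<lambda>n. 2 * C / (real n + 1)) \<longlonglongrightarrow> 0"
    using LIMSEQ_Suc[OF lim_const_over_n[of "2 * C"]] by (simp add: add.commute)
  have "Cauchy (\<lambda>n. s n t)" for t
  proof (rule CauchyI)
    fix e :: real assume "e > 0"
    then obtain N where N: "2 * C / (real N + 1) < e / 2"
      using order_tendstoD(2)[OF lim0, of "e/2"] by (auto simp: eventually_sequentially)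
    have "norm (s m t - s n t) < e" if "m \<ge> N" "n \<ge> N" for m n
      using step'[OF that(1), of t] step'[OF that(2), of t] N norm_triangle_ineq4[of "s m t - s N t" "s n t - s N t"] by simp
    then show "\<exists>M. \<forall>m\<ge>M. \<forall>n\<ge>M. norm (s m t - s n t) < e" by blast
  qed
  then have conv: "(\<lambda>n. s n t) \<longlonglongrightarrow> lim (\<lambda>n. s n t)" for t
    using Cauchy_convergent convergent_LIMSEQ_iff by blast
  define g where "g t = lim (\<lambda>n. s n t)" for t
  have gs: "norm (g t - s n t) \<le> 2 * C / (real n + 1)" for n t
  proof (rule tendsto_upperbound)
    show "(\<lambda>m. norm (s m t - s n t)) \<longlonglongrightarrow> norm (g t - s n t)"
      unfolding g_def by (intro tendsto_intros conv)
    show "\<forall>\<^sub>F m in sequentially. norm (s m t - s n t) \<le> 2 * C / (real n + 1)"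
      using step' by (auto simp: eventually_sequentially)
  qed simp
  have sc: "cper (s n)" for n unfolding s_def by (intro cper_intros)
  have "continuous_on UNIV g"
  proof (rule uniform_limit_theorem[of _ s sequentially])
    show "uniform_limit UNIV s g sequentially"
    proof (rule uniform_limitI)
      fix e :: real assume "e > 0"
      then have "\<forall>\<^sub>F n in sequentially. 2 * C / (real n + 1) < e" using order_tendstoD(2)[OF lim0] by blast
      then show "\<forall>\<^sub>F n in sequentially. \<forall>x\<in>UNIV. dist (s n x) (g x) < e"
        by eventually_elim (use gs in \<open>auto simp: dist_norm norm_minus_commute intro: order.strict_trans1\<close>)
    qed
  qed (auto intro!: always_eventually cper_cont sc)
  moreover have "g (t + 1) = g t" for t using cperD[OF sc] by (simp add: g_def)
  ultimately have g: "cper g" by (auto simp: cper_def)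
  have "fc g j = c j" for j
  proof -
    have "(\<lambda>n. fc g j - fc (s n) j) \<longlonglongrightarrow> 0"
    proof (rule Lim_null_comparison[OF _ lim0])
      show "\<forall>\<^sub>F n in sequentially. norm (fc g j - fc (s n) j) \<le> 2 * C / (real n + 1)"
        using fc_bound[OF cper_diff[OF g sc] gs] by (auto simp: fc_diff g sc)
    qed
    moreover have "\<forall>\<^sub>F n in sequentially. fc g j - fc (s n) j = fc g j - c j"
      using eventually_ge_at_top[of "nat \<bar>j\<bar>"]
    proof eventually_elim
      case (elim n)
      have "fc (s n) j = fc (\<lambda>t. \<Sum>j\<in>{-int n..int n}. c j * chi j t) j" by (simp add: s_def[abs_def])
      then show ?case using elim by (subst (asm) fc_trig) auto
    qed
    ultimately have "(\<lambda>n::nat. fc g j - c j) \<longlonglongrightarrow> 0" using tendsto_cong by fastforce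
    then show ?thesis using LIMSEQ_unique[OF tendsto_const] by fastforce
  qed
  then show thesis using that g gs unfolding s_def by blast
qed

text \<open>The sum of the Fourier series and \<open>f\<close> have the same coefficients, hence are equal by \<open>parseval_le\<close>.\<close>

lemma fourier_inversion:
  assumes f: "cper f" and c: "\<And>j. norm (fc f j) * (1 + \<bar>of_int j\<bar>)\<^sup>2 \<le> C"
  shows "norm (f t - trunc n f t) \<le> 2 * C / (real n + 1)"
proof -
  obtain g where g: "cper g" "\<And>j. fc g j = fc f j"
    "\<And>n t. norm (g t - (\<Sum>j\<in>{-int n..int n}. fc f j * chi j t)) \<le> 2 * C / (real n + 1)"
    using fourier_synthesis[OF c] by blast
  have "l2sq (\<lambda>t. f t - g t) \<le> 0"
    by (rule parseval_le[OF cper_diff[OF f g(1)]]) (simp add: fc_diff[OF f g(1)] g(2))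
  from l2sq_eq_0[OF cper_diff[OF f g(1)] this] have "f t - g t = 0" .
  then show ?thesis using g(3)[of t n] by (simp add: trunc_def)
qed

text \<open>The derivative is synthesised from the coefficients \<open>2 * pi * \<i> * j * fc f j\<close>. Integrating the
  partial sums shows that its primitive is \<open>f\<close> up to a constant.\<close>

lemma rapid_imp_deriv:
  assumes f: "cper f" and r: "\<And>m. \<exists>C. \<forall>j. norm (fc f j) * (1 + \<bar>of_int j\<bar>) ^ m \<le> C"
  obtains f' where "cper f'" "\<And>m. \<exists>C. \<forall>j. norm (fc f' j) * (1 + \<bar>of_int j\<bar>) ^ m \<le> C"
    "\<And>t. (f has_vector_derivative f' t) (at t)"
proof -
  define c where "c j = 2 * pi * \<i> * of_int j * fc f j" for j
  have rc: "\<exists>C. \<forall>j. norm (c j) * (1 + \<bar>of_int j\<bar>) ^ m \<le> C" for m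
  proof -
    obtain C where C: "\<And>j. norm (fc f j) * (1 + \<bar>of_int j\<bar>) ^ Suc m \<le> C" using r[of "Suc m"] by auto
    have "norm (c j) * (1 + \<bar>of_int j\<bar>) ^ m \<le> 2 * pi * C" for j
    proof -
      have "norm (c j) * (1 + \<bar>of_int j\<bar>) ^ m = 2 * pi * (norm (fc f j) * (\<bar>of_int j\<bar> * (1 + \<bar>of_int j\<bar>) ^ m))"
        by (simp add: c_def norm_mult mult_ac)
      also have "\<dots> \<le> 2 * pi * (norm (fc f j) * ((1 + \<bar>of_int j\<bar>) ^ Suc m))"
        by (intro mult_left_mono) (auto intro!: mult_right_mono)
      also have "\<dots> \<le> 2 * pi * C" by (intro mult_left_mono C) auto
      finally show ?thesis .
    qed
    then show ?thesis by blast
  qed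
  obtain C where C: "\<And>j. norm (c j) * (1 + \<bar>of_int j\<bar>)\<^sup>2 \<le> C" using rc[of 2] by auto
  obtain C' where C': "\<And>j. norm (fc f j) * (1 + \<bar>of_int j\<bar>)\<^sup>2 \<le> C'" using r[of 2] by auto
  have C0: "C \<ge> 0" using order_trans[OF norm_ge_zero[of "c 0"]] C[of 0] by simp
  obtain g where g: "cper g" "\<And>j. fc g j = c j"
    "\<And>n t. norm (g t - (\<Sum>j\<in>{-int n..int n}. c j * chi j t)) \<le> 2 * C / (real n + 1)"
    using fourier_synthesis[OF C] by blast
  define s' where "s' n t = (\<Sum>j\<in>{-int n..int n}. c j * chi j t)" for n t
  have lim0: "(\<lambda>n. K / (real n + 1)) \<longlonglongrightarrow> 0" for K :: real
    using LIMSEQ_Suc[OF lim_const_over_n[of K]] by (simp add: add.commute)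
  have conv: "(\<lambda>n. trunc n f t) \<longlonglongrightarrow> f t" for t
  proof -
    have "(\<lambda>n. trunc n f t - f t) \<longlonglongrightarrow> 0"
      by (rule Lim_null_comparison[OF _ lim0[of "2 * C'"]])
         (use fourier_inversion[OF f C', of t] in \<open>auto simp: norm_minus_commute\<close>)
    then show ?thesis by (simp add: LIM_zero_iff)
  qed
  have td: "(trunc n f has_vector_derivative s' n t) (at t)" for n t
  proof -
    have "((\<lambda>t. \<Sum>j\<in>{-int n..int n}. fc f j * chi j t) has_vector_derivative
        (\<Sum>j\<in>{-int n..int n}. fc f j * ((2 * pi * \<i> * of_int j) * chi j t) + 0 * chi j t)) (at t)"
      by (intro has_vector_derivative_sum has_vector_derivative_mult chi_deriv has_vector_derivative_const)
    then show ?thesis unfolding trunc_def[abs_def] s'_def c_def by (simp add: mult_ac)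
  qed
  have "\<exists>h. \<forall>x\<in>UNIV. (\<lambda>n. trunc n f x) \<longlonglongrightarrow> h x \<and> (h has_derivative (\<lambda>y. y *\<^sub>R g x)) (at x within UNIV)"
  proof (rule has_derivative_sequence[where f' = "\<lambda>n x y. y *\<^sub>R s' n x"])
    show "(trunc n f has_derivative (\<lambda>y. y *\<^sub>R s' n x)) (at x within UNIV)" for n x
      using td[of n x] by (simp add: has_vector_derivative_def)
    show "(\<lambda>n. trunc n f 0) \<longlonglongrightarrow> f 0" by (rule conv)
    fix e :: real assume e: "e > 0"
    have "\<forall>\<^sub>F n in sequentially. 2 * C / (real n + 1) < e" using order_tendstoD(2)[OF lim0 e] by blast
    then show "\<forall>\<^sub>F n in sequentially. \<forall>x\<in>UNIV. \<forall>h. norm (h *\<^sub>R s' n x - h *\<^sub>R g x) \<le> e * norm h"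
    proof eventually_elim
      case (elim n)
      have "norm (s' n x - g x) \<le> e" for x using g(3)[of x n] elim by (simp add: s'_def norm_minus_commute)
      then have "norm (h *\<^sub>R s' n x - h *\<^sub>R g x) \<le> norm h * e" for h x
        by (simp add: scaleR_diff_right[symmetric] mult_left_mono)
      then show ?case by (auto simp: mult.commute)
    qed
  qed auto
  then obtain h where h: "\<And>x. (\<lambda>n. trunc n f x) \<longlonglongrightarrow> h x" "\<And>x. (h has_vector_derivative g x) (at x)"
    unfolding has_vector_derivative_def by auto
  have "h = f" using h(1) conv LIMSEQ_unique by blast
  then have "(f has_vector_derivative g t) (at t)" for t using h(2) by simp
  moreover have "\<exists>C. \<forall>j. norm (fc g j) * (1 + \<bar>of_int j\<bar>) ^ m \<le> C" for m unfolding g(2) by (rule rc)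
  ultimately show thesis using that g(1) by blast
qed

lemma rapid_imp_sper:
  assumes "cper f" and "\<And>m. \<exists>C. \<forall>j. norm (fc f j) * (1 + \<bar>of_int j\<bar>) ^ m \<le> C"
  shows "sper f"
proof -
  have "Ck k f" for k
    using assms
  proof (induction k arbitrary: f)
    case (Suc k)
    obtain f' where "cper f'" "\<And>m. \<exists>C. \<forall>j. norm (fc f' j) * (1 + \<bar>of_int j\<bar>) ^ m \<le> C"
      "\<And>t. (f has_vector_derivative f' t) (at t)"
      using rapid_imp_deriv[OF Suc.prems] by blast
    then show ?case using Suc.IH[of f'] by auto
  qed simp
  then show ?thesis using assms(1) by (simp add: sper_def smooth_iff_Ck)
qed

section \<open>The commutator of the smoothing with a smooth function\<close>

lemma vector_derivative_bound:
  fixes f :: "real \<Rightarrow> 'a::real_normed_vector"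
  assumes "\<And>x. x \<in> {a..b} \<Longrightarrow> (f has_vector_derivative f' x) (at x)"
    and "\<And>x. x \<in> {a..b} \<Longrightarrow> norm (f' x) \<le> B" and xy: "x \<in> {a..b}" "y \<in> {a..b}"
  shows "norm (f x - f y) \<le> B * \<bar>x - y\<bar>"
proof -
  have B: "B \<ge> 0" using order_trans[OF norm_ge_zero assms(2)[OF xy(1)]] .
  have "norm (f x - f y) \<le> B * norm (x - y)"
  proof (rule differentiable_bound[of "{a..b}" f "\<lambda>x h. h *\<^sub>R f' x"])
    show "(f has_derivative (\<lambda>h. h *\<^sub>R f' u)) (at u within {a..b})" if "u \<in> {a..b}" for u
      using assms(1)[OF that] unfolding has_vector_derivative_def by (rule has_derivative_at_withinI)
    show "onorm (\<lambda>h. h *\<^sub>R f' u) \<le> B" if "u \<in> {a..b}" for u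
    proof (rule onorm_bound[OF B])
      fix h :: real
      show "norm (h *\<^sub>R f' u) \<le> B * norm h"
        using mult_right_mono[OF assms(2)[OF that] norm_ge_zero[of h]] by (simp add: mult.commute)
    qed
  qed (use xy in auto)
  then show ?thesis by simp
qed

text \<open>Periodicity allows every estimate in \<open>t - s\<close> to be checked for \<open>\<bar>t - s\<bar> \<le> 1/2\<close>, where
  \<open>\<bar>sin (pi * (t - s))\<bar>\<close> is comparable to \<open>\<bar>t - s\<bar>\<close>.\<close>

lemma reduce_mod_1:
  fixes s t :: real
  assumes f: "cper f"
  obtains u where "\<bar>u\<bar> \<le> 1/2" "f t = f (s + u)" "\<bar>sin (pi * (t - s))\<bar> = \<bar>sin (pi * u)\<bar>" "sin (2 * pi * (t - s)) = sin (2 * pi * u)"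
proof -
  obtain l :: int where l: "\<bar>(t - s) - of_int l\<bar> \<le> 1/2" by (rule exists_int_near)
  define u where "u = (t - s) - of_int l"
  have "f t = f (s + u)" using cper_of_int[OF f, of "s + u" l] by (simp add: u_def)
  moreover have "(sin (pi * (t - s)))\<^sup>2 = (sin (pi * u))\<^sup>2" unfolding u_def by (rule sin_pi_sq_int[symmetric])
  then have "\<bar>sin (pi * (t - s))\<bar> = \<bar>sin (pi * u)\<bar>" by (simp add: abs_eq_iff power2_eq_iff)
  moreover have "sin (2 * pi * (t - s)) = sin (2 * pi * u + 2 * pi * of_int l)" by (simp add: u_def algebra_simps)
  then have "sin (2 * pi * (t - s)) = sin (2 * pi * u)"
    using sin.plus_of_int[of "2 * pi * u" l] by (simp add: mult_ac)
  ultimately show thesis using that l by (simp add: u_def)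
qed

lemma sper_lipschitz:
  assumes a: "sper a"
  obtains L where "L \<ge> 0" "\<And>s t. norm (a t - a s) \<le> L * \<bar>t - s\<bar>"
proof -
  obtain a' where a': "sper a'" "\<And>t. (a has_vector_derivative a' t) (at t)" using sper_deriv[OF a] by blast
  obtain L where L: "L > 0" "\<And>t. norm (a' t) \<le> L" using cper_bounded[OF sper_cper[OF a'(1)]] by blast
  have "norm (a t - a s) \<le> L * \<bar>t - s\<bar>" for s t
    using vector_derivative_bound[of "min s t" "max s t" a a' L t s] a'(2) L(2) by auto
  then show thesis using that L(1) by (meson less_imp_le)
qed

lemma sper_lipschitz_sin:
  assumes a: "sper a"
  obtains L where "L \<ge> 0" "\<And>s t. norm (a t - a s) \<le> L * \<bar>sin (pi * (t - s))\<bar>"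
proof -
  obtain L where L: "L \<ge> 0" "\<And>s t. norm (a t - a s) \<le> L * \<bar>t - s\<bar>" using sper_lipschitz[OF a] by blast
  have "norm (a t - a s) \<le> L * \<bar>sin (pi * (t - s))\<bar>" for s t
  proof -
    obtain u where u: "\<bar>u\<bar> \<le> 1/2" "a t = a (s + u)" "\<bar>sin (pi * (t - s))\<bar> = \<bar>sin (pi * u)\<bar>"
      using reduce_mod_1[OF sper_cper[OF a], of t s] by metis
    have "norm (a t - a s) \<le> L * \<bar>u\<bar>" using L(2)[of "s + u" s] u(2) by simp
    also have "\<dots> \<le> L * \<bar>sin (pi * u)\<bar>" using sin_pi_ge[OF u(1)] by (intro mult_left_mono L) linarith
    finally show ?thesis using u(3) by simp
  qed
  then show thesis using that L(1) by blast
qed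

text \<open>Taylor expansion of first order with the linear term replaced by a periodic odd function, so
  that it can be tested against the periodic kernel. The factor \<open>2 * pi\<close> is absorbed by \<open>a'\<close>.\<close>

lemma sper_taylor_sin:
  assumes a: "sper a"
  obtains M a' where "M \<ge> 0"
    "\<And>s t. norm (a t - a s - a' s * of_real (sin (2 * pi * (t - s)))) \<le> M * (sin (pi * (t - s)))\<^sup>2"
proof -
  obtain a' where a': "sper a'" "\<And>t. (a has_vector_derivative a' t) (at t)" using sper_deriv[OF a] by blast
  obtain S where S: "S > 0" "\<And>t. norm (a' t) \<le> S" using cper_bounded[OF sper_cper[OF a'(1)]] by blast
  obtain L where L: "L \<ge> 0" "\<And>s t. norm (a' t - a' s) \<le> L * \<bar>t - s\<bar>" using sper_lipschitz[OF a'(1)] by blast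
  define C where "C = L + 2 * pi * S"
  have C: "C \<ge> 0" using L S by (simp add: C_def)
  have "norm (a t - a s - (a' s / (2 * pi)) * of_real (sin (2 * pi * (t - s)))) \<le> C * (sin (pi * (t - s)))\<^sup>2" for s t
  proof -
    obtain u where u: "\<bar>u\<bar> \<le> 1/2" "a t = a (s + u)" "\<bar>sin (pi * (t - s))\<bar> = \<bar>sin (pi * u)\<bar>" "sin (2 * pi * (t - s)) = sin (2 * pi * u)"
      using reduce_mod_1[OF sper_cper[OF a], of t s] by metis
    define g where "g v = a (v + s) - (a' s / (2 * pi)) * of_real (sin (2 * pi * v))" for v
    define g' where "g' v = a' (v + s) - a' s * of_real (cos (2 * pi * v))" for v
    have gd: "(g has_vector_derivative g' v) (at v)" for v
    proof -
      have "((\<lambda>t. t + s) has_vector_derivative 1) (at v)" by (auto intro!: derivative_eq_intros)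
      from vector_diff_chain_at[OF this a'(2)]
      have 1: "((\<lambda>v. a (v + s)) has_vector_derivative a' (v + s)) (at v)" by (simp add: o_def)
      have "((\<lambda>v. sin (2 * pi * v)) has_real_derivative 2 * pi * cos (2 * pi * v)) (at v)"
        by (auto intro!: derivative_eq_intros)
      then have "((\<lambda>v. complex_of_real (sin (2 * pi * v))) has_vector_derivative of_real (2 * pi * cos (2 * pi * v))) (at v)"
        by (rule has_vector_derivative_of_real)
      from has_vector_derivative_mult[OF has_vector_derivative_const this, of "a' s / (2 * pi)"]
      have 2: "((\<lambda>v. (a' s / (2 * pi)) * complex_of_real (sin (2 * pi * v))) has_vector_derivative a' s * of_real (cos (2 * pi * v))) (at v)"
        by (simp add: field_simps)
      show ?thesis unfolding g_def[abs_def] g'_def by (rule has_vector_derivative_diff[OF 1 2])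
    qed
    have gb: "norm (g' v) \<le> C * \<bar>u\<bar>" if v: "v \<in> {-\<bar>u\<bar>..\<bar>u\<bar>}" for v
    proof -
      have "g' v = (a' (v + s) - a' s) + a' s * of_real (1 - cos (2 * pi * v))" by (simp add: g'_def algebra_simps)
      then have "norm (g' v) \<le> norm (a' (v + s) - a' s) + norm (a' s) * \<bar>1 - cos (2 * pi * v)\<bar>"
        by (metis norm_triangle_ineq norm_mult norm_of_real)
      also have "norm (a' (v + s) - a' s) \<le> L * \<bar>v\<bar>" using L(2)[of "v + s" s] by simp
      also have "norm (a' s) * \<bar>1 - cos (2 * pi * v)\<bar> \<le> S * (2 * pi * \<bar>v\<bar>)"
      proof (rule mult_mono[OF S(2)])
        have "\<bar>1 - cos (2 * (pi * v))\<bar> = 2 * \<bar>sin (pi * v)\<bar> * \<bar>sin (pi * v)\<bar>"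
          by (simp only: cos_double_sin) (simp add: power2_eq_square)
        also have "\<dots> \<le> 2 * \<bar>pi * v\<bar> * 1" by (intro mult_mono abs_sin_x_le_abs_x) auto
        finally show "\<bar>1 - cos (2 * pi * v)\<bar> \<le> 2 * pi * \<bar>v\<bar>" by (simp add: abs_mult mult.assoc)
      qed (use S in auto)
      also have "L * \<bar>v\<bar> + S * (2 * pi * \<bar>v\<bar>) = C * \<bar>v\<bar>" by (simp add: C_def algebra_simps)
      also have "\<dots> \<le> C * \<bar>u\<bar>" using v by (intro mult_left_mono C) auto
      finally show ?thesis by simp
    qed
    have "norm (g u - g 0) \<le> C * \<bar>u\<bar> * \<bar>u - 0\<bar>"
      by (rule vector_derivative_bound[of "-\<bar>u\<bar>" "\<bar>u\<bar>" g g']) (use gd gb in auto)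
    also have "\<dots> = C * u\<^sup>2" by (simp add: power2_eq_square)
    also have "\<dots> \<le> C * (sin (pi * u))\<^sup>2" using sin_pi_sq_ge[OF u(1)] zero_le_power2[of u] by (intro mult_left_mono C) linarith
    also have "g u - g 0 = a t - a s - (a' s / (2 * pi)) * of_real (sin (2 * pi * (t - s)))"
      unfolding g_def u(2) u(4) by (simp add: add.commute)
    also have "(sin (pi * u))\<^sup>2 = (sin (pi * (t - s)))\<^sup>2" using u(3) by (metis power2_abs)
    finally show ?thesis .
  qed
  then show thesis using that[OF C, of "\<lambda>s. a' s / (2 * pi)"] by blast
qed

lemma cper_sin2: "cper (\<lambda>t. sin (2 * pi * (t - s)))"
proof -
  have "sin (2 * pi * (t + 1 - s)) = sin (2 * pi * (t - s))" for t
    using sin_periodic[of "2 * pi * (t - s)"] by (simp add: algebra_simps)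
  then show ?thesis by (auto simp: cper_def intro!: continuous_intros)
qed

text \<open>The kernel is even and the function is odd about the base point.\<close>

lemma ksm_odd: "ksm n (\<lambda>\<tau>. of_real (sin (2 * pi * (\<tau> - \<theta>)))) \<theta> = 0"
proof -
  define h where "h u = korovkin n u * sin (2 * pi * (u - 0))" for u
  have h: "cper h" unfolding h_def by (intro cper_mult cper_kernel cper_sin2)
  have odd: "h (0 - t) = - h t" for t by (simp add: h_def kernel_even)
  have "integral {0..1} h = integral {0..1} (\<lambda>t. - h t)"
    using integral_cper_reflect[OF h, of 0] by (simp only: odd)
  then have h0: "integral {0..1} h = 0" by simp
  have "integral {0..1} (\<lambda>\<tau>. h (\<theta> - \<tau>)) = 0" using integral_cper_reflect[OF h, of \<theta>] h0 by simp
  then have "((\<lambda>\<tau>. h (\<theta> - \<tau>)) has_integral 0) {0..1}"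
    using integrable_integral[OF cper_integrable[OF cper_reflect[OF h]], of \<theta> 0 1] by simp
  from has_integral_of_real[OF this]
  have "((\<lambda>\<tau>. complex_of_real (h (\<theta> - \<tau>))) has_integral 0) {0..1}" by (simp only: of_real_0)
  then have "((\<lambda>\<tau>. - complex_of_real (h (\<theta> - \<tau>))) has_integral - 0) {0..1}" by (rule has_integral_neg)
  moreover have "- complex_of_real (h (\<theta> - \<tau>)) = of_real (korovkin n (\<theta> - \<tau>)) * of_real (sin (2 * pi * (\<tau> - \<theta>)))" for \<tau>
  proof -
    have "sin (2 * pi * (\<theta> - \<tau>)) = - sin (2 * pi * (\<tau> - \<theta>))" by (subst sin_minus[symmetric]) (simp add: algebra_simps)
    then show ?thesis by (simp add: h_def)
  qed
  ultimately show ?thesis unfolding ksm_def by (simp add: integral_unique)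
qed

text \<open>Write \<open>a \<theta> - a \<tau>\<close> as a linear term, a multiple of \<open>sin (2 * pi * (\<tau> - \<theta>))\<close>, plus a remainder
  \<open>O(sin\<^sup>2)\<close>. The remainder contributes \<open>O(1 / n\<^sup>2)\<close>. In the linear term \<open>b \<tau>\<close> is replaced by
  \<open>b \<theta>\<close>; the main part then vanishes by \<open>ksm_odd\<close>, and the rest is small
  relative to \<open>1 / n\<close> by the uniform continuity of \<open>b\<close>. Mere boundedness of \<open>b\<close> would give only \<open>O(1 / n)\<close>.\<close>

lemma ksm_commutator:
  assumes a: "sper a" and b: "cper b" and e: "e > 0"
  obtains n0 where "n0 \<ge> 1"
    "\<And>n \<theta>. n \<ge> n0 \<Longrightarrow> norm (ksm n (\<lambda>\<tau>. (a \<theta> - a \<tau>) * b \<tau>) \<theta>) \<le> e / real n"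
proof -
  obtain S where S: "S > 0" "\<And>t. norm (b t) \<le> S" using cper_bounded[OF b] by blast
  obtain L where L: "L \<ge> 0" "\<And>s t. norm (a t - a s) \<le> L * \<bar>sin (pi * (t - s))\<bar>" using sper_lipschitz_sin[OF a] by blast
  obtain M2 a' where M2: "M2 \<ge> 0"
    "\<And>s t. norm (a t - a s - a' s * of_real (sin (2 * pi * (t - s)))) \<le> M2 * (sin (pi * (t - s)))\<^sup>2"
    using sper_taylor_sin[OF a] by blast
  define d where "d = e / (5 * (L + 1))"
  have d: "d > 0" "5 * L * d \<le> e" using e L(1) by (auto simp: d_def field_simps)
  obtain M where M: "M \<ge> 0" "\<And>s t. norm (b s - b t) \<le> d + M * (sin (pi * (t - s)))\<^sup>2"
    using uniform_modulus[OF b d(1)] by blast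
  define Q where "Q = 4 * L * M + 4 * M2 * S"
  have Q: "Q \<ge> 0" using L(1) M(1) M2(1) S(1) by (simp add: Q_def)
  obtain n0 :: nat where n0: "real n0 > 2 * Q / e" using reals_Archimedean2 by blast
  have "norm (ksm n (\<lambda>\<tau>. (a \<theta> - a \<tau>) * b \<tau>) \<theta>) \<le> e / real n" if n: "n \<ge> max 1 n0" for n \<theta>
  proof -
    have n1: "n \<ge> 1" using n by simp
    define f1 where "f1 \<tau> = (a \<theta> - a \<tau>) * (b \<tau> - b \<theta>)" for \<tau>
    define f2 where "f2 \<tau> = (a \<tau> - a \<theta> - a' \<theta> * of_real (sin (2 * pi * (\<tau> - \<theta>)))) * (- b \<theta>)" for \<tau>
    define f3 where "f3 \<tau> = of_real (sin (2 * pi * (\<tau> - \<theta>))) * (- a' \<theta> * b \<theta>)" for \<tau>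
    note ac = sper_cper[OF a]
    have c1: "cper f1" unfolding f1_def by (intro cper_mult cper_diff cper_const ac b)
    have c3: "cper f3" unfolding f3_def by (intro cper_mult cper_of_real cper_sin2 cper_const)
    have c2: "cper f2" unfolding f2_def by (intro cper_mult cper_diff cper_of_real cper_sin2 cper_const ac)
    have "(\<lambda>\<tau>. (a \<theta> - a \<tau>) * b \<tau>) = (\<lambda>\<tau>. f1 \<tau> + (f2 \<tau> + f3 \<tau>))"
      unfolding f1_def f2_def f3_def by (rule ext) (simp add: algebra_simps)
    then have eq: "ksm n (\<lambda>\<tau>. (a \<theta> - a \<tau>) * b \<tau>) \<theta> = ksm n f1 \<theta> + (ksm n f2 \<theta> + ksm n f3 \<theta>)"
      by (simp add: ksm_add[OF c1 cper_add[OF c2 c3]] ksm_add[OF c2 c3])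
    have k3: "ksm n f3 \<theta> = 0" unfolding f3_def ksm_cmult using ksm_odd[of n \<theta>] by simp
    have k2: "norm (ksm n f2 \<theta>) \<le> 0 + 4 * (M2 * S) / (real n)\<^sup>2"
    proof (rule kernel_integral_bound[OF n1 c2])
      show "M2 * S \<ge> 0" using M2(1) S(1) by simp
      fix \<tau>
      have "norm (f2 \<tau>) \<le> (M2 * (sin (pi * (\<tau> - \<theta>)))\<^sup>2) * S"
        unfolding f2_def norm_mult norm_minus_cancel by (intro mult_mono M2 S) (use M2(1) in auto)
      moreover have "sin (pi * (\<tau> - \<theta>)) = - sin (pi * (\<theta> - \<tau>))" by (subst sin_minus[symmetric]) (simp add: algebra_simps)
      ultimately show "norm (f2 \<tau>) \<le> 0 + M2 * S * (sin (pi * (\<theta> - \<tau>)))\<^sup>2" by (simp add: mult_ac)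
    qed
    have k1: "norm (ksm n f1 \<theta>) \<le> L * d / (2 * real n) + 4 * (L * d * real n / 2 + L * M) / (real n)\<^sup>2"
    proof (rule kernel_integral_bound[OF n1 c1])
      show "0 \<le> L * d * real n / 2 + L * M" using L(1) d M(1) by simp
      fix \<tau>
      let ?s = "sin (pi * (\<theta> - \<tau>))"
      have "norm (f1 \<tau>) \<le> (L * \<bar>?s\<bar>) * (d + M * ?s\<^sup>2)"
        unfolding f1_def norm_mult by (intro mult_mono L(2) M(2)) (use L(1) in auto)
      also have "\<dots> = L * d * \<bar>?s\<bar> + L * M * (\<bar>?s\<bar> * ?s\<^sup>2)" by (simp add: algebra_simps)
      also have "\<dots> \<le> L * d * ((real n * ?s\<^sup>2 + 1 / real n) / 2) + L * M * (1 * ?s\<^sup>2)"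
      proof (intro add_mono mult_left_mono mult_right_mono)
        have "0 \<le> (real n * \<bar>?s\<bar> - 1)\<^sup>2 / real n" by simp
        also have "\<dots> = real n * ?s\<^sup>2 + 1 / real n - 2 * \<bar>?s\<bar>" using n1 by (simp add: power2_eq_square field_simps)
        finally show "\<bar>?s\<bar> \<le> (real n * ?s\<^sup>2 + 1 / real n) / 2" by simp
      qed (use L(1) d(1) M(1) in auto)
      also have "\<dots> = L * d / (2 * real n) + (L * d * real n / 2 + L * M) * ?s\<^sup>2" by (simp add: field_simps)
      finally show "norm (f1 \<tau>) \<le> L * d / (2 * real n) + (L * d * real n / 2 + L * M) * ?s\<^sup>2" .
    qed
    have "norm (ksm n (\<lambda>\<tau>. (a \<theta> - a \<tau>) * b \<tau>) \<theta>) \<le> L * d / (2 * real n) + 4 * (L * d * real n / 2 + L * M) / (real n)\<^sup>2 + 4 * (M2 * S) / (real n)\<^sup>2"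
      unfolding eq k3 using k1 k2 norm_triangle_ineq[of "ksm n f1 \<theta>" "ksm n f2 \<theta>"] by simp
    also have "\<dots> = (5 * L * d / 2 + Q / real n) / real n"
      using n1 by (simp add: Q_def field_simps power2_eq_square)
    also have "\<dots> \<le> (e / 2 + e / 2) / real n"
    proof (intro divide_right_mono add_mono)
      have "2 * Q < e * real n0" using n0 e by (simp add: field_simps)
      also have "\<dots> \<le> e * real n" using n e by (intro mult_left_mono) auto
      finally show "Q / real n \<le> e / 2" using n1 by (simp add: field_simps)
    qed (use d in auto)
    finally show ?thesis by simp
  qed
  then show thesis using that[of "max 1 n0"] by auto
qed

lemma ksm_shift: assumes f: "cper f" shows "ksm n f (\<theta> + a) = ksm n (\<lambda>t. f (t + a)) \<theta>"
  by (simp add: ksm_eq f cper_shift fc_shift chi_add_arg mult_ac)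

section \<open>Scaled Sobolev and Wiener bounds\<close>

definition wt :: "real \<Rightarrow> int \<Rightarrow> real" where
  "wt N j = 1 + \<bar>of_int j\<bar> / N"

text \<open>A bound for the Sobolev norm of order \<open>m\<close> at scale \<open>N\<close>, stated through finite sets of
  frequencies, so that the finiteness of the norm is part of the predicate.\<close>

definition Sob :: "real \<Rightarrow> nat \<Rightarrow> (real \<Rightarrow> complex) \<Rightarrow> real \<Rightarrow> bool" where
  "Sob N m f C \<longleftrightarrow> C \<ge> 0 \<and> (\<forall>J. finite J \<longrightarrow> L2_set (\<lambda>j. wt N j ^ m * norm (fc f j)) J \<le> C)"

text \<open>The analogous bound for the weighted Wiener norm, the absolute sum of the coefficients.\<close>

definition Wie :: "real \<Rightarrow> nat \<Rightarrow> (real \<Rightarrow> complex) \<Rightarrow> real \<Rightarrow> bool" where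
  "Wie N r f C \<longleftrightarrow> C \<ge> 0 \<and> (\<forall>J. finite J \<longrightarrow> (\<Sum>j\<in>J. wt N j ^ r * norm (fc f j)) \<le> C)"

lemma wt_ge_1: "N > 0 \<Longrightarrow> wt N j \<ge> 1" by (simp add: wt_def)
lemma wt_pow_ge_1: "N > 0 \<Longrightarrow> wt N j ^ m \<ge> 1" by (intro one_le_power wt_ge_1)
lemma wt_pow_nonneg: "N > 0 \<Longrightarrow> wt N j ^ m \<ge> 0" using wt_pow_ge_1[of N j m] by linarith
lemma wt_triangle: "N > 0 \<Longrightarrow> wt N j \<le> wt N (j - k) + wt N k"
proof -
  assume N: "N > 0"
  have "\<bar>real_of_int j\<bar> / N \<le> (\<bar>of_int (j - k)\<bar> + \<bar>of_int k\<bar>) / N" using N by (intro divide_right_mono) auto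
  then show ?thesis by (simp add: wt_def add_divide_distrib)
qed
lemma wt_mult: assumes "N > 0" shows "wt N j \<le> wt N (j - k) * wt N k"
proof -
  have "\<bar>real_of_int j\<bar> / N \<le> (\<bar>of_int (j - k)\<bar> + \<bar>of_int k\<bar>) / N" using assms by (intro divide_right_mono) auto
  then have "wt N j \<le> 1 + \<bar>of_int (j - k)\<bar> / N + \<bar>of_int k\<bar> / N" by (simp add: wt_def add_divide_distrib)
  also have "\<dots> \<le> wt N (j - k) * wt N k"
  proof -
    have "1 + x + y \<le> (1 + x) * (1 + y)" if "x \<ge> 0" "y \<ge> 0" for x y :: real
      using mult_nonneg_nonneg[OF that] by (simp add: algebra_simps)
    then show ?thesis using assms by (simp add: wt_def)
  qed
  finally show ?thesis .
qed
lemma wt_mono: "N > 0 \<Longrightarrow> \<bar>j\<bar> \<le> \<bar>k\<bar> \<Longrightarrow> wt N j \<le> wt N k"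
  by (auto simp: wt_def intro!: divide_right_mono)
lemma wt_pow_mult: "N > 0 \<Longrightarrow> wt N j ^ m \<le> wt N (j - k) ^ m * wt N k ^ m"
  unfolding power_mult_distrib[symmetric] using wt_ge_1[of N j] by (intro power_mono wt_mult) auto
lemma wt_pow_tame: assumes "N > 0" shows "wt N j ^ m \<le> 2 ^ m * (wt N (j - k) ^ m + wt N k ^ m)"
proof -
  let ?a = "wt N (j - k)" and ?b = "wt N k"
  have ab: "?a \<ge> 1" "?b \<ge> 1" using wt_ge_1 assms by auto
  have "wt N j ^ m \<le> (2 * max ?a ?b) ^ m"
    using wt_triangle[OF assms, of j k] wt_ge_1[OF assms, of j] by (intro power_mono) auto
  also have "\<dots> = 2 ^ m * max ?a ?b ^ m" by (rule power_mult_distrib)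
  also have "max ?a ?b ^ m \<le> ?a ^ m + ?b ^ m" using ab by (auto simp: max_def)
  finally show ?thesis by simp
qed

lemma SobD: "Sob N m f C \<Longrightarrow> finite J \<Longrightarrow> L2_set (\<lambda>j. wt N j ^ m * norm (fc f j)) J \<le> C"
  and Sob_nonneg: "Sob N m f C \<Longrightarrow> C \<ge> 0"
  by (auto simp: Sob_def)
lemma WieD: "Wie N r f C \<Longrightarrow> finite J \<Longrightarrow> (\<Sum>j\<in>J. wt N j ^ r * norm (fc f j)) \<le> C"
  and Wie_nonneg: "Wie N r f C \<Longrightarrow> C \<ge> 0"
  by (auto simp: Wie_def)

lemma Sob_mono: "Sob N m f C \<Longrightarrow> C \<le> D \<Longrightarrow> Sob N m f D"
  unfolding Sob_def by (meson order_trans)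
lemma Wie_mono: "Wie N m f C \<Longrightarrow> C \<le> D \<Longrightarrow> Wie N m f D"
  unfolding Wie_def by (meson order_trans)

lemma Sob_transfer:
  assumes N: "N > 0" and "Sob N m f C" and "\<And>j. norm (fc g j) \<le> norm (fc f j)"
  shows "Sob N m g C"
  unfolding Sob_def
proof (intro conjI allI impI)
  show "C \<ge> 0" using assms Sob_nonneg by blast
  fix J :: "int set" assume J: "finite J"
  have "L2_set (\<lambda>j. wt N j ^ m * norm (fc g j)) J \<le> L2_set (\<lambda>j. wt N j ^ m * norm (fc f j)) J"
    by (intro L2_set_mono mult_left_mono assms wt_pow_nonneg mult_nonneg_nonneg norm_ge_zero)
  then show "L2_set (\<lambda>j. wt N j ^ m * norm (fc g j)) J \<le> C" using SobD[OF assms(2) J] by linarith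
qed

lemma Sob_order: assumes N: "N > 0" and f: "Sob N m f C" shows "Sob N 0 f C"
  unfolding Sob_def
proof (intro conjI allI impI)
  show "C \<ge> 0" using f Sob_nonneg by blast
  fix J :: "int set" assume J: "finite J"
  have "L2_set (\<lambda>j. wt N j ^ 0 * norm (fc f j)) J \<le> L2_set (\<lambda>j. wt N j ^ m * norm (fc f j)) J"
    using wt_pow_ge_1[OF N] by (intro L2_set_mono mult_right_mono) auto
  then show "L2_set (\<lambda>j. wt N j ^ 0 * norm (fc f j)) J \<le> C" using SobD[OF f J] by linarith
qed

lemma Sob_trunc: "N > 0 \<Longrightarrow> Sob N m f C \<Longrightarrow> Sob N m (trunc n f) C"
  by (rule Sob_transfer) (auto simp: fc_trunc)
lemma fc_tail: "cper f \<Longrightarrow> fc (\<lambda>t. f t - trunc n f t) j = (if \<bar>j\<bar> \<le> int n then 0 else fc f j)"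
  by (subst fc_diff) (auto simp: cper_trunc fc_trunc)
lemma Sob_tail0: "N > 0 \<Longrightarrow> cper f \<Longrightarrow> Sob N m f C \<Longrightarrow> Sob N m (\<lambda>t. f t - trunc n f t) C"
  by (rule Sob_transfer) (auto simp: fc_tail)
lemma Sob_minus: "N > 0 \<Longrightarrow> Sob N m f C \<Longrightarrow> Sob N m (\<lambda>t. - f t) C"
  by (rule Sob_transfer) (auto simp: fc_minus)

lemma Sob_add:
  assumes N: "N > 0" and c: "cper f" "cper g" and "Sob N m f C" "Sob N m g D"
  shows "Sob N m (\<lambda>t. f t + g t) (C + D)"
  unfolding Sob_def
proof (intro conjI allI impI)
  show "C + D \<ge> 0" using assms Sob_nonneg by (meson add_nonneg_nonneg)
  fix J :: "int set" assume J: "finite J"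
  have "L2_set (\<lambda>j. wt N j ^ m * norm (fc (\<lambda>t. f t + g t) j)) J \<le> L2_set (\<lambda>j. wt N j ^ m * norm (fc f j) + wt N j ^ m * norm (fc g j)) J"
    unfolding fc_add[OF c] distrib_left[symmetric]
    by (intro L2_set_mono mult_left_mono norm_triangle_ineq wt_pow_nonneg N mult_nonneg_nonneg norm_ge_zero)
  also have "\<dots> \<le> L2_set (\<lambda>j. wt N j ^ m * norm (fc f j)) J + L2_set (\<lambda>j. wt N j ^ m * norm (fc g j)) J"
    by (rule L2_set_triangle_ineq)
  also have "\<dots> \<le> C + D" by (intro add_mono SobD assms J)
  finally show "L2_set (\<lambda>j. wt N j ^ m * norm (fc (\<lambda>t. f t + g t) j)) J \<le> C + D" .
qed

lemma Sob_diff: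
  assumes N: "N > 0" and c: "cper f" "cper g" and "Sob N m f C" "Sob N m g D"
  shows "Sob N m (\<lambda>t. f t - g t) (C + D)"
  using Sob_add[OF N c(1) cper_minus[OF c(2)] assms(4) Sob_minus[OF N assms(5)]] by simp

lemma Sob_cmult:
  assumes "Sob N m f C" shows "Sob N m (\<lambda>t. c * f t) (norm c * C)"
  unfolding Sob_def
proof (intro conjI allI impI)
  show "norm c * C \<ge> 0" using Sob_nonneg[OF assms] by simp
  fix J :: "int set" assume J: "finite J"
  have "L2_set (\<lambda>j. wt N j ^ m * norm (fc (\<lambda>t. c * f t) j)) J = norm c * L2_set (\<lambda>j. wt N j ^ m * norm (fc f j)) J"
    unfolding fc_cmult norm_mult by (subst L2_set_right_distrib) (auto simp: mult_ac)
  then show "L2_set (\<lambda>j. wt N j ^ m * norm (fc (\<lambda>t. c * f t) j)) J \<le> norm c * C"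
    using mult_left_mono[OF SobD[OF assms J] norm_ge_zero[of c]] by simp
qed

lemma Sob_zero: "Sob N m (\<lambda>t. 0) 0"
  using fc_const[of 0] by (auto simp: Sob_def L2_set_def)

lemma Sob_sum:
  assumes N: "N > 0" and I: "finite I" "\<And>i. i \<in> I \<Longrightarrow> cper (f i)" "\<And>i. i \<in> I \<Longrightarrow> Sob N m (f i) (C i)"
  shows "Sob N m (\<lambda>t. \<Sum>i\<in>I. f i t) (\<Sum>i\<in>I. C i)"
  using I
proof (induction I rule: finite_induct)
  case empty then show ?case by (simp add: Sob_zero)
next
  case (insert x F)
  have "Sob N m (\<lambda>t. f x t + (\<Sum>i\<in>F. f i t)) (C x + (\<Sum>i\<in>F. C i))"
    using insert by (intro Sob_add[OF N] cper_sum) auto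
  then show ?case using insert by simp
qed

text \<open>Bessel in one direction and \<open>parseval_le\<close> in the other.\<close>

lemma Sob_L2: assumes "cper f" "C \<ge> 0" shows "Sob N 0 f C \<longleftrightarrow> l2sq f \<le> C\<^sup>2"
proof
  assume S: "Sob N 0 f C"
  show "l2sq f \<le> C\<^sup>2"
  proof (rule parseval_le[OF assms(1)])
    fix J :: "int set" assume "finite J"
    then have "L2_set (\<lambda>j. norm (fc f j)) J \<le> C" using SobD[OF S] by simp
    then have "(L2_set (\<lambda>j. norm (fc f j)) J)\<^sup>2 \<le> C\<^sup>2" by (intro power_mono) auto
    then show "(\<Sum>j\<in>J. (norm (fc f j))\<^sup>2) \<le> C\<^sup>2" unfolding L2_set_def by (simp add: sum_nonneg)
  qed
next
  assume l: "l2sq f \<le> C\<^sup>2"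
  show "Sob N 0 f C" unfolding Sob_def
  proof (intro conjI allI impI)
    fix J :: "int set" assume J: "finite J"
    have "sqrt (\<Sum>j\<in>J. (norm (fc f j))\<^sup>2) \<le> C"
      by (rule real_le_lsqrt[OF assms(2) order_trans[OF bessel[OF assms(1) J] l]])
    then show "L2_set (\<lambda>j. wt N j ^ 0 * norm (fc f j)) J \<le> C" by (simp add: L2_set_def)
  qed (rule assms)
qed

lemma Sob_mult_sup:
  assumes c: "cper f" "cper y" and y: "\<And>t. norm (y t) \<le> S" and f: "Sob N 0 f C"
  shows "Sob N 0 (\<lambda>t. f t * y t) (S * C)"
proof -
  have S: "S \<ge> 0" using order_trans[OF norm_ge_zero y] .
  have C: "C \<ge> 0" by (rule Sob_nonneg[OF f])
  have "l2sq (\<lambda>t. f t * y t) \<le> S\<^sup>2 * l2sq f"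
    by (rule l2sq_mono[OF cper_mult[OF c] c(1)]) (metis mult.commute norm_mult mult_right_mono norm_ge_zero y)
  also have "\<dots> \<le> S\<^sup>2 * C\<^sup>2" using f Sob_L2[OF c(1) C] by (intro mult_left_mono) auto
  finally show ?thesis using Sob_L2[OF cper_mult[OF c], of "S * C" N] S C by (simp add: power_mult_distrib)
qed

text \<open>Multiplication by a character shifts the coefficients; the hypothesis on the weight records how the
  weight reacts to the shift. It is instantiated once submultiplicatively and once, for tame estimates,
  additively.\<close>

lemma Sob_chi_general:
  assumes f: "Sob N m f C" "Sob N n f D" and N: "N > 0" and ab: "a \<ge> 0" "b \<ge> 0"
    and w: "\<And>j. wt N j ^ m \<le> a * wt N (j - k) ^ m + b * wt N (j - k) ^ n"
  shows "Sob N m (\<lambda>t. chi k t * f t) (a * C + b * D)"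
  unfolding Sob_def
proof (intro conjI allI impI)
  show "a * C + b * D \<ge> 0" using f ab Sob_nonneg by (meson add_nonneg_nonneg mult_nonneg_nonneg)
  fix J :: "int set" assume J: "finite J"
  define J' where "J' = (\<lambda>j. j - k) ` J"
  have J': "finite J'" using J by (simp add: J'_def)
  have re: "L2_set (\<lambda>j. g (j - k)) J = L2_set g J'" for g :: "int \<Rightarrow> real"
    unfolding L2_set_def J'_def by (subst sum.reindex) (auto simp: inj_on_def)
  have "L2_set (\<lambda>j. wt N j ^ m * norm (fc (\<lambda>t. chi k t * f t) j)) J
      \<le> L2_set (\<lambda>j. a * (wt N (j - k) ^ m * norm (fc f (j - k))) + b * (wt N (j - k) ^ n * norm (fc f (j - k)))) J"
  proof (rule L2_set_mono)
    fix j
    show "wt N j ^ m * norm (fc (\<lambda>t. chi k t * f t) j) \<le> a * (wt N (j - k) ^ m * norm (fc f (j - k))) + b * (wt N (j - k) ^ n * norm (fc f (j - k)))"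
      using mult_right_mono[OF w[of j] norm_ge_zero[of "fc f (j - k)"]] unfolding fc_chi_mult by (simp add: algebra_simps)
    show "0 \<le> wt N j ^ m * norm (fc (\<lambda>t. chi k t * f t) j)" by (intro mult_nonneg_nonneg wt_pow_nonneg N norm_ge_zero)
  qed
  also have "\<dots> = L2_set (\<lambda>j. a * (wt N j ^ m * norm (fc f j)) + b * (wt N j ^ n * norm (fc f j))) J'"
    by (rule re[of "\<lambda>j. a * (wt N j ^ m * norm (fc f j)) + b * (wt N j ^ n * norm (fc f j))"])
  also have "\<dots> \<le> L2_set (\<lambda>j. a * (wt N j ^ m * norm (fc f j))) J' + L2_set (\<lambda>j. b * (wt N j ^ n * norm (fc f j))) J'"
    by (rule L2_set_triangle_ineq)
  also have "\<dots> = a * L2_set (\<lambda>j. wt N j ^ m * norm (fc f j)) J' + b * L2_set (\<lambda>j. wt N j ^ n * norm (fc f j)) J'"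
    using ab by (simp add: L2_set_right_distrib)
  also have "\<dots> \<le> a * C + b * D" by (intro add_mono mult_left_mono SobD f J' ab)
  finally show "L2_set (\<lambda>j. wt N j ^ m * norm (fc (\<lambda>t. chi k t * f t) j)) J \<le> a * C + b * D" .
qed

lemma tp_mult_expand:
  assumes "tp n p"
  shows "(\<lambda>t. p t * f t) = (\<lambda>t. \<Sum>k\<in>{-int n..int n}. fc p k * (chi k t * f t))"
  by (subst tp_expand[OF assms]) (auto simp: sum_distrib_right mult.assoc)

lemma Sob_tp_mult:
  assumes N: "N > 0" and p: "tp n p" "Wie N m p P" and f: "cper f" "Sob N m f C"
  shows "Sob N m (\<lambda>t. p t * f t) (P * C)"
proof -
  have "Sob N m (\<lambda>t. \<Sum>k\<in>{-int n..int n}. fc p k * (chi k t * f t)) (\<Sum>k\<in>{-int n..int n}. norm (fc p k) * (wt N k ^ m * C))"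
  proof (intro Sob_sum N Sob_cmult cper_intros f)
    fix k
    have "Sob N m (\<lambda>t. chi k t * f t) (wt N k ^ m * C + 0 * C)"
      by (rule Sob_chi_general[OF f(2) f(2) N]) (use wt_pow_mult[OF N] wt_pow_nonneg[OF N] in \<open>auto simp: mult.commute\<close>)
    then show "Sob N m (\<lambda>t. chi k t * f t) (wt N k ^ m * C)" by simp
  qed auto
  moreover have "(\<Sum>k\<in>{-int n..int n}. norm (fc p k) * (wt N k ^ m * C)) = (\<Sum>k\<in>{-int n..int n}. wt N k ^ m * norm (fc p k)) * C"
    unfolding sum_distrib_right by (intro sum.cong refl) (simp add: mult_ac)
  moreover have "\<dots> \<le> P * C" by (intro mult_right_mono WieD[OF p(2)] Sob_nonneg[OF f(2)]) simp
  ultimately show ?thesis by (subst tp_mult_expand[OF p(1)], elim Sob_mono) simp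
qed

text \<open>Here the high norm of \<open>f\<close> is multiplied only by the unweighted norm of \<open>p\<close>: the weight at \<open>j\<close> is
  at most \<open>2 ^ m\<close> times the larger of the weight at \<open>j - k\<close> and the largest weight on the spectrum
  of \<open>p\<close>. Without such an estimate the iteration would lose a power of \<open>K\<close> on the highest norm.\<close>

lemma Sob_tp_mult_tame:
  assumes N: "N > 0" and p: "tp n p" "Wie N 0 p P" and f: "cper f" "Sob N m f C" "Sob N 0 f D"
  shows "Sob N m (\<lambda>t. p t * f t) (2 ^ m * P * (C + wt N (int n) ^ m * D))"
proof -
  let ?K = "2 ^ m * C + 2 ^ m * wt N (int n) ^ m * D"
  have K: "?K \<ge> 0" using Sob_nonneg[OF f(2)] Sob_nonneg[OF f(3)] wt_pow_nonneg[OF N] by simp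
  have "Sob N m (\<lambda>t. \<Sum>k\<in>{-int n..int n}. fc p k * (chi k t * f t)) (\<Sum>k\<in>{-int n..int n}. norm (fc p k) * ?K)"
  proof (intro Sob_sum N Sob_cmult cper_intros f)
    fix k assume k: "k \<in> {-int n..int n}"
    show "Sob N m (\<lambda>t. chi k t * f t) ?K"
    proof (rule Sob_chi_general[OF f(2) f(3) N])
      fix j
      have "wt N j ^ m \<le> 2 ^ m * (wt N (j - k) ^ m + wt N k ^ m)" by (rule wt_pow_tame[OF N])
      also have "\<dots> \<le> 2 ^ m * (wt N (j - k) ^ m + wt N (int n) ^ m)"
        using k wt_ge_1[OF N, of k] by (intro mult_left_mono add_left_mono power_mono wt_mono N) auto
      finally show "wt N j ^ m \<le> 2 ^ m * wt N (j - k) ^ m + 2 ^ m * wt N (int n) ^ m * wt N (j - k) ^ 0"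
        by (simp add: algebra_simps)
    qed (use wt_pow_nonneg[OF N] in auto)
  qed auto
  moreover have "(\<Sum>k\<in>{-int n..int n}. norm (fc p k) * ?K) = (\<Sum>k\<in>{-int n..int n}. norm (fc p k)) * ?K"
    by (rule sum_distrib_right[symmetric])
  moreover have "\<dots> \<le> P * ?K" using WieD[OF p(2), of "{-int n..int n}"] by (intro mult_right_mono K) simp
  moreover have "P * ?K = 2 ^ m * P * (C + wt N (int n) ^ m * D)" by (simp add: distrib_left mult_ac)
  ultimately show ?thesis by (subst tp_mult_expand[OF p(1)], elim Sob_mono) simp
qed

lemma Sob_tp_order:
  assumes N: "N > 0" and p: "tp n p" "Sob N 0 p C"
  shows "Sob N m p (wt N (int n) ^ m * C)"
  unfolding Sob_def
proof (intro conjI allI impI)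
  show "wt N (int n) ^ m * C \<ge> 0" using Sob_nonneg[OF p(2)] wt_pow_nonneg[OF N] by simp
  fix J :: "int set" assume J: "finite J"
  have "L2_set (\<lambda>j. wt N j ^ m * norm (fc p j)) J \<le> L2_set (\<lambda>j. wt N (int n) ^ m * (wt N j ^ 0 * norm (fc p j))) J"
  proof (rule L2_set_mono)
    fix j
    show "wt N j ^ m * norm (fc p j) \<le> wt N (int n) ^ m * (wt N j ^ 0 * norm (fc p j))"
    proof (cases "\<bar>j\<bar> \<le> int n")
      case True
      then show ?thesis using wt_ge_1[OF N, of j] by (auto intro!: mult_right_mono power_mono wt_mono N)
    next
      case False then show ?thesis using tp_fc_0[OF p(1)] by simp
    qed
    show "0 \<le> wt N j ^ m * norm (fc p j)" by (intro mult_nonneg_nonneg wt_pow_nonneg N norm_ge_zero)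
  qed
  also have "\<dots> = wt N (int n) ^ m * L2_set (\<lambda>j. wt N j ^ 0 * norm (fc p j)) J"
    using wt_pow_nonneg[OF N] by (simp add: L2_set_right_distrib)
  also have "\<dots> \<le> wt N (int n) ^ m * C" by (intro mult_left_mono SobD p J wt_pow_nonneg N)
  finally show "L2_set (\<lambda>j. wt N j ^ m * norm (fc p j)) J \<le> wt N (int n) ^ m * C" .
qed

lemma Sob_tail:
  assumes N: "N > 0" and f: "cper f" "Sob N m f C" and K: "K > 0" "\<And>j. \<bar>j\<bar> > int n \<Longrightarrow> wt N j \<ge> K"
  shows "Sob N 0 (\<lambda>t. f t - trunc n f t) (C / K ^ m)"
  unfolding Sob_def
proof (intro conjI allI impI)
  show "C / K ^ m \<ge> 0" using Sob_nonneg[OF f(2)] K by simp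
  fix J :: "int set" assume J: "finite J"
  have "L2_set (\<lambda>j. wt N j ^ 0 * norm (fc (\<lambda>t. f t - trunc n f t) j)) J \<le> L2_set (\<lambda>j. (1 / K ^ m) * (wt N j ^ m * norm (fc f j))) J"
  proof (rule L2_set_mono)
    fix j
    show "wt N j ^ 0 * norm (fc (\<lambda>t. f t - trunc n f t) j) \<le> (1 / K ^ m) * (wt N j ^ m * norm (fc f j))"
    proof (cases "\<bar>j\<bar> \<le> int n")
      case True then show ?thesis using wt_pow_nonneg[OF N] K by (simp add: fc_tail f)
    next
      case False
      then have "1 \<le> wt N j ^ m / K ^ m" using K by (simp add: le_divide_eq power_mono)
      then show ?thesis using False mult_right_mono[of 1 "wt N j ^ m / K ^ m" "norm (fc f j)"] by (simp add: fc_tail f)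
    qed
  qed simp
  also have "\<dots> = (1 / K ^ m) * L2_set (\<lambda>j. wt N j ^ m * norm (fc f j)) J"
    by (rule L2_set_right_distrib[symmetric]) (use K in simp)
  also have "\<dots> \<le> (1 / K ^ m) * C" using K by (intro mult_left_mono SobD f J) auto
  finally show "L2_set (\<lambda>j. wt N j ^ 0 * norm (fc (\<lambda>t. f t - trunc n f t) j)) J \<le> C / K ^ m" by simp
qed

lemma Sob_limit:
  assumes "\<And>n. n \<ge> n0 \<Longrightarrow> Sob N m (f n) C" and lim: "\<And>j. (\<lambda>n. fc (f n) j) \<longlonglongrightarrow> fc g j"
  shows "Sob N m g C"
  unfolding Sob_def
proof (intro conjI allI impI)
  show "C \<ge> 0" using Sob_nonneg assms(1) by blast
  fix J :: "int set" assume J: "finite J"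
  have "(\<lambda>n. L2_set (\<lambda>j. wt N j ^ m * norm (fc (f n) j)) J) \<longlonglongrightarrow> L2_set (\<lambda>j. wt N j ^ m * norm (fc g j)) J"
    unfolding L2_set_def by (intro tendsto_intros lim)
  then show "L2_set (\<lambda>j. wt N j ^ m * norm (fc g j)) J \<le> C"
    by (rule LIMSEQ_le_const2) (use SobD[OF assms(1) J] in blast)
qed

lemma sum_inverse_squares_le:
  assumes "finite J" shows "(\<Sum>j\<in>J. 1 / (1 + \<bar>of_int j\<bar>)\<^sup>2 :: real) \<le> 3"
proof -
  have b: "(\<Sum>j\<in>{-int n..int n}. 1 / (1 + \<bar>of_int j\<bar>)\<^sup>2 :: real) \<le> 3 - 2 / (real n + 1)" for n
  proof (induction n)
    case (Suc n)
    have "{-int (Suc n)..int (Suc n)} = insert (int (Suc n)) (insert (- int (Suc n)) {-int n..int n})" by auto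
    then have "(\<Sum>j\<in>{-int (Suc n)..int (Suc n)}. 1 / (1 + \<bar>of_int j\<bar>)\<^sup>2 :: real) = 2 / (real n + 2)\<^sup>2 + (\<Sum>j\<in>{-int n..int n}. 1 / (1 + \<bar>of_int j\<bar>)\<^sup>2)"
      by (simp add: add.commute)
    also have "\<dots> \<le> 2 / (real n + 2)\<^sup>2 + (3 - 2 / (real n + 1))" using Suc by simp
    also have "2 / (real n + 2)\<^sup>2 \<le> 2 / ((real n + 1) * (real n + 2))"
      by (intro divide_left_mono) (auto simp: power2_eq_square intro!: mult_right_mono)
    also have "2 / ((real n + 1) * (real n + 2)) = 2 / (real n + 1) - 2 / (real n + 2)" by (simp add: field_simps)
    finally show ?case by (simp add: add.commute)
  qed simp
  obtain n :: nat where n: "\<And>j. j \<in> J \<Longrightarrow> \<bar>j\<bar> \<le> int n"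
  proof -
    have "finite ((\<lambda>j. nat \<bar>j\<bar>) ` J)" using assms by simp
    then obtain n where "\<forall>k\<in>(\<lambda>j. nat \<bar>j\<bar>) ` J. k \<le> n" using finite_nat_set_iff_bounded_le by blast
    then show thesis using that[of n] by fastforce
  qed
  have "(\<Sum>j\<in>J. 1 / (1 + \<bar>of_int j\<bar>)\<^sup>2 :: real) \<le> (\<Sum>j\<in>{-int n..int n}. 1 / (1 + \<bar>of_int j\<bar>)\<^sup>2)"
    by (rule sum_mono2) (use n in force)+
  also have "\<dots> \<le> 3 - 2 / (real n + 1)" by (rule b)
  finally show ?thesis by (smt (verit) divide_nonneg_nonneg of_nat_0_le_iff)
qed

lemma wt_le: "N \<ge> 1 \<Longrightarrow> wt N j \<le> 1 + \<bar>of_int j\<bar>"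
  using divide_left_mono[of 1 N "\<bar>of_int j\<bar>"] by (simp add: wt_def)

lemma sper_tail_Wie:
  assumes f: "sper f"
  obtains C where "C \<ge> 0" "\<And>N n. N \<ge> 1 \<Longrightarrow> Wie (real N) m (\<lambda>t. trunc n f t - trunc N f t) (C / (real N)\<^sup>2) \<or> n < N"
proof -
  obtain C where C: "C \<ge> 0" "\<And>j. norm (fc f j) * (1 + \<bar>of_int j\<bar>) ^ (m + 4) \<le> C"
    using sper_decay[OF f, of "m + 4"] by blast
  have "Wie (real N) m (\<lambda>t. trunc n f t - trunc N f t) (3 * C / (real N)\<^sup>2)" if N: "N \<ge> 1" "N \<le> n" for N n
    unfolding Wie_def
  proof (intro conjI allI impI)
    fix J :: "int set" assume J: "finite J"
    have "(\<Sum>j\<in>J. wt N j ^ m * norm (fc (\<lambda>t. trunc n f t - trunc N f t) j)) \<le> (\<Sum>j\<in>J. (C / (real N)\<^sup>2) * (1 / (1 + \<bar>of_int j\<bar>)\<^sup>2))"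
    proof (rule sum_mono)
      fix j
      let ?x = "1 + \<bar>real_of_int j\<bar>"
      show "wt N j ^ m * norm (fc (\<lambda>t. trunc n f t - trunc N f t) j) \<le> (C / (real N)\<^sup>2) * (1 / ?x\<^sup>2)"
      proof (cases "\<bar>j\<bar> > int N")
        case True
        have "norm (fc (\<lambda>t. trunc n f t - trunc N f t) j) \<le> norm (fc f j)"
          by (subst fc_diff) (auto simp: cper_trunc fc_trunc)
        then have "wt N j ^ m * norm (fc (\<lambda>t. trunc n f t - trunc N f t) j) \<le> ?x ^ m * norm (fc f j)"
          using N wt_ge_1[of "real N" j] by (intro mult_mono power_mono wt_le) auto
        also have "\<dots> = (norm (fc f j) * ?x ^ (m + 4)) / (?x\<^sup>2 * ?x\<^sup>2)" 
        proof -
          have "y ^ m * c = (c * y ^ (m + 4)) / (y\<^sup>2 * y\<^sup>2)" if "y > 0" for y c :: real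
            using that by (simp add: power_add numeral_eq_Suc)
          then show ?thesis by simp
        qed
        also have "\<dots> \<le> C / ((real N)\<^sup>2 * ?x\<^sup>2)"
        proof (rule frac_le[OF C(1) C(2)])
          have "real N \<le> ?x" using True by linarith
          then show "(real N)\<^sup>2 * ?x\<^sup>2 \<le> ?x\<^sup>2 * ?x\<^sup>2" by (intro mult_right_mono power_mono) auto
          show "0 < (real N)\<^sup>2 * ?x\<^sup>2" using N by (intro mult_pos_pos) auto
        qed
        finally show ?thesis by simp
      next
        case False
        then have "fc (\<lambda>t. trunc n f t - trunc N f t) j = 0" using N by (subst fc_diff) (auto simp: cper_trunc fc_trunc)
        then show ?thesis using C(1) by simp
      qed
    qed
    also have "\<dots> = (C / (real N)\<^sup>2) * (\<Sum>j\<in>J. 1 / (1 + \<bar>of_int j\<bar>)\<^sup>2)" by (rule sum_distrib_left[symmetric])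
    also have "\<dots> \<le> (C / (real N)\<^sup>2) * 3" using C(1) by (intro mult_left_mono sum_inverse_squares_le J) auto
    finally show "(\<Sum>j\<in>J. wt N j ^ m * norm (fc (\<lambda>t. trunc n f t - trunc N f t) j)) \<le> 3 * C / (real N)\<^sup>2" by (simp add: mult.commute)
  qed (use C in simp)
  then show thesis using that[of "3 * C"] C(1) by (meson not_le mult_nonneg_nonneg zero_le_numeral)
qed

lemma sper_Sob:
  assumes f: "sper f" and N: "N \<ge> 1"
  obtains C where "Sob N m f C"
proof -
  obtain C where C: "C \<ge> 0" "\<And>j. norm (fc f j) * (1 + \<bar>of_int j\<bar>) ^ (m + 2) \<le> C"
    using sper_decay[OF f, of "m + 2"] by blast
  have "Sob N m f (C * 3)" unfolding Sob_def
  proof (intro conjI allI impI)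
    fix J :: "int set" assume J: "finite J"
    have "L2_set (\<lambda>j. wt N j ^ m * norm (fc f j)) J \<le> (\<Sum>j\<in>J. wt N j ^ m * norm (fc f j))"
      using N wt_pow_nonneg[of N] by (intro L2_set_le_sum) (auto intro!: mult_nonneg_nonneg)
    also have "\<dots> \<le> (\<Sum>j\<in>J. C * (1 / (1 + \<bar>of_int j\<bar>)\<^sup>2))"
    proof (rule sum_mono)
      fix j
      let ?x = "1 + \<bar>real_of_int j\<bar>"
      have "wt N j ^ m * norm (fc f j) \<le> ?x ^ m * norm (fc f j)"
        using N wt_ge_1[of N j] by (intro mult_right_mono power_mono wt_le) auto
      also have "\<dots> = (norm (fc f j) * ?x ^ (m + 2)) / ?x\<^sup>2" 
      proof -
        have "y ^ m * c = (c * y ^ (m + 2)) / y\<^sup>2" if "y > 0" for y c :: real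
          using that by (simp add: power_add numeral_eq_Suc)
        then show ?thesis by simp
      qed
      also have "\<dots> \<le> C / ?x\<^sup>2" by (intro divide_right_mono C) auto
      finally show "wt N j ^ m * norm (fc f j) \<le> C * (1 / ?x\<^sup>2)" by simp
    qed
    also have "\<dots> = C * (\<Sum>j\<in>J. 1 / (1 + \<bar>of_int j\<bar>)\<^sup>2)" by (rule sum_distrib_left[symmetric])
    also have "\<dots> \<le> C * 3" by (intro mult_left_mono sum_inverse_squares_le J C)
    finally show "L2_set (\<lambda>j. wt N j ^ m * norm (fc f j)) J \<le> C * 3" .
  qed (use C in simp)
  then show thesis by (rule that)
qed

lemma Wie_tp_order:
  assumes N: "N > 0" and p: "tp n p" "Wie N 0 p C"
  shows "Wie N r p (wt N (int n) ^ r * C)"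
  unfolding Wie_def
proof (intro conjI allI impI)
  show "wt N (int n) ^ r * C \<ge> 0" using Wie_nonneg[OF p(2)] wt_pow_nonneg[OF N] by simp
  fix J :: "int set" assume J: "finite J"
  have "(\<Sum>j\<in>J. wt N j ^ r * norm (fc p j)) \<le> (\<Sum>j\<in>J. wt N (int n) ^ r * (wt N j ^ 0 * norm (fc p j)))"
  proof (rule sum_mono)
    fix j
    show "wt N j ^ r * norm (fc p j) \<le> wt N (int n) ^ r * (wt N j ^ 0 * norm (fc p j))"
    proof (cases "\<bar>j\<bar> \<le> int n")
      case True
      then show ?thesis using wt_ge_1[OF N, of j] by (auto intro!: mult_right_mono power_mono wt_mono N)
    next
      case False then show ?thesis using tp_fc_0[OF p(1)] by simp
    qed
  qed
  also have "\<dots> = wt N (int n) ^ r * (\<Sum>j\<in>J. wt N j ^ 0 * norm (fc p j))" by (rule sum_distrib_left[symmetric])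
  also have "\<dots> \<le> wt N (int n) ^ r * C" by (intro mult_left_mono WieD p J wt_pow_nonneg N)
  finally show "(\<Sum>j\<in>J. wt N j ^ r * norm (fc p j)) \<le> wt N (int n) ^ r * C" .
qed

lemma Wie_add:
  assumes N: "N > 0" and c: "cper f" "cper g" and "Wie N r f C" "Wie N r g D"
  shows "Wie N r (\<lambda>t. f t + g t) (C + D)"
  unfolding Wie_def
proof (intro conjI allI impI)
  show "C + D \<ge> 0" using assms Wie_nonneg by (meson add_nonneg_nonneg)
  fix J :: "int set" assume J: "finite J"
  have "(\<Sum>j\<in>J. wt N j ^ r * norm (fc (\<lambda>t. f t + g t) j)) \<le> (\<Sum>j\<in>J. wt N j ^ r * norm (fc f j) + wt N j ^ r * norm (fc g j))"
    unfolding fc_add[OF c] distrib_left[symmetric] by (intro sum_mono mult_left_mono norm_triangle_ineq wt_pow_nonneg N)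
  also have "\<dots> \<le> C + D" unfolding sum.distrib by (intro add_mono WieD assms J)
  finally show "(\<Sum>j\<in>J. wt N j ^ r * norm (fc (\<lambda>t. f t + g t) j)) \<le> C + D" .
qed

lemma Wie_mult:
  assumes N: "N > 0" and p: "tp n p" "Wie N r p C" and f: "cper f" "Wie N r f D"
  shows "Wie N r (\<lambda>t. p t * f t) (C * D)"
  unfolding Wie_def
proof (intro conjI allI impI)
  show "C * D \<ge> 0" using p f Wie_nonneg by (meson mult_nonneg_nonneg)
  fix J :: "int set" assume J: "finite J"
  let ?I = "{-int n..int n}"
  have "(\<Sum>j\<in>J. wt N j ^ r * norm (fc (\<lambda>t. p t * f t) j)) \<le> (\<Sum>j\<in>J. \<Sum>k\<in>?I. (wt N k ^ r * norm (fc p k)) * (wt N (j - k) ^ r * norm (fc f (j - k))))"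
  proof (rule sum_mono)
    fix j
    have "wt N j ^ r * norm (fc (\<lambda>t. p t * f t) j) \<le> wt N j ^ r * (\<Sum>k\<in>?I. norm (fc p k) * norm (fc f (j - k)))"
      unfolding fc_tp_mult[OF p(1) f(1)] norm_mult[symmetric] by (intro mult_left_mono norm_sum wt_pow_nonneg N)
    also have "\<dots> = (\<Sum>k\<in>?I. wt N j ^ r * (norm (fc p k) * norm (fc f (j - k))))" by (rule sum_distrib_left)
    also have "\<dots> \<le> (\<Sum>k\<in>?I. (wt N (j - k) ^ r * wt N k ^ r) * (norm (fc p k) * norm (fc f (j - k))))"
      by (intro sum_mono mult_right_mono wt_pow_mult N) auto
    finally show "wt N j ^ r * norm (fc (\<lambda>t. p t * f t) j) \<le> (\<Sum>k\<in>?I. (wt N k ^ r * norm (fc p k)) * (wt N (j - k) ^ r * norm (fc f (j - k))))"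
      by (simp add: mult_ac)
  qed
  also have "\<dots> = (\<Sum>k\<in>?I. (wt N k ^ r * norm (fc p k)) * (\<Sum>j\<in>J. wt N (j - k) ^ r * norm (fc f (j - k))))"
    by (subst sum.swap) (simp add: sum_distrib_left)
  also have "\<dots> \<le> (\<Sum>k\<in>?I. (wt N k ^ r * norm (fc p k)) * D)"
  proof (intro sum_mono mult_left_mono)
    fix k
    have "(\<Sum>j\<in>J. wt N (j - k) ^ r * norm (fc f (j - k))) = (\<Sum>j\<in>(\<lambda>j. j - k) ` J. wt N j ^ r * norm (fc f j))"
      by (subst sum.reindex) (auto simp: inj_on_def)
    then show "(\<Sum>j\<in>J. wt N (j - k) ^ r * norm (fc f (j - k))) \<le> D" using WieD[OF f(2)] J by simp
    show "0 \<le> wt N k ^ r * norm (fc p k)" by (intro mult_nonneg_nonneg wt_pow_nonneg N norm_ge_zero)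
  qed
  also have "\<dots> = (\<Sum>k\<in>?I. wt N k ^ r * norm (fc p k)) * D" by (rule sum_distrib_right[symmetric])
  also have "\<dots> \<le> C * D" by (intro mult_right_mono WieD[OF p(2)] Wie_nonneg[OF f(2)]) simp
  finally show "(\<Sum>j\<in>J. wt N j ^ r * norm (fc (\<lambda>t. p t * f t) j)) \<le> C * D" .
qed

lemma Wie_sup:
  assumes N: "N > 0" and p: "tp n p" "Wie N r p C" shows "norm (p t) \<le> C"
proof -
  have "norm (p t) \<le> (\<Sum>k\<in>{-int n..int n}. norm (fc p k * chi k t))"
    by (subst tp_expand[OF p(1)]) (rule norm_sum)
  also have "\<dots> \<le> (\<Sum>k\<in>{-int n..int n}. wt N k ^ r * norm (fc p k))"
    using mult_right_mono[OF wt_pow_ge_1[OF N]] by (intro sum_mono) (simp add: norm_mult)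
  also have "\<dots> \<le> C" by (rule WieD[OF p(2)]) simp
  finally show ?thesis .
qed

section \<open>Quotients by nearly constant trigonometric polynomials\<close>

lemma power_le_exp: fixes x :: real assumes "x \<ge> 0" shows "x ^ k \<le> real k ^ k * exp x"
proof (cases "k = 0")
  case False
  have "(x / real k) ^ k \<le> (1 + x / real k) ^ k" using assms by (intro power_mono) auto
  also have "\<dots> \<le> exp x" using False assms by (intro exp_ge_one_plus_x_over_n_power_n) auto
  finally show ?thesis using False by (simp add: power_divide divide_le_eq mult.commute)
qed (use assms in simp)

lemma sum_poly_geometric:
  fixes a :: real assumes a: "a \<ge> 0"
  obtains C where "C > 0" "\<And>n. (\<Sum>I<n. (a + 2 * real I) ^ k * (1/4) ^ I) \<le> C"
proof -
  define K where "K = 4 ^ k * real k ^ k * exp (a / 4)"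
  have K: "K > 0" by (cases "k = 0") (auto simp: K_def)
  have e: "exp (1/2::real) \<le> 2"
  proof -
    have "(exp (1/2::real))\<^sup>2 \<le> 2\<^sup>2" using exp_le by (simp add: power2_eq_square exp_add[symmetric])
    then show ?thesis by (rule power2_le_imp_le) simp
  qed
  have b: "(a + 2 * real I) ^ k * (1/4) ^ I \<le> K * (1/2) ^ I" for I
  proof -
    have "((a + 2 * real I) / 4) ^ k \<le> real k ^ k * exp ((a + 2 * real I) / 4)"
      using a by (intro power_le_exp) auto
    also have "exp ((a + 2 * real I) / 4) = exp (a / 4) * exp (1/2) ^ I"
      by (simp add: exp_add[symmetric] exp_of_nat_mult[symmetric] field_simps)
    finally have "(a + 2 * real I) ^ k \<le> K * exp (1/2) ^ I" by (simp add: power_divide K_def field_simps)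
    then have "(a + 2 * real I) ^ k * (1/4) ^ I \<le> K * exp (1/2) ^ I * (1/4) ^ I" by (intro mult_right_mono) auto
    also have "\<dots> = K * (exp (1/2) / 4) ^ I" by (simp add: power_divide)
    also have "\<dots> \<le> K * (1/2) ^ I" using K e by (intro mult_left_mono power_mono) auto
    finally show ?thesis .
  qed
  have "(\<Sum>I<n. (a + 2 * real I) ^ k * (1/4) ^ I) \<le> 2 * K" for n
  proof -
    have "(\<Sum>I<n. (a + 2 * real I) ^ k * (1/4) ^ I) \<le> (\<Sum>I<n. K * (1/2) ^ I)" by (intro sum_mono b)
    also have "\<dots> = K * (\<Sum>I<n. (1/2) ^ I)" by (rule sum_distrib_left[symmetric])
    also have "(\<Sum>I<n. (1/2::real) ^ I) = 2 * (1 - (1/2) ^ n)" by (subst sum_gp_strict) auto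
    also have "K * (2 * (1 - (1/2) ^ n)) \<le> K * (2 * 1)" using K by (intro mult_left_mono) auto
    finally show ?thesis by simp
  qed
  then show thesis using that[of "2 * K"] K by simp
qed

text \<open>The geometric series for \<open>1 / (1 + d)\<close>, truncated after \<open>I\<close> terms, gives a trigonometric polynomial of degree
  \<open>(D + 2 * I) * N\<close> that is within \<open>2 * S / 2 ^ I\<close> of the quotient. Hence the coefficients at
  frequencies of about \<open>2 * I * N\<close> have a square sum of \<open>O(4 ^ (- I))\<close>, and this exponential decay in
  \<open>\<bar>j\<bar> / N\<close> beats the polynomial weights, uniformly in \<open>N\<close>.\<close>

lemma Sob_quotient:
  "\<exists>C>0. \<forall>N g d S. N \<ge> 1 \<longrightarrow> tp (D * N) g \<longrightarrow> tp (2 * N) d \<longrightarrow> (\<forall>t. norm (g t) \<le> S) \<longrightarrow>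
     (\<forall>t. norm (d t) \<le> 1/2) \<longrightarrow> Sob (real N) m (\<lambda>t. g t / (1 + d t)) (C * S)"
proof -
  obtain C where C: "C > 0" "\<And>n. (\<Sum>I<n. (real D + 4 + 2 * real I) ^ (2 * m) * (1/4) ^ I) \<le> C"
    using sum_poly_geometric[of "real D + 4" "2 * m"] by auto
  have main: "Sob (real N) m (\<lambda>t. g t / (1 + d t)) ((2 * sqrt C) * S)"
    if N: "N \<ge> 1" and g: "tp (D * N) g" and d: "tp (2 * N) d" and S: "\<And>t. norm (g t) \<le> S"
      and d2: "\<And>t. norm (d t) \<le> 1/2" for N g d S
  proof -
    define f where "f t = g t / (1 + d t)" for t
    define p where "p I t = g t * (\<Sum>i<I. (- d t) ^ i)" for I t
    have S0: "S \<ge> 0" using order_trans[OF norm_ge_zero S] .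
    have low: "norm (1 + d t) \<ge> 1/2" for t
      using norm_triangle_ineq4[of "1 + d t" "d t"] d2[of t] by simp
    have nz: "1 + d t \<noteq> 0" for t using low[of t] by auto
    have cf: "cper f" unfolding f_def
      by (intro cper_divide cper_add cper_const tp_cper[OF g] tp_cper[OF d] nz)
    have tpp: "tp ((D + 2 * I) * N) (p I)" for I
    proof -
      have "tp (I * (2 * N)) (\<lambda>t. \<Sum>i<I. (- d t) ^ i)"
      proof (rule tp_sum)
        fix i assume "i \<in> {..<I}"
        then show "tp (I * (2 * N)) (\<lambda>t. (- d t) ^ i)"
          by (intro tp_mono[OF tp_power[OF tp_minus[OF d]]] mult_right_mono) auto
      qed simp
      from tp_mult[OF g this] show ?thesis unfolding p_def by (simp add: algebra_simps)
    qed
    have err: "norm (f t - p I t) \<le> 2 * S * (1/2) ^ I" for I t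
    proof -
      have "(\<Sum>i<I. (- d t) ^ i) = (1 - (- d t) ^ I) / (1 + d t)"
      proof -
        have "- d t \<noteq> 1" using nz[of t] by (metis add.left_inverse)
        then show ?thesis using sum_gp_strict[of "- d t" I] by simp
      qed
      then have "f t - p I t = g t * (- d t) ^ I / (1 + d t)"
        unfolding f_def p_def by (simp only: times_divide_eq_right diff_divide_distrib[symmetric]) (simp add: algebra_simps)
      then have "norm (f t - p I t) = norm (g t) * norm (d t) ^ I / norm (1 + d t)"
        by (simp add: norm_mult norm_divide norm_power)
      also have "\<dots> \<le> S * (1/2) ^ I / (1/2)"
        using S0 by (intro frac_le mult_mono power_mono S d2 low mult_nonneg_nonneg) auto
      finally show ?thesis by simp
    qed
    \<comment> \<open>the number of the frequency block of width \<open>2 * N\<close>; block 0 also takes all low frequencies\<close>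
    define idx where "idx j = (nat \<bar>j\<bar> div N - D - 1) div 2" for j
    have block: "(\<Sum>j\<in>J. (norm (fc f j))\<^sup>2) \<le> 4 * S\<^sup>2 * (1/4) ^ I" if J: "finite J" "\<And>j. j \<in> J \<Longrightarrow> idx j = I" for J I
    proof -
      define q where "q = (if I = 0 then (\<lambda>t. 0) else p I)"
      have cq: "cper q" using tp_cper[OF tpp] by (simp add: q_def)
      have "fc f j = fc (\<lambda>t. f t - q t) j" if "j \<in> J" for j
      proof (cases "I = 0")
        case False
        have "idx j = I" by (rule J(2)[OF that])
        then have "D + 1 + 2 * I \<le> nat \<bar>j\<bar> div N" using False unfolding idx_def by linarith
        then have "(D + 1 + 2 * I) * N \<le> nat \<bar>j\<bar>" using N by (simp add: less_eq_div_iff_mult_less_eq)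
        then have "(D + 2 * I) * N < nat \<bar>j\<bar>" using N by (simp add: algebra_simps)
        then have "fc (p I) j = 0" by (intro tp_fc_0[OF tpp]) linarith
        then show ?thesis using False by (simp add: q_def fc_diff[OF cf tp_cper[OF tpp]])
      qed (simp add: q_def)
      then have "(\<Sum>j\<in>J. (norm (fc f j))\<^sup>2) = (\<Sum>j\<in>J. (norm (fc (\<lambda>t. f t - q t) j))\<^sup>2)" by simp
      also have "\<dots> \<le> l2sq (\<lambda>t. f t - q t)" by (rule bessel[OF cper_diff[OF cf cq] J(1)])
      also have "\<dots> \<le> (2 * S * (1/2) ^ I)\<^sup>2"
      proof (rule l2sq_bound[OF cper_diff[OF cf cq]])
        show "norm (f t - q t) \<le> 2 * S * (1/2) ^ I" for t
          using err[of t I] by (auto simp: q_def p_def)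
      qed
      also have "\<dots> = 4 * S\<^sup>2 * (1/4) ^ I"
      proof -
        have "((1/2::real) ^ I)\<^sup>2 = (1/4) ^ I" by (simp add: power2_eq_square power_mult_distrib[symmetric])
        then show ?thesis by (simp add: power_mult_distrib)
      qed
      finally show ?thesis .
    qed
    have wtb: "wt N j \<le> real D + 4 + 2 * real (idx j)" for j
    proof -
      have "\<bar>real_of_int j\<bar> / real N \<le> real (nat \<bar>j\<bar> div N) + 1"
      proof -
        let ?a = "nat \<bar>j\<bar>"
        have "?a \<le> N * (?a div N) + N"
          using mod_less_divisor[of N ?a] mult_div_mod_eq[of N ?a] N by linarith
        then have "real ?a \<le> real (N * (?a div N) + N)" by (rule of_nat_mono)
        then have "real ?a \<le> (real (?a div N) + 1) * real N" by (simp add: algebra_simps)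
        then show ?thesis using N by (simp add: divide_le_eq)
      qed
      moreover have "nat \<bar>j\<bar> div N \<le> D + 2 + 2 * idx j" unfolding idx_def by linarith
      then have "real (nat \<bar>j\<bar> div N) \<le> real (D + 2 + 2 * idx j)" by (rule of_nat_mono)
      then have "real (nat \<bar>j\<bar> div N) \<le> real D + 2 + 2 * real (idx j)" by simp
      ultimately show ?thesis by (simp add: wt_def)
    qed
    have "Sob (real N) m f ((2 * sqrt C) * S)" unfolding Sob_def
    proof (intro conjI allI impI)
      show "0 \<le> 2 * sqrt C * S" using S0 C(1) by simp
      fix J :: "int set" assume J: "finite J"
      obtain n where n: "idx ` J \<subseteq> {..<n}" using J by (meson finite_imageI finite_nat_iff_bounded)
      have "(\<Sum>j\<in>J. (wt N j ^ m * norm (fc f j))\<^sup>2) = (\<Sum>I<n. \<Sum>j\<in>{j\<in>J. idx j = I}. (wt N j ^ m * norm (fc f j))\<^sup>2)"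
        by (rule sum.group[symmetric]) (use J n in auto)
      also have "\<dots> \<le> (\<Sum>I<n. (4 * S\<^sup>2) * ((real D + 4 + 2 * real I) ^ (2 * m) * (1/4) ^ I))"
      proof (rule sum_mono)
        fix I
        have "(\<Sum>j\<in>{j\<in>J. idx j = I}. (wt N j ^ m * norm (fc f j))\<^sup>2) \<le> (\<Sum>j\<in>{j\<in>J. idx j = I}. (real D + 4 + 2 * real I) ^ (2 * m) * (norm (fc f j))\<^sup>2)"
        proof (rule sum_mono)
          fix j assume j: "j \<in> {j\<in>J. idx j = I}"
          have "(wt N j ^ m)\<^sup>2 \<le> (real D + 4 + 2 * real I) ^ (2 * m)"
            using wtb[of j] j wt_ge_1[of "real N" j] N by (simp add: power_mult[symmetric] mult.commute) (intro power_mono, auto)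
          then show "(wt N j ^ m * norm (fc f j))\<^sup>2 \<le> (real D + 4 + 2 * real I) ^ (2 * m) * (norm (fc f j))\<^sup>2"
            by (simp add: power_mult_distrib mult_right_mono)
        qed
        also have "\<dots> = (real D + 4 + 2 * real I) ^ (2 * m) * (\<Sum>j\<in>{j\<in>J. idx j = I}. (norm (fc f j))\<^sup>2)"
          by (rule sum_distrib_left[symmetric])
        also have "\<dots> \<le> (real D + 4 + 2 * real I) ^ (2 * m) * (4 * S\<^sup>2 * (1/4) ^ I)"
          using J by (intro mult_left_mono block) auto
        finally show "(\<Sum>j\<in>{j\<in>J. idx j = I}. (wt N j ^ m * norm (fc f j))\<^sup>2) \<le> (4 * S\<^sup>2) * ((real D + 4 + 2 * real I) ^ (2 * m) * (1/4) ^ I)"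
          by (simp only: mult_ac)
      qed
      also have "\<dots> = (4 * S\<^sup>2) * (\<Sum>I<n. (real D + 4 + 2 * real I) ^ (2 * m) * (1/4) ^ I)" by (rule sum_distrib_left[symmetric])
      also have "\<dots> \<le> (4 * S\<^sup>2) * C" by (intro mult_left_mono C) simp
      also have "\<dots> = (2 * sqrt C * S)\<^sup>2" using C(1) by (simp add: power_mult_distrib)
      finally show "L2_set (\<lambda>j. wt N j ^ m * norm (fc f j)) J \<le> 2 * sqrt C * S"
        unfolding L2_set_def using S0 C(1) by (intro real_le_lsqrt) auto
    qed
    then show ?thesis by (simp add: f_def[abs_def])
  qed
  show ?thesis
  proof (intro exI[of _ "2 * sqrt C"] conjI allI impI)
    show "0 < 2 * sqrt C" using C(1) by simp
    fix N g d S
    assume "N \<ge> 1" "tp (D * N) g" "tp (2 * N) d" "\<forall>t. norm (g t) \<le> S" "\<forall>t. norm (d t) \<le> 1/2"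
    then show "Sob (real N) m (\<lambda>t. g t / (1 + d t)) ((2 * sqrt C) * S)" by (intro main) auto
  qed
qed

section \<open>Matrix-valued functions\<close>

definition allent :: "((real \<Rightarrow> complex) \<Rightarrow> bool) \<Rightarrow> (real \<Rightarrow> complex^2^2) \<Rightarrow> bool" where
  "allent Q M \<longleftrightarrow> (\<forall>a b. Q (\<lambda>t. M t $ a $ b))"

definition dg :: "(2 \<Rightarrow> complex) \<Rightarrow> complex^2^2" where
  "dg l = (\<chi> a b. if a = b then l a else 0)"

definition adj2 :: "complex^2^2 \<Rightarrow> complex^2^2" where
  "adj2 M = vector [vector [M$2$2, - (M$1$2)], vector [- (M$2$1), M$1$1]]"

definition inv2 :: "complex^2^2 \<Rightarrow> complex^2^2" where
  "inv2 M = (\<chi> a b. adj2 M $ a $ b / det M)"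

definition entbd :: "complex^2^2 \<Rightarrow> real \<Rightarrow> bool" where
  "entbd M c \<longleftrightarrow> (\<forall>a b. norm (M $ a $ b) \<le> c)"

lemma allentD: "allent Q M \<Longrightarrow> Q (\<lambda>t. M t $ a $ b)"
  by (auto simp: allent_def)

lemma allentI: "(\<And>a b. Q (\<lambda>t. M t $ a $ b)) \<Longrightarrow> allent Q M"
  by (auto simp: allent_def)

lemma mm_entry: fixes A B :: "'a::semiring_1^2^2" shows "(A ** B) $ a $ b = A$a$1 * B$1$b + A$a$2 * B$2$b"
  by (simp add: matrix_matrix_mult_def sum_2)

lemma adj2_entries: "adj2 M $ 1 $ 1 = M$2$2" "adj2 M $ 1 $ 2 = - (M$1$2)" "adj2 M $ 2 $ 1 = - (M$2$1)" "adj2 M $ 2 $ 2 = M$1$1"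
  by (simp_all add: adj2_def)

lemma mat_eq_2: "(A::'a^2^2) = B \<longleftrightarrow> A$1$1 = B$1$1 \<and> A$1$2 = B$1$2 \<and> A$2$1 = B$2$1 \<and> A$2$2 = B$2$2"
  by (auto simp: vec_eq_iff forall_2)

lemma all_22: "(\<forall>a b. P (a::2) (b::2)) \<longleftrightarrow> P 1 1 \<and> P 1 2 \<and> P 2 1 \<and> P 2 2"
  by (auto simp: forall_2)

lemma mat_entries: "(mat 1 :: 'a::semiring_1^2^2) $ a $ b = (if a = b then 1 else 0)"
  by (simp add: mat_def)

lemma inv2_right: assumes "det M \<noteq> 0" shows "M ** inv2 M = mat 1"
proof -
  have "(M$1$1 * M$2$2 - M$1$2 * M$2$1) / det M = 1" using assms by (simp add: det_2)
  then show ?thesis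
    by (simp add: mat_eq_2 mm_entry inv2_def adj2_entries mat_entries diff_divide_distrib mult.commute)
qed

lemma inv2_left: assumes "det M \<noteq> 0" shows "inv2 M ** M = mat 1"
proof -
  have "(M$1$1 * M$2$2 - M$1$2 * M$2$1) / det M = 1" using assms by (simp add: det_2)
  then show ?thesis
    by (simp add: mat_eq_2 mm_entry inv2_def adj2_entries mat_entries diff_divide_distrib mult.commute)
qed

lemma mm_diff_left: fixes A B C :: "complex^2^2" shows "(A - B) ** C = A ** C - B ** (C)"
  by (simp add: mat_eq_2 mm_entry algebra_simps)
lemma mm_diff_right: fixes A B C :: "complex^2^2" shows "C ** (A - B) = C ** A - C ** (B)"
  by (simp add: mat_eq_2 mm_entry algebra_simps)
lemma mm_add_left: fixes A B C :: "complex^2^2" shows "(A + B) ** C = A ** C + B ** (C)"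
  by (simp add: mat_eq_2 mm_entry algebra_simps)
lemmas mm_dist = mm_diff_left mm_diff_right matrix_add_ldistrib mm_add_left

lemma entbd_mult: assumes "entbd A c" "entbd B d" shows "entbd (A ** B) (2 * c * d)"
  unfolding entbd_def
proof (intro allI)
  fix a b
  have c: "c \<ge> 0" using assms(1) order_trans[OF norm_ge_zero] unfolding entbd_def by blast
  have "norm ((A ** B) $ a $ b) \<le> norm (A$a$1) * norm (B$1$b) + norm (A$a$2) * norm (B$2$b)"
    unfolding mm_entry by (rule order_trans[OF norm_triangle_ineq]) (simp add: norm_mult)
  also have "\<dots> \<le> c * d + c * d" using assms c unfolding entbd_def by (intro add_mono mult_mono) auto
  finally show "norm ((A ** B) $ a $ b) \<le> 2 * c * d" by simp
qed

lemma entbd_adj2: "entbd M c \<Longrightarrow> entbd (adj2 M) c"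
  unfolding entbd_def all_22 by (simp add: adj2_entries)

lemma dg_entries: "dg l $ a $ b = (if a = b then l a else 0)"
  by (simp add: dg_def)

lemma dg_right: fixes M :: "complex^2^2" shows "(M ** dg l) $ a $ b = M $ a $ b * l b"
  using exhaust_2[of b] by (auto simp: mm_entry dg_entries)

lemma dg_left: fixes M :: "complex^2^2" shows "(dg l ** M) $ a $ b = l a * M $ a $ b"
  using exhaust_2[of a] by (auto simp: mm_entry dg_entries)

lemma uniform_ent:
  fixes P :: "2 \<Rightarrow> 2 \<Rightarrow> real \<Rightarrow> bool"
  assumes ex: "\<And>a b. \<exists>C\<ge>0. P a b C" and mono: "\<And>a b C D. P a b C \<Longrightarrow> C \<le> D \<Longrightarrow> P a b D"
  obtains C where "C \<ge> 0" "\<And>a b. P a b C"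
proof -
  obtain f where f: "\<And>a b. f a b \<ge> 0 \<and> P a b (f a b)" using ex by metis
  define C where "C = (\<Sum>a\<in>UNIV. \<Sum>b\<in>UNIV. f a b)"
  have "f a b \<le> C" for a b
  proof -
    have "f a b \<le> (\<Sum>b\<in>UNIV. f a b)" using f by (intro member_le_sum) auto
    also have "\<dots> \<le> C" unfolding C_def using f by (intro member_le_sum sum_nonneg) auto
    finally show ?thesis .
  qed
  then have "P a b C" for a b using f mono by blast
  moreover have "C \<ge> 0" unfolding C_def using f by (intro sum_nonneg) auto
  ultimately show thesis using that by blast
qed

lemma allent_mult:
  assumes "allent Q A" "allent R B"
    and "\<And>f g. Q f \<Longrightarrow> R g \<Longrightarrow> S (\<lambda>t. f t * g t)" and "\<And>f g. S f \<Longrightarrow> S g \<Longrightarrow> S (\<lambda>t. f t + g t)"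
  shows "allent S (\<lambda>t. A t ** B t)"
  using assms by (auto simp: allent_def mm_entry)

lemma allent_cper_mult: "allent cper A \<Longrightarrow> allent cper B \<Longrightarrow> allent cper (\<lambda>t. A t ** B t)"
  by (erule (1) allent_mult) (auto intro: cper_mult cper_add)
lemma allent_sper_mult: "allent sper A \<Longrightarrow> allent sper B \<Longrightarrow> allent sper (\<lambda>t. A t ** B t)"
  by (erule (1) allent_mult) (auto intro: sper_mult sper_add)
lemma allent_tp_mult: "allent (tp n) A \<Longrightarrow> allent (tp m) B \<Longrightarrow> allent (tp (n + m)) (\<lambda>t. A t ** B t)"
  by (erule (1) allent_mult) (auto intro: tp_mult tp_add)
lemma allent_const: "(\<And>c. Q (\<lambda>t. c)) \<Longrightarrow> allent Q (\<lambda>t. M)"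
  by (auto simp: allent_def)
lemma allent_mono: "allent Q A \<Longrightarrow> (\<And>f. Q f \<Longrightarrow> R f) \<Longrightarrow> allent R A"
  by (auto simp: allent_def)

lemma allent_adj2: assumes "allent Q M" "\<And>f. Q f \<Longrightarrow> Q (\<lambda>t. - f t)" shows "allent Q (\<lambda>t. adj2 (M t))"
  using assms by (auto simp: allent_def all_22 adj2_entries)

lemma sper_det: assumes "allent sper M" shows "sper (\<lambda>t. det (M t))"
  unfolding det_2 by (intro sper_diff sper_mult allentD[OF assms])
lemma cper_det: assumes "allent cper M" shows "cper (\<lambda>t. det (M t))"
  unfolding det_2 by (intro cper_diff cper_mult allentD[OF assms])
lemma tp_det: assumes "allent (tp n) M" shows "tp (n + n) (\<lambda>t. det (M t))"
  unfolding det_2 by (intro tp_diff tp_mult allentD[OF assms])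

lemma allent_sper_inv2: assumes "allent sper M" "\<And>t. det (M t) \<noteq> 0" shows "allent sper (\<lambda>t. inv2 (M t))"
  unfolding allent_def inv2_def
  by (auto intro!: sper_divide sper_det assms allentD[OF allent_adj2[OF assms(1) sper_minus]])
lemma allent_cper_inv2: assumes "allent cper M" "\<And>t. det (M t) \<noteq> 0" shows "allent cper (\<lambda>t. inv2 (M t))"
  unfolding allent_def inv2_def
  by (auto intro!: cper_divide cper_det assms allentD[OF allent_adj2[OF assms(1) cper_minus]])

section \<open>Approximating the conjugacy by a trigonometric polynomial\<close>

lemma sper_trunc_lim: assumes f: "sper f" shows "(\<lambda>n. trunc n f t) \<longlonglongrightarrow> f t"
    and "\<exists>C. \<forall>n t. norm (f t - trunc n f t) \<le> C / (real n + 1)"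
proof -
  obtain C where C: "\<And>j. norm (fc f j) * (1 + \<bar>of_int j\<bar>) ^ 2 \<le> C" using sper_decay[OF f, of 2] by blast
  note inv = fourier_inversion[OF sper_cper[OF f] C]
  show "\<exists>C. \<forall>n t. norm (f t - trunc n f t) \<le> C / (real n + 1)" using inv by blast
  have lim0: "(\<lambda>n. 2 * C / (real n + 1)) \<longlonglongrightarrow> 0"
    using LIMSEQ_Suc[OF lim_const_over_n[of "2 * C"]] by (simp add: add.commute)
  have "(\<lambda>n. trunc n f t - f t) \<longlonglongrightarrow> 0"
    by (rule Lim_null_comparison[OF _ lim0]) (use inv in \<open>auto simp: norm_minus_commute\<close>)
  then show "(\<lambda>n. trunc n f t) \<longlonglongrightarrow> f t" by (simp add: LIM_zero_iff)
qed

text \<open>Multiplication by a high-frequency tail of a smooth function, which is not a trigonometric polynomial: the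
  bound for finitely many terms passes to the limit.\<close>

lemma Sob_tail_mult:
  assumes f: "sper f" and N: "N > 0" and w: "\<And>n. n \<ge> n0 \<Longrightarrow> Wie N m (\<lambda>t. trunc n f t - trunc n0 f t) P"
    and h: "cper h" "Sob N m h C"
  shows "Sob N m (\<lambda>t. (f t - trunc n0 f t) * h t) (P * C)"
proof (rule Sob_limit[of n0 N m "\<lambda>n t. (trunc n f t - trunc n0 f t) * h t"])
  fix n assume n: "n \<ge> n0"
  have "tp n (\<lambda>t. trunc n f t - trunc n0 f t)" using n by (intro tp_diff tp_trunc tp_mono[OF tp_trunc])
  then show "Sob N m (\<lambda>t. (trunc n f t - trunc n0 f t) * h t) (P * C)"
    using w[OF n] h by (intro Sob_tp_mult N)
next
  fix j
  obtain K where K: "\<And>n t. norm (f t - trunc n f t) \<le> K / (real n + 1)" using sper_trunc_lim(2)[OF f] by blast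
  obtain S where S: "S > 0" "\<And>t. norm (h t) \<le> S" using cper_bounded[OF h(1)] by blast
  note cf = sper_cper[OF f]
  have "(\<lambda>n. fc (\<lambda>t. (f t - trunc n0 f t) * h t) j - fc (\<lambda>t. (trunc n f t - trunc n0 f t) * h t) j) \<longlonglongrightarrow> 0"
  proof (rule Lim_null_comparison)
    show "\<forall>\<^sub>F n in sequentially. norm (fc (\<lambda>t. (f t - trunc n0 f t) * h t) j - fc (\<lambda>t. (trunc n f t - trunc n0 f t) * h t) j) \<le> (K * S) / (real n + 1)"
    proof (rule always_eventually, rule allI)
      fix n
      have "fc (\<lambda>t. (f t - trunc n0 f t) * h t) j - fc (\<lambda>t. (trunc n f t - trunc n0 f t) * h t) j
          = fc (\<lambda>t. (f t - trunc n0 f t) * h t - (trunc n f t - trunc n0 f t) * h t) j"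
        by (intro fc_diff[symmetric] cper_mult cper_diff cf cper_trunc h)
      also have "\<dots> = fc (\<lambda>t. (f t - trunc n f t) * h t) j" by (simp add: algebra_simps)
      also have "norm \<dots> \<le> (K / (real n + 1)) * S"
      proof (rule fc_bound)
        show "cper (\<lambda>t. (f t - trunc n f t) * h t)" by (intro cper_mult cper_diff cf cper_trunc h)
        show "norm ((f t - trunc n f t) * h t) \<le> (K / (real n + 1)) * S" for t
          unfolding norm_mult using order_trans[OF norm_ge_zero K] by (intro mult_mono K S) auto
      qed
      finally show "norm (fc (\<lambda>t. (f t - trunc n0 f t) * h t) j - fc (\<lambda>t. (trunc n f t - trunc n0 f t) * h t) j) \<le> (K * S) / (real n + 1)" by simp
    qed
    show "(\<lambda>n. (K * S) / (real n + 1)) \<longlonglongrightarrow> 0"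
      using LIMSEQ_Suc[OF lim_const_over_n[of "K * S"]] by (simp add: add.commute)
  qed
  from tendsto_minus[OF this]
  have "(\<lambda>n. fc (\<lambda>t. (trunc n f t - trunc n0 f t) * h t) j - fc (\<lambda>t. (f t - trunc n0 f t) * h t) j) \<longlonglongrightarrow> 0"
    by (simp only: minus_diff_eq minus_zero)
  then show "(\<lambda>n. fc (\<lambda>t. (trunc n f t - trunc n0 f t) * h t) j) \<longlonglongrightarrow> fc (\<lambda>t. (f t - trunc n0 f t) * h t) j"
    by (rule LIM_zero_cancel)
qed

text \<open>The matrix function \<open>Z\<close> is within \<open>\<eta>\<close> of the identity and conjugates the perturbed cocycle \<open>dg l + F\<close>
  back to \<open>dg l\<close>. The perturbation has size \<open>\<epsilon>\<close> in the norm of order 0 and size \<open>E\<close> in the norm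
  of order \<open>m\<close>, both at scale \<open>N\<close>; in the iteration \<open>\<epsilon>\<close> shrinks while \<open>E\<close> may grow.\<close>

definition near_const ::
  "real \<Rightarrow> (2 \<Rightarrow> complex) \<Rightarrow> real \<Rightarrow> nat \<Rightarrow> (real \<Rightarrow> complex^2^2) \<Rightarrow> (real \<Rightarrow> complex^2^2) \<Rightarrow> real \<Rightarrow> real \<Rightarrow> real \<Rightarrow> bool"
where
  "near_const \<alpha> l N m F Z \<eta> \<epsilon> E \<longleftrightarrow>
     allent sper F \<and> allent cper Z \<and>
     (\<forall>t. Z (t + \<alpha>) ** dg l = (dg l + F t) ** Z t) \<and>
     (\<forall>t. entbd (Z t - mat 1) \<eta>) \<and>
     allent (\<lambda>f. Sob N 0 f \<epsilon>) F \<and> allent (\<lambda>f. Sob N m f E) F"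

lemma allent_bounded:
  assumes "allent cper M"
  shows "\<exists>\<beta>\<ge>1. \<forall>t a b. norm (M t $ a $ b) \<le> \<beta>"
proof -
  define P where "P a b C \<longleftrightarrow> (\<forall>t. norm (M t $ a $ b) \<le> C)" for a b C
  have ex: "\<exists>C\<ge>0. P a b C" for a b
  proof -
    have "cper (\<lambda>t. M t $ a $ b)" using assms by (rule allentD)
    then obtain S where "S > 0" "\<And>t. norm (M t $ a $ b) \<le> S" by (rule cper_bounded) blast
    then show ?thesis unfolding P_def by (meson less_imp_le)
  qed
  have mono: "P a b D" if "P a b C" "C \<le> D" for a b C D
    using that unfolding P_def by (meson order_trans)
  obtain C where C: "C \<ge> 0" "\<And>a b. P a b C" using uniform_ent[of P] ex mono by metis
  have "\<forall>t a b. norm (M t $ a $ b) \<le> C + 1"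
  proof (intro allI)
    fix t a b
    show "norm (M t $ a $ b) \<le> C + 1" using C(2)[of a b] unfolding P_def by (smt (verit))
  qed
  then show ?thesis using C(1) by (intro exI[of _ "C + 1"]) simp
qed

lemma allent_tail_Wie:
  assumes "allent sper M"
  shows "\<exists>C\<ge>0. \<forall>a b N n. N \<ge> 1 \<longrightarrow> N \<le> n \<longrightarrow>
      Wie (real N) m (\<lambda>t. trunc n (\<lambda>t. M t $ a $ b) t - trunc N (\<lambda>t. M t $ a $ b) t) (C / (real N)\<^sup>2)"
proof -
  define P where "P a b C \<longleftrightarrow> (\<forall>N n. N \<ge> 1 \<longrightarrow> N \<le> n \<longrightarrow>
      Wie (real N) m (\<lambda>t. trunc n (\<lambda>t. M t $ a $ b) t - trunc N (\<lambda>t. M t $ a $ b) t) (C / (real N)\<^sup>2))" for a b C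
  have ex: "\<exists>C\<ge>0. P a b C" for a b
  proof -
    have "sper (\<lambda>t. M t $ a $ b)" using assms by (rule allentD)
    then obtain C where "C \<ge> 0" "\<And>N n. N \<ge> 1 \<Longrightarrow> Wie (real N) m (\<lambda>t. trunc n (\<lambda>t. M t $ a $ b) t - trunc N (\<lambda>t. M t $ a $ b) t) (C / (real N)\<^sup>2) \<or> n < N"
      by (rule sper_tail_Wie[where m = m]) blast
    then show ?thesis unfolding P_def by (meson not_le)
  qed
  have mono: "P a b D" if "P a b C" "C \<le> D" for a b C D
    using that unfolding P_def by (meson Wie_mono divide_right_mono zero_le_power2)
  obtain C where "C \<ge> 0" "\<And>a b. P a b C" using uniform_ent[of P] ex mono by metis
  then show ?thesis unfolding P_def by blast
qed

lemma allent_sper_add: "allent sper A \<Longrightarrow> allent sper B \<Longrightarrow> allent sper (\<lambda>t. A t + B t)"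
  and allent_sper_diff: "allent sper A \<Longrightarrow> allent sper B \<Longrightarrow> allent sper (\<lambda>t. A t - B t)"
  and allent_sper_shift: "allent sper A \<Longrightarrow> allent sper (\<lambda>t. A (t + s))"
  and allent_sper_const: "allent sper (\<lambda>t. M)"
  by (auto simp: allent_def intro: sper_add sper_diff sper_const sper_shift)
lemma allent_cper_add: "allent cper A \<Longrightarrow> allent cper B \<Longrightarrow> allent cper (\<lambda>t. A t + B t)"
  and allent_cper_diff: "allent cper A \<Longrightarrow> allent cper B \<Longrightarrow> allent cper (\<lambda>t. A t - B t)"
  and allent_cper_shift: "allent cper A \<Longrightarrow> allent cper (\<lambda>t. A (t + s))"
  and allent_cper_const: "allent cper (\<lambda>t. M)"
  by (auto simp: allent_def intro: cper_add cper_diff cper_const cper_shift)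
lemma allent_tp_add: "allent (tp n) A \<Longrightarrow> allent (tp n) B \<Longrightarrow> allent (tp n) (\<lambda>t. A t + B t)"
  and allent_tp_diff: "allent (tp n) A \<Longrightarrow> allent (tp n) B \<Longrightarrow> allent (tp n) (\<lambda>t. A t - B t)"
  and allent_tp_shift: "allent (tp n) A \<Longrightarrow> allent (tp n) (\<lambda>t. A (t + s))"
  and allent_tp_const: "allent (tp n) (\<lambda>t. M)"
  by (auto simp: allent_def intro: tp_add tp_diff tp_const tp_shift)

lemma uniform_nat:
  fixes P :: "2 \<Rightarrow> nat \<Rightarrow> bool"
  assumes "\<And>a. \<exists>n0. \<forall>n\<ge>n0. P a n"
  shows "\<exists>n0. \<forall>n\<ge>n0. \<forall>a. P a n"
proof -
  obtain n1 n2 where "\<forall>n\<ge>n1. P 1 n" "\<forall>n\<ge>n2. P 2 n" using assms[of 1] assms[of 2] by blast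
  then have "\<forall>n\<ge>max n1 n2. \<forall>a. P a n" by (simp add: forall_2)
  then show ?thesis by blast
qed

lemma allent_ksm_approx:
  assumes B: "allent cper B" and e: "e > 0"
  shows "\<exists>n0. \<forall>n\<ge>n0. \<forall>a b \<theta>. norm (ksm n (\<lambda>t. B t $ a $ b) \<theta> - B \<theta> $ a $ b) \<le> e"
proof (intro uniform_nat)
  fix a b
  have "cper (\<lambda>t. B t $ a $ b)" using B by (rule allentD)
  then obtain n0 where "\<And>n \<theta>. n \<ge> n0 \<Longrightarrow> norm (ksm n (\<lambda>t. B t $ a $ b) \<theta> - B \<theta> $ a $ b) \<le> e"
    using e by (rule ksm_approx) blast
  then show "\<exists>n0. \<forall>n\<ge>n0. \<forall>\<theta>. norm (ksm n (\<lambda>t. B t $ a $ b) \<theta> - B \<theta> $ a $ b) \<le> e" by blast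
qed

lemma allent_ksm_commutator:
  assumes A: "allent sper A" and B: "allent cper B" and e: "e > 0"
  shows "\<exists>n0. \<forall>n\<ge>n0. \<forall>a b c \<theta>. norm (ksm n (\<lambda>\<tau>. (A \<theta> $ a $ c - A \<tau> $ a $ c) * B \<tau> $ c $ b) \<theta>) \<le> e / real n"
proof (intro uniform_nat)
  fix a b c
  have sa: "sper (\<lambda>t. A t $ a $ c)" using A by (rule allentD)
  have cb: "cper (\<lambda>t. B t $ c $ b)" using B by (rule allentD)
  obtain n0 where "\<And>n \<theta>. n \<ge> n0 \<Longrightarrow> norm (ksm n (\<lambda>\<tau>. (A \<theta> $ a $ c - A \<tau> $ a $ c) * B \<tau> $ c $ b) \<theta>) \<le> e / real n"
    using sa cb e by (rule ksm_commutator) blast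
  then show "\<exists>n0. \<forall>n\<ge>n0. \<forall>\<theta>. norm (ksm n (\<lambda>\<tau>. (A \<theta> $ a $ c - A \<tau> $ a $ c) * B \<tau> $ c $ b) \<theta>) \<le> e / real n" by blast
qed

text \<open>Take \<open>W\<close> to be the entrywise smoothing of \<open>B\<close> by the kernel of degree \<open>N\<close>, and \<open>Z = W\<inverse> ** B\<close>. Then
  \<open>F = W (t + \<alpha>)\<inverse> ** (A t ** W t - W (t + \<alpha>) ** dg l)\<close>, and since smoothing commutes with
  translation, the bracket is the commutator of smoothing with multiplication by \<open>A\<close>, uniformly
  \<open>o(1 / N)\<close>. To bound high Sobolev norms, \<open>A\<close> is replaced by its truncation at \<open>N\<close>. Then \<open>F\<close>
  is a trigonometric polynomial of degree \<open>3 * N\<close> divided by \<open>det W\<close>, for which \<open>Sob_quotient\<close>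
  turns a uniform bound into a Sobolev bound; the tail of \<open>A\<close> contributes \<open>O(1 / N\<^sup>2)\<close>.\<close>

lemma initial_approximation:
  fixes A B :: "real \<Rightarrow> complex^2^2" and \<alpha> e :: real and l :: "2 \<Rightarrow> complex" and m :: nat
  assumes A: "allent sper A" and B: "allent cper B" and det: "\<And>t. det (B t) = 1"
    and eq: "\<And>t. B (t + \<alpha>) ** dg l = A t ** B t" and e: "e > 0"
  obtains N0 :: nat where "N0 \<ge> 1" "\<And>N. N \<ge> N0 \<Longrightarrow> \<exists>W F Z. allent (tp N) W \<and>
      (\<forall>t. W t ** Z t = B t) \<and> near_const \<alpha> l (real N) m F Z e (e / real N) (e / real N)"
proof -
  obtain \<beta> where \<beta>: "\<beta> \<ge> 1" "\<And>a b t. norm (B t $ a $ b) \<le> \<beta>"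
    using allent_bounded[OF B] by blast
  obtain C where C: "C \<ge> 0" "\<And>a b N n. N \<ge> 1 \<Longrightarrow> N \<le> n \<Longrightarrow>
      Wie (real N) m (\<lambda>t. trunc n (\<lambda>t. A t $ a $ b) t - trunc N (\<lambda>t. A t $ a $ b) t) (C / (real N)\<^sup>2)"
    using allent_tail_Wie[OF A, of m] by blast
  obtain C3 where C3: "C3 > 0" "\<And>N g d S. N \<ge> 1 \<Longrightarrow> tp (3 * N) g \<Longrightarrow> tp (2 * N) d \<Longrightarrow> (\<And>t. norm (g t) \<le> S) \<Longrightarrow>
       (\<And>t. norm (d t) \<le> 1/2) \<Longrightarrow> Sob (real N) m (\<lambda>t. g t / (1 + d t)) (C3 * S)"
    using Sob_quotient[of 3 m] by blast
  obtain C2 where C2: "C2 > 0" "\<And>N g d S. N \<ge> 1 \<Longrightarrow> tp (2 * N) g \<Longrightarrow> tp (2 * N) d \<Longrightarrow> (\<And>t. norm (g t) \<le> S) \<Longrightarrow>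
       (\<And>t. norm (d t) \<le> 1/2) \<Longrightarrow> Sob (real N) m (\<lambda>t. g t / (1 + d t)) (C2 * S)"
    using Sob_quotient[of 2 m] by blast
  \<comment> \<open>\<open>\<eta>\<close> bounds the uniform distance of \<open>W\<close> and \<open>B\<close>, \<open>e1\<close> the commutator times \<open>N\<close>, and \<open>Q / N\<close> the
    part of \<open>N * F\<close> that the tail of \<open>A\<close> contributes\<close>
  define \<eta> where "\<eta> = min (1 / 8) (e / 4) / \<beta>"
  have \<eta>: "\<eta> > 0" "4 * \<beta> * \<eta> \<le> 1/2" "4 * \<beta> * \<eta> \<le> e" using e \<beta>(1) by (auto simp: \<eta>_def)
  define e1 where "e1 = e / (8 * \<beta> * C3)"
  have e1: "e1 > 0" "4 * \<beta> * C3 * e1 = e / 2" using e \<beta>(1) C3(1) by (auto simp: e1_def)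
  define Q where "Q = 4 * \<beta>\<^sup>2 * C * C3 + 4 * C * C2 * \<beta>\<^sup>2"
  have ev1: "\<forall>\<^sub>F N in sequentially. Q / real N < e / 2"
    by (rule order_tendstoD(2)[OF lim_const_over_n]) (use e in simp)
  then obtain N1 where N1: "\<And>N. N \<ge> N1 \<Longrightarrow> Q / real N < e / 2"
    unfolding eventually_sequentially by blast
  obtain N2 where N2: "\<And>N a b \<theta>. N \<ge> N2 \<Longrightarrow> norm (ksm N (\<lambda>t. B t $ a $ b) \<theta> - B \<theta> $ a $ b) \<le> \<eta>"
    using allent_ksm_approx[OF B \<eta>(1)] by blast
  obtain N3 where N3: "\<And>N a b c \<theta>. N \<ge> N3 \<Longrightarrow>
      norm (ksm N (\<lambda>\<tau>. (A \<theta> $ a $ c - A \<tau> $ a $ c) * B \<tau> $ c $ b) \<theta>) \<le> e1 / real N"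
    using allent_ksm_commutator[OF A B e1(1)] by blast
  define N0 where "N0 = max (max N1 N2) (max N3 1)"
  have "\<exists>W F Z. allent (tp N) W \<and>
      (\<forall>t. W t ** Z t = B t) \<and> near_const \<alpha> l (real N) m F Z e (e / real N) (e / real N)" if "N \<ge> N0" for N
  proof -
    have ge: "N \<ge> N1" "N \<ge> N2" "N \<ge> N3" "N \<ge> 1" using that by (auto simp: N0_def)
    note N = ge(4) N1[OF ge(1)] and Wap = N2[OF ge(2)] and Com = N3[OF ge(3)]
    have N': "real N > 0" using N(1) by simp
    define W where "W t = (\<chi> a b. ksm N (\<lambda>t. B t $ a $ b) t)" for t
    have We: "W t $ a $ b = ksm N (\<lambda>t. B t $ a $ b) t" for t a b by (simp add: W_def)
    have tpW: "allent (tp N) W" unfolding allent_def We using tp_ksm[OF allentD[OF B]] by simp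
    have Wb: "norm (W t $ a $ b) \<le> \<beta>" for t a b
      unfolding We by (rule ksm_bound[OF N(1) allentD[OF B] \<beta>(2)])
    have WB: "entbd (W t - B t) \<eta>" for t using Wap by (simp add: entbd_def We)
    define d where "d t = det (W t) - 1" for t
    have dW: "det (W t) = 1 + d t" for t by (simp add: d_def)
    have d: "norm (d t) \<le> 1/2" for t
    proof -
      have pr: "norm (W t $ a $ b * W t $ a' $ b' - B t $ a $ b * B t $ a' $ b') \<le> 2 * \<beta> * \<eta>" for a b a' b'
      proof -
        have "W t $ a $ b * W t $ a' $ b' - B t $ a $ b * B t $ a' $ b' =
          (W t - B t) $ a $ b * W t $ a' $ b' + B t $ a $ b * (W t - B t) $ a' $ b'" by (simp add: algebra_simps)
        also have "norm \<dots> \<le> \<eta> * \<beta> + \<beta> * \<eta>"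
          using WB[of t] \<beta> Wb \<eta>(1) unfolding entbd_def
          by (intro order_trans[OF norm_triangle_ineq] add_mono order_trans[OF eq_refl[OF norm_mult]] mult_mono) auto
        finally show ?thesis by simp
      qed
      have "d t = (W t $ 1 $ 1 * W t $ 2 $ 2 - B t $ 1 $ 1 * B t $ 2 $ 2) - (W t $ 1 $ 2 * W t $ 2 $ 1 - B t $ 1 $ 2 * B t $ 2 $ 1)"
        using det[of t] by (simp add: d_def det_2 algebra_simps)
      also have "norm \<dots> \<le> 2 * \<beta> * \<eta> + 2 * \<beta> * \<eta>" by (rule order_trans[OF norm_triangle_ineq4]) (intro add_mono pr)
      finally show ?thesis using \<eta>(2) by simp
    qed
    have low: "norm (1 + d t) \<ge> 1/2" for t
      using norm_triangle_ineq4[of "1 + d t" "d t"] d[of t] by simp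
    have nz: "det (W t) \<noteq> 0" for t using low[of t] unfolding dW by auto
    have tpd: "tp (2 * N) d"
      using tp_diff[OF tp_det[OF tpW] tp_const[of "N + N" 1]] unfolding d_def[abs_def] by (simp add: mult_2)
    have sW: "allent sper W" using tpW by (rule allent_mono) (rule tp_sper)
    define V where "V t = inv2 (W (t + \<alpha>))" for t
    have sV: "allent sper V"
      unfolding V_def by (rule allent_sper_inv2[OF allent_sper_shift[OF sW] nz])
    define F where "F t = V t ** (A t ** W t - W (t + \<alpha>) ** dg l)" for t
    define Z where "Z t = inv2 (W t) ** B t" for t
    have cW: "allent cper W" using sW by (rule allent_mono) (rule sper_cper)
    have cZ: "allent cper Z" unfolding Z_def by (intro allent_cper_mult allent_cper_inv2 cW nz B)
    have sF: "allent sper F" unfolding F_def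
      by (rule allent_sper_mult[OF sV allent_sper_diff[OF allent_sper_mult[OF A sW]
            allent_sper_mult[OF allent_sper_shift[OF sW] allent_sper_const]]])
    have WZ: "W t ** Z t = B t" for t
      unfolding Z_def matrix_mul_assoc inv2_right[OF nz] by simp
    have Zeq: "Z (t + \<alpha>) ** dg l = (dg l + F t) ** Z t" for t
    proof -
      have "(dg l + F t) ** Z t = dg l ** Z t + (V t ** (A t ** (W t ** Z t)) - (V t ** W (t + \<alpha>)) ** dg l ** Z t)"
        unfolding F_def mm_dist by (simp add: matrix_mul_assoc)
      also have "V t ** W (t + \<alpha>) = mat 1" unfolding V_def by (rule inv2_left[OF nz])
      finally have "(dg l + F t) ** Z t = V t ** (A t ** B t)" by (simp add: WZ)
      also have "\<dots> = Z (t + \<alpha>) ** dg l" by (simp add: eq[symmetric] V_def Z_def matrix_mul_assoc)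
      finally show ?thesis by simp
    qed
    have Zb: "entbd (Z t - mat 1) e" for t
    proof -
      have Zm: "Z t - mat 1 = inv2 (W t) ** (B t - W t)" unfolding Z_def mm_dist inv2_left[OF nz] ..
      have iW: "entbd (inv2 (W t)) (2 * \<beta>)" unfolding entbd_def inv2_def
      proof (intro allI)
        fix a b
        have "entbd (adj2 (W t)) \<beta>" by (intro entbd_adj2) (simp add: entbd_def Wb)
        then have "norm (adj2 (W t) $ a $ b) / norm (det (W t)) \<le> \<beta> / (1/2)"
          unfolding dW entbd_def using low[of t] by (intro frac_le) (auto intro: order_trans[OF norm_ge_zero])
        then show "norm ((\<chi> a b. adj2 (W t) $ a $ b / det (W t)) $ a $ b) \<le> 2 * \<beta>" by (simp add: norm_divide)
      qed
      have "entbd (B t - W t) \<eta>" using WB[of t] by (simp add: entbd_def norm_minus_commute)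
      from entbd_mult[OF iW this] have "entbd (Z t - mat 1) (4 * \<beta> * \<eta>)" unfolding Zm by simp
      then show ?thesis using \<eta>(3) unfolding entbd_def by (meson order_trans)
    qed
    \<comment> \<open>splitting off the tail of \<open>A\<close> makes the numerator of \<open>F\<close> a trigonometric polynomial\<close>
    define A1 where "A1 t = (\<chi> a b. trunc N (\<lambda>t. A t $ a $ b) t)" for t
    have A1e: "A1 t $ a $ b = trunc N (\<lambda>t. A t $ a $ b) t" for t a b by (simp add: A1_def)
    have tpA1: "allent (tp N) A1" by (simp add: allent_def A1e tp_trunc)
    have A1b: "norm (A t $ a $ b - A1 t $ a $ b) \<le> C / (real N)\<^sup>2" for t a b
    proof (rule tendsto_upperbound)
      show "(\<lambda>n. norm (trunc n (\<lambda>t. A t $ a $ b) t - trunc N (\<lambda>t. A t $ a $ b) t)) \<longlonglongrightarrow> norm (A t $ a $ b - A1 t $ a $ b)"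
        unfolding A1e by (intro tendsto_intros sper_trunc_lim allentD[OF A])
      have "norm (trunc n (\<lambda>t. A t $ a $ b) t - trunc N (\<lambda>t. A t $ a $ b) t) \<le> C / (real N)\<^sup>2" if "n \<ge> N" for n
        by (rule Wie_sup[OF N', of n _ m]) (use C(2)[OF N(1) that] that in \<open>auto intro!: tp_diff tp_trunc tp_mono[OF tp_trunc]\<close>)
      then show "\<forall>\<^sub>F n in sequentially. norm (trunc n (\<lambda>t. A t $ a $ b) t - trunc N (\<lambda>t. A t $ a $ b) t) \<le> C / (real N)\<^sup>2"
        by (auto simp: eventually_sequentially)
    qed simp
    define r where "r = 2 * (e1 / real N) + 2 * (C / (real N)\<^sup>2) * \<beta>"
    define R1 where "R1 t = A1 t ** W t - W (t + \<alpha>) ** dg l" for t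
    have R1b: "norm (R1 t $ a $ b) \<le> r" for t a b
    proof -
      have kb: "ksm N (\<lambda>\<tau>. A t $ a $ c * B \<tau> $ c $ b) t = A t $ a $ c * W t $ c $ b" for c
        unfolding We using ksm_cmult[of N "\<lambda>\<tau>. B \<tau> $ c $ b" "A t $ a $ c" t] by (simp add: mult.commute)
      have cA: "cper (\<lambda>\<tau>. A \<tau> $ a $ c)" for a c by (rule sper_cper[OF allentD[OF A]])
      note cB = allentD[OF B]
      have "W (t + \<alpha>) $ a $ b * l b = ksm N (\<lambda>\<tau>. B (\<tau> + \<alpha>) $ a $ b * l b) t"
        unfolding We ksm_shift[OF cB] ksm_cmult ..
      also have "(\<lambda>\<tau>. B (\<tau> + \<alpha>) $ a $ b * l b) = (\<lambda>\<tau>. A \<tau> $ a $ 1 * B \<tau> $ 1 $ b + A \<tau> $ a $ 2 * B \<tau> $ 2 $ b)"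
        using eq by (simp add: mm_entry[symmetric] dg_right[symmetric])
      also have "ksm N \<dots> t = ksm N (\<lambda>\<tau>. A \<tau> $ a $ 1 * B \<tau> $ 1 $ b) t + ksm N (\<lambda>\<tau>. A \<tau> $ a $ 2 * B \<tau> $ 2 $ b) t"
        by (intro ksm_add cper_mult cA cB)
      finally have WD: "W (t + \<alpha>) $ a $ b * l b = \<dots>" .
      have co: "A t $ a $ c * W t $ c $ b - ksm N (\<lambda>\<tau>. A \<tau> $ a $ c * B \<tau> $ c $ b) t = ksm N (\<lambda>\<tau>. (A t $ a $ c - A \<tau> $ a $ c) * B \<tau> $ c $ b) t" for c
        unfolding left_diff_distrib kb[symmetric] by (intro ksm_diff[symmetric] cper_mult cper_const cA cB)
      have "R1 t $ a $ b = (ksm N (\<lambda>\<tau>. (A t $ a $ 1 - A \<tau> $ a $ 1) * B \<tau> $ 1 $ b) t + ksm N (\<lambda>\<tau>. (A t $ a $ 2 - A \<tau> $ a $ 2) * B \<tau> $ 2 $ b) t)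
          - ((A t $ a $ 1 - A1 t $ a $ 1) * W t $ 1 $ b + (A t $ a $ 2 - A1 t $ a $ 2) * W t $ 2 $ b)"
        unfolding R1_def co[symmetric] vector_minus_component dg_right WD unfolding mm_entry by (simp add: algebra_simps)
      also have "norm \<dots> \<le> (e1 / real N + e1 / real N) + ((C / (real N)\<^sup>2) * \<beta> + (C / (real N)\<^sup>2) * \<beta>)"
        using C(1) \<beta>(1)
        by (intro order_trans[OF norm_triangle_ineq4] order_trans[OF norm_triangle_ineq] add_mono Com order_trans[OF eq_refl[OF norm_mult]] mult_mono A1b Wb) auto
      finally show ?thesis by (simp add: r_def)
    qed
    have r0: "r \<ge> 0" using order_trans[OF norm_ge_zero R1b] .
    have tpR1: "allent (tp (2 * N)) R1"
    proof -
      have "allent (tp (N + N)) (\<lambda>t. A1 t ** W t - W (t + \<alpha>) ** dg l)"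
        by (rule allent_tp_diff[OF allent_tp_mult[OF tpA1 tpW] allent_tp_mult[OF allent_tp_shift[OF tpW] allent_tp_const]])
      then show ?thesis unfolding R1_def by (simp add: mult_2)
    qed
    have tps: "tp (2 * N) (\<lambda>t. d (t + \<alpha>))" by (rule tp_shift[OF tpd])
    have tpadj: "allent (tp N) (\<lambda>t. adj2 (W (t + \<alpha>)))"
      by (rule allent_adj2[OF allent_tp_shift[OF tpW] tp_minus])
    have adjb: "norm (adj2 (W t) $ a $ b) \<le> \<beta>" for t a b
      using entbd_adj2[of "W t" \<beta>] Wb by (simp add: entbd_def)
    have Fdec: "F t $ a $ b = (adj2 (W (t + \<alpha>)) $ a $ 1 * R1 t $ 1 $ b + adj2 (W (t + \<alpha>)) $ a $ 2 * R1 t $ 2 $ b) / (1 + d (t + \<alpha>)) +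
        (\<Sum>c\<in>UNIV. \<Sum>k\<in>UNIV. (A t $ c $ k - A1 t $ c $ k) * ((adj2 (W (t + \<alpha>)) $ a $ c * W t $ k $ b) / (1 + d (t + \<alpha>))))" for t a b
    proof -
      have "F t = V t ** R1 t + V t ** ((A t - A1 t) ** W t)"
        unfolding F_def R1_def mm_dist by simp
      then show ?thesis
        unfolding V_def inv2_def dW[symmetric] by (simp add: mm_entry sum_2 divide_inverse algebra_simps)
    qed
    have SF: "Sob (real N) m (\<lambda>t. F t $ a $ b) (e / real N)" for a b
    proof -
      have S1: "Sob (real N) m (\<lambda>t. (adj2 (W (t + \<alpha>)) $ a $ 1 * R1 t $ 1 $ b + adj2 (W (t + \<alpha>)) $ a $ 2 * R1 t $ 2 $ b) / (1 + d (t + \<alpha>))) (C3 * (\<beta> * r + \<beta> * r))"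
      proof (rule C3(2)[OF N(1) _ tps])
        have "tp (N + 2 * N) (\<lambda>t. adj2 (W (t + \<alpha>)) $ a $ 1 * R1 t $ 1 $ b + adj2 (W (t + \<alpha>)) $ a $ 2 * R1 t $ 2 $ b)"
          by (intro tp_add tp_mult allentD[OF tpadj] allentD[OF tpR1])
        then show "tp (3 * N) (\<lambda>t. adj2 (W (t + \<alpha>)) $ a $ 1 * R1 t $ 1 $ b + adj2 (W (t + \<alpha>)) $ a $ 2 * R1 t $ 2 $ b)" by simp
        show "norm (adj2 (W (t + \<alpha>)) $ a $ 1 * R1 t $ 1 $ b + adj2 (W (t + \<alpha>)) $ a $ 2 * R1 t $ 2 $ b) \<le> \<beta> * r + \<beta> * r" for t
          using \<beta>(1) r0 by (intro order_trans[OF norm_triangle_ineq] add_mono order_trans[OF eq_refl[OF norm_mult]] mult_mono adjb R1b) auto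
        show "norm (d (t + \<alpha>)) \<le> 1/2" for t by (rule d)
      qed
      have ch: "cper (\<lambda>t. (adj2 (W (t + \<alpha>)) $ a $ c * W t $ k $ b) / (1 + d (t + \<alpha>)))" for c k
        by (intro cper_divide cper_mult cper_add cper_const tp_cper[OF allentD[OF tpadj]] tp_cper[OF allentD[OF tpW]] tp_cper[OF tps])
           (use nz[unfolded dW] in simp)
      have S2: "Sob (real N) m (\<lambda>t. (A t $ c $ k - A1 t $ c $ k) * ((adj2 (W (t + \<alpha>)) $ a $ c * W t $ k $ b) / (1 + d (t + \<alpha>)))) ((C / (real N)\<^sup>2) * (C2 * (\<beta> * \<beta>)))" for c k
        unfolding A1e
      proof (rule Sob_tail_mult[OF allentD[OF A] N' _ ch])
        show "Wie (real N) m (\<lambda>t. trunc n (\<lambda>t. A t $ c $ k) t - trunc N (\<lambda>t. A t $ c $ k) t) (C / (real N)\<^sup>2)" if "n \<ge> N" for n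
          using C(2)[OF N(1) that] .
        show "Sob (real N) m (\<lambda>t. (adj2 (W (t + \<alpha>)) $ a $ c * W t $ k $ b) / (1 + d (t + \<alpha>))) (C2 * (\<beta> * \<beta>))"
        proof (rule C2(2)[OF N(1) _ tps])
          have "tp (N + N) (\<lambda>t. adj2 (W (t + \<alpha>)) $ a $ c * W t $ k $ b)"
            by (intro tp_mult allentD[OF tpadj] allentD[OF tpW])
          then show "tp (2 * N) (\<lambda>t. adj2 (W (t + \<alpha>)) $ a $ c * W t $ k $ b)" by (simp add: mult_2)
          show "norm (adj2 (W (t + \<alpha>)) $ a $ c * W t $ k $ b) \<le> \<beta> * \<beta>" for t
            unfolding norm_mult using \<beta>(1) by (intro mult_mono adjb Wb) auto
          show "norm (d (t + \<alpha>)) \<le> 1/2" for t by (rule d)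
        qed
      qed
      have cA': "cper (\<lambda>t. A t $ c $ k - A1 t $ c $ k)" for c k
        by (intro cper_diff sper_cper[OF allentD[OF A]] tp_cper[OF allentD[OF tpA1]])
      have "Sob (real N) m (\<lambda>t. F t $ a $ b) (C3 * (\<beta> * r + \<beta> * r) + (\<Sum>c\<in>(UNIV::2 set). \<Sum>k\<in>(UNIV::2 set). (C / (real N)\<^sup>2) * (C2 * (\<beta> * \<beta>))))"
        unfolding Fdec
      proof (rule Sob_add[OF N' _ _ S1])
        show "cper (\<lambda>t. (adj2 (W (t + \<alpha>)) $ a $ 1 * R1 t $ 1 $ b + adj2 (W (t + \<alpha>)) $ a $ 2 * R1 t $ 2 $ b) / (1 + d (t + \<alpha>)))"
          by (intro cper_divide cper_mult cper_add cper_const tp_cper[OF allentD[OF tpadj]] tp_cper[OF allentD[OF tpR1]] tp_cper[OF tps])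
             (use nz[unfolded dW] in simp)
        show "cper (\<lambda>t. \<Sum>c\<in>UNIV. \<Sum>k\<in>UNIV. (A t $ c $ k - A1 t $ c $ k) * ((adj2 (W (t + \<alpha>)) $ a $ c * W t $ k $ b) / (1 + d (t + \<alpha>))))"
          by (intro cper_sum cper_mult cA' ch)
        show "Sob (real N) m (\<lambda>t. \<Sum>c\<in>UNIV. \<Sum>k\<in>UNIV. (A t $ c $ k - A1 t $ c $ k) * ((adj2 (W (t + \<alpha>)) $ a $ c * W t $ k $ b) / (1 + d (t + \<alpha>))))
           (\<Sum>c\<in>(UNIV::2 set). \<Sum>k\<in>(UNIV::2 set). (C / (real N)\<^sup>2) * (C2 * (\<beta> * \<beta>)))"
          by (intro Sob_sum N' cper_sum cper_mult cA' ch S2) auto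
      qed
      moreover have "C3 * (\<beta> * r + \<beta> * r) + (\<Sum>c\<in>(UNIV::2 set). \<Sum>k\<in>(UNIV::2 set). (C / (real N)\<^sup>2) * (C2 * (\<beta> * \<beta>))) = (4 * \<beta> * C3 * e1 + Q / real N) / real N"
        using N' by (simp add: r_def Q_def field_simps power2_eq_square)
      moreover have "\<dots> \<le> e / real N" using N' N(2) e1(2) by (intro divide_right_mono) linarith+
      ultimately show ?thesis by (elim Sob_mono) linarith
    qed
    have "allent (\<lambda>f. Sob (real N) m f (e / real N)) F" by (rule allentI) (rule SF)
    moreover have "allent (\<lambda>f. Sob (real N) 0 f (e / real N)) F" by (rule allentI) (rule Sob_order[OF N' SF])
    ultimately have "near_const \<alpha> l (real N) m F Z e (e / real N) (e / real N)"
      unfolding near_const_def using sF cZ Zeq Zb by blast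
    then show ?thesis using tpW WZ by blast
  qed
  then show thesis using that[of "max 1 N0"] by simp
qed

section \<open>One step of the iteration\<close>

text \<open>The diagonal zero modes: there the divisor is 0, for every rotation number and all eigenvalues.\<close>

definition res_set :: "2 \<Rightarrow> 2 \<Rightarrow> int set" where
  "res_set a b = (if a = b then {0} else {})"

text \<open>The eigenvalues of \<open>Y \<mapsto> Y (t + \<alpha>) ** dg l - dg l ** Y t\<close> on the entry \<open>(a, b)\<close> and the
  frequency \<open>j\<close>.\<close>

definition divisor :: "real \<Rightarrow> (2 \<Rightarrow> complex) \<Rightarrow> 2 \<Rightarrow> 2 \<Rightarrow> int \<Rightarrow> complex" where
  "divisor \<alpha> l a b j = chi j \<alpha> * l b - l a"

text \<open>A square-summed bound rather than one for each divisor: together with the square-summable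
  coefficients of the error it bounds a Wiener norm without losing a further factor \<open>sqrt N\<close>.\<close>

definition div_ok :: "real \<Rightarrow> (2 \<Rightarrow> complex) \<Rightarrow> real \<Rightarrow> real \<Rightarrow> nat \<Rightarrow> bool" where
  "div_ok \<alpha> l N \<Lambda> s \<longleftrightarrow>
     (\<forall>a b j. j \<notin> res_set a b \<longrightarrow> divisor \<alpha> l a b j \<noteq> 0) \<and>
     (\<forall>a b n K. K \<ge> 1 \<longrightarrow> real n \<le> K * N \<longrightarrow>
        L2_set (\<lambda>j. 1 / norm (divisor \<alpha> l a b j)) ({-int n..int n} - res_set a b) \<le> \<Lambda> * N * K ^ s)"

text \<open>Together with the two lemmas that follow this implements the absorption of a small multiple of a norm into the
  left side: an a priori bound, however large, is halved again and again.\<close>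

lemma Sob_limit_bound:
  assumes it: "\<And>n::nat. Sob N m f (L + X / 2 ^ n)" and L: "L \<ge> 0"
  shows "Sob N m f L"
  unfolding Sob_def
proof (intro conjI allI impI L)
  fix J :: "int set" assume J: "finite J"
  have "(\<lambda>n. L + X / 2 ^ n) \<longlonglongrightarrow> L + 0"
    by (intro tendsto_intros LIMSEQ_divide_realpow_zero) auto
  then show "L2_set (\<lambda>j. wt N j ^ m * norm (fc f j)) J \<le> L"
    using SobD[OF it J] by (intro LIMSEQ_le_const[of "\<lambda>n. L + X / 2 ^ n"]) auto
qed

lemma allent_Sob_mono: "allent (\<lambda>f. Sob N m f C) A \<Longrightarrow> C \<le> D \<Longrightarrow> allent (\<lambda>f. Sob N m f D) A"
  unfolding allent_def using Sob_mono by blast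

lemma allent_Sob_absorb:
  assumes ex: "allent (\<lambda>f. Sob N m f X) F"
    and step: "\<And>X. allent (\<lambda>f. Sob N m f X) F \<Longrightarrow> allent (\<lambda>f. Sob N m f (a + X / 2)) F" and a: "a \<ge> 0"
  shows "allent (\<lambda>f. Sob N m f (2 * a)) F"
proof -
  have it: "allent (\<lambda>f. Sob N m f (2 * a + X / 2 ^ n)) F" for n :: nat
  proof (induction n)
    case 0
    show ?case by (rule allent_Sob_mono[OF ex]) (use a in simp)
  next
    case (Suc n)
    have "a + (2 * a + X / 2 ^ n) / 2 = 2 * a + X / 2 ^ Suc n" by (simp add: field_simps)
    with step[OF Suc] show ?case by simp
  qed
  show ?thesis
    by (rule allentI, rule Sob_limit_bound, rule allentD[OF it]) (use a in simp)
qed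

lemma allent_Sob_exists:
  assumes "allent sper F" "N \<ge> 1" shows "\<exists>X. allent (\<lambda>f. Sob N m f X) F"
proof -
  have ex: "\<exists>C\<ge>0. Sob N m (\<lambda>t. F t $ a $ b) C" for a b
  proof -
    have "sper (\<lambda>t. F t $ a $ b)" using assms(1) by (rule allentD)
    then obtain C where "Sob N m (\<lambda>t. F t $ a $ b) C" using assms(2) by (rule sper_Sob)
    then show ?thesis using Sob_nonneg by blast
  qed
  define Q where "Q a b C \<longleftrightarrow> Sob N m (\<lambda>t. F t $ a $ b) C" for a b C
  have mono: "Q a b D" if "Q a b C" "C \<le> D" for a b C D
    using that unfolding Q_def by (rule Sob_mono)
  obtain C where "C \<ge> 0" "\<And>a b. Q a b C"
    using uniform_ent[of Q] ex[folded Q_def] mono by metis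
  then have "\<And>a b. Sob N m (\<lambda>t. F t $ a $ b) C" unfolding Q_def by blast
  then show ?thesis unfolding allent_def by blast
qed

lemma allent_Sob_add:
  assumes "N > 0" "allent cper A" "allent cper B" "allent (\<lambda>f. Sob N m f C) A" "allent (\<lambda>f. Sob N m f D) B"
  shows "allent (\<lambda>f. Sob N m f (C + D)) (\<lambda>t. A t + B t)"
  using assms unfolding allent_def by (auto intro!: Sob_add)

lemma allent_Sob_diff:
  assumes "N > 0" "allent cper A" "allent cper B" "allent (\<lambda>f. Sob N m f C) A" "allent (\<lambda>f. Sob N m f D) B"
  shows "allent (\<lambda>f. Sob N m f (C + D)) (\<lambda>t. A t - B t)"
  using assms unfolding allent_def by (auto intro!: Sob_diff)

lemma allent_Sob_mult:
  assumes N: "N > 0" and c: "allent cper A" "allent cper B"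
    and pr: "\<And>a b c. Sob N m (\<lambda>t. A t $ a $ c * B t $ c $ b) C"
  shows "allent (\<lambda>f. Sob N m f (2 * C)) (\<lambda>t. A t ** B t)"
proof (rule allentI)
  fix a b
  have "Sob N m (\<lambda>t. A t $ a $ 1 * B t $ 1 $ b + A t $ a $ 2 * B t $ 2 $ b) (C + C)"
    by (rule Sob_add[OF N cper_mult[OF allentD[OF c(1)] allentD[OF c(2)]] cper_mult[OF allentD[OF c(1)] allentD[OF c(2)]] pr pr])
  then show "Sob N m (\<lambda>t. (A t ** B t) $ a $ b) (2 * C)" by (simp add: mm_entry)
qed

definition mtrunc :: "nat \<Rightarrow> (real \<Rightarrow> complex^2^2) \<Rightarrow> real \<Rightarrow> complex^2^2" where
  "mtrunc n M t = (\<chi> a b. trunc n (\<lambda>t. M t $ a $ b) t)"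

lemma mtrunc_entry: "mtrunc n M t $ a $ b = trunc n (\<lambda>t. M t $ a $ b) t"
  by (simp add: mtrunc_def)

lemma mtrunc_entry_fun: "(\<lambda>t. mtrunc n M t $ a $ b) = trunc n (\<lambda>t. M t $ a $ b)"
  by (simp add: mtrunc_entry)

lemma allent_tp_mtrunc: "allent (tp n) (mtrunc n M)"
  by (simp add: allent_def mtrunc_entry_fun tp_trunc)

lemma allent_tp_cper: "allent (tp n) M \<Longrightarrow> allent cper M"
  and allent_tp_sper: "allent (tp n) M \<Longrightarrow> allent sper M"
  and allent_sper_cper: "allent sper M \<Longrightarrow> allent cper M"
  unfolding allent_def using tp_cper tp_sper sper_cper by blast+

lemma trunc_add: "cper f \<Longrightarrow> cper g \<Longrightarrow> trunc n (\<lambda>t. f t + g t) t = trunc n f t + trunc n g t"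
  by (simp add: trunc_def fc_add distrib_right sum.distrib)

lemma mtrunc_add: "allent cper A \<Longrightarrow> allent cper B \<Longrightarrow> mtrunc n (\<lambda>t. A t + B t) t = mtrunc n A t + mtrunc n B t"
  unfolding vec_eq_iff by (auto simp: mtrunc_entry trunc_add allentD)

lemma allent_Sob_mtrunc: "N > 0 \<Longrightarrow> allent (\<lambda>f. Sob N m f C) M \<Longrightarrow> allent (\<lambda>f. Sob N m f C) (mtrunc n M)"
  unfolding allent_def mtrunc_entry_fun by (auto intro: Sob_trunc)

lemma allent_Sob_tail0: "N > 0 \<Longrightarrow> allent cper M \<Longrightarrow> allent (\<lambda>f. Sob N m f C) M \<Longrightarrow> allent (\<lambda>f. Sob N m f C) (\<lambda>t. M t - mtrunc n M t)"
  unfolding allent_def by (auto simp: mtrunc_entry intro: Sob_tail0)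

lemma tp_eqI:
  assumes "tp n p" "tp n q" "\<And>j. \<bar>j\<bar> \<le> int n \<Longrightarrow> fc p j = fc q j" shows "p t = q t"
  by (subst tp_expand[OF assms(1)], subst tp_expand[OF assms(2)]) (auto intro!: sum.cong simp: assms(3))

lemma Wie_0_trunc:
  assumes "(\<Sum>j\<in>{-int k..int k}. norm (fc f j)) \<le> p" and "n \<le> k"
  shows "Wie N 0 (trunc n f) p"
  unfolding Wie_def
proof (intro conjI allI impI)
  show "p \<ge> 0" using assms(1) by (meson norm_ge_zero order_trans sum_nonneg)
  fix J :: "int set" assume J: "finite J"
  have "(\<Sum>j\<in>J. wt N j ^ 0 * norm (fc (trunc n f) j)) = (\<Sum>j\<in>J. if \<bar>j\<bar> \<le> int n then norm (fc f j) else 0)"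
    by (intro sum.cong refl) (auto simp: fc_trunc)
  also have "\<dots> = (\<Sum>j\<in>{j\<in>J. \<bar>j\<bar> \<le> int n}. norm (fc f j))"
    using J by (simp add: sum.inter_filter)
  also have "\<dots> \<le> (\<Sum>j\<in>{-int k..int k}. norm (fc f j))"
    using assms(2) by (intro sum_mono2) auto
  finally show "(\<Sum>j\<in>J. wt N j ^ 0 * norm (fc (trunc n f) j)) \<le> p" using assms(1) by linarith
qed

lemma Wie_0_annulus:
  assumes f: "cper f" and "(\<Sum>j\<in>{-int k..int k}. norm (fc f j)) \<le> p" and "n \<le> k"
  shows "Wie N 0 (\<lambda>t. trunc k f t - trunc n f t) p"
  unfolding Wie_def
proof (intro conjI allI impI)
  have W: "Wie N 0 (trunc k f) p" by (rule Wie_0_trunc[OF assms(2)]) simp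
  then show "p \<ge> 0" by (rule Wie_nonneg)
  fix J :: "int set" assume J: "finite J"
  have "(\<Sum>j\<in>J. wt N j ^ 0 * norm (fc (\<lambda>t. trunc k f t - trunc n f t) j)) \<le> (\<Sum>j\<in>J. wt N j ^ 0 * norm (fc (trunc k f) j))"
    using assms(3) by (intro sum_mono) (auto simp: fc_diff cper_trunc fc_trunc)
  also have "\<dots> \<le> p" by (rule WieD[OF W J])
  finally show "(\<Sum>j\<in>J. wt N j ^ 0 * norm (fc (\<lambda>t. trunc k f t - trunc n f t) j)) \<le> p" .
qed

lemma L2_bound_sum_quotient:
  assumes g: "L2_set (\<lambda>j. norm (g j)) J \<le> A" and d: "L2_set (\<lambda>j. 1 / norm (d j)) J \<le> B"
    and eq: "\<And>j. j \<in> J \<Longrightarrow> y j * d j = g j" "\<And>j. j \<in> J \<Longrightarrow> d j \<noteq> 0"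
  shows "(\<Sum>j\<in>J. norm (y j :: complex)) \<le> A * B"
proof -
  have "(\<Sum>j\<in>J. norm (y j)) = (\<Sum>j\<in>J. \<bar>norm (g j)\<bar> * \<bar>1 / norm (d j)\<bar>)"
    using eq by (intro sum.cong refl) (auto simp: field_simps norm_mult[symmetric])
  also have "\<dots> \<le> L2_set (\<lambda>j. norm (g j)) J * L2_set (\<lambda>j. 1 / norm (d j)) J"
    by (rule L2_set_mult_ineq)
  also have "\<dots> \<le> A * B" using g d by (intro mult_mono) (auto intro: order_trans[OF L2_set_nonneg])
  finally show ?thesis .
qed

lemma small_perturbation_det:
  assumes "entbd P (1/4)" shows "det (mat 1 + P :: complex^2^2) \<noteq> 0"
proof
  assume z: "det (mat 1 + P) = 0"
  have b: "norm (P $ a $ b) \<le> 1/4" for a b using assms by (simp add: entbd_def)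
  have l: "norm (1 + P $ a $ a) \<ge> 3/4" for a
    using norm_triangle_ineq4[of "1 + P $ a $ a" "P $ a $ a"] b[of a a] by simp
  have "(1 + P$1$1) * (1 + P$2$2) = P$1$2 * P$2$1"
    using z by (simp add: det_2 mat_entries)
  then have "norm (1 + P$1$1) * norm (1 + P$2$2) = norm (P$1$2) * norm (P$2$1)" by (metis norm_mult)
  moreover have "norm (1 + P$1$1) * norm (1 + P$2$2) \<ge> (3/4) * (3/4)" by (intro mult_mono l) auto
  moreover have "norm (P$1$2) * norm (P$2$1) \<le> (1/4) * (1/4)" by (intro mult_mono b) auto
  ultimately show False by simp
qed

text \<open>The difference \<open>Z' - Z\<close> equals \<open>- P ** Z'\<close>, so the largest entry of \<open>Z'\<close> is bounded in terms of itself.\<close>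

lemma small_perturbation_solve:
  fixes P Z Z' :: "complex^2^2"
  assumes P: "entbd P p" "p \<le> 1/4" and Z: "entbd (Z - mat 1) (1/4)" and eq: "(mat 1 + P) ** Z' = Z"
  shows "entbd (Z' - Z) (4 * p)"
  unfolding entbd_def
proof (intro allI)
  fix a b
  have pb: "norm (P $ a $ c) \<le> p" for a c using P(1) by (simp add: entbd_def)
  have p0: "p \<ge> 0" using order_trans[OF norm_ge_zero pb] .
  define s where "s = norm (Z' $ 1 $ b) + norm (Z' $ 2 $ b)"
  have d: "Z' $ a $ b - Z $ a $ b = - (P $ a $ 1 * Z' $ 1 $ b + P $ a $ 2 * Z' $ 2 $ b)" for a
    using arg_cong[OF eq, of "\<lambda>M. M $ a $ b"] exhaust_2[of a] by (auto simp: mm_entry mat_entries algebra_simps)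
  have diff: "norm (Z' $ a $ b - Z $ a $ b) \<le> p * s" for a
  proof -
    have "norm (Z' $ a $ b - Z $ a $ b) \<le> norm (P $ a $ 1) * norm (Z' $ 1 $ b) + norm (P $ a $ 2) * norm (Z' $ 2 $ b)"
      unfolding d norm_minus_cancel by (rule order_trans[OF norm_triangle_ineq]) (simp add: norm_mult)
    also have "\<dots> \<le> p * norm (Z' $ 1 $ b) + p * norm (Z' $ 2 $ b)" by (intro add_mono mult_right_mono pb) auto
    finally show ?thesis by (simp add: s_def algebra_simps)
  qed
  have Zb: "norm (Z $ a $ b) \<le> (if a = b then 1 else 0) + 1/4" for a
  proof -
    have "norm (Z $ a $ b) \<le> norm (mat 1 $ a $ b :: complex) + norm ((Z - mat 1) $ a $ b)"
      using norm_triangle_ineq[of "mat 1 $ a $ b" "(Z - mat 1) $ a $ b"] by simp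
    moreover have "norm ((Z - mat 1) $ a $ b) \<le> 1/4" using Z by (simp add: entbd_def)
    ultimately show ?thesis by (auto simp: mat_entries split: if_splits)
  qed
  have "norm (Z' $ a $ b) \<le> norm (Z $ a $ b) + p * s" for a
    using norm_triangle_ineq[of "Z $ a $ b" "Z' $ a $ b - Z $ a $ b"] diff[of a] by simp
  from this[of 1] this[of 2] Zb[of 1] Zb[of 2]
  have "s \<le> 3/2 + 2 * (p * s)" unfolding s_def[symmetric] using s_def exhaust_2[of b] by auto
  moreover have "p * s \<le> (1/4) * s" using P(2) by (intro mult_right_mono) (auto simp: s_def)
  ultimately have "s \<le> 3" by linarith
  then have "p * s \<le> p * 3" using p0 by (intro mult_left_mono)
  then have "norm (Z' $ a $ b - Z $ a $ b) \<le> 4 * p" using diff[of a] p0 by linarith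
  then show "norm ((Z' - Z) $ a $ b) \<le> 4 * p" by simp
qed

text \<open>Normalise \<open>Z\<close> on the right by the diagonal matrix \<open>c\<close> of its diagonal means and subtract the identity; the result \<open>Y\<close>
  satisfies \<open>Y (t + \<alpha>) ** dg l - dg l ** Y t = F t ** (mat 1 + Y t)\<close> and has no diagonal zero
  modes. Its coefficients are therefore those of the right side divided by the divisors, and the Cauchy-Schwarz
  inequality with \<open>div_ok\<close> bounds the Wiener norm of the low frequencies of \<open>Y\<close> by \<open>p\<close>: the factor \<open>N\<close> of the divisors cancels
  the \<open>1 / N\<close> in the size of \<open>F\<close>. Conjugating by \<open>mat 1 + P\<close>, where \<open>P\<close> is the
  truncation of \<open>Y\<close> at \<open>n = K * N\<close>, removes all of \<open>F\<close> but its high frequencies, which have size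
  \<open>E / K ^ m\<close>, and terms of size \<open>p * \<epsilon>\<close>. The norm of order \<open>m\<close> grows by a constant factor, apart from the truncated
  terms, which are small in the norm of order 0 and cost \<open>K ^ m\<close>.

  The last two conclusions say that \<open>Z\<close> is already almost diagonal and constant at frequencies up
  to \<open>n\<close>; in the limit of the iteration they identify the product of the factors \<open>mat 1 + P\<close>.\<close>

lemma kam_step:
  fixes N \<Lambda> K \<epsilon> E \<eta> \<alpha> p :: real and l :: "2 \<Rightarrow> complex" and F Z :: "real \<Rightarrow> complex^2^2" and s m n :: nat
  assumes dv: "div_ok \<alpha> l N \<Lambda> s" and N: "N \<ge> 1" and \<Lambda>: "\<Lambda> > 0" and K: "K \<ge> 1"
    and nc: "near_const \<alpha> l N m F Z \<eta> (\<epsilon> / N) (E / N)" and \<eta>: "\<eta> \<le> 1/4"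
    and p: "p = 4 * \<Lambda> * (2 * K) ^ s * \<epsilon>" "2 ^ (m + 2) * p \<le> 1"
    and n: "n = nat \<lfloor>K * N\<rfloor>"
  obtains P F' Z' where "allent (tp n) P" "allent (\<lambda>f. Wie N 0 f p) P" "\<And>t. (mat 1 + P t) ** Z' t = Z t"
    "near_const \<alpha> l N m F' Z' (\<eta> + 4 * p) (8 * (E / K ^ m + p * \<epsilon>) / N) (20 * 2 ^ m * (E + K ^ m * \<epsilon>) / N)"
    "\<And>a b j. \<bar>j\<bar> \<le> int n \<Longrightarrow> j \<notin> res_set a b \<Longrightarrow> norm (fc (\<lambda>t. Z t $ a $ b) j) \<le> 2 * p"
    "\<And>a b j. norm (fc (\<lambda>t. Z t $ a $ b) j) \<le> 2"
proof -
  have N0: "N > 0" using N by simp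
  have KN: "K * N \<ge> 1" using mult_mono[of 1 K 1 N] K N by simp
  have nKN: "real n \<le> K * N" using KN unfolding n by (simp add: of_nat_nat)
  have nKN': "K * N < real n + 1" using KN unfolding n by (simp add: of_nat_nat)
  have wn: "wt N (int n) \<le> 1 + K" using nKN N0 by (simp add: wt_def divide_le_eq)
  have wtail: "wt N j \<ge> K" if "\<bar>j\<bar> > int n" for j
  proof -
    have "real n + 1 \<le> \<bar>real_of_int j\<bar>" using that by linarith
    then have "K * N \<le> \<bar>real_of_int j\<bar>" using nKN' by linarith
    then have "K \<le> \<bar>real_of_int j\<bar> / N" using N0 by (simp add: le_divide_eq)
    then show ?thesis by (simp add: wt_def)
  qed
  have sF: "allent sper F" and cZ: "allent cper Z"
    and Zeq: "\<And>t. Z (t + \<alpha>) ** dg l = (dg l + F t) ** Z t"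
    and Zb: "\<And>t. entbd (Z t - mat 1) \<eta>"
    and F0: "allent (\<lambda>f. Sob N 0 f (\<epsilon> / N)) F" and Fm: "allent (\<lambda>f. Sob N m f (E / N)) F"
    using nc unfolding near_const_def by blast+
  have cF: "allent cper F" by (rule allent_sper_cper[OF sF])
  have \<epsilon>0: "\<epsilon> \<ge> 0" using Sob_nonneg[OF allentD[OF F0]] N0 by (simp add: zero_le_divide_iff)
  have E0: "E \<ge> 0" using Sob_nonneg[OF allentD[OF Fm]] N0 by (simp add: zero_le_divide_iff)
  have p0: "p \<ge> 0" unfolding p using \<Lambda> K \<epsilon>0 by simp
  have p4: "p \<le> 1/4"
  proof -
    have "4 * p \<le> 2 ^ (m + 2) * p" using p0 by (intro mult_right_mono) (auto simp: power_add)
    then show ?thesis using p(2) by linarith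
  qed
  have Zb1: "norm (Z t $ a $ b - (if a = b then 1 else 0)) \<le> 1/4" for t a b
  proof -
    have "norm ((Z t - mat 1) $ a $ b) \<le> \<eta>" using Zb[of t] unfolding entbd_def by blast
    then show ?thesis using \<eta> by (simp add: mat_entries)
  qed
  \<comment> \<open>the diagonal means of \<open>Z\<close> are near 1 because \<open>Z\<close> is near the identity\<close>
  define c where "c a = fc (\<lambda>t. Z t $ a $ a) 0" for a
  have c1: "norm (c a - 1) \<le> 1/4" for a
  proof -
    have "c a - 1 = fc (\<lambda>t. Z t $ a $ a - 1) 0"
      unfolding c_def by (subst fc_diff) (auto simp: fc_const allentD[OF cZ])
    also have "norm \<dots> \<le> 1/4"
      by (rule fc_bound) (use Zb1[of _ a a] in \<open>auto intro!: cper_diff allentD[OF cZ]\<close>)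
    finally show ?thesis .
  qed
  have cl: "norm (c a) \<ge> 3/4" for a using norm_triangle_ineq4[of "c a" "c a - 1"] c1[of a] by simp
  have cu: "norm (c a) \<le> 5/4" for a using norm_triangle_ineq[of "c a - 1" 1] c1[of a] by simp
  have cnz: "c a \<noteq> 0" for a using cl[of a] by auto
  define U where "U t = (\<chi> a b. Z t $ a $ b / c b)" for t
  have Ue: "U t $ a $ b = Z t $ a $ b / c b" for t a b by (simp add: U_def)
  define Y where "Y t = U t - mat 1" for t
  have Ye: "Y t $ a $ b = Z t $ a $ b / c b - (if a = b then 1 else 0)" for t a b
    by (simp add: Y_def Ue mat_entries)
  have cU: "allent cper U" unfolding allent_def Ue
    by (auto intro!: cper_divide allentD[OF cZ] cnz)
  have cY: "allent cper Y" unfolding Y_def by (rule allent_cper_diff[OF cU allent_cper_const])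
  have Yb: "norm (Y t $ a $ b) \<le> 1" for t a b
  proof -
    have "Y t $ a $ b = ((Z t $ a $ b - (if a = b then 1 else 0)) - (if a = b then c b - 1 else 0)) / c b"
      using cnz[of b] by (auto simp: Ye field_simps)
    also have "norm \<dots> \<le> (1/4 + 1/4) / (3/4)"
      unfolding norm_divide
    proof (rule frac_le)
      have "norm (if a = b then c b - 1 else 0) \<le> 1/4" using c1[of b] by simp
      with Zb1[of t a b] show "norm ((Z t $ a $ b - (if a = b then 1 else 0)) - (if a = b then c b - 1 else 0)) \<le> 1/4 + 1/4"
        using norm_triangle_ineq4[of "Z t $ a $ b - (if a = b then 1 else 0)" "if a = b then c b - 1 else 0"] by linarith
      show "3/4 \<le> norm (c b)" by (rule cl)
    qed simp_all
    finally show ?thesis by simp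
  qed
  have Ub: "norm (U t $ a $ b) \<le> 2" for t a b
  proof -
    have "U t $ a $ b = Y t $ a $ b + (if a = b then 1 else 0)" by (simp add: Y_def mat_entries)
    also have "norm \<dots> \<le> 1 + 1"
    proof (rule order_trans[OF norm_triangle_ineq], rule add_mono[OF Yb])
      show "norm (if a = b then 1 else 0 :: complex) \<le> 1" by simp
    qed
    finally show ?thesis by simp
  qed
  have fcY: "fc (\<lambda>t. Y t $ a $ b) j = fc (\<lambda>t. Z t $ a $ b) j / c b - (if j \<in> res_set a b then 1 else 0)" for a b j
  proof -
    have "(\<lambda>t. Y t $ a $ b) = (\<lambda>t. inverse (c b) * Z t $ a $ b - (if a = b then 1 else 0))"
      by (auto simp: Ye divide_inverse)
    then show ?thesis
      by (simp only:) (subst fc_diff, auto simp: fc_cmult fc_const res_set_def divide_inverse intro!: cper_mult allentD[OF cZ])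
  qed
  have fcY0: "fc (\<lambda>t. Y t $ a $ b) j = 0" if "j \<in> res_set a b" for a b j
    using that cnz[of b] unfolding fcY by (auto simp: res_set_def c_def split: if_splits)
  have Ueq: "Y (t + \<alpha>) $ a $ b * l b - l a * Y t $ a $ b = (F t ** U t) $ a $ b" for t a b
  proof -
    have "(Z (t + \<alpha>) ** dg l) $ a $ b = (dg l ** Z t + F t ** Z t) $ a $ b" by (simp add: Zeq mm_add_left)
    then have "Z (t + \<alpha>) $ a $ b * l b = l a * Z t $ a $ b + (F t ** Z t) $ a $ b" by (simp add: dg_right dg_left)
    then have "Z (t + \<alpha>) $ a $ b * l b / c b = (l a * Z t $ a $ b + (F t ** Z t) $ a $ b) / c b" by simp
    then show ?thesis by (auto simp: Ye mm_entry Ue add_divide_distrib algebra_simps)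
  qed
  have cFU: "allent cper (\<lambda>t. F t ** U t)" by (rule allent_cper_mult[OF cF cU])
  have coef: "fc (\<lambda>t. Y t $ a $ b) j * divisor \<alpha> l a b j = fc (\<lambda>t. (F t ** U t) $ a $ b) j" for a b j
  proof -
    note cy = allentD[OF cY, of a b]
    have "fc (\<lambda>t. (F t ** U t) $ a $ b) j = fc (\<lambda>t. Y (t + \<alpha>) $ a $ b * l b - l a * Y t $ a $ b) j"
      by (simp only: Ueq)
    also have "\<dots> = fc (\<lambda>t. Y (t + \<alpha>) $ a $ b) j * l b - l a * fc (\<lambda>t. Y t $ a $ b) j"
      by (subst fc_diff) (auto simp: fc_cmult fc_cmult2 intro!: cper_mult cper_shift[OF cy] cy)
    also have "fc (\<lambda>t. Y (t + \<alpha>) $ a $ b) j = chi j \<alpha> * fc (\<lambda>t. Y t $ a $ b) j" by (rule fc_shift[OF cy])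
    finally show ?thesis by (simp add: divisor_def algebra_simps)
  qed
  have FU0: "allent (\<lambda>f. Sob N 0 f (4 * \<epsilon> / N)) (\<lambda>t. F t ** U t)"
  proof -
    have "allent (\<lambda>f. Sob N 0 f (2 * (2 * (\<epsilon> / N)))) (\<lambda>t. F t ** U t)"
      by (rule allent_Sob_mult[OF N0 cF cU]) (rule Sob_mult_sup[OF allentD[OF cF] allentD[OF cU] Ub allentD[OF F0]])
    then show ?thesis by simp
  qed
  \<comment> \<open>up to \<open>2 * n\<close> instead of \<open>n\<close>, since the product of \<open>F\<close> with the frequencies of \<open>Y\<close> between
    \<open>n\<close> and \<open>2 * n\<close> also reaches frequencies below \<open>n\<close>\<close>
  have Ysum: "(\<Sum>j\<in>{-int (2 * n)..int (2 * n)}. norm (fc (\<lambda>t. Y t $ a $ b) j)) \<le> p" for a b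
  proof -
    let ?J = "{-int (2 * n)..int (2 * n)} - res_set a b"
    have "(\<Sum>j\<in>{-int (2 * n)..int (2 * n)}. norm (fc (\<lambda>t. Y t $ a $ b) j)) = (\<Sum>j\<in>?J. norm (fc (\<lambda>t. Y t $ a $ b) j))"
      by (rule sum.mono_neutral_right) (auto simp: fcY0)
    also have "\<dots> \<le> (4 * \<epsilon> / N) * (\<Lambda> * N * (2 * K) ^ s)"
    proof (rule L2_bound_sum_quotient)
      show "L2_set (\<lambda>j. norm (fc (\<lambda>t. (F t ** U t) $ a $ b) j)) ?J \<le> 4 * \<epsilon> / N"
        using SobD[OF allentD[OF FU0, of a b], of ?J] by simp
      have "2 * K \<ge> 1" "real (2 * n) \<le> 2 * K * N" using K nKN by auto
      then show "L2_set (\<lambda>j. 1 / norm (divisor \<alpha> l a b j)) ?J \<le> \<Lambda> * N * (2 * K) ^ s"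
        using dv unfolding div_ok_def by blast
      show "fc (\<lambda>t. Y t $ a $ b) j * divisor \<alpha> l a b j = fc (\<lambda>t. (F t ** U t) $ a $ b) j" for j by (rule coef)
      show "divisor \<alpha> l a b j \<noteq> 0" if "j \<in> ?J" for j using dv that unfolding div_ok_def by blast
    qed
    also have "\<dots> = p" using N0 by (simp add: p(1))
    finally show ?thesis .
  qed
  define P where "P = mtrunc n Y"
  have tpP: "allent (tp n) P" unfolding P_def by (rule allent_tp_mtrunc)
  have cP: "allent cper P" by (rule allent_tp_cper[OF tpP])
  have WP: "allent (\<lambda>f. Wie N 0 f p) P"
    unfolding allent_def P_def mtrunc_entry_fun by (intro allI Wie_0_trunc[OF Ysum]) linarith
  have Pb: "entbd (P t) p" for t
    unfolding entbd_def using Wie_sup[OF N0 allentD[OF tpP] allentD[OF WP]] by blast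
  have Pb4: "entbd (P t) (1/4)" for t using Pb[of t] p4 unfolding entbd_def by (meson order_trans)
  define T where "T = mtrunc (2 * n) Y"
  have tpT: "allent (tp (2 * n)) T" unfolding T_def by (rule allent_tp_mtrunc)
  have cT: "allent cper T" by (rule allent_tp_cper[OF tpT])
  have WT: "allent (\<lambda>f. Wie N 0 f p) T"
    unfolding allent_def T_def mtrunc_entry_fun by (intro allI Wie_0_trunc[OF Ysum]) simp
  have tpTP: "allent (tp (2 * n)) (\<lambda>t. T t - P t)"
  proof (rule allent_tp_diff[OF tpT])
    have "n \<le> 2 * n" by linarith
    then show "allent (tp (2 * n)) P" using tpP tp_mono unfolding allent_def by blast
  qed
  have WTP: "allent (\<lambda>f. Wie N 0 f p) (\<lambda>t. T t - P t)"
    unfolding allent_def T_def P_def vector_minus_component mtrunc_entry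
    by (intro allI Wie_0_annulus[OF allentD[OF cY] Ysum]) linarith
  have LP: "P (t + \<alpha>) ** dg l - dg l ** P t = mtrunc n (\<lambda>t. F t ** U t) t" for t
    unfolding vec_eq_iff
  proof (intro allI)
    fix a b
    have "P (t + \<alpha>) $ a $ b * l b - l a * P t $ a $ b = trunc n (\<lambda>t. (F t ** U t) $ a $ b) t"
    proof (rule tp_eqI[where t = t and p = "\<lambda>t. P (t + \<alpha>) $ a $ b * l b - l a * P t $ a $ b" and n = n])
      note tpp = allentD[OF tpP, of a b]
      note cpp = allentD[OF cP, of a b]
      have eq: "P (t + \<alpha>) $ a $ b * l b = l b * P (t + \<alpha>) $ a $ b" for t by simp
      show "tp n (\<lambda>t. P (t + \<alpha>) $ a $ b * l b - l a * P t $ a $ b)"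
        unfolding eq by (intro tp_diff tp_cmult tp_shift[OF tpp] tpp)
      show "tp n (trunc n (\<lambda>t. (F t ** U t) $ a $ b))" by (rule tp_trunc)
      fix j :: int assume j: "\<bar>j\<bar> \<le> int n"
      have "fc (\<lambda>t. P (t + \<alpha>) $ a $ b * l b - l a * P t $ a $ b) j = chi j \<alpha> * fc (\<lambda>t. P t $ a $ b) j * l b - l a * fc (\<lambda>t. P t $ a $ b) j"
        by (subst fc_diff) (auto simp: fc_cmult fc_cmult2 fc_shift[OF cpp] intro!: cper_mult cper_shift[OF cpp] cpp)
      also have "fc (\<lambda>t. P t $ a $ b) j = fc (\<lambda>t. Y t $ a $ b) j"
        using j unfolding P_def mtrunc_entry_fun fc_trunc by simp
      also have "chi j \<alpha> * fc (\<lambda>t. Y t $ a $ b) j * l b - l a * fc (\<lambda>t. Y t $ a $ b) j = fc (\<lambda>t. Y t $ a $ b) j * divisor \<alpha> l a b j"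
        by (simp add: divisor_def algebra_simps)
      also have "\<dots> = fc (trunc n (\<lambda>t. (F t ** U t) $ a $ b)) j" using j by (simp add: coef fc_trunc)
      finally show "fc (\<lambda>t. P (t + \<alpha>) $ a $ b * l b - l a * P t $ a $ b) j = fc (trunc n (\<lambda>t. (F t ** U t) $ a $ b)) j" .
    qed
    then show "(P (t + \<alpha>) ** dg l - dg l ** P t) $ a $ b = mtrunc n (\<lambda>t. F t ** U t) t $ a $ b"
      by (simp add: dg_right dg_left mtrunc_entry)
  qed
  have Pnz: "det (mat 1 + P t) \<noteq> 0" for t by (rule small_perturbation_det[OF Pb4])
  define G where "G t = F t + F t ** P t - mtrunc n (\<lambda>t. F t ** U t) t" for t
  define F' where "F' t = inv2 (mat 1 + P (t + \<alpha>)) ** G t" for t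
  define Z' where "Z' t = inv2 (mat 1 + P t) ** Z t" for t
  have Z'eq: "(mat 1 + P t) ** Z' t = Z t" for t
    unfolding Z'_def matrix_mul_assoc inv2_right[OF Pnz] by simp
  have F'G: "F' t = G t - P (t + \<alpha>) ** F' t" for t
  proof -
    have "(mat 1 + P (t + \<alpha>)) ** F' t = G t" unfolding F'_def matrix_mul_assoc inv2_right[OF Pnz] by simp
    then have "F' t + P (t + \<alpha>) ** F' t = G t" by (simp add: mm_add_left)
    then show ?thesis by (metis add_diff_cancel_right')
  qed
  have sP: "allent sper P" by (rule allent_tp_sper[OF tpP])
  have s1P: "allent sper (\<lambda>t. mat 1 + P t)" by (rule allent_sper_add[OF allent_sper_const sP])
  have sFP: "allent sper (\<lambda>t. F t ** P t)" by (rule allent_sper_mult[OF sF sP])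
  have cFP: "allent cper (\<lambda>t. F t ** P t)" by (rule allent_sper_cper[OF sFP])
  have sG: "allent sper G"
    unfolding G_def by (rule allent_sper_diff[OF allent_sper_add[OF sF sFP] allent_tp_sper[OF allent_tp_mtrunc]])
  have sF': "allent sper F'"
    unfolding F'_def
    by (rule allent_sper_mult[OF allent_sper_inv2[OF allent_sper_shift[OF s1P]] sG]) (rule Pnz)
  have cG: "allent cper G" by (rule allent_sper_cper[OF sG])
  have cF': "allent cper F'" by (rule allent_sper_cper[OF sF'])
  have cZ': "allent cper Z'"
    unfolding Z'_def by (rule allent_cper_mult[OF allent_cper_inv2[OF allent_sper_cper[OF s1P] Pnz] cZ])
  have eqn: "Z' (t + \<alpha>) ** dg l = (dg l + F' t) ** Z' t" for t
  proof -
    let ?I = "inv2 (mat 1 + P (t + \<alpha>))"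
    have a: "(mat 1 + P (t + \<alpha>)) ** (dg l + F' t) = (dg l + F t) ** (mat 1 + P t)"
    proof -
      have "(mat 1 + P (t + \<alpha>)) ** (dg l + F' t) = dg l + P (t + \<alpha>) ** dg l + (F' t + P (t + \<alpha>) ** F' t)"
        by (simp add: mm_add_left matrix_add_ldistrib)
      also have "F' t + P (t + \<alpha>) ** F' t = G t" using F'G[of t] by (metis diff_add_cancel)
      also have "dg l + P (t + \<alpha>) ** dg l + G t = dg l + F t + F t ** P t + dg l ** P t"
        unfolding G_def LP[symmetric] by simp
      finally show ?thesis by (simp add: mm_add_left matrix_add_ldistrib)
    qed
    have "Z' (t + \<alpha>) ** dg l = ?I ** (Z (t + \<alpha>) ** dg l)" by (simp add: Z'_def matrix_mul_assoc)
    also have "\<dots> = ?I ** ((dg l + F t) ** ((mat 1 + P t) ** Z' t))" by (simp only: Zeq Z'eq)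
    also have "\<dots> = ?I ** (((dg l + F t) ** (mat 1 + P t)) ** Z' t)" by (simp only: matrix_mul_assoc)
    also have "\<dots> = (?I ** (mat 1 + P (t + \<alpha>))) ** (dg l + F' t) ** Z' t" by (simp only: a[symmetric] matrix_mul_assoc)
    also have "?I ** (mat 1 + P (t + \<alpha>)) = mat 1" by (rule inv2_left[OF Pnz])
    finally show ?thesis by simp
  qed
  have Z'b: "entbd (Z' t - mat 1) (\<eta> + 4 * p)" for t
  proof -
    have "entbd (Z t - mat 1) (1/4)" using Zb[of t] \<eta> unfolding entbd_def by (meson order_trans)
    then have 1: "entbd (Z' t - Z t) (4 * p)" by (rule small_perturbation_solve[OF Pb p4 _ Z'eq])
    show ?thesis unfolding entbd_def
    proof (intro allI)
      fix a b
      have "norm ((Z' t - Z t) $ a $ b) \<le> 4 * p" "norm ((Z t - mat 1) $ a $ b) \<le> \<eta>"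
        using 1 Zb[of t] unfolding entbd_def by blast+
      moreover have "(Z' t - mat 1) $ a $ b = (Z t - mat 1) $ a $ b + (Z' t - Z t) $ a $ b" by simp
      ultimately show "norm ((Z' t - mat 1) $ a $ b) \<le> \<eta> + 4 * p"
        using norm_triangle_ineq[of "(Z t - mat 1) $ a $ b" "(Z' t - Z t) $ a $ b"] by simp
    qed
  qed
  \<comment> \<open>the new error is a sum of products in which one factor has only high frequencies or another factor is \<open>O(p)\<close>\<close>
  define H where "H t = F t - mtrunc n F t" for t
  define F\<^sub>Y where "F\<^sub>Y t = F t ** (Y t - P t)" for t
  have cYP: "allent cper (\<lambda>t. Y t - P t)" by (rule allent_cper_diff[OF cY cP])
  have cFY: "allent cper F\<^sub>Y" unfolding F\<^sub>Y_def by (rule allent_cper_mult[OF cF cYP])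
  have cTF: "allent cper (mtrunc n F)" by (rule allent_tp_cper[OF allent_tp_mtrunc])
  have cH: "allent cper H" unfolding H_def by (rule allent_cper_diff[OF cF cTF])
  have Gdec: "G t = H t + (F t ** P t - mtrunc n (\<lambda>t. F t ** P t) t) - mtrunc n F\<^sub>Y t" for t
  proof -
    have "F t ** U t = F t + (F t ** P t + F\<^sub>Y t)" for t
      unfolding F\<^sub>Y_def Y_def mm_dist by simp
    then have "mtrunc n (\<lambda>t. F t ** U t) t = mtrunc n F t + (mtrunc n (\<lambda>t. F t ** P t) t + mtrunc n F\<^sub>Y t)"
      by (simp only: mtrunc_add[OF cF allent_cper_add[OF cFP cFY]] mtrunc_add[OF cFP cFY])
    then show ?thesis by (simp add: G_def H_def)
  qed
  have H0: "allent (\<lambda>f. Sob N 0 f (E / N / K ^ m)) H"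
    unfolding allent_def H_def vector_minus_component mtrunc_entry
    by (intro allI Sob_tail[OF N0 allentD[OF cF] allentD[OF Fm]] wtail) (use K in auto)
  have Hm: "allent (\<lambda>f. Sob N m f (E / N)) H"
    unfolding H_def by (rule allent_Sob_tail0[OF N0 cF Fm])
  have swap: "(\<lambda>t. A t $ a $ c * B t $ c $ b) = (\<lambda>t. B t $ c $ b * A t $ a $ c)" for A B :: "real \<Rightarrow> complex^2^2" and a b c
    by (simp add: mult.commute)
  have FP0: "allent (\<lambda>f. Sob N 0 f (2 * (p * (\<epsilon> / N)))) (\<lambda>t. F t ** P t)"
    by (rule allent_Sob_mult[OF N0 cF cP])
       (subst swap, rule Sob_tp_mult[OF N0 allentD[OF tpP] allentD[OF WP] allentD[OF cF] allentD[OF F0]])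
  have FPm: "allent (\<lambda>f. Sob N m f (2 * (2 ^ m * p * (E / N + wt N (int n) ^ m * (\<epsilon> / N))))) (\<lambda>t. F t ** P t)"
    by (rule allent_Sob_mult[OF N0 cF cP])
       (subst swap, rule Sob_tp_mult_tame[OF N0 allentD[OF tpP] allentD[OF WP] allentD[OF cF] allentD[OF Fm] allentD[OF F0]])
  have FTP0: "allent (\<lambda>f. Sob N 0 f (2 * (p * (\<epsilon> / N)))) (\<lambda>t. F t ** (T t - P t))"
    by (rule allent_Sob_mult[OF N0 cF allent_tp_cper[OF tpTP]])
       (subst swap, rule Sob_tp_mult[OF N0 allentD[OF tpTP] allentD[OF WTP] allentD[OF cF] allentD[OF F0]])
  have HY0: "allent (\<lambda>f. Sob N 0 f (2 * (1 * (E / N / K ^ m)))) (\<lambda>t. H t ** Y t)"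
    by (rule allent_Sob_mult[OF N0 cH cY]) (rule Sob_mult_sup[OF allentD[OF cH] allentD[OF cY] Yb allentD[OF H0]])
  have HT0: "allent (\<lambda>f. Sob N 0 f (2 * (p * (E / N / K ^ m)))) (\<lambda>t. H t ** T t)"
    by (rule allent_Sob_mult[OF N0 cH cT])
       (subst swap, rule Sob_tp_mult[OF N0 allentD[OF tpT] allentD[OF WT] allentD[OF cH] allentD[OF H0]])
  have cHY: "allent cper (\<lambda>t. H t ** Y t)" by (rule allent_cper_mult[OF cH cY])
  have cHT: "allent cper (\<lambda>t. H t ** T t)" by (rule allent_cper_mult[OF cH cT])
  have cFTP: "allent cper (\<lambda>t. F t ** (T t - P t))" by (rule allent_cper_mult[OF cF allent_tp_cper[OF tpTP]])
  \<comment> \<open>frequencies of \<open>Y\<close> beyond \<open>2 * n\<close> meet frequencies of \<open>F\<close> up to \<open>n\<close> only in products of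
    frequency above \<open>n\<close>, which the truncation removes\<close>
  have TFY: "mtrunc n F\<^sub>Y t = mtrunc n (\<lambda>t. F t ** (T t - P t) + (H t ** Y t - H t ** T t)) t" for t
  proof -
    define R where "R t = mtrunc n F t ** (Y t - T t)" for t
    have cYT: "allent cper (\<lambda>t. Y t - T t)" by (rule allent_cper_diff[OF cY cT])
    have cR: "allent cper R" unfolding R_def by (rule allent_cper_mult[OF cTF cYT])
    have "F\<^sub>Y t = (F t ** (T t - P t) + (H t ** Y t - H t ** T t)) + R t" for t
      unfolding F\<^sub>Y_def R_def H_def mm_dist by simp
    then have eqf: "F\<^sub>Y = (\<lambda>t. (F t ** (T t - P t) + (H t ** Y t - H t ** T t)) + R t)" by (rule ext)
    have "mtrunc n F\<^sub>Y t = mtrunc n (\<lambda>t. F t ** (T t - P t) + (H t ** Y t - H t ** T t)) t + mtrunc n R t"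
      unfolding eqf by (rule mtrunc_add[OF allent_cper_add[OF cFTP allent_cper_diff[OF cHY cHT]] cR])
    moreover have "mtrunc n R t = 0"
    proof -
      have "fc (\<lambda>t. R t $ a $ b) j = 0" if j: "\<bar>j\<bar> \<le> int n" for a b j
      proof -
        have z: "fc (\<lambda>t. mtrunc n F t $ a $ k * (Y t - T t) $ k $ b) j = 0" for k
        proof -
          have "fc (\<lambda>t. (Y t - T t) $ k $ b) i = 0" if "\<bar>i\<bar> \<le> int (2 * n)" for i
            unfolding vector_minus_component T_def mtrunc_entry
            by (subst fc_tail[OF allentD[OF cY]]) (use that in simp)
          then show ?thesis
            by (subst fc_tp_mult[OF allentD[OF allent_tp_mtrunc] allentD[OF cYT]]) (rule sum.neutral, use j in auto)
        qed
        have "fc (\<lambda>t. R t $ a $ b) j = fc (\<lambda>t. mtrunc n F t $ a $ 1 * (Y t - T t) $ 1 $ b) j + fc (\<lambda>t. mtrunc n F t $ a $ 2 * (Y t - T t) $ 2 $ b) j"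
          unfolding R_def mm_entry by (rule fc_add[OF cper_mult[OF allentD[OF cTF] allentD[OF cYT]] cper_mult[OF allentD[OF cTF] allentD[OF cYT]]])
        then show ?thesis by (simp only: z add_0)
      qed
      then have "trunc n (\<lambda>t. R t $ a $ b) t = 0" for a b unfolding trunc_def by (intro sum.neutral) auto
      then show ?thesis by (simp add: vec_eq_iff mtrunc_entry)
    qed
    ultimately show ?thesis by simp
  qed
  have TFY0: "allent (\<lambda>f. Sob N 0 f (2 * (p * (\<epsilon> / N)) + (2 * (1 * (E / N / K ^ m)) + 2 * (p * (E / N / K ^ m))))) (mtrunc n F\<^sub>Y)"
  proof -
    have "allent (\<lambda>f. Sob N 0 f (2 * (p * (\<epsilon> / N)) + (2 * (1 * (E / N / K ^ m)) + 2 * (p * (E / N / K ^ m)))))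
        (mtrunc n (\<lambda>t. F t ** (T t - P t) + (H t ** Y t - H t ** T t)))"
      by (rule allent_Sob_mtrunc[OF N0 allent_Sob_add[OF N0 cFTP allent_cper_diff[OF cHY cHT] FTP0 allent_Sob_diff[OF N0 cHY cHT HY0 HT0]]])
    moreover have "mtrunc n F\<^sub>Y = mtrunc n (\<lambda>t. F t ** (T t - P t) + (H t ** Y t - H t ** T t))"
      by (rule ext) (rule TFY)
    ultimately show ?thesis by simp
  qed
  have cFPt: "allent cper (\<lambda>t. F t ** P t - mtrunc n (\<lambda>t. F t ** P t) t)"
    by (rule allent_cper_diff[OF cFP allent_tp_cper[OF allent_tp_mtrunc]])
  have cTFY: "allent cper (mtrunc n F\<^sub>Y)" by (rule allent_tp_cper[OF allent_tp_mtrunc])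
  have "allent (\<lambda>f. Sob N 0 f (E / N / K ^ m + 2 * (p * (\<epsilon> / N)) + (2 * (p * (\<epsilon> / N)) + (2 * (1 * (E / N / K ^ m)) + 2 * (p * (E / N / K ^ m)))))) G"
    unfolding Gdec[abs_def]
    by (rule allent_Sob_diff[OF N0 allent_cper_add[OF cH cFPt] cTFY allent_Sob_add[OF N0 cH cFPt H0 allent_Sob_tail0[OF N0 cFP FP0]] TFY0])
  then have G0: "allent (\<lambda>f. Sob N 0 f (4 * (E / K ^ m + p * \<epsilon>) / N)) G"
  proof (rule allent_Sob_mono)
    have "p * (E / N / K ^ m) \<le> (1/4) * (E / N / K ^ m)" using p4 E0 N0 K by (intro mult_right_mono) auto
    moreover have "4 * (E / K ^ m + p * \<epsilon>) / N = 4 * (E / N / K ^ m) + 4 * (p * (\<epsilon> / N))"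
      by (simp add: add_divide_distrib distrib_left mult.commute)
    moreover have "E / N / K ^ m \<ge> 0" using E0 N0 K by simp
    ultimately show "E / N / K ^ m + 2 * (p * (\<epsilon> / N)) + (2 * (p * (\<epsilon> / N)) + (2 * (1 * (E / N / K ^ m)) + 2 * (p * (E / N / K ^ m)))) \<le> 4 * (E / K ^ m + p * \<epsilon>) / N"
      by linarith
  qed
  define g0 where "g0 = 4 * (E / K ^ m + p * \<epsilon>) / N"
  have g00: "g0 \<ge> 0" unfolding g0_def using E0 K p0 \<epsilon>0 N0 by simp
  have cPs: "allent cper (\<lambda>t. P (t + \<alpha>))" by (rule allent_cper_shift[OF cP])
  have tpPs: "allent (tp n) (\<lambda>t. P (t + \<alpha>))" by (rule allent_tp_shift[OF tpP])
  have WPs: "allent (\<lambda>f. Wie N 0 f p) (\<lambda>t. P (t + \<alpha>))"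
    unfolding allent_def
  proof (intro allI)
    fix a b
    show "Wie N 0 (\<lambda>t. P (t + \<alpha>) $ a $ b) p"
      using allentD[OF WP, of a b] fc_shift[OF allentD[OF cP, of a b]] unfolding Wie_def by (simp add: norm_mult)
  qed
  have cPF': "allent cper (\<lambda>t. P (t + \<alpha>) ** F' t)" by (rule allent_cper_mult[OF cPs cF'])
  \<comment> \<open>\<open>F'\<close> solves \<open>F' = G - P (t + \<alpha>) ** F'\<close> with small \<open>P\<close>, so its norms are controlled by those of \<open>G\<close>
    through absorption\<close>
  have F'0: "allent (\<lambda>f. Sob N 0 f (2 * g0)) F'"
  proof -
    obtain X where X: "allent (\<lambda>f. Sob N 0 f X) F'" using allent_Sob_exists[OF sF' N] by blast
    show ?thesis
    proof (rule allent_Sob_absorb[OF X _ g00])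
      fix X assume X: "allent (\<lambda>f. Sob N 0 f X) F'"
      have "allent (\<lambda>f. Sob N 0 f (2 * (p * X))) (\<lambda>t. P (t + \<alpha>) ** F' t)"
        by (rule allent_Sob_mult[OF N0 cPs cF']) (rule Sob_tp_mult[OF N0 allentD[OF tpPs] allentD[OF WPs] allentD[OF cF'] allentD[OF X]])
      then have "allent (\<lambda>f. Sob N 0 f (g0 + 2 * (p * X))) (\<lambda>t. G t - P (t + \<alpha>) ** F' t)"
        by (rule allent_Sob_diff[OF N0 cG cPF' G0[folded g0_def]])
      then have "allent (\<lambda>f. Sob N 0 f (g0 + 2 * (p * X))) F'" by (simp only: F'G[symmetric])
      then show "allent (\<lambda>f. Sob N 0 f (g0 + X / 2)) F'"
      proof (rule allent_Sob_mono)
        have "p * X \<le> (1/4) * X" using p4 Sob_nonneg[OF allentD[OF X]] by (intro mult_right_mono) auto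
        then show "g0 + 2 * (p * X) \<le> g0 + X / 2" by simp
      qed
    qed
  qed
  define w where "w = wt N (int n) ^ m"
  have w1: "w \<ge> 1" unfolding w_def by (rule wt_pow_ge_1[OF N0])
  have w2: "w \<le> 2 ^ m * K ^ m"
  proof -
    have "w \<le> (1 + K) ^ m" unfolding w_def using wn wt_ge_1[OF N0, of "int n"] by (intro power_mono) auto
    also have "\<dots> \<le> (2 * K) ^ m" using K by (intro power_mono) auto
    finally show ?thesis by (simp add: power_mult_distrib)
  qed
  have pm: "2 ^ m * p \<le> 1/4" using p(2) by (simp add: power_add)
  have TFYm: "allent (\<lambda>f. Sob N m f (w * (4 * (\<epsilon> / N)))) (mtrunc n F\<^sub>Y)"
  proof (rule allentI)
    fix a b
    have FY0: "allent (\<lambda>f. Sob N 0 f (2 * (1 * (\<epsilon> / N)))) (\<lambda>t. F t ** Y t)"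
      by (rule allent_Sob_mult[OF N0 cF cY]) (rule Sob_mult_sup[OF allentD[OF cF] allentD[OF cY] Yb allentD[OF F0]])
    have "allent (\<lambda>f. Sob N 0 f (2 * (1 * (\<epsilon> / N)) + 2 * (p * (\<epsilon> / N)))) F\<^sub>Y"
      unfolding F\<^sub>Y_def mm_diff_right by (rule allent_Sob_diff[OF N0 allent_cper_mult[OF cF cY] cFP FY0 FP0])
    then have "allent (\<lambda>f. Sob N 0 f (4 * (\<epsilon> / N))) F\<^sub>Y"
    proof (rule allent_Sob_mono)
      have "p * (\<epsilon> / N) \<le> 1 * (\<epsilon> / N)" using p4 \<epsilon>0 N0 by (intro mult_right_mono) auto
      then show "2 * (1 * (\<epsilon> / N)) + 2 * (p * (\<epsilon> / N)) \<le> 4 * (\<epsilon> / N)" by simp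
    qed
    then have "allent (\<lambda>f. Sob N 0 f (4 * (\<epsilon> / N))) (mtrunc n F\<^sub>Y)" by (rule allent_Sob_mtrunc[OF N0])
    then show "Sob N m (\<lambda>t. mtrunc n F\<^sub>Y t $ a $ b) (w * (4 * (\<epsilon> / N)))"
      unfolding w_def by (intro Sob_tp_order[OF N0 allentD[OF allent_tp_mtrunc]]) (rule allentD)
  qed
  define gm where "gm = (2 * E + 5 * w * \<epsilon>) / N"
  have "allent (\<lambda>f. Sob N m f (E / N + 2 * (2 ^ m * p * (E / N + w * (\<epsilon> / N))) + w * (4 * (\<epsilon> / N)))) G"
    unfolding Gdec[abs_def]
    by (rule allent_Sob_diff[OF N0 allent_cper_add[OF cH cFPt] cTFY allent_Sob_add[OF N0 cH cFPt Hm allent_Sob_tail0[OF N0 cFP FPm[folded w_def]]] TFYm])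
  then have Gm: "allent (\<lambda>f. Sob N m f gm) G"
  proof (rule allent_Sob_mono)
    define u v q where "u = E / N" and "v = w * (\<epsilon> / N)" and "q = 2 ^ m * p * (u + v)"
    have uv: "u \<ge> 0" "v \<ge> 0" using E0 N0 w1 \<epsilon>0 by (auto simp: u_def v_def)
    have "q \<le> (1/4) * (u + v)" unfolding q_def using pm uv by (intro mult_right_mono) auto
    moreover have "gm = 2 * u + 5 * v" by (simp add: gm_def u_def v_def add_divide_distrib)
    moreover have v4: "w * (4 * (\<epsilon> / N)) = 4 * v" by (simp add: v_def)
    ultimately have "u + 2 * q + 4 * v \<le> gm" using uv by argo
    then show "E / N + 2 * (2 ^ m * p * (E / N + w * (\<epsilon> / N))) + w * (4 * (\<epsilon> / N)) \<le> gm"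
      unfolding u_def[symmetric] v_def[symmetric] q_def[symmetric] v4 .
  qed
  have gm0: "gm \<ge> 0" unfolding gm_def using E0 w1 \<epsilon>0 N0 by simp
  have F'm: "allent (\<lambda>f. Sob N m f (2 * (gm + w * g0))) F'"
  proof -
    obtain X where X: "allent (\<lambda>f. Sob N m f X) F'" using allent_Sob_exists[OF sF' N] by blast
    have a0: "gm + w * g0 \<ge> 0" using gm0 w1 g00 by simp
    show ?thesis
    proof (rule allent_Sob_absorb[OF X _ a0])
      fix X assume X: "allent (\<lambda>f. Sob N m f X) F'"
      have "allent (\<lambda>f. Sob N m f (2 * (2 ^ m * p * (X + w * (2 * g0))))) (\<lambda>t. P (t + \<alpha>) ** F' t)"
        unfolding w_def by (rule allent_Sob_mult[OF N0 cPs cF'])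
          (rule Sob_tp_mult_tame[OF N0 allentD[OF tpPs] allentD[OF WPs] allentD[OF cF'] allentD[OF X] allentD[OF F'0]])
      then have "allent (\<lambda>f. Sob N m f (gm + 2 * (2 ^ m * p * (X + w * (2 * g0))))) (\<lambda>t. G t - P (t + \<alpha>) ** F' t)"
        by (rule allent_Sob_diff[OF N0 cG cPF' Gm])
      then have "allent (\<lambda>f. Sob N m f (gm + 2 * (2 ^ m * p * (X + w * (2 * g0))))) F'" by (simp only: F'G[symmetric])
      then show "allent (\<lambda>f. Sob N m f (gm + w * g0 + X / 2)) F'"
      proof (rule allent_Sob_mono)
        have "2 ^ m * p * (X + w * (2 * g0)) \<le> (1/4) * (X + w * (2 * g0))"
          using pm Sob_nonneg[OF allentD[OF X]] w1 g00 by (intro mult_right_mono) auto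
        then show "gm + 2 * (2 ^ m * p * (X + w * (2 * g0))) \<le> gm + w * g0 + X / 2" by simp
      qed
    qed
  qed
  have fin0: "allent (\<lambda>f. Sob N 0 f (8 * (E / K ^ m + p * \<epsilon>) / N)) F'"
    using F'0 by (simp add: g0_def)
  have finm: "allent (\<lambda>f. Sob N m f (20 * 2 ^ m * (E + K ^ m * \<epsilon>) / N)) F'"
    using F'm
  proof (rule allent_Sob_mono)
    have a: "w * (E / K ^ m) \<le> 2 ^ m * E"
    proof -
      have "w * (E / K ^ m) \<le> (2 ^ m * K ^ m) * (E / K ^ m)" using w2 E0 K by (intro mult_right_mono) auto
      then show ?thesis using K by simp
    qed
    have b: "w * \<epsilon> \<le> 2 ^ m * (K ^ m * \<epsilon>)" using mult_right_mono[OF w2 \<epsilon>0] by (simp add: mult.assoc)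
    have c: "w * (p * \<epsilon>) \<le> (1/4) * (2 ^ m * (K ^ m * \<epsilon>))"
    proof -
      have "w * (p * \<epsilon>) = p * (w * \<epsilon>)" by simp
      also have "\<dots> \<le> (1/4) * (2 ^ m * (K ^ m * \<epsilon>))" by (rule mult_mono[OF p4 b]) (use w1 \<epsilon>0 in simp_all)
      finally show ?thesis .
    qed
    have d: "E \<le> 2 ^ m * E" using E0 mult_right_mono[of 1 "2 ^ m" E] by simp
    have "2 * (gm + w * g0) = (4 * E + 10 * (w * \<epsilon>) + 8 * (w * (E / K ^ m)) + 8 * (w * (p * \<epsilon>))) / N"
      using N0 by (simp add: gm_def g0_def field_simps)
    also have "\<dots> \<le> (20 * 2 ^ m * (E + K ^ m * \<epsilon>)) / N"
    proof (rule divide_right_mono)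
      have "2 ^ m * (K ^ m * \<epsilon>) \<ge> 0" using K \<epsilon>0 by simp
      then have "4 * E + 10 * (w * \<epsilon>) + 8 * (w * (E / K ^ m)) + 8 * (w * (p * \<epsilon>)) \<le> 20 * (2 ^ m * E) + 20 * (2 ^ m * (K ^ m * \<epsilon>))"
        using a b c d E0 by argo
      then show "4 * E + 10 * (w * \<epsilon>) + 8 * (w * (E / K ^ m)) + 8 * (w * (p * \<epsilon>)) \<le> 20 * 2 ^ m * (E + K ^ m * \<epsilon>)"
        by (simp add: distrib_left mult.assoc)
    qed (use N0 in simp)
    finally show "2 * (gm + w * g0) \<le> 20 * 2 ^ m * (E + K ^ m * \<epsilon>) / N" .
  qed
  have nc': "near_const \<alpha> l N m F' Z' (\<eta> + 4 * p) (8 * (E / K ^ m + p * \<epsilon>) / N) (20 * 2 ^ m * (E + K ^ m * \<epsilon>) / N)"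
    unfolding near_const_def using sF' cZ' eqn Z'b fin0 finm by blast
  have small: "norm (fc (\<lambda>t. Z t $ a $ b) j) \<le> 2 * p" if j: "\<bar>j\<bar> \<le> int n" "j \<notin> res_set a b" for a b j
  proof -
    have "norm (fc (\<lambda>t. Y t $ a $ b) j) \<le> (\<Sum>j\<in>{-int (2 * n)..int (2 * n)}. norm (fc (\<lambda>t. Y t $ a $ b) j))"
      by (rule member_le_sum) (use j in auto)
    then have yp: "norm (fc (\<lambda>t. Y t $ a $ b) j) \<le> p" using Ysum[of a b] by linarith
    have "fc (\<lambda>t. Z t $ a $ b) j = fc (\<lambda>t. Y t $ a $ b) j * c b" using fcY[of a b j] j(2) cnz[of b] by simp
    then have "norm (fc (\<lambda>t. Z t $ a $ b) j) = norm (fc (\<lambda>t. Y t $ a $ b) j) * norm (c b)" by (simp only: norm_mult)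
    also have "\<dots> \<le> p * (5/4)" by (rule mult_mono[OF yp cu p0]) simp
    finally have "norm (fc (\<lambda>t. Z t $ a $ b) j) \<le> p * (5/4)" .
    then show ?thesis using p0 by linarith
  qed
  have bounded: "norm (fc (\<lambda>t. Z t $ a $ b) j) \<le> 2" for a b j
  proof (rule fc_bound[OF allentD[OF cZ]])
    fix t
    have "norm (if a = b then 1 else 0 :: complex) \<le> 1" by simp
    then show "norm (Z t $ a $ b) \<le> 2"
      using Zb1[of t a b] norm_triangle_ineq[of "Z t $ a $ b - (if a = b then 1 else 0)" "if a = b then 1 else 0"]
      unfolding diff_add_cancel by linarith
  qed
  show thesis by (rule that[OF tpP WP Z'eq nc' small bounded])
qed

section \<open>Convergence of the iteration\<close>

text \<open>In the convolution for \<open>W ** Z\<close> the mean of the diagonal of \<open>Z\<close> contributes a coefficient of \<open>W\<close> itself, which has the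
  asserted decay. The other coefficients of \<open>Z\<close> up to \<open>n\<close> are tiny, and beyond \<open>n\<close> either the
  coefficient of \<open>W\<close> has a large frequency or the fixed frequency \<open>j\<close> does.\<close>

lemma coefficient_limit:
  fixes B :: "real \<Rightarrow> complex^2^2"
  assumes N: "N > 0" and r: "r \<ge> 1"
    and ap: "\<And>i::nat. \<exists>W Z d n. allent (tp d) W \<and> allent (\<lambda>f. Wie N r f M) W \<and> allent cper Z \<and> (\<forall>t. W t ** Z t = B t) \<and>
      (\<forall>a b j. norm (fc (\<lambda>t. Z t $ a $ b) j) \<le> 2) \<and>
      (\<forall>a b j. \<bar>j\<bar> \<le> int n \<longrightarrow> j \<notin> res_set a b \<longrightarrow> norm (fc (\<lambda>t. Z t $ a $ b) j) \<le> (1/2) ^ i) \<and>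
      (\<forall>j. \<bar>j\<bar> > int n \<longrightarrow> wt N j \<ge> 2 ^ i)"
  shows "norm (fc (\<lambda>t. B t $ a $ b) j) * wt N j ^ r \<le> 4 * M"
proof -
  define w where "w = wt N j ^ r"
  have w1: "w \<ge> 1" unfolding w_def by (rule wt_pow_ge_1[OF N])
  have main: "norm (fc (\<lambda>t. B t $ a $ b) j) \<le> 4 * M / w + (2 * M * (1 + 2 * w)) * (1/2) ^ i" for i :: nat
  proof -
    obtain W Z d n where tpW: "allent (tp d) W" and WW: "allent (\<lambda>f. Wie N r f M) W" and cZ: "allent cper Z"
      and WZ: "\<And>t. W t ** Z t = B t"
      and Z2: "\<And>a b j. norm (fc (\<lambda>t. Z t $ a $ b) j) \<le> 2"
      and Zs: "\<And>a b j. \<bar>j\<bar> \<le> int n \<Longrightarrow> j \<notin> res_set a b \<Longrightarrow> norm (fc (\<lambda>t. Z t $ a $ b) j) \<le> (1/2) ^ i"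
      and wt2: "\<And>j. \<bar>j\<bar> > int n \<Longrightarrow> wt N j \<ge> 2 ^ i"
      using ap[of i] by blast
    let ?I = "{-int d..int d}"
    have M0: "M \<ge> 0" by (rule Wie_nonneg[OF allentD[OF WW]])
    have prodbd: "norm (fc (\<lambda>t. W t $ a $ c * Z t $ c $ b) j) \<le> 2 * M / w + (M * (1 + 2 * w)) * (1/2) ^ i" for c
    proof -
      define u where "u k = norm (fc (\<lambda>t. W t $ a $ c) k)" for k
      define v where "v k = norm (fc (\<lambda>t. Z t $ c $ b) k)" for k
      have u0: "u k \<ge> 0" for k by (simp add: u_def)
      have usum: "(\<Sum>k\<in>J. wt N k ^ r * u k) \<le> M" if "finite J" for J
        unfolding u_def by (rule WieD[OF allentD[OF WW] that])
      have uk: "u k * v (j - k) \<le> (if k = j then 2 * u j else 0) + (wt N k ^ r * u k) * ((1 + 2 * w) * (1/2) ^ i)" for k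
      proof (cases "k = j")
        case True
        have "u k * v (j - k) \<le> u j * 2" unfolding True by (intro mult_left_mono u0) (simp add: v_def Z2)
        moreover have "0 \<le> (wt N k ^ r * u k) * ((1 + 2 * w) * (1/2) ^ i)"
          using u0 wt_pow_nonneg[OF N] w1 by (intro mult_nonneg_nonneg) auto
        ultimately show ?thesis using True by simp
      next
        case False
        then have nr: "j - k \<notin> res_set c b" by (auto simp: res_set_def)
        have "v (j - k) \<le> wt N k ^ r * ((1 + 2 * w) * (1/2) ^ i)"
        proof (cases "\<bar>j - k\<bar> \<le> int n")
          case True
          have "v (j - k) \<le> 1 * (1 * (1/2) ^ i)" unfolding v_def using Zs[OF True nr] by simp
          also have "\<dots> \<le> wt N k ^ r * ((1 + 2 * w) * (1/2) ^ i)"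
            using wt_pow_ge_1[OF N] wt_pow_nonneg[OF N] w1 by (intro mult_mono) auto
          finally show ?thesis .
        next
          case far: False
          have "2 ^ i \<le> wt N (j - k)" using far by (intro wt2) simp
          also have "\<dots> \<le> wt N (j - k) ^ r" using r wt_ge_1[OF N] by (intro self_le_power) auto
          also have "\<dots> \<le> wt N (j - k - j) ^ r * w" unfolding w_def by (rule wt_pow_mult[OF N])
          also have "wt N (j - k - j) = wt N k" by (simp add: wt_def)
          finally have "1 \<le> (wt N k ^ r * w) * (1/2) ^ i" by (simp add: power_divide le_divide_eq)
          then have "v (j - k) \<le> 2 * ((wt N k ^ r * w) * (1/2) ^ i)" using Z2[of c b "j - k"] unfolding v_def by linarith
          also have "\<dots> = wt N k ^ r * ((2 * w) * (1/2) ^ i)" by simp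
          also have "\<dots> \<le> wt N k ^ r * ((1 + 2 * w) * (1/2) ^ i)"
            using wt_pow_nonneg[OF N] by (intro mult_left_mono mult_right_mono) auto
          finally show ?thesis .
        qed
        from mult_left_mono[OF this u0[of k]] False show ?thesis by (simp add: mult_ac)
      qed
      have "norm (fc (\<lambda>t. W t $ a $ c * Z t $ c $ b) j) \<le> (\<Sum>k\<in>?I. u k * v (j - k))"
        unfolding fc_tp_mult[OF allentD[OF tpW] allentD[OF cZ]] u_def v_def norm_mult[symmetric] by (rule norm_sum)
      also have "\<dots> \<le> (\<Sum>k\<in>?I. (if k = j then 2 * u j else 0) + (wt N k ^ r * u k) * ((1 + 2 * w) * (1/2) ^ i))"
        by (intro sum_mono uk)
      also have "\<dots> = (\<Sum>k\<in>?I. if k = j then 2 * u j else 0) + (\<Sum>k\<in>?I. wt N k ^ r * u k) * ((1 + 2 * w) * (1/2) ^ i)"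
        unfolding sum.distrib sum_distrib_right ..
      also have "\<dots> \<le> 2 * M / w + M * ((1 + 2 * w) * (1/2) ^ i)"
      proof (rule add_mono)
        have "w * u j \<le> M" using usum[of "{j}"] by (simp add: w_def)
        then have "2 * u j \<le> 2 * M / w" using w1 by (simp add: field_simps)
        moreover have "(\<Sum>k\<in>?I. if k = j then 2 * u j else 0) \<le> 2 * u j" using u0[of j] by (simp add: sum.delta)
        ultimately show "(\<Sum>k\<in>?I. if k = j then 2 * u j else 0) \<le> 2 * M / w" by linarith
        show "(\<Sum>k\<in>?I. wt N k ^ r * u k) * ((1 + 2 * w) * (1/2) ^ i) \<le> M * ((1 + 2 * w) * (1/2) ^ i)"
          using w1 by (intro mult_right_mono usum) auto
      qed
      finally show ?thesis by (simp add: mult.assoc)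
    qed
    note cW = allentD[OF allent_tp_cper[OF tpW]]
    have "fc (\<lambda>t. B t $ a $ b) j = fc (\<lambda>t. W t $ a $ 1 * Z t $ 1 $ b) j + fc (\<lambda>t. W t $ a $ 2 * Z t $ 2 $ b) j"
      unfolding WZ[symmetric] mm_entry by (rule fc_add[OF cper_mult[OF cW allentD[OF cZ]] cper_mult[OF cW allentD[OF cZ]]])
    then have "norm (fc (\<lambda>t. B t $ a $ b) j) \<le> (2 * M / w + (M * (1 + 2 * w)) * (1/2) ^ i) + (2 * M / w + (M * (1 + 2 * w)) * (1/2) ^ i)"
      by (simp only:) (rule order_trans[OF norm_triangle_ineq add_mono[OF prodbd prodbd]])
    then show ?thesis by simp
  qed
  have "norm (fc (\<lambda>t. B t $ a $ b) j) \<le> 4 * M / w + 0"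
  proof (rule LIMSEQ_le_const)
    have "(\<lambda>i. (2 * M * (1 + 2 * w)) * (1/2) ^ i) \<longlonglongrightarrow> (2 * M * (1 + 2 * w)) * 0"
      by (intro tendsto_mult tendsto_const LIMSEQ_power_zero) simp
    then show "(\<lambda>i. 4 * M / w + (2 * M * (1 + 2 * w)) * (1/2) ^ i) \<longlonglongrightarrow> 4 * M / w + 0"
      by (intro tendsto_add tendsto_const) simp
    show "\<exists>n0. \<forall>i\<ge>n0. norm (fc (\<lambda>t. B t $ a $ b) j) \<le> 4 * M / w + (2 * M * (1 + 2 * w)) * (1/2) ^ i"
      using main by blast
  qed
  then show ?thesis using w1 unfolding w_def[symmetric] by (simp add: field_simps)
qed

lemma allent_Wie_exists:
  assumes "allent (tp d) W" and N: "N > 0"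
  shows "\<exists>M\<ge>0. allent (\<lambda>f. Wie N r f M) W"
proof -
  have ex: "\<exists>C\<ge>0. Wie N r (\<lambda>t. W t $ a $ b) C" for a b
  proof -
    have t: "tp d (\<lambda>t. W t $ a $ b)" using assms(1) by (rule allentD)
    have "Wie N 0 (trunc d (\<lambda>t. W t $ a $ b)) (\<Sum>j\<in>{-int d..int d}. norm (fc (\<lambda>t. W t $ a $ b) j))"
      by (rule Wie_0_trunc[where k = d]) simp_all
    then have "Wie N 0 (\<lambda>t. W t $ a $ b) (\<Sum>j\<in>{-int d..int d}. norm (fc (\<lambda>t. W t $ a $ b) j))"
      unfolding tp_eq_trunc[OF t] .
    from Wie_tp_order[OF N t this, of r] show ?thesis using Wie_nonneg by blast
  qed
  define Q where "Q a b C \<longleftrightarrow> Wie N r (\<lambda>t. W t $ a $ b) C" for a b C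
  have mono: "Q a b D" if "Q a b C" "C \<le> D" for a b C D
    using that unfolding Q_def by (rule Wie_mono)
  obtain C where C: "C \<ge> 0" "\<And>a b. Q a b C"
    using uniform_ent[of Q] ex[folded Q_def] mono by metis
  then have "\<And>a b. Wie N r (\<lambda>t. W t $ a $ b) C" unfolding Q_def by blast
  with C(1) show ?thesis unfolding allent_def by blast
qed

lemma allent_Wie_step:
  assumes N: "N > 0" and W: "allent (tp d) W" "allent (\<lambda>f. Wie N r f M) W"
    and P: "allent (tp n) P" "allent (\<lambda>f. Wie N r f q) P"
  shows "allent (\<lambda>f. Wie N r f (M + 2 * (M * q))) (\<lambda>t. W t ** (mat 1 + P t))"
proof (rule allentI)
  fix a b
  note cW = allentD[OF allent_tp_cper[OF W(1)]] and cP = allentD[OF allent_tp_cper[OF P(1)]]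
  have pr: "Wie N r (\<lambda>t. W t $ a $ c * P t $ c $ b) (M * q)" for c
    by (rule Wie_mult[OF N allentD[OF W(1)] allentD[OF W(2)] cP allentD[OF P(2)]])
  have "Wie N r (\<lambda>t. W t $ a $ b + (W t $ a $ 1 * P t $ 1 $ b + W t $ a $ 2 * P t $ 2 $ b)) (M + (M * q + M * q))"
    by (rule Wie_add[OF N cW cper_add[OF cper_mult[OF cW cP] cper_mult[OF cW cP]] allentD[OF W(2)]
          Wie_add[OF N cper_mult[OF cW cP] cper_mult[OF cW cP] pr pr]])
  moreover have "(W t ** (mat 1 + P t)) $ a $ b = W t $ a $ b + (W t $ a $ 1 * P t $ 1 $ b + W t $ a $ 2 * P t $ 2 $ b)" for t
    unfolding matrix_add_ldistrib by (simp add: mm_entry[of "W t" "P t"])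
  ultimately show "Wie N r (\<lambda>t. (W t ** (mat 1 + P t)) $ a $ b) (M + 2 * (M * q))" by simp
qed

text \<open>With \<open>K i = exp (x i)\<close>, \<open>x (Suc i) = 3/2 * x i\<close>, the bounds \<open>\<epsilon> i = exp (- a * x i)\<close> and
  \<open>E i = exp (b * x i)\<close> reproduce themselves under \<open>kam_step\<close>. The conditions on the exponents are
  \<open>2 * a - s > 3/2 * a\<close> for the quadratic term, \<open>m - b > 3/2 * a\<close> for the high frequencies,
  and \<open>b\<close>, \<open>m - a < 3/2 * b\<close> for the high norm. The choice of \<open>a\<close> leaves room for the weight
  \<open>K ^ r\<close>: the Wiener norms of order \<open>r\<close> of the factors are summable, so the product of the
  factors \<open>mat 1 + P\<close> stays bounded in that norm. All constants depend on \<open>\<Lambda>\<close>, \<open>s\<close> and \<open>r\<close> only,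
  which is what makes the threshold \<open>e0\<close> independent of the scale.\<close>

lemma iteration:
  fixes \<Lambda> :: real and s r :: nat
  assumes \<Lambda>: "\<Lambda> > 0" and r: "r \<ge> 1"
  shows "\<exists>e0 m. 0 < e0 \<and> e0 \<le> 1/8 \<and> (\<forall>N \<alpha> l W F Z B d. N \<ge> 1 \<longrightarrow> div_ok \<alpha> l N \<Lambda> s \<longrightarrow> allent (tp d) W \<longrightarrow>
    (\<forall>t. W t ** Z t = B t) \<longrightarrow> near_const \<alpha> l N m F Z e0 (e0 / N) (e0 / N) \<longrightarrow>
    (\<exists>C. \<forall>a b j. norm (fc (\<lambda>t. B t $ a $ b) j) * wt N j ^ r \<le> C))"
proof -
  define a where "a = 2 * (s + 1 + r)"
  define m where "m = 3 * a + 5"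
  define b :: real where "b = 3/2 * real a + 4"
  have ar: "real a = 2 * (real s + 1 + real r)" "real m = 3 * real a + 5"
    "real s \<ge> 0" "real r \<ge> 0" "real a \<ge> 0" by (simp_all add: a_def m_def)
  define c0 where "c0 = 4 * \<Lambda> * 2 ^ s"
  define Cs where "Cs = 64 * 2 ^ r * c0 * 2 ^ (m + 2) + (8 + 8 * c0) + 40 * 2 ^ m"
  have c0: "c0 > 0" using \<Lambda> by (simp add: c0_def)
  have Cs1: "64 * 2 ^ r * c0 * 2 ^ (m + 2) \<le> Cs" "8 + 8 * c0 \<le> Cs" "40 * 2 ^ m \<le> Cs" "Cs \<ge> 1"
    using c0 one_le_power[of "2::real" m] by (auto simp: Cs_def)
  \<comment> \<open>large enough that \<open>exp (- x0)\<close> absorbs every constant that occurs in a step\<close>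
  define x0 where "x0 = max 2 (ln Cs)"
  have x0: "x0 \<ge> 2" "Cs * exp (- x0) \<le> 1"
  proof -
    have "exp (ln Cs) \<le> exp x0" by (simp add: x0_def)
    then have "Cs \<le> exp x0" using Cs1(4) by simp
    then show "Cs * exp (- x0) \<le> 1" by (simp add: exp_minus field_simps)
  qed (simp add: x0_def)
  define x where "x i = x0 * (3/2) ^ i" for i :: nat
  have xS: "x (Suc i) = 3/2 * x i" for i by (simp add: x_def)
  have xlow: "x i \<ge> x0 + real i" for i
  proof (induction i)
    case (Suc i)
    then show ?case using x0(1) by (simp add: xS)
  qed (simp add: x_def)
  have x2: "x i \<ge> 2" for i using xlow[of i] x0(1) by simp
  have ehalf: "exp (- real i) \<le> (1/2) ^ i" for i
  proof -
    have "exp (- real i) = exp (-1) ^ i" by (simp add: exp_of_nat_mult[symmetric])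
    also have "\<dots> \<le> (1/2) ^ i"
    proof (rule power_mono)
      show "exp (-1::real) \<le> 1/2" using exp_ge_add_one_self[of 1] by (simp add: exp_minus field_simps)
    qed simp
    finally show ?thesis .
  qed
  have small: "Cs * exp (- x i) \<le> (1/2) ^ i" for i
  proof -
    have "Cs * exp (- x i) \<le> Cs * (exp (- x0) * exp (- real i))"
      using xlow[of i] Cs1(4) by (intro mult_left_mono) (auto simp: exp_add[symmetric])
    also have "\<dots> = (Cs * exp (- x0)) * exp (- real i)" by simp
    also have "\<dots> \<le> 1 * (1/2) ^ i" using x0(2) ehalf by (intro mult_mono) auto
    finally show ?thesis by simp
  qed
  have small1: "Cs * exp (- x i) \<le> 1" for i using small[of i] power_le_one[of "1/2::real" i] by linarith
  define K where "K i = exp (x i)" for i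
  define p where "p i = 4 * \<Lambda> * (2 * K i) ^ s * exp (- real a * x i)" for i
  have Kp: "K i ^ k = exp (real k * x i)" for i k by (simp add: K_def exp_of_nat_mult[symmetric])
  have K1: "K i \<ge> 1" for i using x2[of i] by (simp add: K_def)
  have pe: "p i = c0 * exp ((real s - real a) * x i)" for i
    unfolding p_def power_mult_distrib Kp c0_def by (simp add: exp_add[symmetric] algebra_simps)
  have pr: "2 ^ r * K i ^ r * p i \<le> 2 ^ r * c0 * exp (- x i)" for i
  proof -
    have "(real r + real s - real a) * x i \<le> (-1) * x i" using x2[of i] ar by (intro mult_right_mono) argo+
    then have "exp ((real r + real s - real a) * x i) \<le> exp (- x i)" by simp
    moreover have "2 ^ r * K i ^ r * p i = 2 ^ r * c0 * exp ((real r + real s - real a) * x i)"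
      unfolding pe Kp by (simp add: exp_add[symmetric] algebra_simps)
    ultimately show ?thesis using c0 by (simp add: mult_left_mono)
  qed
  have p0: "p i \<ge> 0" for i unfolding pe using c0 by simp
  have pq: "64 * 2 ^ (m + 2) * (2 ^ r * K i ^ r * p i) \<le> (1/2) ^ i" for i
  proof -
    have "64 * 2 ^ (m + 2) * (2 ^ r * K i ^ r * p i) \<le> 64 * 2 ^ (m + 2) * (2 ^ r * c0 * exp (- x i))"
      by (intro mult_left_mono pr) auto
    also have "\<dots> = (64 * 2 ^ r * c0 * 2 ^ (m + 2)) * exp (- x i)" by simp
    also have "\<dots> \<le> Cs * exp (- x i)" by (intro mult_right_mono Cs1) auto
    also have "\<dots> \<le> (1/2) ^ i" by (rule small)
    finally show ?thesis .
  qed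
  define q where "q i = 2 ^ r * K i ^ r * p i" for i
  have q0: "q i \<ge> 0" for i unfolding q_def using p0 K1[of i] by (intro mult_nonneg_nonneg) auto
  have qs: "64 * q i \<le> (1/2) ^ i" for i
  proof -
    have "1 * (64 * q i) \<le> 2 ^ (m + 2) * (64 * q i)"
      using q0[of i] by (intro mult_right_mono one_le_power) auto
    then have "64 * q i \<le> 64 * 2 ^ (m + 2) * q i" by (simp only: mult_ac mult_1)
    also have "\<dots> \<le> (1/2) ^ i" by (rule pq[folded q_def])
    finally show ?thesis .
  qed
  have pleq: "p i \<le> q i" for i
  proof -
    have "1 * 1 \<le> 2 ^ r * K i ^ r" by (intro mult_mono one_le_power) (use K1[of i] in auto)
    from mult_right_mono[OF this p0[of i]] show ?thesis by (simp add: q_def)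
  qed
  have pm: "2 ^ (m + 2) * p i \<le> 1" for i
  proof -
    have "2 ^ (m + 2) * p i \<le> 64 * 2 ^ (m + 2) * q i" using pleq[of i] q0[of i] p0[of i] by (intro mult_mono) auto
    also have "\<dots> \<le> (1/2) ^ i" by (rule pq[folded q_def])
    also have "\<dots> \<le> 1" by (simp add: power_le_one)
    finally show ?thesis .
  qed
  define \<epsilon> where "\<epsilon> i = exp (- real a * x i)" for i
  define E where "E i = exp (b * x i)" for i
  have eps_step: "8 * (E i / K i ^ m + p i * \<epsilon> i) \<le> \<epsilon> (Suc i)" for i
  proof -
    have 1: "E i / K i ^ m = \<epsilon> (Suc i) * exp (- x i)"
      unfolding E_def \<epsilon>_def Kp xS by (simp add: exp_diff[symmetric] exp_add[symmetric] b_def m_def algebra_simps)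
    have 2: "p i * \<epsilon> i \<le> c0 * (\<epsilon> (Suc i) * exp (- x i))"
    proof -
      have "(real s - 2 * real a) * x i \<le> (- (3/2) * real a - 1) * x i" using x2[of i] ar by (intro mult_right_mono) argo+
      then have "exp ((real s - 2 * real a) * x i) \<le> exp ((- (3/2) * real a - 1) * x i)" by simp
      moreover have "p i * \<epsilon> i = c0 * exp ((real s - 2 * real a) * x i)"
        unfolding pe \<epsilon>_def by (simp add: exp_add[symmetric] algebra_simps)
      moreover have "\<epsilon> (Suc i) * exp (- x i) = exp ((- (3/2) * real a - 1) * x i)"
        unfolding \<epsilon>_def xS by (simp add: exp_add[symmetric] algebra_simps)
      ultimately show ?thesis using c0 by (simp add: mult_left_mono)
    qed
    have "8 * (E i / K i ^ m + p i * \<epsilon> i) \<le> 8 * (\<epsilon> (Suc i) * exp (- x i) + c0 * (\<epsilon> (Suc i) * exp (- x i)))"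
      using 1 2 by simp
    also have "\<dots> = \<epsilon> (Suc i) * ((8 + 8 * c0) * exp (- x i))" by (simp add: algebra_simps)
    also have "\<dots> \<le> \<epsilon> (Suc i) * 1"
    proof (rule mult_left_mono)
      have "(8 + 8 * c0) * exp (- x i) \<le> Cs * exp (- x i)" by (intro mult_right_mono Cs1) auto
      then show "(8 + 8 * c0) * exp (- x i) \<le> 1" using small1[of i] by linarith
    qed (simp add: \<epsilon>_def)
    finally show ?thesis by simp
  qed
  have E_step: "20 * 2 ^ m * (E i + K i ^ m * \<epsilon> i) \<le> E (Suc i)" for i
  proof -
    have "b * x i \<le> (3/2 * b - 1) * x i" using x2[of i] ar b_def by (intro mult_right_mono) argo+
    then have 1: "E i \<le> exp ((3/2 * b - 1) * x i)" by (simp add: E_def)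
    have "(real m - real a) * x i \<le> (3/2 * b - 1) * x i" using x2[of i] ar b_def by (intro mult_right_mono) argo+
    then have "exp ((real m - real a) * x i) \<le> exp ((3/2 * b - 1) * x i)" by simp
    moreover have "K i ^ m * \<epsilon> i = exp ((real m - real a) * x i)" unfolding Kp \<epsilon>_def by (simp add: exp_add[symmetric] algebra_simps)
    ultimately have 2: "K i ^ m * \<epsilon> i \<le> exp ((3/2 * b - 1) * x i)" by simp
    have "20 * 2 ^ m * (E i + K i ^ m * \<epsilon> i) \<le> 20 * 2 ^ m * (exp ((3/2 * b - 1) * x i) + exp ((3/2 * b - 1) * x i))"
      using 1 2 by (intro mult_left_mono add_mono) auto
    also have "\<dots> = E (Suc i) * ((40 * 2 ^ m) * exp (- x i))"
    proof -
      have "exp ((3/2 * b - 1) * x i) = E (Suc i) * exp (- x i)"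
        unfolding E_def xS by (simp add: exp_add[symmetric] algebra_simps)
      then show ?thesis by (simp only:) simp
    qed
    also have "\<dots> \<le> E (Suc i) * 1"
    proof (rule mult_left_mono)
      have "(40 * 2 ^ m) * exp (- x i) \<le> Cs * exp (- x i)" by (intro mult_right_mono Cs1) auto
      then show "(40 * 2 ^ m) * exp (- x i) \<le> 1" using small1[of i] by linarith
    qed (simp add: E_def)
    finally show ?thesis by simp
  qed
  define e0 where "e0 = min (1/8) (\<epsilon> 0)"
  have e0: "0 < e0" "e0 \<le> 1/8" "e0 \<le> \<epsilon> 0" "e0 \<le> E 0"
  proof -
    have "b * x 0 \<ge> 0" using x2[of 0] by (simp add: b_def)
    then have "1 \<le> E 0" by (simp add: E_def)
    then show "e0 \<le> E 0" by (simp add: e0_def)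
  qed (auto simp: e0_def \<epsilon>_def)
  have near_mono: "near_const \<alpha> l N m F Z \<eta>' \<epsilon>' E'"
    if "near_const \<alpha> l N m F Z \<eta> \<epsilon> E" "\<eta> \<le> \<eta>'" "\<epsilon> \<le> \<epsilon>'" "E \<le> E'" for \<alpha> l N F Z \<eta> \<epsilon> E \<eta>' \<epsilon>' E'
  proof -
    have f: "allent sper F" "allent cper Z" "\<forall>t. Z (t + \<alpha>) ** dg l = (dg l + F t) ** Z t"
      "\<forall>t. entbd (Z t - mat 1) \<eta>" "allent (\<lambda>f. Sob N 0 f \<epsilon>) F" "allent (\<lambda>f. Sob N m f E) F"
      using that(1) unfolding near_const_def by blast+
    have "\<forall>t. entbd (Z t - mat 1) \<eta>'"
      using f(4) that(2) unfolding entbd_def by (meson order_trans)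
    then show ?thesis
      unfolding near_const_def
      using f(1-3) allent_Sob_mono[OF f(5) that(3)] allent_Sob_mono[OF f(6) that(4)] by blast
  qed
  have "\<exists>C. \<forall>a b j. norm (fc (\<lambda>t. B t $ a $ b) j) * wt N j ^ r \<le> C"
    if N: "N \<ge> 1" and dv: "div_ok \<alpha> l N \<Lambda> s" and tpW: "allent (tp d) W" and WZ: "\<forall>t. W t ** Z t = B t"
      and nc: "near_const \<alpha> l N m F Z e0 (e0 / N) (e0 / N)" for N \<alpha> l W F Z B d
  proof -
    have N0: "N > 0" using N by simp
    obtain M0 where M0: "M0 \<ge> 0" "allent (\<lambda>f. Wie N r f M0) W" using allent_Wie_exists[OF tpW N0] by blast
    define Mi where "Mi i = M0 * (2 - (1/2) ^ i)" for i :: nat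
    define \<eta> where "\<eta> i = (1/4 :: real) - (1/8) * (1/2) ^ i" for i :: nat
    define Inv where "Inv i W F Z \<longleftrightarrow> (\<exists>d. allent (tp d) W) \<and> allent (\<lambda>f. Wie N r f (Mi i)) W \<and>
        (\<forall>t. W t ** Z t = B t) \<and> near_const \<alpha> l N m F Z (\<eta> i) (\<epsilon> i / N) (E i / N)" for i W F Z
    have start: "Inv 0 W F Z"
      unfolding Inv_def
    proof (intro conjI)
      show "\<exists>d. allent (tp d) W" using tpW by blast
      show "allent (\<lambda>f. Wie N r f (Mi 0)) W" using M0(2) by (simp add: Mi_def)
      show "near_const \<alpha> l N m F Z (\<eta> 0) (\<epsilon> 0 / N) (E 0 / N)"
        by (rule near_mono[OF nc]) (use e0 N0 in \<open>auto simp: \<eta>_def intro!: divide_right_mono\<close>)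
    qed (rule WZ)
    have step: "(\<exists>W' F' Z'. Inv (Suc i) W' F' Z') \<and>
       (\<forall>a b j. norm (fc (\<lambda>t. Z t $ a $ b) j) \<le> 2) \<and>
       (\<forall>a b j. \<bar>j\<bar> \<le> int (nat \<lfloor>K i * N\<rfloor>) \<longrightarrow> j \<notin> res_set a b \<longrightarrow> norm (fc (\<lambda>t. Z t $ a $ b) j) \<le> (1/2) ^ i)"
      if inv: "Inv i W F Z" for i W F Z
    proof -
      obtain d where tpW: "allent (tp d) W" using inv unfolding Inv_def by blast
      have WW: "allent (\<lambda>f. Wie N r f (Mi i)) W" and WZ: "\<And>t. W t ** Z t = B t"
        and nc: "near_const \<alpha> l N m F Z (\<eta> i) (\<epsilon> i / N) (E i / N)"
        using inv unfolding Inv_def by blast+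
      have \<eta>4: "\<eta> i \<le> 1/4" by (simp add: \<eta>_def)
      have pdef: "p i = 4 * \<Lambda> * (2 * K i) ^ s * \<epsilon> i" by (simp add: p_def \<epsilon>_def)
      obtain P F' Z' where tpP: "allent (tp (nat \<lfloor>K i * N\<rfloor>)) P" and WP: "allent (\<lambda>f. Wie N 0 f (p i)) P"
        and Z': "\<And>t. (mat 1 + P t) ** Z' t = Z t"
        and nc': "near_const \<alpha> l N m F' Z' (\<eta> i + 4 * p i) (8 * (E i / K i ^ m + p i * \<epsilon> i) / N) (20 * 2 ^ m * (E i + K i ^ m * \<epsilon> i) / N)"
        and Zs: "\<And>a b j. \<bar>j\<bar> \<le> int (nat \<lfloor>K i * N\<rfloor>) \<Longrightarrow> j \<notin> res_set a b \<Longrightarrow> norm (fc (\<lambda>t. Z t $ a $ b) j) \<le> 2 * p i"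
        and Z2: "\<And>a b j. norm (fc (\<lambda>t. Z t $ a $ b) j) \<le> 2"
        by (rule kam_step[OF dv N \<Lambda> K1 nc \<eta>4 pdef pm refl]) blast
      have p64: "64 * p i \<le> (1/2) ^ i" using qs[of i] pleq[of i] by linarith
      have wn: "wt N (int (nat \<lfloor>K i * N\<rfloor>)) \<le> 2 * K i"
      proof -
        define k where "k = nat \<lfloor>K i * N\<rfloor>"
        have "real k \<le> K i * N" using K1[of i] N0 by (simp add: k_def of_nat_nat)
        then have "real k / N \<le> K i" using N0 by (simp add: divide_le_eq)
        then show ?thesis using K1[of i] unfolding k_def[symmetric] by (simp add: wt_def)
      qed
      have WPr: "allent (\<lambda>f. Wie N r f (q i)) P"
      proof (rule allentI)
        fix a b
        have "Wie N r (\<lambda>t. P t $ a $ b) (wt N (int (nat \<lfloor>K i * N\<rfloor>)) ^ r * p i)"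
          by (rule Wie_tp_order[OF N0 allentD[OF tpP] allentD[OF WP]])
        then show "Wie N r (\<lambda>t. P t $ a $ b) (q i)"
        proof (rule Wie_mono)
          have "wt N (int (nat \<lfloor>K i * N\<rfloor>)) ^ r \<le> (2 * K i) ^ r"
            using wn wt_ge_1[OF N0, of "int (nat \<lfloor>K i * N\<rfloor>)"] by (intro power_mono) auto
          from mult_right_mono[OF this p0[of i]] show "wt N (int (nat \<lfloor>K i * N\<rfloor>)) ^ r * p i \<le> q i"
            by (simp add: q_def power_mult_distrib)
        qed
      qed
      define W' where "W' t = W t ** (mat 1 + P t)" for t
      have "Inv (Suc i) W' F' Z'"
        unfolding Inv_def
      proof (intro conjI allI)
        have "allent (tp (d + nat \<lfloor>K i * N\<rfloor>)) W'"
          unfolding W'_def by (rule allent_tp_mult[OF tpW allent_tp_add[OF allent_tp_const tpP]])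
        then show "\<exists>d. allent (tp d) W'" by blast
        show "W' t ** Z' t = B t" for t unfolding W'_def by (simp add: matrix_mul_assoc[symmetric] Z' WZ)
        show "near_const \<alpha> l N m F' Z' (\<eta> (Suc i)) (\<epsilon> (Suc i) / N) (E (Suc i) / N)"
        proof (rule near_mono[OF nc'])
          show "\<eta> i + 4 * p i \<le> \<eta> (Suc i)" using p64 by (simp add: \<eta>_def)
        qed (use eps_step[of i] E_step[of i] N0 in \<open>auto intro!: divide_right_mono\<close>)
        have h: "(1/2::real) ^ i \<le> 1" by (simp add: power_le_one)
        have h0: "(1/2::real) ^ i \<ge> 0" by simp
        have "allent (\<lambda>f. Wie N r f (Mi i + 2 * (Mi i * q i))) W'"
          unfolding W'_def by (rule allent_Wie_step[OF N0 tpW WW tpP WPr])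
        moreover have "Mi i + 2 * (Mi i * q i) \<le> Mi (Suc i)"
        proof -
          have "Mi i \<le> M0 * 2" unfolding Mi_def using M0(1) by (intro mult_left_mono) auto
          then have "Mi i * q i \<le> (M0 * 2) * ((1/64) * (1/2) ^ i)"
            using q0[of i] qs[of i] M0(1) by (intro mult_mono) auto
          also have "\<dots> \<le> M0 * ((1/4) * (1/2) ^ i)" using M0(1) h0 by (simp add: mult_left_mono)
          finally have "Mi i + 2 * (Mi i * q i) \<le> M0 * (2 - (1/2) ^ i) + 2 * (M0 * ((1/4) * (1/2) ^ i))" by (simp add: Mi_def)
          also have "\<dots> = Mi (Suc i)" by (simp add: Mi_def algebra_simps)
          finally show ?thesis .
        qed
        ultimately show "allent (\<lambda>f. Wie N r f (Mi (Suc i))) W'" unfolding allent_def using Wie_mono by blast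
      qed
      moreover have "norm (fc (\<lambda>t. Z t $ a $ b) j) \<le> (1/2) ^ i"
        if "\<bar>j\<bar> \<le> int (nat \<lfloor>K i * N\<rfloor>)" "j \<notin> res_set a b" for a b j
        using Zs[OF that] p64 p0[of i] by linarith
      ultimately show ?thesis using Z2 by blast
    qed
    have ex: "\<exists>W F Z. Inv i W F Z" for i
    proof (induction i)
      case 0 then show ?case using start by blast
    next
      case (Suc i) then show ?case using step by blast
    qed
    have "norm (fc (\<lambda>t. B t $ a $ b) j) * wt N j ^ r \<le> 4 * (2 * M0)" for a b j
    proof (rule coefficient_limit[OF N0 r])
      fix i :: nat
      obtain W F Z where inv: "Inv i W F Z" using ex by blast
      obtain d where tpW: "allent (tp d) W" using inv unfolding Inv_def by blast
      have WW: "allent (\<lambda>f. Wie N r f (Mi i)) W" and WZ: "\<forall>t. W t ** Z t = B t"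
        and cZ: "allent cper Z"
        using inv unfolding Inv_def near_const_def by blast+
      have "Mi i \<le> 2 * M0" using M0(1) by (simp add: Mi_def algebra_simps)
      then have WW2: "allent (\<lambda>f. Wie N r f (2 * M0)) W" using WW unfolding allent_def using Wie_mono by blast
      have far: "wt N j \<ge> 2 ^ i" if "\<bar>j\<bar> > int (nat \<lfloor>K i * N\<rfloor>)" for j
      proof -
        have "K i * N \<ge> 0" using K1[of i] N0 by simp
        then have "K i * N \<le> \<bar>real_of_int j\<bar>" using that by linarith
        then have "K i \<le> \<bar>real_of_int j\<bar> / N" using N0 by (simp add: le_divide_eq)
        moreover have "2 ^ i \<le> K i"
        proof -
          have "(2::real) ^ i \<le> exp 1 ^ i" using exp_ge_add_one_self[of 1] by (intro power_mono) auto
          also have "\<dots> = exp (real i)" by (simp add: exp_of_nat_mult[symmetric])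
          also have "\<dots> \<le> K i" using xlow[of i] x0(1) by (simp add: K_def)
          finally show ?thesis .
        qed
        ultimately show ?thesis by (simp add: wt_def)
      qed
      show "\<exists>W Z d n. allent (tp d) W \<and> allent (\<lambda>f. Wie N r f (2 * M0)) W \<and> allent cper Z \<and> (\<forall>t. W t ** Z t = B t) \<and>
        (\<forall>a b j. norm (fc (\<lambda>t. Z t $ a $ b) j) \<le> 2) \<and>
        (\<forall>a b j. \<bar>j\<bar> \<le> int n \<longrightarrow> j \<notin> res_set a b \<longrightarrow> norm (fc (\<lambda>t. Z t $ a $ b) j) \<le> (1/2) ^ i) \<and>
        (\<forall>j. \<bar>j\<bar> > int n \<longrightarrow> wt N j \<ge> 2 ^ i)"
        using tpW WW2 cZ WZ step[OF inv] far by blast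
    qed
    then show ?thesis by blast
  qed
  then show ?thesis using e0(1,2) by blast
qed

section \<open>Scales at which the rotation number is Diophantine\<close>

lemma gauss_map_range: "gauss_map x \<ge> 0" "gauss_map x < 1"
  by (auto simp: gauss_map_def frac_lt_1)

text \<open>An orbit that reaches 0 stays there, while the orbit of \<open>\<alpha>\<close> returns to \<open>(1/5, 1/4]\<close>.\<close>

lemma gauss_orbit_pos:
  assumes "\<alpha> \<in> Sigma_set \<gamma> \<sigma>"
  shows "(gauss_map ^^ k) \<alpha> \<in> {0<..<1}"
proof -
  have a: "0 < \<alpha>" "\<alpha> < 1" using assms by (auto simp: Sigma_set_def)
  have nz: "(gauss_map ^^ k) \<alpha> \<noteq> 0"
  proof
    assume z: "(gauss_map ^^ k) \<alpha> = 0"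
    have "(gauss_map ^^ (k + i)) \<alpha> = 0" for i
    proof (induction i)
      case (Suc i)
      have "gauss_map 0 = 0" by (simp add: gauss_map_def)
      then show ?case using Suc by simp
    qed (use z in simp)
    then have z': "(gauss_map ^^ k') \<alpha> = 0" if "k' \<ge> k" for k'
      using that by (metis le_add_diff_inverse)
    have "\<exists>k'\<ge>k. (gauss_map ^^ k') \<alpha> \<in> CD \<gamma> \<sigma> \<inter> {1/5<..1/4} \<and> (gauss_map ^^ Suc k') \<alpha> \<in> CD \<gamma> \<sigma> \<inter> {1/5<..1/4}"
      using assms unfolding Sigma_set_def by (simp only: mem_Collect_eq)
    then obtain k' where k': "k' \<ge> k" "(gauss_map ^^ k') \<alpha> \<in> CD \<gamma> \<sigma> \<inter> {1/5<..1/4}" by (elim exE conjE)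
    then show False using z'[OF k'(1)] by simp
  qed
  show ?thesis
  proof (cases k)
    case 0 then show ?thesis using a by simp
  next
    case (Suc n)
    then show ?thesis using nz gauss_map_range[of "(gauss_map ^^ n) \<alpha>"] by (auto simp: less_le)
  qed
qed

text \<open>Two consecutive convergents \<open>p'/q'\<close> and \<open>p/q\<close> of \<open>\<alpha>\<close>, built by the continued fraction recursion. The Gauss map enters
  through the ratio of their approximation errors.\<close>

lemma convergent_basis:
  assumes pos: "\<And>k. (gauss_map ^^ k) \<alpha> \<in> {0<..<1}"
  shows "\<exists>q p q' p' :: int. q \<ge> 1 \<and> q \<ge> int k \<and> q' \<ge> 0 \<and> (k > 0 \<longrightarrow> q' \<ge> 1) \<and> q' \<le> q \<and>
     \<bar>q * p' - p * q'\<bar> = 1 \<and> of_int q * \<alpha> - of_int p = - ((gauss_map ^^ k) \<alpha>) * (of_int q' * \<alpha> - of_int p')"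
proof (induction k)
  case 0
  show ?case by (rule exI[of _ 1], rule exI[of _ 0], rule exI[of _ 0], rule exI[of _ 1]) simp
next
  case (Suc k)
  obtain q p q' p' :: int where h: "q \<ge> 1" "q \<ge> int k" "q' \<ge> 0" "k > 0 \<longrightarrow> q' \<ge> 1" "q' \<le> q"
     "\<bar>q * p' - p * q'\<bar> = 1" and th: "of_int q * \<alpha> - of_int p = - ((gauss_map ^^ k) \<alpha>) * (of_int q' * \<alpha> - of_int p')"
    using Suc by blast
  define x where "x = (gauss_map ^^ k) \<alpha>"
  define a where "a = \<lfloor>1 / x\<rfloor>"
  have x: "0 < x" "x < 1" using pos[of k] by (auto simp: x_def)
  have "1 \<le> 1 / x" using x by simp
  then have a1: "a \<ge> 1" unfolding a_def by (simp add: le_floor_iff)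
  have xS: "(gauss_map ^^ Suc k) \<alpha> = 1 / x - of_int a" by (simp add: x_def[symmetric] gauss_map_def frac_def a_def)
  let ?q = "a * q + q'" and ?p = "a * p + p'"
  have aq: "a * q \<ge> q" using mult_right_mono[of 1 a q] a1 h(1) by simp
  have c1: "?q \<ge> 1" "q \<le> ?q" using aq h(1,3) by linarith+
  have c2: "?q \<ge> int (Suc k)" using aq h by (cases "k = 0") linarith+
  have c3: "\<bar>?q * p - ?p * q\<bar> = 1"
  proof -
    have "?q * p - ?p * q = - (q * p' - p * q')" by (simp add: algebra_simps)
    then show ?thesis using h(6) by simp
  qed
  have c4: "of_int ?q * \<alpha> - of_int ?p = - (1 / x - of_int a) * (of_int q * \<alpha> - of_int p)"
  proof -
    have th': "of_int q' * \<alpha> - of_int p' = - (1 / x) * (of_int q * \<alpha> - of_int p)"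
      using th x by (simp add: x_def[symmetric] field_simps)
    have "of_int ?q * \<alpha> - of_int ?p = of_int a * (of_int q * \<alpha> - of_int p) + (of_int q' * \<alpha> - of_int p')"
      by (simp add: algebra_simps)
    also have "\<dots> = - (1 / x - of_int a) * (of_int q * \<alpha> - of_int p)" unfolding th' by (simp add: left_diff_distrib)
    finally show ?thesis .
  qed
  show ?case
    unfolding xS
    by (rule exI[of _ ?q], rule exI[of _ ?p], rule exI[of _ q], rule exI[of _ p]) (use c1 c2 c3 c4 h(1) in simp)
qed

lemma CD_lower:
  assumes "x \<in> CD \<gamma> \<sigma>" "\<gamma> > 0" "a \<noteq> (0::int)"
  shows "\<bar>of_int a * x - of_int b\<bar> \<ge> inverse \<gamma> * (of_int \<bar>a\<bar>) powr (- \<sigma>)"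
proof -
  have "inverse \<gamma> * of_int \<bar>a\<bar> powr (- \<sigma>) \<le> infdist (of_int a * x) \<int>"
    using assms unfolding CD_def by blast
  also have "\<dots> \<le> dist (of_int a * x) (of_int b)" by (rule infdist_le) simp
  finally show ?thesis by (simp add: dist_real_def)
qed

text \<open>A Diophantine condition relative to the scale \<open>N\<close>: frequencies up to \<open>N\<close> have divisors of size
  \<open>1 / N\<close>, as good as for a badly approximable number, and beyond \<open>N\<close> the loss is polynomial in \<open>\<bar>j\<bar> / N\<close>.\<close>

definition dioph_scale :: "real \<Rightarrow> real \<Rightarrow> nat \<Rightarrow> nat \<Rightarrow> bool" where
  "dioph_scale \<alpha> c s N \<longleftrightarrow> (\<forall>j l :: int. j \<noteq> 0 \<longrightarrow> \<bar>of_int j * \<alpha> - of_int l\<bar> \<ge> c / (real N * wt (real N) j ^ s))"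

text \<open>Let \<open>x\<close> be the \<open>k\<close>-th iterate of \<open>\<alpha>\<close> and let \<open>N = q\<close> be the denominator of the convergent. In the
  unimodular basis of two consecutive convergents, \<open>(j, l) = a * (q, p) + b * (q', p')\<close>, the form
  \<open>j * \<alpha> - l\<close> is \<open>\<plusminus> t * (a * x - b)\<close> with \<open>\<bar>t\<bar>\<close> between \<open>1 / (2 * N)\<close> and \<open>1 / N\<close>. If the form is small,
  then \<open>\<bar>a\<bar> \<le> 1 + \<bar>j\<bar> / N\<close>, and the Diophantine condition for \<open>x\<close> applies with \<open>a\<close> in place of \<open>j\<close>.\<close>

lemma infinitely_many_dioph_scales:
  assumes S: "\<alpha> \<in> Sigma_set \<gamma> \<sigma>" and g: "\<gamma> > 0" and s: "real s \<ge> \<sigma>"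
  shows "\<exists>N\<ge>n0. N \<ge> 1 \<and> dioph_scale \<alpha> (min (1/2) (1 / (2 * \<gamma>))) s N"
proof -
  let ?c = "min (1/2) (1 / (2 * \<gamma>))"
  obtain k where k: "k \<ge> n0" "(gauss_map ^^ k) \<alpha> \<in> CD \<gamma> \<sigma>"
    using S unfolding Sigma_set_def by blast
  define x where "x = (gauss_map ^^ k) \<alpha>"
  have pos: "\<And>k. (gauss_map ^^ k) \<alpha> \<in> {0<..<1}" by (rule gauss_orbit_pos[OF S])
  have x: "0 < x" "x < 1" "x \<in> CD \<gamma> \<sigma>" using pos[of k] k by (auto simp: x_def)
  obtain q p q' p' :: int where q: "q \<ge> 1" "q \<ge> int k" "q' \<ge> 0" "q' \<le> q" and un: "\<bar>q * p' - p * q'\<bar> = 1"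
    and th: "of_int q * \<alpha> - of_int p = - x * (of_int q' * \<alpha> - of_int p')"
    using convergent_basis[OF pos, of k] unfolding x_def by blast
  define N where "N = nat q"
  have N: "N \<ge> n0" "N \<ge> 1" and Nq: "real N = of_int q" using q k(1) by (auto simp: N_def)
  define t where "t = of_int q' * \<alpha> - of_int p'"
  \<comment> \<open>the determinant of the basis, expressed through the two approximation errors\<close>
  have one: "\<bar>t\<bar> * (of_int q + of_int q' * x) = 1"
  proof -
    have "of_int q * t - of_int q' * (of_int q * \<alpha> - of_int p) = of_int (- (q * p' - p * q'))"
      by (simp add: t_def algebra_simps)
    moreover have "of_int q * t - of_int q' * (of_int q * \<alpha> - of_int p) = t * (of_int q + of_int q' * x)"
      unfolding th t_def[symmetric] by (simp add: algebra_simps)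
    ultimately have "\<bar>t * (of_int q + of_int q' * x)\<bar> = of_int \<bar>q * p' - p * q'\<bar>" by (simp add: abs_minus_commute)
    moreover have "(of_int q + of_int q' * x) \<ge> 0" using q x by simp
    ultimately show ?thesis using un by (simp add: abs_mult)
  qed
  have tl: "\<bar>t\<bar> \<ge> 1 / (2 * real N)"
  proof -
    have "of_int q' * x \<le> of_int q * 1" using q x by (intro mult_mono) auto
    then have "\<bar>t\<bar> * (of_int q + of_int q' * x) \<le> \<bar>t\<bar> * (2 * real N)" unfolding Nq by (intro mult_left_mono) auto
    then show ?thesis using one N by (simp add: divide_le_eq)
  qed
  have tu: "\<bar>t\<bar> \<le> 1 / real N"
  proof -
    have "\<bar>t\<bar> * real N \<le> \<bar>t\<bar> * (of_int q + of_int q' * x)" unfolding Nq using q x by (intro mult_left_mono) auto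
    then show ?thesis using one N by (simp add: le_divide_eq)
  qed
  have N0: "real N > 0" using N by simp
  have "\<bar>of_int j * \<alpha> - of_int l\<bar> \<ge> ?c / (real N * wt (real N) j ^ s)" if j: "j \<noteq> 0" for j l :: int
  proof -
    define y where "y = of_int j * \<alpha> - of_int l"
    have w: "wt (real N) j ^ s \<ge> 1" by (rule wt_pow_ge_1[OF N0])
    have cw: "?c / (real N * wt (real N) j ^ s) \<le> ?c / real N"
    proof (rule divide_left_mono)
      show "real N \<le> real N * wt (real N) j ^ s" using mult_left_mono[OF w, of "real N"] by simp
    qed (use g N0 w in auto)
    show ?thesis
    proof (cases "\<bar>y\<bar> \<ge> 1 / (2 * real N)")
      case True
      have "?c / real N \<le> (1/2) / real N" by (intro divide_right_mono) auto
      with True cw show ?thesis by (simp add: y_def)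
    next
      case False
      define D where "D = q * p' - p * q'"
      have D: "D * D = 1" using un unfolding D_def[symmetric] by (metis abs_mult_self_eq mult_1)
      define a where "a = D * (j * p' - l * q')"
      define b where "b = D * (q * l - p * j)"
      have jab: "j = a * q + b * q'"
      proof -
        have "a * q + b * q' = D * D * j" unfolding a_def b_def D_def by (simp add: algebra_simps)
        then show ?thesis using D by simp
      qed
      have lab: "l = a * p + b * p'"
      proof -
        have "a * p + b * p' = D * D * l" unfolding a_def b_def D_def by (simp add: algebra_simps)
        then show ?thesis using D by simp
      qed
      have yab: "y = - t * (of_int a * x - of_int b)"
      proof -
        have "y = of_int a * (of_int q * \<alpha> - of_int p) + of_int b * (of_int q' * \<alpha> - of_int p')"
          unfolding y_def jab lab by (simp add: algebra_simps)
        then show ?thesis unfolding th t_def[symmetric] by (simp add: algebra_simps)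
      qed
      then have yabs: "\<bar>y\<bar> = \<bar>t\<bar> * \<bar>of_int a * x - of_int b\<bar>" by (simp add: abs_mult)
      show ?thesis
      proof (cases "a = 0")
        case True
        then have "b \<noteq> 0" using j jab by auto
        then have "1 \<le> \<bar>of_int b :: real\<bar>" by linarith
        then have "\<bar>t\<bar> * 1 \<le> \<bar>y\<bar>" unfolding yabs True by (intro mult_left_mono) auto
        with False tl show ?thesis by simp
      next
        case a0: False
        \<comment> \<open>Cramer expresses \<open>a\<close> by the two small linear forms \<open>y\<close> and \<open>t\<close>\<close>
        have "\<bar>D\<bar> = 1" using un by (simp add: D_def)
        then have "\<bar>a\<bar> = \<bar>j * p' - l * q'\<bar>" by (simp add: a_def abs_mult)
        then have "\<bar>of_int a :: real\<bar> = \<bar>of_int (j * p' - l * q')\<bar>" by (metis of_int_abs)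
        also have "of_int (j * p' - l * q') = of_int q' * y - of_int j * t"
          by (simp add: y_def t_def algebra_simps)
        also have "\<bar>\<dots>\<bar> \<le> of_int q' * \<bar>y\<bar> + \<bar>of_int j\<bar> * \<bar>t\<bar>"
          using abs_triangle_ineq4[of "of_int q' * y" "of_int j * t"] q(3) by (simp add: abs_mult)
        also have "\<dots> \<le> real N * (1 / real N) + \<bar>of_int j\<bar> * (1 / real N)"
        proof (intro add_mono mult_mono mult_left_mono)
          show "of_int q' \<le> real N" using q Nq by simp
          have "1 / (2 * real N) \<le> 1 / real N" using N0 by (intro divide_left_mono) auto
          then show "\<bar>y\<bar> \<le> 1 / real N" using False by linarith
        qed (use tu N0 in auto)
        also have "\<dots> = wt (real N) j" using N0 by (simp add: wt_def)
        finally have aw: "\<bar>of_int a\<bar> \<le> wt (real N) j" .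
        have a1: "\<bar>of_int a :: real\<bar> \<ge> 1" using a0 by linarith
        have "inverse (wt (real N) j ^ s) \<le> inverse (\<bar>of_int a\<bar> ^ s)"
          using aw a1 by (intro le_imp_inverse_le power_mono zero_less_power) auto
        also have "\<dots> = \<bar>of_int a\<bar> powr (- real s)"
          using a1 by (simp add: powr_minus powr_realpow)
        also have "\<dots> \<le> \<bar>of_int a\<bar> powr (- \<sigma>)" using s a1 by (intro powr_mono) auto
        finally have iw: "inverse (wt (real N) j ^ s) \<le> \<bar>of_int a\<bar> powr (- \<sigma>)" .
        have "inverse \<gamma> * \<bar>of_int a\<bar> powr (- \<sigma>) \<le> \<bar>of_int a * x - of_int b\<bar>"
          using CD_lower[OF x(3) g a0, of b] by simp
        moreover have "inverse \<gamma> * inverse (wt (real N) j ^ s) \<le> inverse \<gamma> * \<bar>of_int a\<bar> powr (- \<sigma>)"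
          using iw g by (intro mult_left_mono) auto
        ultimately have xx: "inverse \<gamma> * inverse (wt (real N) j ^ s) \<le> \<bar>of_int a * x - of_int b\<bar>"
          by (rule order_trans[rotated])
        have "?c / (real N * wt (real N) j ^ s) \<le> (1 / (2 * \<gamma>)) / (real N * wt (real N) j ^ s)"
          using N0 w by (intro divide_right_mono mult_nonneg_nonneg) auto
        also have "\<dots> = (1 / (2 * real N)) * (inverse \<gamma> * inverse (wt (real N) j ^ s))" using g N0 by (simp add: field_simps)
        also have "\<dots> \<le> \<bar>t\<bar> * \<bar>of_int a * x - of_int b\<bar>"
          using xx tl g w N0 by (intro mult_mono) auto
        finally show ?thesis unfolding yabs[symmetric] y_def .
      qed
    qed
  qed
  then show ?thesis unfolding dioph_scale_def using N by blast
qed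

section \<open>Almost every phase is good at infinitely many scales\<close>

text \<open>The exponent 2 makes the right side summable over \<open>j\<close>, uniformly in \<open>N\<close>, so that violations
  have small measure.\<close>

definition transl_scale :: "real \<Rightarrow> real \<Rightarrow> real \<Rightarrow> nat \<Rightarrow> bool" where
  "transl_scale \<alpha> \<phi> c N \<longleftrightarrow> (\<forall>j l :: int. \<bar>of_int j * \<alpha> + \<phi> - of_int l\<bar> \<ge> c / (real N * (wt (real N) j)\<^sup>2))"

text \<open>The terms are \<open>N / (N + \<bar>j\<bar>)\<^sup>2\<close>; for positive and for negative \<open>j\<close> they are dominated by a
  telescoping series of total at most 1.\<close>

lemma sum_inverse_wt_sq:
  assumes "N \<ge> 1" "finite J"
  shows "(\<Sum>j\<in>J. 1 / (real N * (wt (real N) j)\<^sup>2)) \<le> 3"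
proof -
  have b: "(\<Sum>j\<in>{-int n..int n}. real N / (real N + \<bar>of_int j\<bar>)\<^sup>2) \<le> 3 - 2 * real N / (real N + real n)" for n
  proof (induction n)
    case 0 show ?case using assms(1) by (simp add: power2_eq_square)
  next
    case (Suc n)
    have "{-int (Suc n)..int (Suc n)} = insert (int (Suc n)) (insert (- int (Suc n)) {-int n..int n})" by auto
    then have "(\<Sum>j\<in>{-int (Suc n)..int (Suc n)}. real N / (real N + \<bar>of_int j\<bar>)\<^sup>2)
       = 2 * (real N / (real N + real n + 1)\<^sup>2) + (\<Sum>j\<in>{-int n..int n}. real N / (real N + \<bar>of_int j\<bar>)\<^sup>2)"
      by (simp add: add_ac)
    also have "\<dots> \<le> 2 * (real N / (real N + real n + 1)\<^sup>2) + (3 - 2 * real N / (real N + real n))" using Suc by simp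
    also have "real N / (real N + real n + 1)\<^sup>2 \<le> real N / ((real N + real n) * (real N + real n + 1))"
      using assms(1) by (intro divide_left_mono) (auto simp: power2_eq_square intro!: mult_right_mono mult_pos_pos)
    also have "real N / ((real N + real n) * (real N + real n + 1)) = real N / (real N + real n) - real N / (real N + real n + 1)"
    proof -
      have "x / (y * (y + 1)) = x / y - x / (y + 1)" if "y > 0" for x y :: real using that by (simp add: field_simps)
      then show ?thesis using assms(1) by simp
    qed
    finally show ?case by (simp add: algebra_simps)
  qed
  obtain n :: nat where n: "\<And>j. j \<in> J \<Longrightarrow> \<bar>j\<bar> \<le> int n"
  proof -
    have "finite ((\<lambda>j. nat \<bar>j\<bar>) ` J)" using assms by simp
    then obtain n where "\<forall>k\<in>(\<lambda>j. nat \<bar>j\<bar>) ` J. k \<le> n" using finite_nat_set_iff_bounded_le by blast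
    then show thesis using that[of n] by fastforce
  qed
  have "1 / (real N * (wt (real N) j)\<^sup>2) = real N / (real N + \<bar>of_int j\<bar>)\<^sup>2" for j
  proof -
    have "real N * wt (real N) j = real N + \<bar>of_int j\<bar>" using assms(1) by (simp add: wt_def field_simps)
    then have "(real N + \<bar>of_int j\<bar>)\<^sup>2 = real N * (real N * (wt (real N) j)\<^sup>2)" 
      by (simp only: \<open>real N * wt (real N) j = real N + \<bar>of_int j\<bar>\<close>[symmetric]) (simp add: power2_eq_square)
    then show ?thesis using assms(1) by simp
  qed
  then have "(\<Sum>j\<in>J. 1 / (real N * (wt (real N) j)\<^sup>2)) = (\<Sum>j\<in>J. real N / (real N + \<bar>of_int j\<bar>)\<^sup>2)" by simp
  also have "\<dots> \<le> (\<Sum>j\<in>{-int n..int n}. real N / (real N + \<bar>of_int j\<bar>)\<^sup>2)"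
    by (rule sum_mono2) (use n in force)+
  also have "\<dots> \<le> 3 - 2 * real N / (real N + real n)" by (rule b)
  finally show ?thesis by (smt (verit) divide_nonneg_nonneg of_nat_0_le_iff mult_nonneg_nonneg)
qed

definition bad_transl :: "real \<Rightarrow> real \<Rightarrow> nat \<Rightarrow> real set" where
  "bad_transl \<alpha> c N = {\<phi>\<in>{0..1}. \<not> transl_scale \<alpha> \<phi> c N}"

lemma bad_transl_sets: "bad_transl \<alpha> c N \<in> sets lborel"
proof -
  have "bad_transl \<alpha> c N = {0..1} \<inter> (\<Union>j::int. \<Union>l::int. {\<phi>. \<bar>of_int j * \<alpha> + \<phi> - of_int l\<bar> < c / (real N * (wt (real N) j)\<^sup>2)})"
    by (auto simp: bad_transl_def transl_scale_def not_le)
  also have "\<dots> \<in> sets lborel"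
    by (intro sets.Int sets.countable_UN) (auto intro!: borel_open open_Collect_less continuous_intros)
  finally show ?thesis .
qed

text \<open>For each \<open>j\<close> at most three integers can be close to \<open>j * \<alpha> + \<phi>\<close> with \<open>\<phi>\<close> in the unit interval, so the bad
  phases lie in intervals of total length \<open>6 * c / (N * (wt N j)\<^sup>2)\<close>.\<close>

lemma bad_transl_measure:
  assumes N: "N \<ge> 1" and c: "0 < c" "c \<le> 1/2"
  shows "emeasure lborel (bad_transl \<alpha> c N) \<le> ennreal (18 * c)"
proof -
  define d where "d j = c / (real N * (wt (real N) j)\<^sup>2)" for j
  define I where "I j l = {of_int l - of_int j * \<alpha> - d j .. of_int l - of_int j * \<alpha> + d j}" for j l :: int
  define U where "U j = (\<Union>l\<in>{\<lfloor>of_int j * \<alpha>\<rfloor>..\<lfloor>of_int j * \<alpha>\<rfloor> + 2}. I j l)" for j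
  have N0: "real N > 0" using N by simp
  have d0: "0 < d j" "d j \<le> 1/2" for j
  proof -
    have w: "(wt (real N) j)\<^sup>2 \<ge> 1" by (rule wt_pow_ge_1[OF N0])
    have "1 * 1 \<le> real N * (wt (real N) j)\<^sup>2" using N w by (intro mult_mono) auto
    then show "0 < d j" "d j \<le> 1/2" unfolding d_def using c by (auto simp: divide_le_eq)
  qed
  have Ui: "emeasure lborel (U j) \<le> ennreal (6 * d j)" for j
  proof -
    have "emeasure lborel (U j) \<le> (\<Sum>l\<in>{\<lfloor>of_int j * \<alpha>\<rfloor>..\<lfloor>of_int j * \<alpha>\<rfloor> + 2}. emeasure lborel (I j l))"
      unfolding U_def by (rule emeasure_subadditive_finite) (auto simp: I_def)
    also have "\<dots> = (\<Sum>l\<in>{\<lfloor>of_int j * \<alpha>\<rfloor>..\<lfloor>of_int j * \<alpha>\<rfloor> + 2}. ennreal (2 * d j))"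
      using d0[of j] by (intro sum.cong refl) (simp add: I_def)
    also have "\<dots> = ennreal (6 * d j)" using d0[of j] by (simp add: ennreal_mult' mult.assoc)
    finally show ?thesis .
  qed
  have sub: "bad_transl \<alpha> c N \<subseteq> (\<Union>j. U j)"
  proof
    fix \<phi> assume "\<phi> \<in> bad_transl \<alpha> c N"
    then obtain j l :: int where p: "0 \<le> \<phi>" "\<phi> \<le> 1" and jl: "\<bar>of_int j * \<alpha> + \<phi> - of_int l\<bar> < d j"
      by (auto simp: bad_transl_def transl_scale_def not_le d_def)
    have "of_int l > of_int j * \<alpha> - 1/2" "of_int l < of_int j * \<alpha> + 3/2" using jl d0[of j] p by linarith+
    then have "l \<in> {\<lfloor>of_int j * \<alpha>\<rfloor>..\<lfloor>of_int j * \<alpha>\<rfloor> + 2}" unfolding atLeastAtMost_iff by linarith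
    moreover have "\<phi> \<in> I j l" using jl by (auto simp: I_def)
    ultimately show "\<phi> \<in> (\<Union>j. U j)" unfolding U_def by blast
  qed
  define e where "e i = (from_nat_into (UNIV :: int set) i)" for i :: nat
  have eb: "bij e" unfolding e_def
    by (rule bij_betw_from_nat_into[OF countableI_type infinite_UNIV_int])
  have "(\<Union>j. U j) = (\<Union>i. U (e i))" 
    using bij_is_surj[OF eb] by (simp only: image_image[of U e UNIV, symmetric])
  then have "emeasure lborel (bad_transl \<alpha> c N) \<le> emeasure lborel (\<Union>i. U (e i))"
    using sub by (intro emeasure_mono) (auto simp: U_def I_def)
  also have "\<dots> \<le> (\<Sum>i. emeasure lborel (U (e i)))"
    by (rule emeasure_subadditive_countably) (auto simp: U_def I_def)
  also have "\<dots> \<le> ennreal (18 * c)"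
  proof (rule suminf_le_const)
    fix n
    have "(\<Sum>i<n. emeasure lborel (U (e i))) \<le> (\<Sum>i<n. ennreal (6 * d (e i)))" by (intro sum_mono Ui)
    also have "\<dots> = ennreal (\<Sum>i<n. 6 * d (e i))" 
      by (rule sum_ennreal) (use d0(1) in \<open>simp add: less_imp_le\<close>)
    also have "(\<Sum>i<n. 6 * d (e i)) = 6 * c * (\<Sum>j\<in>e ` {..<n}. 1 / (real N * (wt (real N) j)\<^sup>2))"
      using bij_is_inj[OF eb] by (subst sum.reindex) (auto simp: inj_on_def inj_def d_def sum_distrib_left)
    also have "ennreal \<dots> \<le> ennreal (18 * c)"
      using sum_inverse_wt_sq[OF N, of "e ` {..<n}"] c by (intro ennreal_leI) (simp add: mult_left_mono)
    finally show "(\<Sum>i<n. emeasure lborel (U (e i))) \<le> ennreal (18 * c)" .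
  qed simp
  finally show ?thesis .
qed

definition exceptional_phases :: "real \<Rightarrow> (nat \<Rightarrow> bool) \<Rightarrow> real set" where
  "exceptional_phases \<alpha> S = {\<phi>\<in>{0..1}. \<forall>c>0. \<exists>n. \<forall>N\<ge>n. S N \<longrightarrow> \<not> transl_scale \<alpha> \<phi> c N}"

text \<open>If \<open>\<phi>\<close> is exceptional, then for every \<open>c\<close> it is bad at all large scales with \<open>S\<close>. For fixed
  \<open>c\<close> the sets of phases bad from scale \<open>n\<close> on increase with \<open>n\<close>, and each has measure at most
  \<open>18 * c\<close>, so their union does too; let \<open>c\<close> tend to 0.\<close>

lemma exceptional_phases_null:
  assumes S: "\<And>n. \<exists>N\<ge>n. N \<ge> 1 \<and> S N"
  shows "exceptional_phases \<alpha> S \<in> null_sets lebesgue"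
proof -
  define B where "B c n = (\<Inter>N\<in>{N. N \<ge> n \<and> S N}. bad_transl \<alpha> c N)" for c :: real and n :: nat
  have ne: "{N. N \<ge> n \<and> S N} \<noteq> {}" for n using S[of n] by blast
  have Bs: "B c n \<in> sets lborel" for c n
    unfolding B_def using ne bad_transl_sets[of \<alpha> c] by (intro sets.countable_INT') auto
  have Bm: "emeasure lborel (\<Union>n. B c n) \<le> ennreal (18 * c)" if c: "0 < c" "c \<le> 1/2" for c
  proof -
    have "emeasure lborel (\<Union>n. B c n) = (SUP n. emeasure lborel (B c n))"
      using Bs by (intro SUP_emeasure_incseq[symmetric]) (auto simp: incseq_def B_def)
    also have "\<dots> \<le> ennreal (18 * c)"
    proof (rule SUP_least)
      fix n
      obtain N where N: "N \<ge> n" "N \<ge> 1" "S N" using S by blast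
      have "emeasure lborel (B c n) \<le> emeasure lborel (bad_transl \<alpha> c N)"
        using N by (intro emeasure_mono bad_transl_sets) (auto simp: B_def)
      also have "\<dots> \<le> ennreal (18 * c)" by (rule bad_transl_measure[OF N(2) c])
      finally show "emeasure lborel (B c n) \<le> ennreal (18 * c)" .
    qed
    finally show ?thesis .
  qed
  define E where "E = (\<Inter>m::nat. \<Union>n. B (1 / (real m + 2)) n)"
  have Es: "E \<in> sets lborel" unfolding E_def using Bs by (intro sets.countable_INT'' sets.countable_UN) auto
  have "emeasure lborel E \<le> ennreal e" if "e > 0" for e
  proof -
    obtain m :: nat where m: "real m > 18 / e" using reals_Archimedean2 by blast
    have "emeasure lborel E \<le> emeasure lborel (\<Union>n. B (1 / (real m + 2)) n)"
      using Bs by (intro emeasure_mono sets.countable_UN) (auto simp: E_def)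
    also have "\<dots> \<le> ennreal (18 * (1 / (real m + 2)))" by (rule Bm) auto
    also have "\<dots> \<le> ennreal e"
    proof (rule ennreal_leI)
      have "18 < e * real m" using m that by (simp add: divide_less_eq mult.commute)
      also have "\<dots> \<le> e * (real m + 2)" using that by simp
      finally show "18 * (1 / (real m + 2)) \<le> e" by (simp add: divide_le_eq)
    qed
    finally show ?thesis .
  qed
  note small = this
  have "emeasure lborel E \<le> 0"
  proof (rule ennreal_le_epsilon)
    fix e :: real assume "0 < e"
    from small[OF this] show "emeasure lborel E \<le> 0 + ennreal e" by simp
  qed
  then have "emeasure lborel E = 0" by simp
  then have "E \<in> null_sets lborel" using Es by (simp add: null_setsI)
  moreover have "exceptional_phases \<alpha> S \<subseteq> E"
  proof
    fix \<phi> assume p: "\<phi> \<in> exceptional_phases \<alpha> S"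
    have "\<exists>n. \<phi> \<in> B (1 / (real m + 2)) n" for m :: nat
    proof -
      obtain n where "\<forall>N\<ge>n. S N \<longrightarrow> \<not> transl_scale \<alpha> \<phi> (1 / (real m + 2)) N"
        using p unfolding exceptional_phases_def by (auto dest!: spec[of _ "1 / (real m + 2)"])
      then show ?thesis using p by (intro exI[of _ n]) (auto simp: B_def bad_transl_def exceptional_phases_def)
    qed
    then show "\<phi> \<in> E" by (auto simp: E_def)
  qed
  ultimately show ?thesis
    by (intro null_sets_completion_subset[of "exceptional_phases \<alpha> S" E] null_sets_completionI)
qed

section \<open>Small divisors at a good scale\<close>

text \<open>The distances to the nearest integers, with sign, are \<open>\<kappa>\<close>-separated and at least \<open>\<kappa>\<close> in absolute value. So they lie in distinct
  cells of length \<open>\<kappa>\<close>, and the sum is dominated by the inverse squares of the integers.\<close>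

lemma spaced_inverse_squares:
  fixes y :: "int \<Rightarrow> real"
  assumes fin: "finite J" and k: "\<kappa> > 0"
    and h1: "\<And>j l::int. j \<in> J \<Longrightarrow> \<bar>y j - of_int l\<bar> \<ge> \<kappa>"
    and h2: "\<And>i j l::int. i \<in> J \<Longrightarrow> j \<in> J \<Longrightarrow> i \<noteq> j \<Longrightarrow> \<bar>y i - y j - of_int l\<bar> \<ge> \<kappa>"
  shows "(\<Sum>j\<in>J. 1 / (y j - of_int (round (y j)))\<^sup>2) \<le> 27 / \<kappa>\<^sup>2"
proof -
  define r where "r j = y j - of_int (round (y j))" for j
  define m where "m j = \<lfloor>r j / \<kappa>\<rfloor>" for j
  have rk: "\<bar>r j\<bar> \<ge> \<kappa>" if "j \<in> J" for j unfolding r_def by (rule h1[OF that])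
  have "inj_on m J"
  proof (rule inj_onI, rule ccontr)
    fix i j assume ij: "i \<in> J" "j \<in> J" "m i = m j" "i \<noteq> j"
    have "\<bar>r i / \<kappa> - r j / \<kappa>\<bar> < 1"
      using ij(3) of_int_floor_le[of "r i / \<kappa>"] of_int_floor_le[of "r j / \<kappa>"]
        real_of_int_floor_add_one_gt[of "r i / \<kappa>"] real_of_int_floor_add_one_gt[of "r j / \<kappa>"]
      unfolding m_def by linarith
    then have "\<bar>r i - r j\<bar> < \<kappa>" using k by (simp add: diff_divide_distrib[symmetric] abs_divide)
    moreover have "\<bar>y i - y j - of_int (round (y i) - round (y j))\<bar> \<ge> \<kappa>" by (rule h2[OF ij(1,2,4)])
    ultimately show False unfolding r_def by simp
  qed
  moreover have "1 / (r j)\<^sup>2 \<le> 9 / \<kappa>\<^sup>2 * (1 / (1 + \<bar>of_int (m j)\<bar>)\<^sup>2)" if j: "j \<in> J" for j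
  proof -
    have q: "\<bar>r j / \<kappa>\<bar> \<ge> 1" using rk[OF j] k by (simp add: abs_divide)
    have "\<bar>real_of_int (m j)\<bar> \<le> \<bar>r j / \<kappa>\<bar> + 1"
      using of_int_floor_le[of "r j / \<kappa>"] real_of_int_floor_add_one_gt[of "r j / \<kappa>"]
      unfolding m_def by linarith
    then have "1 + \<bar>real_of_int (m j)\<bar> \<le> 3 * \<bar>r j / \<kappa>\<bar>" using q by linarith
    then have "(1 + \<bar>real_of_int (m j)\<bar>)\<^sup>2 \<le> (3 * \<bar>r j / \<kappa>\<bar>)\<^sup>2" by (rule power_mono) simp
    also have "\<dots> = 9 / \<kappa>\<^sup>2 * (r j)\<^sup>2" by (simp add: power_mult_distrib power_divide)
    finally have b: "(1 + \<bar>real_of_int (m j)\<bar>)\<^sup>2 \<le> 9 / \<kappa>\<^sup>2 * (r j)\<^sup>2" .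
    have "r j \<noteq> 0" using rk[OF j] k by auto
    then have "(r j)\<^sup>2 > 0" by simp
    moreover have X0: "(1 + \<bar>real_of_int (m j)\<bar>)\<^sup>2 > 0" by (intro zero_less_power) linarith
    ultimately have "(1 + \<bar>real_of_int (m j)\<bar>)\<^sup>2 / ((1 + \<bar>real_of_int (m j)\<bar>)\<^sup>2 * (r j)\<^sup>2)
       \<le> (9 / \<kappa>\<^sup>2 * (r j)\<^sup>2) / ((1 + \<bar>real_of_int (m j)\<bar>)\<^sup>2 * (r j)\<^sup>2)"
      using b by (intro divide_right_mono) auto
    then show ?thesis using \<open>r j \<noteq> 0\<close> X0 by (simp add: mult.commute)
  qed
  ultimately have "(\<Sum>j\<in>J. 1 / (r j)\<^sup>2) \<le> 9 / \<kappa>\<^sup>2 * (\<Sum>k\<in>m ` J. 1 / (1 + \<bar>of_int k\<bar>)\<^sup>2)"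
    by (simp add: sum.reindex sum_distrib_left) (rule sum_mono, simp)
  also have "\<dots> \<le> 9 / \<kappa>\<^sup>2 * 3" using sum_inverse_squares_le[of "m ` J"] fin by (intro mult_left_mono) auto
  finally show ?thesis unfolding r_def by simp
qed

lemma norm_cis_minus_1_ge: "norm (cis (2 * pi * y) - 1) \<ge> 4 * \<bar>y - of_int (round y)\<bar>"
proof -
  define r where "r = y - of_int (round y)"
  have "\<bar>r\<bar> \<le> 1/2" unfolding r_def using of_int_round_abs_le[of y] by linarith
  have "cis (2 * pi * y) = cis (2 * pi * r)"
  proof -
    have "cis (2 * pi * y) = cis (2 * pi * r) * cis (2 * pi * of_int (round y))"
      by (simp add: cis_mult r_def algebra_simps)
    also have "cis (2 * pi * of_int (round y)) = 1" by (rule cis_multiple_2pi) simp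
    finally show ?thesis by simp
  qed
  moreover have "norm (cis (2 * pi * r) - 1) = 2 * \<bar>sin (pi * r)\<bar>"
    using dist_exp_i_1[of "2 * pi * r"] by (simp add: cis_conv_exp)
  moreover have "\<bar>sin (pi * r)\<bar> \<ge> 2 * \<bar>r\<bar>" by (rule sin_pi_ge) fact
  ultimately show ?thesis unfolding r_def by simp
qed

text \<open>For frequencies up to \<open>n \<le> K * N\<close> differences are at most \<open>2 * n\<close>, with weight at most \<open>3 * K\<close>. Hence the
  numbers \<open>j * \<alpha> + \<psi>\<close> are separated modulo 1 by \<open>\<kappa> = c / (N * (3 * K) ^ s)\<close>, and the square sum of the
  inverse divisors is governed by the single smallest one.\<close>

lemma rotation_divisor_bound:
  assumes N: "N \<ge> 1" and c: "c > 0" and D: "dioph_scale \<alpha> c s N" and u: "u \<noteq> 0"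
    and T: "\<And>j l::int. j \<notin> R \<Longrightarrow> \<bar>of_int j * \<alpha> + \<psi> - of_int l\<bar> \<ge> c / (real N * wt (real N) j ^ s)"
  defines "d \<equiv> \<lambda>j. u * (cis (2 * pi * (of_int j * \<alpha> + \<psi>)) - 1)"
  shows "j \<notin> R \<Longrightarrow> d j \<noteq> 0"
    and "K \<ge> 1 \<Longrightarrow> real n \<le> K * real N \<Longrightarrow>
      L2_set (\<lambda>j. 1 / norm (d j)) ({-int n..int n} - R) \<le> 2 * 3 ^ s / (c * norm u) * real N * K ^ s"
proof -
  have N0: "real N > 0" using N by simp
  have w1: "wt (real N) j \<ge> 1" for j by (simp add: wt_def)
  define y where "y j = of_int j * \<alpha> + \<psi>" for j
  define r where "r j = y j - of_int (round (y j))" for j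
  have dr: "norm (d j) \<ge> norm u * (4 * \<bar>r j\<bar>)" for j
    unfolding d_def norm_mult r_def y_def by (intro mult_left_mono norm_cis_minus_1_ge) simp
  have pos: "c / (real N * wt (real N) j ^ s) > 0" for j
    using c N0 w1[of j] by (intro divide_pos_pos mult_pos_pos zero_less_power) auto
  have rpos: "\<bar>r j\<bar> > 0" if "j \<notin> R" for j
    using T[OF that, of "round (y j)"] pos[of j] unfolding r_def y_def by linarith
  have dpos: "norm (d j) > 0" if "j \<notin> R" for j
    using dr[of j] rpos[OF that] u by (smt (verit) mult_pos_pos zero_less_norm_iff)
  show "j \<notin> R \<Longrightarrow> d j \<noteq> 0" using dpos by fastforce
  assume K: "K \<ge> 1" and n: "real n \<le> K * real N"
  define J where "J = {-int n..int n} - R"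
  define \<kappa> where "\<kappa> = c / (real N * (3 * K) ^ s)"
  have k: "\<kappa> > 0" unfolding \<kappa>_def using c N0 K by (intro divide_pos_pos mult_pos_pos zero_less_power) auto
  have kl: "\<kappa> \<le> c / (real N * wt (real N) j ^ s)" if j: "\<bar>j\<bar> \<le> 2 * int n" for j
  proof -
    have "\<bar>real_of_int j\<bar> \<le> 2 * real n" using j by linarith
    also have "\<dots> \<le> 2 * (K * real N)" using n by simp
    finally have "\<bar>real_of_int j\<bar> / real N \<le> 2 * K" using N0 by (simp add: divide_le_eq)
    then have "wt (real N) j \<le> 3 * K" using K by (simp add: wt_def)
    then have "wt (real N) j ^ s \<le> (3 * K) ^ s" using w1[of j] by (intro power_mono) auto
    moreover have "3 * K > 0" using K by simp
    moreover have "wt (real N) j ^ s > 0" using w1[of j] by (intro zero_less_power) simp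
    ultimately show ?thesis unfolding \<kappa>_def using c N0
      by (intro divide_left_mono mult_left_mono mult_pos_pos zero_less_power[of "3 * K"]) auto
  qed
  have "(\<Sum>j\<in>J. 1 / (r j)\<^sup>2) \<le> 27 / \<kappa>\<^sup>2" unfolding r_def
  proof (rule spaced_inverse_squares[OF _ k])
    show "finite J" by (simp add: J_def)
    fix j l :: int assume j: "j \<in> J"
    then have "\<bar>j\<bar> \<le> 2 * int n" "j \<notin> R" by (auto simp: J_def)
    then show "\<bar>y j - of_int l\<bar> \<ge> \<kappa>" unfolding y_def using T[of j l] kl[of j] by linarith
  next
    fix i j l :: int assume ij: "i \<in> J" "j \<in> J" "i \<noteq> j"
    then have b: "\<bar>i - j\<bar> \<le> 2 * int n" by (auto simp: J_def)
    have "\<bar>of_int (i - j) * \<alpha> - of_int l\<bar> \<ge> c / (real N * wt (real N) (i - j) ^ s)"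
      using D[unfolded dioph_scale_def, rule_format, of "i - j" l] ij(3) by (simp del: of_int_diff)
    moreover have "y i - y j - of_int l = of_int (i - j) * \<alpha> - of_int l" by (simp add: y_def algebra_simps)
    ultimately show "\<bar>y i - y j - of_int l\<bar> \<ge> \<kappa>" using kl[OF b] by linarith
  qed
  note S = this
  have "(\<Sum>j\<in>J. (1 / norm (d j))\<^sup>2) \<le> (\<Sum>j\<in>J. 1 / (16 * (norm u)\<^sup>2) * (1 / (r j)\<^sup>2))"
  proof (rule sum_mono)
    fix j assume "j \<in> J"
    then have j: "j \<notin> R" by (simp add: J_def)
    have p: "norm u * (4 * \<bar>r j\<bar>) > 0" using u rpos[OF j] by simp
    have "1 / norm (d j) \<le> 1 / (norm u * (4 * \<bar>r j\<bar>))"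
      using dr[of j] p by (intro divide_left_mono mult_pos_pos dpos[OF j]) auto
    then have "(1 / norm (d j))\<^sup>2 \<le> (1 / (norm u * (4 * \<bar>r j\<bar>)))\<^sup>2" by (rule power_mono) simp
    also have "\<dots> = 1 / (16 * (norm u)\<^sup>2) * (1 / (r j)\<^sup>2)" by (simp add: power_divide power_mult_distrib)
    finally show "(1 / norm (d j))\<^sup>2 \<le> 1 / (16 * (norm u)\<^sup>2) * (1 / (r j)\<^sup>2)" .
  qed
  also have "\<dots> \<le> 1 / (16 * (norm u)\<^sup>2) * (27 / \<kappa>\<^sup>2)" unfolding sum_distrib_left[symmetric]
    using S by (intro mult_left_mono) auto
  also have "\<dots> \<le> (2 / (norm u * \<kappa>))\<^sup>2"
  proof -
    have "27 / 16 * (1 / (norm u * \<kappa>)\<^sup>2) \<le> 4 * (1 / (norm u * \<kappa>)\<^sup>2)" by (intro mult_right_mono) auto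
    then show ?thesis by (simp add: power_divide power_mult_distrib)
  qed
  finally have "L2_set (\<lambda>j. 1 / norm (d j)) J \<le> 2 / (norm u * \<kappa>)" unfolding L2_set_def
    using k by (intro real_le_lsqrt) auto
  also have "\<dots> = 2 * 3 ^ s / (c * norm u) * real N * K ^ s"
    using c N0 K u by (simp add: \<kappa>_def power_mult_distrib mult_ac)
  finally show "L2_set (\<lambda>j. 1 / norm (d j)) ({-int n..int n} - R) \<le> 2 * 3 ^ s / (c * norm u) * real N * K ^ s"
    unfolding J_def .
qed

text \<open>The divisor is at least the difference of the moduli, so already the number of frequencies, \<open>O(K * N)\<close>, is an
  adequate bound.\<close>

lemma hyperbolic_divisor_bound:
  fixes u v :: complex
  assumes N: "N \<ge> 1" and h: "norm u \<noteq> norm v" and s: "s \<ge> 1"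
  defines "h \<equiv> \<bar>norm u - norm v\<bar>"
  shows "chi j \<alpha> * u - v \<noteq> 0"
    and "K \<ge> 1 \<Longrightarrow> real n \<le> K * real N \<Longrightarrow>
      L2_set (\<lambda>j. 1 / norm (chi j \<alpha> * u - v)) {-int n..int n} \<le> 3 / h * real N * K ^ s"
proof -
  have h0: "h > 0" using h by (simp add: h_def)
  have g: "norm (chi j \<alpha> * u - v) \<ge> h" for j
    using norm_triangle_ineq3[of "chi j \<alpha> * u" v] by (simp add: h_def norm_mult)
  show "chi j \<alpha> * u - v \<noteq> 0" using g[of j] h0 by auto
  assume K: "K \<ge> 1" and n: "real n \<le> K * real N"
  have "L2_set (\<lambda>j. 1 / norm (chi j \<alpha> * u - v)) {-int n..int n} \<le> (\<Sum>j\<in>{-int n..int n}. 1 / norm (chi j \<alpha> * u - v))"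
    by (rule L2_set_le_sum) simp
  also have "\<dots> \<le> (\<Sum>j\<in>{-int n..int n}. 1 / h)"
    by (rule sum_mono, rule divide_left_mono[OF g]) (use h0 less_le_trans[OF h0 g] in \<open>simp_all del: zero_less_norm_iff\<close>)
  also have "\<dots> = (2 * real n + 1) / h" by simp
  also have "\<dots> \<le> 3 * (K * real N) / h"
  proof (rule divide_right_mono)
    have "1 * 1 \<le> K * real N" using K N by (intro mult_mono) auto
    then show "2 * real n + 1 \<le> 3 * (K * real N)" using n by linarith
  qed (use h0 in simp)
  also have "\<dots> \<le> 3 * (K ^ s * real N) / h"
  proof -
    have "K ^ 1 \<le> K ^ s" by (rule power_increasing[OF s K])
    then show ?thesis using h0 by (intro divide_right_mono mult_left_mono mult_right_mono) auto
  qed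
  finally show "L2_set (\<lambda>j. 1 / norm (chi j \<alpha> * u - v)) {-int n..int n} \<le> 3 / h * real N * K ^ s"
    by (simp add: mult_ac)
qed

lemma div_okI:
  assumes "\<And>a b j. j \<notin> res_set a b \<Longrightarrow> divisor \<alpha> l a b j \<noteq> 0"
    and "\<And>a b n K. K \<ge> 1 \<Longrightarrow> real n \<le> K * N \<Longrightarrow>
        L2_set (\<lambda>j. 1 / norm (divisor \<alpha> l a b j)) ({-int n..int n} - res_set a b) \<le> \<Lambda> a b * N * K ^ s"
    and "\<And>a b. \<Lambda> a b \<le> \<Lambda>'" and "N \<ge> 0"
  shows "div_ok \<alpha> l N \<Lambda>' s"
  unfolding div_ok_def
proof (intro conjI allI impI)
  fix a b :: 2 and n and K :: real assume K: "K \<ge> 1" "real n \<le> K * N"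
  have "\<Lambda> a b * N * K ^ s \<le> \<Lambda>' * N * K ^ s" using assms(3,4) K(1) by (intro mult_right_mono) auto
  with assms(2)[OF K] show "L2_set (\<lambda>j. 1 / norm (divisor \<alpha> l a b j)) ({-int n..int n} - res_set a b) \<le> \<Lambda>' * N * K ^ s"
    by (rule order_trans)
qed (use assms(1) in auto)

lemma diagonal_divisor: "divisor \<alpha> l a a j = l a * (cis (2 * pi * (of_int j * \<alpha> + 0)) - 1)"
  by (simp add: divisor_def chi_def algebra_simps)

lemma scale_mono:
  assumes "c' \<le> c"
  shows "dioph_scale \<alpha> c s N \<Longrightarrow> dioph_scale \<alpha> c' s N" and "transl_scale \<alpha> \<phi> c N \<Longrightarrow> transl_scale \<alpha> \<phi> c' N"
proof -
  have d: "c' / (real N * x) \<le> c / (real N * x)" if "x \<ge> 0" for x using assms that by (intro divide_right_mono) auto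
  have w: "wt (real N) j ^ k \<ge> 0" for j k by (simp add: wt_def)
  show "dioph_scale \<alpha> c s N \<Longrightarrow> dioph_scale \<alpha> c' s N"
    unfolding dioph_scale_def by (intro allI impI, rule order_trans[OF d[OF w]]) simp
  show "transl_scale \<alpha> \<phi> c N \<Longrightarrow> transl_scale \<alpha> \<phi> c' N"
    unfolding transl_scale_def by (intro allI, rule order_trans[OF d[OF w]]) simp
qed

text \<open>The off-diagonal divisors are, up to a unimodular factor, those of the phases \<open>\<plusminus> \<phi>\<close>; the two signs are exchanged by
  \<open>j \<mapsto> - j\<close>.\<close>

lemma elliptic_div_ok:
  assumes N: "N \<ge> 1" and c: "c > 0" and s: "s \<ge> 2" and D: "dioph_scale \<alpha> c s N" and T: "transl_scale \<alpha> \<phi> c N"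
  shows "div_ok \<alpha> (\<lambda>a. if a = 1 then cis (pi * \<phi>) else cis (- pi * \<phi>)) (real N) (2 * 3 ^ s / c) s"
proof -
  let ?l = "\<lambda>a::2. if a = 1 then cis (pi * \<phi>) else cis (- pi * \<phi>)"
  define \<psi> where "\<psi> a b = (if a = b then 0 else if a = 1 then - \<phi> else \<phi>)" for a b :: 2
  have e: "divisor \<alpha> ?l a b j = ?l a * (cis (2 * pi * (of_int j * \<alpha> + \<psi> a b)) - 1)" for a b j
    using exhaust_2[of a] exhaust_2[of b]
    by (auto simp: divisor_def chi_def \<psi>_def cis_mult algebra_simps)
  have u: "?l a \<noteq> 0" "norm (?l a) = 1" for a by auto
  have N0: "real N > 0" using N by simp
  have w1: "wt (real N) j \<ge> 1" for j by (simp add: wt_def)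
  have T2: "\<bar>of_int j * \<alpha> + \<phi> - of_int l\<bar> \<ge> c / (real N * wt (real N) j ^ s)" for j l :: int
  proof -
    have "wt (real N) j ^ 2 \<le> wt (real N) j ^ s" by (rule power_increasing[OF s w1])
    then have "c / (real N * wt (real N) j ^ s) \<le> c / (real N * wt (real N) j ^ 2)" using c N0 w1[of j]
      by (intro divide_left_mono mult_left_mono mult_pos_pos zero_less_power) auto
    also have "\<dots> \<le> \<bar>of_int j * \<alpha> + \<phi> - of_int l\<bar>" using T unfolding transl_scale_def by simp
    finally show ?thesis .
  qed
  have T3: "\<bar>of_int j * \<alpha> + \<psi> a b - of_int l\<bar> \<ge> c / (real N * wt (real N) j ^ s)" if "j \<notin> res_set a b" for a b and j l :: int
  proof (cases "a = b")
    case True then show ?thesis using D that by (simp add: \<psi>_def res_set_def dioph_scale_def)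
  next
    case False
    have "wt (real N) (- j) = wt (real N) j" by (simp add: wt_def)
    moreover have "\<bar>of_int j * \<alpha> + - \<phi> - of_int l\<bar> = \<bar>of_int (- j) * \<alpha> + \<phi> - of_int (- l)\<bar>" by simp
    ultimately show ?thesis using False T2[of j l] T2[of "- j" "- l"] unfolding \<psi>_def by (simp only: if_False) (auto simp only: split: if_split)
  qed
  show ?thesis
  proof (rule div_okI[where \<Lambda> = "\<lambda>a b. 2 * 3 ^ s / c"])
    fix a b :: 2 and j assume "j \<notin> res_set a b"
    then show "divisor \<alpha> ?l a b j \<noteq> 0" unfolding e
      by (intro rotation_divisor_bound(1)[OF N c D u(1)[of a] T3[of _ a b]])
  next
    fix a b :: 2 and n and K :: real assume K: "K \<ge> 1" "real n \<le> K * real N"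
    show "L2_set (\<lambda>j. 1 / norm (divisor \<alpha> ?l a b j)) ({-int n..int n} - res_set a b) \<le> 2 * 3 ^ s / c * real N * K ^ s"
      using rotation_divisor_bound(2)[OF N c D u(1)[of a] T3[of _ a b] K] unfolding e u(2) by simp
  qed auto
qed

lemma hyperbolic_div_ok:
  assumes c: "c > 0" and s: "s \<ge> 1" and l: "l 1 \<noteq> 0" "l 2 \<noteq> 0" "norm (l 1) \<noteq> norm (l 2)"
  shows "\<exists>\<Lambda>>0. \<forall>N\<ge>1. dioph_scale \<alpha> c s N \<longrightarrow> div_ok \<alpha> l (real N) \<Lambda> s"
proof -
  define L where "L a b = (if a = b then 2 * 3 ^ s / (c * norm (l a)) else 3 / \<bar>norm (l b) - norm (l a)\<bar>)" for a b :: 2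
  define \<Lambda> where "\<Lambda> = L 1 1 + L 2 2 + L 1 2 + L 2 1"
  have L0: "L a b \<ge> 0" for a b using c by (simp add: L_def)
  have Lle: "L a b \<le> \<Lambda>" for a b
    using exhaust_2[of a] exhaust_2[of b] L0[of 1 1] L0[of 1 2] L0[of 2 1] L0[of 2 2] unfolding \<Lambda>_def by (elim disjE) simp_all
  have "L 1 1 > 0" using c l(1) by (simp add: L_def)
  then have "\<Lambda> > 0" using Lle[of 1 1] by linarith
  moreover have "div_ok \<alpha> l (real N) \<Lambda> s" if N: "N \<ge> 1" and D: "dioph_scale \<alpha> c s N" for N
  proof (rule div_okI[where \<Lambda> = L])
    have la: "l a \<noteq> 0" for a using l(1,2) exhaust_2[of a] by auto
    have ne: "norm (l b) \<noteq> norm (l a)" if "a \<noteq> b" for a b using l(3) that exhaust_2[of a] exhaust_2[of b] by auto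
    have T: "\<bar>of_int j * \<alpha> + 0 - of_int i\<bar> \<ge> c / (real N * wt (real N) j ^ s)" if "j \<notin> res_set a a" for j i :: int and a
      using D that by (simp add: res_set_def dioph_scale_def)
    {
      fix a b :: 2 and j assume j: "j \<notin> res_set a b"
      show "divisor \<alpha> l a b j \<noteq> 0"
      proof (cases "a = b")
        case True
        show ?thesis using j unfolding True diagonal_divisor
          by (intro rotation_divisor_bound(1)[OF N c D la[of b] T[of _ b]]) simp
      next
        case False show ?thesis unfolding divisor_def by (rule hyperbolic_divisor_bound(1)[OF N ne[OF False] s])
      qed
    next
      fix a b :: 2 and n and K :: real assume K: "K \<ge> 1" "real n \<le> K * real N"
      show "L2_set (\<lambda>j. 1 / norm (divisor \<alpha> l a b j)) ({-int n..int n} - res_set a b) \<le> L a b * real N * K ^ s"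
      proof (cases "a = b")
        case True
        show ?thesis using rotation_divisor_bound(2)[OF N c D la[of b] T[of _ b] K] unfolding True diagonal_divisor L_def by simp
      next
        case False 
        have "res_set a b = {}" using False by (simp add: res_set_def)
        then show ?thesis using hyperbolic_divisor_bound(2)[OF N ne[OF False] s K, of \<alpha>] False unfolding divisor_def L_def by simp
      qed
    }
  qed (use Lle in auto)
  ultimately show ?thesis by blast
qed

section \<open>Smoothness of the conjugacy\<close>

text \<open>For each order \<open>r\<close> a single scale \<open>N\<close>, beyond the threshold that \<open>initial_approximation\<close> gives for the constants of
  \<open>iteration\<close>, bounds the coefficients by \<open>C * wt N j ^ (- r)\<close>. For fixed \<open>N\<close> this is decay of
  order \<open>r\<close>.\<close>

lemma conjugacy_smooth:
  fixes A B :: "real \<Rightarrow> complex^2^2" and l :: "2 \<Rightarrow> complex"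
  assumes A: "allent sper A" and B: "allent cper B" and det: "\<And>t. det (B t) = 1"
    and eq: "\<And>t. B (t + \<alpha>) ** dg l = A t ** B t"
    and L: "\<Lambda> > 0" and ok: "\<And>n0. \<exists>N\<ge>n0. N \<ge> 1 \<and> div_ok \<alpha> l (real N) \<Lambda> s"
  shows "allent sper B"
proof (rule allentI)
  fix a b
  show "sper (\<lambda>t. B t $ a $ b)"
  proof (rule rapid_imp_sper)
    show "cper (\<lambda>t. B t $ a $ b)" by (rule allentD[OF B])
    fix r0 :: nat
    define r where "r = Suc r0"
    have r: "r \<ge> 1" by (simp add: r_def)
    obtain e0 m where e0: "0 < e0" "e0 \<le> 1/8" and it: "\<forall>N \<alpha> l W F Z B d. N \<ge> 1 \<longrightarrow> div_ok \<alpha> l N \<Lambda> s \<longrightarrow>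
        allent (tp d) W \<longrightarrow> (\<forall>t. W t ** Z t = B t) \<longrightarrow> near_const \<alpha> l N m F Z e0 (e0 / N) (e0 / N) \<longrightarrow>
        (\<exists>C. \<forall>a b j. norm (fc (\<lambda>t. B t $ a $ b) j) * wt N j ^ r \<le> C)"
      using iteration[OF L r, of s] by (elim exE conjE) (rule that)
    obtain N0 :: nat where N0: "N0 \<ge> 1" "\<And>N. N \<ge> N0 \<Longrightarrow> \<exists>W F Z. allent (tp N) W \<and>
        (\<forall>t. W t ** Z t = B t) \<and> near_const \<alpha> l (real N) m F Z e0 (e0 / real N) (e0 / real N)"
      by (rule initial_approximation[OF A B det eq e0(1), of m]) blast
    obtain N where N: "N \<ge> N0" "N \<ge> 1" "div_ok \<alpha> l (real N) \<Lambda> s" using ok[of N0] by blast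
    obtain W F Z where W: "allent (tp N) W" "\<forall>t. W t ** Z t = B t" "near_const \<alpha> l (real N) m F Z e0 (e0 / real N) (e0 / real N)"
      using N0(2)[OF N(1)] by blast
    have N1: "real N \<ge> 1" using N(2) by simp
    have "\<exists>C. \<forall>a b j. norm (fc (\<lambda>t. B t $ a $ b) j) * wt (real N) j ^ r \<le> C"
      by (rule it[rule_format, OF N1 N(3) W(1) _ W(3)]) (rule W(2)[rule_format])
    then obtain C where C: "\<And>a b j. norm (fc (\<lambda>t. B t $ a $ b) j) * wt (real N) j ^ r \<le> C" by blast
    have "norm (fc (\<lambda>t. B t $ a $ b) j) * (1 + \<bar>of_int j\<bar>) ^ r0 \<le> C * real N ^ r" for j
    proof -
      have "(1 + \<bar>real_of_int j\<bar>) ^ r0 \<le> (1 + \<bar>real_of_int j\<bar>) ^ r" by (rule power_increasing) (auto simp: r_def)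
      also have "\<dots> \<le> (real N * wt (real N) j) ^ r"
        using N1 by (intro power_mono) (auto simp: wt_def field_simps)
      also have "\<dots> = real N ^ r * wt (real N) j ^ r" by (rule power_mult_distrib)
      finally have "norm (fc (\<lambda>t. B t $ a $ b) j) * (1 + \<bar>of_int j\<bar>) ^ r0 \<le> norm (fc (\<lambda>t. B t $ a $ b) j) * (real N ^ r * wt (real N) j ^ r)"
        by (rule mult_left_mono) simp
      also have "\<dots> = (norm (fc (\<lambda>t. B t $ a $ b) j) * wt (real N) j ^ r) * real N ^ r" by (simp only: mult_ac)
      also have "\<dots> \<le> C * real N ^ r" by (rule mult_right_mono[OF C]) simp
      finally show ?thesis .
    qed
    then show "\<exists>C. \<forall>j. norm (fc (\<lambda>t. B t $ a $ b) j) * (1 + \<bar>of_int j\<bar>) ^ r0 \<le> C" by blast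
  qed
qed

section \<open>Haar-null sets\<close>

lemma SL2_closed: "closed SL2"
proof -
  have "continuous_on UNIV (\<lambda>X::real^2^2. det X)" unfolding det_2 by (intro continuous_intros)
  then have "closed ((\<lambda>X::real^2^2. det X) -` {1})" by (rule closed_vimage[OF closed_singleton, rotated]) 
  moreover have "(\<lambda>X::real^2^2. det X) -` {1} = SL2" by (auto simp: SL2_def)
  ultimately show ?thesis by simp
qed

lemma haar_space: assumes "haar_measure_SL2 M" shows "space M = SL2"
proof -
  have "sets M = sets (restrict_space borel SL2)" using assms by (simp add: haar_measure_SL2_def)
  then have "space M = space (restrict_space borel SL2 :: (real^2^2) measure)" by (rule sets_eq_imp_space_eq)
  then show ?thesis by (simp add: space_restrict_space)
qed

lemma haar_sets: assumes "haar_measure_SL2 M" "S \<in> sets borel" shows "S \<inter> SL2 \<in> sets M"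
proof -
  have "SL2 \<inter> S \<in> sets (restrict_space borel SL2)" 
    unfolding sets_restrict_space using assms(2) by blast
  then show ?thesis using assms(1) by (simp add: haar_measure_SL2_def Int_commute)
qed

text \<open>Balls meet \<open>SL2\<close> in compact sets.\<close>

lemma haar_sigma_finite: assumes M: "haar_measure_SL2 M" shows "sigma_finite_measure M"
proof
  let ?A = "range (\<lambda>n::nat. cball 0 (real n) \<inter> SL2)"
  have "?A \<subseteq> sets M" using haar_sets[OF M] by auto
  moreover have "\<Union>?A = space M"
  proof -
    have "\<exists>n::nat. X \<in> cball 0 (real n)" for X :: "real^2^2" using real_arch_simple[of "norm X"] by simp
    then show ?thesis unfolding haar_space[OF M] by blast
  qed
  moreover have "\<forall>a\<in>?A. emeasure M a \<noteq> \<infinity>"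
  proof
    fix a assume "a \<in> ?A"
    then obtain n :: nat where a: "a = cball 0 (real n) \<inter> SL2" by blast
    have "compact a" unfolding a by (rule compact_Int_closed[OF compact_cball SL2_closed])
    then have "emeasure M a < \<infinity>" using M a unfolding haar_measure_SL2_def by blast
    then show "emeasure M a \<noteq> \<infinity>" by simp
  qed
  ultimately show "\<exists>A. countable A \<and> A \<subseteq> sets M \<and> \<Union>A = space M \<and> (\<forall>a\<in>A. emeasure M a \<noteq> \<infinity>)"
    by (intro exI[of _ ?A] conjI) auto
qed

lemma SL2_mult: "X \<in> SL2 \<Longrightarrow> Y \<in> SL2 \<Longrightarrow> X ** Y \<in> SL2"
  by (simp add: SL2_def det_mul)

text \<open>Compute the product measure of \<open>{(t, X). g t ** X \<in> S}\<close> in two ways. Slices at fixed \<open>X\<close> are null by hypothesis;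
  slices at fixed \<open>t\<close> are left translates of \<open>S\<close>, all of the same measure. As the line has infinite
  length, that measure is 0.\<close>

lemma haar_null_if_null_on_curves:
  fixes g :: "real \<Rightarrow> real^2^2"
  assumes M: "haar_measure_SL2 M" and g: "continuous_on UNIV g" "\<And>t. g t \<in> SL2" "\<And>t. g t ** g (-t) = mat 1"
    and S: "S \<in> sets borel" and nul: "\<And>X. X \<in> SL2 \<Longrightarrow> emeasure lborel {t. g t ** X \<in> S} = 0"
  shows "emeasure M (S \<inter> SL2) = 0"
proof -
  interpret M: sigma_finite_measure M by (rule haar_sigma_finite[OF M])
  interpret P: pair_sigma_finite lborel M by standard
  note sp = haar_space[OF M]
  define H where "H = (\<lambda>p. g (fst p) ** snd p) -` S \<inter> space (lborel \<Otimes>\<^sub>M M)"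
  have c: "continuous_on UNIV (\<lambda>p::real \<times> (real^2^2). g (fst p) ** snd p)"
    unfolding matrix_matrix_mult_def
    by (intro continuous_intros continuous_on_vec_lambda continuous_on_compose2[OF g(1)]) auto
  have idm: "(\<lambda>X. X) \<in> borel_measurable M"
  proof -
    have "(\<lambda>X. X) \<in> borel_measurable (restrict_space borel SL2 :: (real^2^2) measure)" by (intro measurable_restrict_space1) simp
    then show ?thesis using M measurable_cong_sets[of M "restrict_space borel SL2" borel borel]
      by (auto simp: haar_measure_SL2_def)
  qed
  have "(\<lambda>p. g (fst p) ** snd p) \<in> borel_measurable (lborel \<Otimes>\<^sub>M M)"
  proof -
    have "(\<lambda>p. (fst p, snd p)) \<in> measurable (lborel \<Otimes>\<^sub>M M) (borel \<Otimes>\<^sub>M borel)"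
      using measurable_compose[OF measurable_snd idm] by (intro measurable_Pair) auto
    then have "(\<lambda>p. (fst p, snd p)) \<in> measurable (lborel \<Otimes>\<^sub>M M) borel" unfolding borel_prod .
    from measurable_compose[OF this borel_measurable_continuous_onI[OF c]] show ?thesis by simp
  qed
  then have H: "H \<in> sets (lborel \<Otimes>\<^sub>M M)" unfolding H_def by (rule measurable_sets[OF _ S])
  have in1: "Pair t -` H = (\<lambda>X. g (- t) ** X) ` (S \<inter> SL2)" for t
  proof -
    have i: "g t ** (g (-t) ** X) = X" "g (-t) ** (g t ** X) = X" for X
      using g(3)[of t] g(3)[of "-t"] by (simp_all add: matrix_mul_assoc)
    have "X \<in> (\<lambda>X. g (- t) ** X) ` (S \<inter> SL2)" if "g t ** X \<in> S" "X \<in> SL2" for X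
      using that SL2_mult[OF g(2)] by (intro image_eqI[of _ _ "g t ** X"]) (simp_all only: i Int_iff)
    then show ?thesis by (auto simp: H_def space_pair_measure sp i intro: SL2_mult g(2))
  qed
  have "(\<integral>\<^sup>+t. emeasure M (S \<inter> SL2) \<partial>lborel) = (\<integral>\<^sup>+t. emeasure M (Pair t -` H) \<partial>lborel)"
    using M g(2) haar_sets[OF M S] unfolding in1 haar_measure_SL2_def by simp
  also have "\<dots> = emeasure (lborel \<Otimes>\<^sub>M M) H" by (rule M.emeasure_pair_measure_alt[OF H, symmetric])
  also have "\<dots> = (\<integral>\<^sup>+X. emeasure lborel ((\<lambda>t. (t, X)) -` H) \<partial>M)" by (rule P.emeasure_pair_measure_alt2[OF H])
  also have "\<dots> = (\<integral>\<^sup>+X. 0 \<partial>M)"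
  proof (rule nn_integral_cong)
    fix X assume "X \<in> space M"
    then have X: "X \<in> SL2" by (simp add: sp)
    then have "(\<lambda>t. (t, X)) -` H = {t. g t ** X \<in> S}" by (auto simp: H_def space_pair_measure sp)
    then show "emeasure lborel ((\<lambda>t. (t, X)) -` H) = 0" using nul[OF X] by simp
  qed
  finally have "emeasure M (S \<inter> SL2) * emeasure lborel (UNIV :: real set) = 0" by simp
  then show ?thesis by simp
qed

text \<open>Under the lower unipotent group the lower left entry becomes \<open>t * X$1$1 + X$2$1\<close>, which vanishes for at most one \<open>t\<close>,
  since the first column is nonzero.\<close>

lemma haar_null_lower_left_zero:
  assumes M: "haar_measure_SL2 M" shows "emeasure M ({X. X$2$1 = 0} \<inter> SL2) = 0"
proof (rule haar_null_if_null_on_curves[OF M])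
  define g :: "real \<Rightarrow> real^2^2" where "g t = (\<chi> i j. if i = j then 1 else if i = 2 then t else 0)" for t
  have e: "g t $ 1 $ 1 = 1" "g t $ 1 $ 2 = 0" "g t $ 2 $ 1 = t" "g t $ 2 $ 2 = 1" for t by (simp_all add: g_def)
  have "continuous_on UNIV (\<lambda>t. if i = j then 1 else if i = 2 then t else (0::real))" for i j :: 2
    by (cases "i = j"; cases "i = 2") simp_all
  then show "continuous_on UNIV g" unfolding g_def
    by (rule continuous_on_vec_lambda[OF continuous_on_vec_lambda])
  show "g t \<in> SL2" for t by (simp add: SL2_def det_2 e)
  show "g t ** g (- t) = mat 1" for t
    by (simp add: vec_eq_iff forall_2 matrix_matrix_mult_def sum_2 e mat_def)
  show "{X::real^2^2. X$2$1 = 0} \<in> sets borel"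
    by (intro borel_closed closed_Collect_eq continuous_intros)
  fix X :: "real^2^2" assume X: "X \<in> SL2"
  have "{t. g t ** X \<in> {X. X$2$1 = 0}} \<subseteq> {- X$2$1 / X$1$1}"
  proof
    fix t assume "t \<in> {t. g t ** X \<in> {X. X$2$1 = 0}}"
    then have t: "t * X$1$1 + X$2$1 = 0" by (simp add: matrix_matrix_mult_def sum_2 e)
    have "X$1$1 \<noteq> 0" using X t by (auto simp: SL2_def det_2)
    then show "t \<in> {- X$2$1 / X$1$1}" using t by (simp add: field_simps)
  qed
  then have "countable {t. g t ** X \<in> {X. X$2$1 = 0}}" by (rule countable_subset) simp
  then show "emeasure lborel {t. g t ** X \<in> {X. X$2$1 = 0}} = 0" by (rule emeasure_lborel_countable)
qed

text \<open>Under the upper unipotent group the trace becomes \<open>tr X + t * X$2$1\<close>, and the lower left entry is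
  unchanged.\<close>

lemma haar_null_trace:
  assumes M: "haar_measure_SL2 M" and N: "N \<in> null_sets lborel"
  shows "emeasure M ({X. X$2$1 \<noteq> 0 \<and> X$1$1 + X$2$2 \<in> N} \<inter> SL2) = 0"
proof (rule haar_null_if_null_on_curves[OF M])
  define g :: "real \<Rightarrow> real^2^2" where "g t = (\<chi> i j. if i = j then 1 else if i = 1 then t else 0)" for t
  have e: "g t $ 1 $ 1 = 1" "g t $ 1 $ 2 = t" "g t $ 2 $ 1 = 0" "g t $ 2 $ 2 = 1" for t by (simp_all add: g_def)
  have "continuous_on UNIV (\<lambda>t. if i = j then 1 else if i = 1 then t else (0::real))" for i j :: 2
    by (cases "i = j"; cases "i = 1") simp_all
  then show "continuous_on UNIV g" unfolding g_def
    by (rule continuous_on_vec_lambda[OF continuous_on_vec_lambda])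
  show "g t \<in> SL2" for t by (simp add: SL2_def det_2 e)
  show "g t ** g (- t) = mat 1" for t
    by (simp add: vec_eq_iff forall_2 matrix_matrix_mult_def sum_2 e mat_def)
  have Nb: "N \<in> sets borel" using N by auto
  have "{X::real^2^2. X$2$1 = 0} \<in> sets borel" by (intro borel_closed closed_Collect_eq continuous_intros)
  moreover have "{X::real^2^2. X$1$1 + X$2$2 \<in> N} \<in> sets borel"
  proof -
    have "(\<lambda>X::real^2^2. X$1$1 + X$2$2) \<in> borel_measurable borel"
      by (intro borel_measurable_continuous_onI continuous_intros)
    from measurable_sets[OF this Nb] show ?thesis by (simp add: vimage_def)
  qed
  ultimately have "{X::real^2^2. X$1$1 + X$2$2 \<in> N} - {X. X$2$1 = 0} \<in> sets borel" by (intro sets.Diff)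
  moreover have "{X::real^2^2. X$1$1 + X$2$2 \<in> N} - {X. X$2$1 = 0} = {X. X$2$1 \<noteq> 0 \<and> X$1$1 + X$2$2 \<in> N}" by auto
  ultimately show "{X::real^2^2. X$2$1 \<noteq> 0 \<and> X$1$1 + X$2$2 \<in> N} \<in> sets borel" by simp
  fix X :: "real^2^2" assume X: "X \<in> SL2"
  show "emeasure lborel {t. g t ** X \<in> {X. X$2$1 \<noteq> 0 \<and> X$1$1 + X$2$2 \<in> N}} = 0"
  proof (cases "X$2$1 = 0")
    case True then show ?thesis by (simp add: matrix_matrix_mult_def sum_2 e)
  next
    case False
    define T where "T t = (X$1$1 + X$2$2) + X$2$1 * t" for t
    have Tm: "T \<in> borel_measurable lborel" unfolding T_def by simp
    have "{t. g t ** X \<in> {X. X$2$1 \<noteq> 0 \<and> X$1$1 + X$2$2 \<in> N}} = T -` N"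
      using False by (auto simp: matrix_matrix_mult_def sum_2 e T_def algebra_simps)
    moreover have "emeasure lborel (T -` N) = 0"
    proof -
      have "0 = emeasure lborel N" by (rule null_setsD1[OF N, symmetric])
      also have "\<dots> = emeasure (density (distr lborel borel T) (\<lambda>_. ennreal \<bar>X$2$1\<bar>)) N"
        using lborel_real_affine[OF False, of "X$1$1 + X$2$2"] unfolding T_def by simp
      also have "\<dots> = ennreal \<bar>X$2$1\<bar> * emeasure (distr lborel borel T) N"
        using Nb by (intro emeasure_density_const) simp
      also have "emeasure (distr lborel borel T) N = emeasure lborel (T -` N)"
        using Tm Nb by (simp add: emeasure_distr)
      finally show ?thesis using False by simp
    qed
    ultimately show ?thesis by simp
  qed
qed

lemma generic_matrices_total:
  assumes N: "N \<in> null_sets lborel"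
  shows "total_haar_measure {X\<in>SL2. X$2$1 \<noteq> 0 \<and> X$1$1 + X$2$2 \<notin> N}"
  unfolding total_haar_measure_def
proof (intro conjI allI impI)
  fix M assume M: "haar_measure_SL2 M"
  let ?U = "{X. X$2$1 = 0} \<inter> SL2" and ?V = "{X. X$2$1 \<noteq> 0 \<and> X$1$1 + X$2$2 \<in> N} \<inter> SL2"
  have "?U \<in> sets M" by (intro haar_sets[OF M] borel_closed closed_Collect_eq continuous_intros)
  then have U: "?U \<in> null_sets M" using haar_null_lower_left_zero[OF M] by auto
  have "?V \<in> sets M"
  proof (rule haar_sets[OF M])
    have "{X::real^2^2. X$2$1 = 0} \<in> sets borel" by (intro borel_closed closed_Collect_eq continuous_intros)
    moreover have "{X::real^2^2. X$1$1 + X$2$2 \<in> N} \<in> sets borel"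
    proof -
      have "(\<lambda>X::real^2^2. X$1$1 + X$2$2) \<in> borel_measurable borel"
        by (intro borel_measurable_continuous_onI continuous_intros)
      from measurable_sets[OF this, of N] show ?thesis using N by (auto simp: vimage_def)
    qed
    ultimately have "{X::real^2^2. X$1$1 + X$2$2 \<in> N} - {X. X$2$1 = 0} \<in> sets borel" by (intro sets.Diff)
    moreover have "{X::real^2^2. X$1$1 + X$2$2 \<in> N} - {X. X$2$1 = 0} = {X. X$2$1 \<noteq> 0 \<and> X$1$1 + X$2$2 \<in> N}" by auto
    ultimately show "{X::real^2^2. X$2$1 \<noteq> 0 \<and> X$1$1 + X$2$2 \<in> N} \<in> sets borel" by simp
  qed
  then have V: "?V \<in> null_sets M" using haar_null_trace[OF M N] by auto
  show "AE X in M. X \<in> {X \<in> SL2. X$2$1 \<noteq> 0 \<and> X$1$1 + X$2$2 \<notin> N}"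
    by (rule AE_I'[OF null_sets.Un[OF U V]]) (auto simp: haar_space[OF M])
qed auto

section \<open>Generic constant cocycles\<close>

definition cmat :: "real^2^2 \<Rightarrow> complex^2^2" where
  "cmat X = (\<chi> a b. of_real (X $ a $ b))"

lemma cmat_entry: "cmat X $ a $ b = of_real (X $ a $ b)" by (simp add: cmat_def)

lemma cmat_mult: "cmat (X ** Y) = cmat X ** cmat Y"
  by (simp add: mat_eq_2 mm_entry cmat_entry)

lemma det_cmat: "det (cmat X) = of_real (det X)"
  by (simp add: det_2 cmat_entry)

text \<open>The map from phases to traces is differentiable and therefore preserves null sets. Enclosing the image in a Borel null set
  makes it measurable for the Haar measure, which lives on Borel sets.\<close>

lemma exceptional_traces_null:
  assumes S: "\<And>n. \<exists>N\<ge>n. N \<ge> 1 \<and> S N"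
  obtains T where "T \<in> null_sets lborel" "2 \<in> T" "-2 \<in> T" "\<And>\<phi>. \<phi> \<in> exceptional_phases \<alpha> S \<Longrightarrow> 2 * cos (pi * \<phi>) \<in> T"
proof -
  let ?T = "(\<lambda>\<phi>. 2 * cos (pi * \<phi>)) ` exceptional_phases \<alpha> S \<union> {2, -2}"
  have "negligible (exceptional_phases \<alpha> S)" using exceptional_phases_null[OF S] by (simp add: negligible_iff_null_sets)
  then have "negligible ((\<lambda>\<phi>. 2 * cos (pi * \<phi>)) ` exceptional_phases \<alpha> S)"
  proof (rule negligible_differentiable_image_negligible[OF order_refl])
    show "(\<lambda>\<phi>. 2 * cos (pi * \<phi>)) differentiable_on exceptional_phases \<alpha> S"
      unfolding differentiable_on_def
    proof
      fix x
      have "((\<lambda>\<phi>. 2 * cos (pi * \<phi>)) has_real_derivative (2 * (- sin (pi * x) * pi))) (at x within exceptional_phases \<alpha> S)"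
        by (auto intro!: derivative_eq_intros)
      then show "(\<lambda>\<phi>. 2 * cos (pi * \<phi>)) differentiable at x within exceptional_phases \<alpha> S"
        by (meson differentiable_def has_field_derivative_def)
    qed
  qed
  then have "negligible ?T" by (rule negligible_Un) (rule negligible_finite, simp)
  then have "?T \<in> null_sets (completion lborel)" by (simp add: negligible_iff_null_sets)
  then obtain T where "T \<in> null_sets lborel" "?T \<subseteq> T" unfolding null_sets_completion_iff2 by blast
  then show thesis by (intro that[of T]) auto
qed

text \<open>Traces of absolute value below 2 correspond to phases, \<open>\<tau> = 2 * cos (pi * \<phi>)\<close>, and those above 2 to real eigenvalues
  \<open>(\<tau> \<plusminus> sqrt (\<tau>\<^sup>2 - 4)) / 2\<close> of different moduli.\<close>

lemma eigenvalues_div_ok: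
  fixes \<tau> :: real
  assumes c: "c > 0" and s: "s \<ge> 2" and D: "\<And>n0. \<exists>N\<ge>n0. N \<ge> 1 \<and> dioph_scale \<alpha> c s N"
    and t2: "\<tau> \<noteq> 2" "\<tau> \<noteq> -2" and ne: "\<And>\<phi>. \<tau> = 2 * cos (pi * \<phi>) \<Longrightarrow> \<phi> \<notin> exceptional_phases \<alpha> (dioph_scale \<alpha> c s)"
  obtains l :: "2 \<Rightarrow> complex" and \<Lambda> where "l 1 * l 2 = 1" "l 1 + l 2 = of_real \<tau>" "\<Lambda> > 0"
    "\<And>n0. \<exists>N\<ge>n0. N \<ge> 1 \<and> div_ok \<alpha> l (real N) \<Lambda> s"
proof (cases "\<bar>\<tau>\<bar> < 2")
  case True
  define \<phi> where "\<phi> = arccos (\<tau> / 2) / pi"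
  have "\<tau> = 2 * cos (pi * \<phi>)" using True by (simp add: \<phi>_def)
  moreover have "\<phi> \<in> {0..1}"
    using True arccos_lbound[of "\<tau> / 2"] arccos_ubound[of "\<tau> / 2"] by (simp add: \<phi>_def)
  ultimately obtain c' where c': "c' > 0" "\<And>n. \<exists>N\<ge>n. dioph_scale \<alpha> c s N \<and> transl_scale \<alpha> \<phi> c' N"
    using ne[of \<phi>] unfolding exceptional_phases_def by blast
  define d where "d = min c c'"
  have d: "d > 0" "d \<le> c" "d \<le> c'" using c c'(1) by (auto simp: d_def)
  let ?l = "\<lambda>a::2. if a = 1 then cis (pi * \<phi>) else cis (- pi * \<phi>)"
  show thesis
  proof (rule that[of ?l "2 * 3 ^ s / d"])
    show "?l 1 * ?l 2 = 1" by (simp add: cis_mult)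
    show "?l 1 + ?l 2 = of_real \<tau>" using \<open>\<tau> = 2 * cos (pi * \<phi>)\<close> by (simp add: complex_eq_iff)
    show "2 * 3 ^ s / d > 0" using d by simp
    fix n0
    obtain N where N: "N \<ge> max n0 1" "dioph_scale \<alpha> c s N" "transl_scale \<alpha> \<phi> c' N" using c'(2) by blast
    have "div_ok \<alpha> ?l (real N) (2 * 3 ^ s / d) s"
      using N(1) by (intro elliptic_div_ok[OF _ d(1) s scale_mono(1)[OF d(2) N(2)] scale_mono(2)[OF d(3) N(3)]]) simp
    then show "\<exists>N\<ge>n0. N \<ge> 1 \<and> div_ok \<alpha> ?l (real N) (2 * 3 ^ s / d) s" using N(1) by auto
  qed
next
  case False
  then have t: "\<bar>\<tau>\<bar> > 2" using t2 by linarith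
  define q where "q = sqrt (\<tau>\<^sup>2 - 4)"
  have "2\<^sup>2 < \<bar>\<tau>\<bar>\<^sup>2" by (rule power_strict_mono[OF t]) simp_all
  then have q: "q > 0" "q\<^sup>2 = \<tau>\<^sup>2 - 4" by (auto simp: q_def)
  define u where "u = (\<tau> + q) / 2"
  define v where "v = (\<tau> - q) / 2"
  have uv: "u * v = 1" "u + v = \<tau>"
    using q(2) by (auto simp: u_def v_def field_simps power2_eq_square)
  have "u\<^sup>2 - v\<^sup>2 = \<tau> * q" by (simp add: u_def v_def field_simps power2_eq_square)
  then have "\<bar>u\<bar> \<noteq> \<bar>v\<bar>" using t q(1) by (metis abs_eq_iff' abs_zero eq_iff_diff_eq_0 mult_eq_0_iff not_numeral_less_zero order_less_irrefl power2_abs)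
  define l :: "2 \<Rightarrow> complex" where "l a = (if a = 1 then of_real u else of_real v)" for a
  have l: "l 1 = of_real u" "l 2 = of_real v" by (simp_all add: l_def)
  have uv0: "u \<noteq> 0" "v \<noteq> 0" using uv(1) by auto
  obtain \<Lambda> where L: "\<Lambda> > 0" "\<And>N. N \<ge> 1 \<Longrightarrow> dioph_scale \<alpha> c s N \<Longrightarrow> div_ok \<alpha> l (real N) \<Lambda> s"
    using hyperbolic_div_ok[OF c, of s l \<alpha>] s uv0 \<open>\<bar>u\<bar> \<noteq> \<bar>v\<bar>\<close> unfolding l by auto
  show thesis
  proof (rule that[of l \<Lambda>])
    show "l 1 * l 2 = 1" unfolding l of_real_mult[symmetric] uv(1) by simp
    show "l 1 + l 2 = of_real \<tau>" unfolding l of_real_add[symmetric] uv(2) by simp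
    show "\<Lambda> > 0" by (rule L(1))
    show "\<exists>N\<ge>n0. N \<ge> 1 \<and> div_ok \<alpha> l (real N) \<Lambda> s" for n0 using D[of n0] L(2) by blast
  qed
qed

text \<open>The columns \<open>(l b - X$2$2, X$2$1)\<close> are eigenvectors, independent because \<open>X$2$1 \<noteq> 0\<close>. Dividing by a square
  root of the determinant makes the determinant 1, which \<open>conjugacy_smooth\<close> requires.\<close>

lemma diagonalisation:
  fixes X :: "real^2^2" and l :: "2 \<Rightarrow> complex"
  assumes X: "det X = 1" "X$2$1 \<noteq> 0" and l: "l 1 * l 2 = 1" "l 1 + l 2 = of_real (X$1$1 + X$2$2)" "l 1 \<noteq> l 2"
  obtains Q where "det Q = 1" "cmat X ** Q = Q ** dg l"
proof -
  define k where "k = csqrt (of_real (X$2$1) * (l 1 - l 2))"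
  have k2: "k * k = of_real (X$2$1) * (l 1 - l 2)" unfolding k_def power2_eq_square[symmetric] by simp
  then have k0: "k \<noteq> 0" using X(2) l(3) by auto
  define Q :: "complex^2^2" where "Q = (\<chi> a b. (if a = 1 then l b - of_real (X$2$2) else of_real (X$2$1)) / k)"
  have Q: "Q$1$b = (l b - of_real (X$2$2)) / k" "Q$2$b = of_real (X$2$1) / k" for b by (simp_all add: Q_def)
  have "det Q = (of_real (X$2$1) * (l 1 - l 2)) / (k * k)" 
    by (simp add: det_2 Q diff_divide_distrib[symmetric]) (simp add: algebra_simps)
  then have dQ: "det Q = 1" using k2 X(2) l(3) by simp
  have "complex_of_real (X$1$1 * X$2$2 - X$1$2 * X$2$1) = 1" using X(1) by (simp add: det_2)
  then have dX: "complex_of_real (X$1$2) * of_real (X$2$1) = of_real (X$1$1) * of_real (X$2$2) - 1" by (simp add: algebra_simps)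
  have tr: "complex_of_real (X$1$1) = l 1 + l 2 - of_real (X$2$2)" using l(2) by simp
  have "of_real (X$1$1) * (l b - of_real (X$2$2)) + of_real (X$1$2) * of_real (X$2$1) = (l b - of_real (X$2$2)) * l b" for b
  proof -
    have "l b * l b = l b * (l 1 + l 2) - 1" using l(1) exhaust_2[of b] by (auto simp: algebra_simps)
    then show ?thesis unfolding dX tr by (simp add: algebra_simps)
  qed
  then have e: "(of_real (X$1$1) * (l b - of_real (X$2$2)) + of_real (X$1$2) * of_real (X$2$1)) / k = (l b - of_real (X$2$2)) * l b / k" for b
    by simp
  have "(cmat X ** Q) $ 1 $ b = (Q ** dg l) $ 1 $ b" for b
  proof -
    have "(cmat X ** Q) $ 1 $ b = (of_real (X$1$1) * (l b - of_real (X$2$2)) + of_real (X$1$2) * of_real (X$2$1)) / k"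
      by (simp add: mm_entry cmat_entry Q add_divide_distrib)
    then show ?thesis unfolding e dg_right Q by simp
  qed
  moreover have "(cmat X ** Q) $ 2 $ b = (Q ** dg l) $ 2 $ b" for b
  proof -
    have "(cmat X ** Q) $ 2 $ b = (of_real (X$2$1) * (l b - of_real (X$2$2)) + of_real (X$2$2) * of_real (X$2$1)) / k"
      by (simp add: mm_entry cmat_entry Q add_divide_distrib)
    also have "of_real (X$2$1) * (l b - of_real (X$2$2)) + of_real (X$2$2) * of_real (X$2$1) = of_real (X$2$1) * l b"
      by (simp add: algebra_simps)
    finally show ?thesis unfolding dg_right Q by simp
  qed
  ultimately have "(cmat X ** Q) $ a $ b = (Q ** dg l) $ a $ b" for a b
    using exhaust_2[of a] by auto
  then have "cmat X ** Q = Q ** dg l" by (simp add: vec_eq_iff)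
  then show thesis by (rule that[OF dQ])
qed

lemma smooth_matrix_iff_entries:
  "smooth F \<longleftrightarrow> (\<forall>a b. smooth (\<lambda>t. complex_of_real (F t $ a $ b)))" for F :: "real \<Rightarrow> real^2^2"
proof
  assume F: "smooth F"
  have bl: "bounded_linear (\<lambda>M::real^2^2. complex_of_real (M $ a $ b))" for a b
    by (rule bounded_linear_compose[OF bounded_linear_of_real bounded_linear_compose[OF bounded_linear_vec_nth bounded_linear_vec_nth]])
  show "\<forall>a b. smooth (\<lambda>t. complex_of_real (F t $ a $ b))"
    using F unfolding smooth_iff_Ck by (intro allI Ck_bounded_linear[OF bl]) blast
next
  assume e: "\<forall>a b. smooth (\<lambda>t. complex_of_real (F t $ a $ b))"
  define h :: "2 \<Rightarrow> 2 \<Rightarrow> complex \<Rightarrow> real^2^2" where "h a b z = (\<chi> i j. if i = a \<and> j = b then Re z else 0)" for a b z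
  have "linear (h a b)" for a b by (rule linearI) (auto simp: h_def vec_eq_iff)
  then have bl: "bounded_linear (h a b)" for a b by (simp add: linear_conv_bounded_linear)
  have "Ck k (\<lambda>t. h a b (of_real (F t $ a $ b)))" for k a b
    using e unfolding smooth_iff_Ck by (intro Ck_bounded_linear[OF bl]) blast
  then have "Ck k (\<lambda>t. h 1 1 (of_real (F t $ 1 $ 1)) + h 1 2 (of_real (F t $ 1 $ 2)) + h 2 1 (of_real (F t $ 2 $ 1)) + h 2 2 (of_real (F t $ 2 $ 2)))" for k
    by (intro Ck_add)
  moreover have "h 1 1 (of_real (F t $ 1 $ 1)) + h 1 2 (of_real (F t $ 1 $ 2)) + h 2 1 (of_real (F t $ 2 $ 1)) + h 2 2 (of_real (F t $ 2 $ 2)) = F t" for t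
    by (simp add: vec_eq_iff forall_2 h_def)
  ultimately show "smooth F" unfolding smooth_iff_Ck by simp
qed

lemma allent_sper_cmat:
  assumes per: "\<And>t. F (t + 1) = F t" and F: "continuous_on UNIV F"
  shows "allent cper (\<lambda>t. cmat (F t))" and "smooth F \<longleftrightarrow> allent sper (\<lambda>t. cmat (F t))"
proof -
  show c: "allent cper (\<lambda>t. cmat (F t))" unfolding allent_def cper_def cmat_entry
    using per by (auto intro!: continuous_intros F)
  show "smooth F \<longleftrightarrow> allent sper (\<lambda>t. cmat (F t))"
    unfolding smooth_matrix_iff_entries using c unfolding allent_def sper_def cmat_entry by blast
qed

lemma smooth_continuous: "smooth f \<Longrightarrow> continuous_on UNIV f"
  unfolding smooth_def by (metis continuous_at_imp_continuous_on has_vector_derivative_continuous)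

text \<open>Multiplying the conjugacy by the constant complex eigenvector matrix changes neither its smoothness nor its
  determinant and replaces \<open>X\<close> by a diagonal matrix.\<close>

lemma conjugacy_to_generic_smooth:
  fixes X :: "real^2^2"
  assumes X: "X \<in> SL2" "X$2$1 \<noteq> 0" and l: "l 1 * l 2 = 1" "l 1 + l 2 = of_real (X$1$1 + X$2$2)" "l 1 \<noteq> l 2"
    and L: "\<Lambda> > 0" and ok: "\<And>n0. \<exists>N\<ge>n0. N \<ge> 1 \<and> div_ok \<alpha> l (real N) \<Lambda> s"
    and A: "A \<in> Cinf_circle_SL2" and B: "B \<in> C0_circle_SL2"
    and eq: "\<And>\<theta>. A \<theta> = B (\<theta> + \<alpha>) ** X ** matrix_inv (B \<theta>)"
  shows "B \<in> Cinf_circle_SL2"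
proof -
  have Ap: "\<And>t. A (t + 1) = A t" "smooth A" using A by (auto simp: Cinf_circle_SL2_def circle_maps_SL2_def)
  have Bp: "\<And>t. B (t + 1) = B t" "continuous_on UNIV B" "\<And>t. det (B t) = 1"
    using B by (auto simp: C0_circle_SL2_def circle_maps_SL2_def SL2_def)
  have Ac: "allent sper (\<lambda>t. cmat (A t))" using allent_sper_cmat(2)[OF Ap(1) smooth_continuous[OF Ap(2)]] Ap(2) by simp
  have AB: "B (t + \<alpha>) ** X = A t ** B t" for t
  proof -
    have "matrix_inv (B t) ** B t = mat 1" 
    proof -
      have "invertible (B t)" by (simp add: invertible_det_nz Bp(3))
      then show ?thesis unfolding invertible_def matrix_inv_def by (rule someI2_ex) blast
    qed
    then show ?thesis unfolding eq by (simp add: matrix_mul_assoc[symmetric])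
  qed
  obtain Q where Q: "det Q = 1" "cmat X ** Q = Q ** dg l"
    by (rule diagonalisation[OF _ X(2) l]) (use X(1) in \<open>auto simp: SL2_def\<close>)
  define C where "C t = cmat (B t) ** Q" for t
  have Cc: "allent cper C" unfolding C_def
    by (rule allent_cper_mult[OF allent_sper_cmat(1)[OF Bp(1,2)] allent_const[where Q = cper]]) (simp add: cper_def)
  have "det (C t) = 1" for t by (simp add: C_def det_mul det_cmat Bp(3) Q(1))
  moreover have "C (t + \<alpha>) ** dg l = cmat (A t) ** C t" for t
  proof -
    have "C (t + \<alpha>) ** dg l = cmat (B (t + \<alpha>) ** X) ** Q"
      by (simp add: C_def cmat_mult matrix_mul_assoc[symmetric] Q(2))
    then show ?thesis by (simp add: AB C_def cmat_mult matrix_mul_assoc)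
  qed
  ultimately have "allent sper C" by (rule conjugacy_smooth[OF Ac Cc _ _ L ok])
  then have "allent sper (\<lambda>t. C t ** inv2 Q)"
    by (rule allent_sper_mult[OF _ allent_const[where Q = sper]]) (rule sper_const)
  moreover have "C t ** inv2 Q = cmat (B t)" for t
    using inv2_right[of Q] Q(1) by (simp add: C_def matrix_mul_assoc[symmetric])
  ultimately have "smooth B" using allent_sper_cmat(2)[OF Bp(1,2)] by simp
  then show ?thesis using B by (auto simp: Cinf_circle_SL2_def C0_circle_SL2_def)
qed

theorem corollary2p1:
  fixes \<gamma> \<sigma> \<alpha> :: real
  assumes "admissible \<gamma> \<sigma>"
    and "\<alpha> \<in> Sigma_set \<gamma> \<sigma>"
  shows "\<exists>\<A>. total_haar_measure \<A> \<and>
    (\<forall>A\<^sub>0\<in>\<A>. \<forall>A\<in>Cinf_circle_SL2. \<forall>B\<in>C0_circle_SL2.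
       (\<forall>\<theta>. A \<theta> = B (\<theta> + \<alpha>) ** A\<^sub>0 ** matrix_inv (B \<theta>)) \<longrightarrow>
       B \<in> Cinf_circle_SL2)"
proof -
  have g: "\<gamma> > 0" using assms(1) by (simp add: admissible_def)
  define c where "c = min (1/2) (1 / (2 * \<gamma>))"
  define s where "s = max 2 (nat \<lceil>\<sigma>\<rceil>)"
  have c: "c > 0" using g by (simp add: c_def)
  have s: "s \<ge> 2" "real s \<ge> \<sigma>" unfolding s_def by linarith+
  have D: "\<exists>N\<ge>n0. N \<ge> 1 \<and> dioph_scale \<alpha> c s N" for n0
    unfolding c_def by (rule infinitely_many_dioph_scales[OF assms(2) g s(2)])
  obtain T where T: "T \<in> null_sets lborel" "2 \<in> T" "-2 \<in> T"
      "\<And>\<phi>. \<phi> \<in> exceptional_phases \<alpha> (dioph_scale \<alpha> c s) \<Longrightarrow> 2 * cos (pi * \<phi>) \<in> T"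
    by (rule exceptional_traces_null[OF D]) blast
  show ?thesis
  proof (intro exI conjI ballI impI)
    show "total_haar_measure {X\<in>SL2. X$2$1 \<noteq> 0 \<and> X$1$1 + X$2$2 \<notin> T}"
      by (rule generic_matrices_total[OF T(1)])
    fix X A B
    assume X: "X \<in> {X\<in>SL2. X$2$1 \<noteq> 0 \<and> X$1$1 + X$2$2 \<notin> T}" and A: "A \<in> Cinf_circle_SL2" and B: "B \<in> C0_circle_SL2"
      and eq: "\<forall>\<theta>. A \<theta> = B (\<theta> + \<alpha>) ** X ** matrix_inv (B \<theta>)"
    define \<tau> where "\<tau> = X$1$1 + X$2$2"
    have X': "X \<in> SL2" "X$2$1 \<noteq> 0" and t: "\<tau> \<notin> T" using X by (auto simp: \<tau>_def)
    obtain l :: "2 \<Rightarrow> complex" and \<Lambda> where l: "l 1 * l 2 = 1" "l 1 + l 2 = of_real \<tau>" "\<Lambda> > 0"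
      "\<And>n0. \<exists>N\<ge>n0. N \<ge> 1 \<and> div_ok \<alpha> l (real N) \<Lambda> s"
    proof (rule eigenvalues_div_ok[OF c s(1) D])
      show "\<tau> \<noteq> 2" "\<tau> \<noteq> - 2" using t T(2,3) by auto
      show "\<phi> \<notin> exceptional_phases \<alpha> (dioph_scale \<alpha> c s)" if "\<tau> = 2 * cos (pi * \<phi>)" for \<phi>
        using T(4)[of \<phi>] t that by auto
    qed blast
    have "l 1 \<noteq> l 2"
    proof
      assume e: "l 1 = l 2"
      then have "l 1 ^ 2 = 1" using l(1) by (simp add: power2_eq_square)
      then have "l 1 = 1 \<or> l 1 = -1" by (simp add: power2_eq_1_iff)
      then have "complex_of_real \<tau> = of_real 2 \<or> complex_of_real \<tau> = of_real (-2)" using l(2) e by auto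
      then show False using t T(2,3) unfolding of_real_eq_iff by auto
    qed
    then show "B \<in> Cinf_circle_SL2"
      by (rule conjugacy_to_generic_smooth[OF X' l(1) l(2)[unfolded \<tau>_def] _ l(3,4) A B eq[rule_format]])
  qed
qed

end
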